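(* Let $(a_1,a_2,a_3,a_4,a_5)\in\mathbb{R}^5$ with $0<a_1<a_2<a_3<a_4<a_5$, and let $$b_1=-\frac{a_1a_4a_5}{a_2a_3},\qquad w=\sqrt{z-a_1}\sqrt{z-a_2}\sqrt{z-a_3}\sqrt{z-a_4}\sqrt{z-a_5}\sqrt{z-b_1},$$ $$g(z)=\frac{\sqrt{z-a_1}\sqrt{z-a_4}\sqrt{z-a_5}}{\sqrt{z-a_2}\sqrt{z-a_3}\sqrt{z-b_1}},\qquad \omega_3=\frac1z\,dz.$$ Then there exist $\lambda_1,\lambda_2,\lambda_3,\lambda_4\in\mathbb{C}$ such that $$\omega_1=\frac12\left(\frac1{g(z)}-g(z)\right)\omega_3+\frac{(\lambda_1+\lambda_2z)\,dz}{w},$$ $$\omega_2=\frac i2\left(\frac1{g(z)}+g(z)\right)\omega_3+\frac{(\lambda_3+\lambda_4z)\,dz}{w},$$ $$\omega_3=\frac1z\,dz$$ is the Weierstrass representation for a genus two doubly periodic harmonic surface with orthogonal top and bottom Scherk ends. There is one handle between every consecutive pair of ends (in the sense made precise by the period equations in the context).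
   Context: Domain: $g$ and $w$ are regarded as meromorphic functions on the compact genus two hyperelliptic Riemann surface $X$ given by $w^2=(z-b_1)\prod_{k=1}^5(z-a_k)$, with $g=(z-a_1)(z-a_4)(z-a_5)/w$. The ends are the four points of $X$ over $z=0$ and $z=\infty$; $X'$ is $X$ with these points removed. Harmonic surface, doubly periodic: given meromorphic one-forms $\omega_1,\omega_2,\omega_3$ on a compact Riemann surface $X$, holomorphic on $X'=X\setminus\{p_1,\dots,p_m\}$, the triple is the Weierstrass representation of a doubly periodic harmonic surface if the real periods $\operatorname{Re}\int_\gamma(\omega_1,\omega_2,\omega_3)$, over closed curves $\gamma$ in $X'$, lie in a rank-two lattice $L\subset\mathbb{R}^3$ of translations (generated by two linearly independent vectors), so that $f(z)=\operatorname{Re}\int^z(\omega_1,\omega_2,\omega_3)$ is a well-defined harmonic map $X'\to\mathbb{R}^3/L$; the doubly periodic surface is the preimage in $\mathbb{R}^3$ of the image. "Genus two" refers to the genus of $X$, i.e. of the quotient surface. Scherk ends: an end is a Scherk end if it is asymptotic to a vertical half-plane modulo a horizontal translation period (so $\omega_3$ has a simple pole with real residue and $\omega_1,\omega_2$ have at most simple poles, with a nonzero horizontal real period around the end, to which the half-plane is parallel). The bottom ends lie over $z=0$ (third coordinate tends to $-\infty$) and the top ends over $z=\infty$ (third coordinate tends to $+\infty$). Top and bottom ends are orthogonal if the asymptotic half-planes of the top ends are orthogonal to those of the bottom ends. Handles: one handle is between (the images of) $a_1$ and $a_2$, the other between $a_3$ and $a_4$, the latter opening in the opposite direction. Integrals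 between consecutive $a_k$ are taken along the real axis using one of the two branches of $w$ (and correspondingly of $g$) continued from the upper half-plane. The period problem, and the statement that there is one handle between every consecutive pair of ends, is expressed by the equations $$\operatorname{Re}\int_{a_1}^{a_2}\omega_1=\operatorname{Re}\int_{a_2}^{a_3}\omega_1=\operatorname{Re}\int_{a_3}^{a_4}\omega_1=\operatorname{Re}\int_{a_4}^{a_5}\omega_1=0,$$ $$\operatorname{Re}\int_{a_1}^{a_2}\omega_2=\operatorname{Re}\int_{a_3}^{a_4}\omega_2=0,\qquad \operatorname{Re}\int_{a_2}^{a_3}\omega_2=-\operatorname{Re}\int_{a_4}^{a_5}\omega_2=\pi.$$ *)

theory Defs
  imports "HOL-Complex_Analysis.Complex_Analysis"
begin

section \<open>Riemann surfaces and meromorphic one-forms\<close>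

type_synonym 'a chart = "'a set \<times> ('a \<Rightarrow> complex)"

definition chart_inv :: "'a chart \<Rightarrow> complex \<Rightarrow> 'a" where
  "chart_inv c = inv_into (fst c) (snd c)"

definition chart_image :: "'a chart \<Rightarrow> complex set" where
  "chart_image c = snd c ` fst c"

definition transition :: "'a chart \<Rightarrow> 'a chart \<Rightarrow> complex \<Rightarrow> complex" where
  "transition c d = snd d \<circ> chart_inv c"

definition compact_riemann_surface :: "'a topology \<Rightarrow> 'a chart set \<Rightarrow> bool" where
  "compact_riemann_surface X A \<longleftrightarrow>
     compact_space X \<and> Hausdorff_space X \<and> connected_space X \<and>
     \<Union> (fst ` A) = topspace X \<and>
     (\<forall>c\<in>A. openin X (fst c) \<and> open (chart_image c) \<and>
        homeomorphic_map (subtopology X (fst c)) (top_of_set (chart_image c)) (snd c)) \<and>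
     (\<forall>c\<in>A. \<forall>d\<in>A. transition c d holomorphic_on snd c ` (fst c \<inter> fst d))"

text \<open>A one-form is given by its coefficient functions: in the chart \<open>c\<close> with coordinate
  \<open>\<zeta>\<close> it reads \<open>\<omega> c \<zeta> d\<zeta>\<close>. The condition \<open>nicely_meromorphic_on\<close> fixes the values of
  the coefficient functions (removable singularities are removed, the value at a pole is 0).\<close>

type_synonym 'a form = "'a chart \<Rightarrow> complex \<Rightarrow> complex"

definition meromorphic_form :: "'a chart set \<Rightarrow> 'a form \<Rightarrow> bool" where
  "meromorphic_form A \<omega> \<longleftrightarrow>
     (\<forall>c\<in>A. \<omega> c nicely_meromorphic_on chart_image c) \<and>
     (\<forall>c\<in>A. \<forall>d\<in>A. \<forall>p \<in> fst c \<inter> fst d.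
        \<forall>\<^sub>F \<zeta> in at (snd c p). \<omega> c \<zeta> = \<omega> d (transition c d \<zeta>) * deriv (transition c d) \<zeta>)"

definition form_holomorphic_on :: "'a chart set \<Rightarrow> 'a form \<Rightarrow> 'a set \<Rightarrow> bool" where
  "form_holomorphic_on A \<omega> S \<longleftrightarrow> (\<forall>c\<in>A. \<omega> c holomorphic_on snd c ` (fst c \<inter> S))"

text \<open>The meromorphic form \<open>f dh\<close> for meromorphic functions \<open>f\<close> and \<open>h\<close>, whose values at their
  poles are irrelevant.\<close>

definition fdh :: "('a \<Rightarrow> complex) \<Rightarrow> ('a \<Rightarrow> complex) \<Rightarrow> 'a form" where
  "fdh f h c = remove_sings (\<lambda>\<zeta>. f (chart_inv c \<zeta>) * deriv (h \<circ> chart_inv c) \<zeta>)"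

text \<open>The genus is the dimension of the space of holomorphic one-forms.\<close>

definition has_genus :: "'a topology \<Rightarrow> 'a chart set \<Rightarrow> nat \<Rightarrow> bool" where
  "has_genus X A n \<longleftrightarrow>
     (\<exists>B :: nat \<Rightarrow> 'a form.
        (\<forall>i<n. meromorphic_form A (B i) \<and> form_holomorphic_on A (B i) (topspace X)) \<and>
        (\<forall>\<omega>. meromorphic_form A \<omega> \<and> form_holomorphic_on A \<omega> (topspace X) \<longrightarrow>
           (\<exists>!k :: nat \<Rightarrow> complex. (\<forall>i\<ge>n. k i = 0) \<and>
              (\<forall>c\<in>A. \<forall>\<zeta>\<in>chart_image c. \<omega> c \<zeta> = (\<Sum>i<n. k i * B i c \<zeta>)))))"

text \<open>\<open>\<integral>\<^sub>\<gamma> \<omega> = I\<close> for \<open>\<gamma> : [0,1] \<rightarrow> X\<close> piecewise continuously differentiable: \<open>\<gamma>\<close> is subdivided into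
  pieces lying in charts.\<close>

definition has_form_integral ::
    "'a chart set \<Rightarrow> 'a form \<Rightarrow> (real \<Rightarrow> 'a) \<Rightarrow> complex \<Rightarrow> bool" where
  "has_form_integral A \<omega> \<gamma> I \<longleftrightarrow>
     (\<exists>n (t :: nat \<Rightarrow> real) (c :: nat \<Rightarrow> 'a chart) J.
        t 0 = 0 \<and> t n = 1 \<and>
        (\<forall>i<n. t i < t (Suc i) \<and> c i \<in> A \<and> \<gamma> ` {t i..t (Suc i)} \<subseteq> fst (c i) \<and>
           valid_path (subpath (t i) (t (Suc i)) (snd (c i) \<circ> \<gamma>)) \<and>
           (\<omega> (c i) has_contour_integral J i) (subpath (t i) (t (Suc i)) (snd (c i) \<circ> \<gamma>))) \<and>
        I = (\<Sum>i<n. J i))"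

section \<open>Weierstrass representations of doubly periodic harmonic surfaces\<close>

definition triple :: "'b \<Rightarrow> 'b \<Rightarrow> 'b \<Rightarrow> 3 \<Rightarrow> 'b" where
  "triple x y z = (\<lambda>k. if k = 1 then x else if k = 2 then y else z)"

text \<open>All values \<open>Re \<integral>\<^sub>\<gamma> (\<omega>\<^sub>1, \<omega>\<^sub>2, \<omega>\<^sub>3)\<close> for paths \<open>\<gamma>\<close> in \<open>S\<close> from \<open>p\<close> to \<open>q\<close>.\<close>

definition real_integrals ::
    "'a chart set \<Rightarrow> (3 \<Rightarrow> 'a form) \<Rightarrow> 'a set \<Rightarrow> 'a \<Rightarrow> 'a \<Rightarrow> (real^3) set" where
  "real_integrals A \<omega> S p q =
     {(\<chi> k. Re (I k)) | I. \<exists>\<gamma>. \<gamma> ` {0..1} \<subseteq> S \<and> \<gamma> 0 = p \<and> \<gamma> 1 = q \<and>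
        (\<forall>k. has_form_integral A (\<omega> k) \<gamma> (I k))}"

definition rank_two_lattice :: "(real^3) set \<Rightarrow> bool" where
  "rank_two_lattice L \<longleftrightarrow>
     (\<exists>v1 v2. v1 \<noteq> v2 \<and> independent {v1, v2} \<and>
        L = {of_int m *\<^sub>R v1 + of_int n *\<^sub>R v2 | m n. True})"

text \<open>\<open>E\<close> is the set of ends, so \<open>X' = topspace X - E\<close>.\<close>

definition doubly_periodic_weierstrass_rep ::
    "'a topology \<Rightarrow> 'a chart set \<Rightarrow> 'a set \<Rightarrow> (3 \<Rightarrow> 'a form) \<Rightarrow> bool" where
  "doubly_periodic_weierstrass_rep X A E \<omega> \<longleftrightarrow>
     compact_riemann_surface X A \<and> finite E \<and> E \<subseteq> topspace X \<and>
     (\<forall>k. meromorphic_form A (\<omega> k) \<and> form_holomorphic_on A (\<omega> k) (topspace X - E)) \<and>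
     (\<exists>L. rank_two_lattice L \<and>
        (\<forall>q \<in> topspace X - E. real_integrals A \<omega> (topspace X - E) q q \<subseteq> L))"

section \<open>Scherk ends\<close>

text \<open>The vertical half-plane parallel to the horizontal vector \<open>T\<close>, bounded by the horizontal line
  through \<open>v\<close>, going up for \<open>\<sigma> = 1\<close> and down for \<open>\<sigma> = -1\<close>.\<close>

definition vertical_half_plane :: "real^3 \<Rightarrow> real^3 \<Rightarrow> real \<Rightarrow> (real^3) set" where
  "vertical_half_plane v T \<sigma> = {v + s *\<^sub>R T + (\<sigma> * t) *\<^sub>R axis 3 1 | s t. t \<ge> 0}"

text \<open>Scherk end at \<open>p\<close> with horizontal period \<open>T = Re (2\<pi>i Res\<^sub>p \<omega>)\<close>. The geometric conditions are
  stated for the multivalued map \<open>f = Re \<integral> (\<omega>\<^sub>1, \<omega>\<^sub>2, \<omega>\<^sub>3)\<close> on a punctured coordinate disc \<open>D\<close>, based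
  at \<open>q0\<close>; its values at a point differ by multiples of \<open>T\<close>. They say: the third coordinate tends
  to \<open>\<sigma> \<infinity>\<close>; the surface approaches the half-plane; and the half-plane approaches the surface.\<close>

definition scherk_end ::
    "'a chart set \<Rightarrow> (3 \<Rightarrow> 'a form) \<Rightarrow> 'a \<Rightarrow> real \<Rightarrow> real^3 \<Rightarrow> bool" where
  "scherk_end A \<omega> p \<sigma> T \<longleftrightarrow>
     (\<exists>c\<in>A. p \<in> fst c \<and>
        (is_pole (\<omega> 3 c) (snd c p) \<and> zorder (\<omega> 3 c) (snd c p) = -1 \<and>
           residue (\<omega> 3 c) (snd c p) \<in> \<real>) \<and>
        (\<forall>k\<in>{1, 2}. is_pole (\<omega> k c) (snd c p) \<longrightarrow> zorder (\<omega> k c) (snd c p) = -1) \<and>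
        T = (\<chi> k. Re (2 * pi * \<i> * residue (\<omega> k c) (snd c p))) \<and> T \<noteq> 0 \<and> T $ 3 = 0 \<and>
        (\<exists>r>0. ball (snd c p) r \<subseteq> chart_image c \<and>
           (let D = {q \<in> fst c. q \<noteq> p \<and> snd c q \<in> ball (snd c p) r} in
            \<exists>q0\<in>D. \<exists>v.
              (let H = vertical_half_plane v T \<sigma>; f = real_integrals A \<omega> D q0 in
               (\<forall>M. \<exists>\<delta>>0. \<forall>q\<in>D. snd c q \<in> ball (snd c p) \<delta> \<longrightarrow> (\<forall>x\<in>f q. \<sigma> * x $ 3 > M)) \<and>
               (\<forall>\<epsilon>>0. \<exists>\<delta>>0. \<forall>q\<in>D. snd c q \<in> ball (snd c p) \<delta> \<longrightarrow> (\<forall>x\<in>f q. \<exists>h\<in>H. dist x h < \<epsilon>)) \<and>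
               (\<forall>\<epsilon>>0. \<exists>M. \<forall>h\<in>H. \<sigma> * h $ 3 > M \<longrightarrow> (\<exists>q\<in>D. \<exists>x\<in>f q. dist x h < \<epsilon>))))))"

text \<open>Two vertical half-planes with horizontal directions \<open>T\<close> and \<open>T'\<close> are orthogonal iff \<open>T\<close> and
  \<open>T'\<close> are.\<close>

definition orthogonal_scherk_ends ::
    "'a chart set \<Rightarrow> (3 \<Rightarrow> 'a form) \<Rightarrow> 'a set \<Rightarrow> 'a set \<Rightarrow> bool" where
  "orthogonal_scherk_ends A \<omega> E_bot E_top \<longleftrightarrow>
     (\<exists>T. (\<forall>p\<in>E_bot. scherk_end A \<omega> p (-1) (T p)) \<and>
          (\<forall>q\<in>E_top. scherk_end A \<omega> q 1 (T q)) \<and>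
          (\<forall>p\<in>E_bot. \<forall>q\<in>E_top. orthogonal (T p) (T q)))"

section \<open>The compact hyperelliptic surface of a polynomial of even degree\<close>

text \<open>The curve \<open>w\<^sup>2 = P(z)\<close>, \<open>deg P = 2m\<close>, is glued to \<open>v\<^sup>2 = u\<^bsup>2m\<^esup> P(1/u)\<close> along \<open>u = 1/z\<close>,
  \<open>v = w/z\<^bsup>m\<^esup>\<close>. \<open>At_Inf v\<close> stands for the point \<open>u = 0\<close> of the second curve.\<close>

datatype hpoint = Aff complex complex | At_Inf complex

definition hyp_carrier :: "complex poly \<Rightarrow> hpoint set" where
  "hyp_carrier P = {Aff z w | z w. w^2 = poly P z} \<union> {At_Inf v | v. v^2 = lead_coeff P}"

definition aff_curve :: "complex poly \<Rightarrow> (complex \<times> complex) set" where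
  "aff_curve P = {(z, w). w^2 = poly P z}"

definition inf_param :: "complex poly \<Rightarrow> complex \<times> complex \<Rightarrow> hpoint" where
  "inf_param P = (\<lambda>(u, v). if u = 0 then At_Inf v else Aff (1/u) (v / u ^ (degree P div 2)))"

definition hyp_open :: "complex poly \<Rightarrow> hpoint set \<Rightarrow> bool" where
  "hyp_open P U \<longleftrightarrow> U \<subseteq> hyp_carrier P \<and>
     openin (top_of_set (aff_curve P)) {x \<in> aff_curve P. case_prod Aff x \<in> U} \<and>
     openin (top_of_set (aff_curve (reflect_poly P)))
       {x \<in> aff_curve (reflect_poly P). inf_param P x \<in> U}"

definition hyp_top :: "complex poly \<Rightarrow> hpoint topology" where
  "hyp_top P = topology (hyp_open P)"

lemma openin_hyp_top: "openin (hyp_top P) U \<longleftrightarrow> hyp_open P U"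
proof -
  have "istopology (hyp_open P)"
    unfolding istopology_def
  proof (intro conjI allI impI)
    fix S T assume "hyp_open P S" "hyp_open P T"
    moreover have "{x \<in> C. f x \<in> S \<inter> T} = {x \<in> C. f x \<in> S} \<inter> {x \<in> C. f x \<in> T}"
      for C :: "(complex \<times> complex) set" and f by blast
    ultimately show "hyp_open P (S \<inter> T)"
      unfolding hyp_open_def by (auto intro: openin_Int)
  next
    fix K assume "\<forall>S\<in>K. hyp_open P S"
    moreover have "{x \<in> C. f x \<in> \<Union>K} = (\<Union>S\<in>K. {x \<in> C. f x \<in> S})"
      for C :: "(complex \<times> complex) set" and f by blast
    ultimately show "hyp_open P (\<Union>K)"
      unfolding hyp_open_def by (auto intro!: openin_Union)
  qed
  thus ?thesis by (simp add: hyp_top_def topology_inverse')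
qed

text \<open>The meromorphic functions \<open>z\<close>, \<open>w\<close> and \<open>u = 1/z\<close>; the value 0 at a pole is a convention.\<close>

fun z_fun :: "hpoint \<Rightarrow> complex" where
  "z_fun (Aff z w) = z" | "z_fun (At_Inf v) = 0"

fun w_fun :: "hpoint \<Rightarrow> complex" where
  "w_fun (Aff z w) = w" | "w_fun (At_Inf v) = 0"

fun u_fun :: "hpoint \<Rightarrow> complex" where
  "u_fun (Aff z w) = 1/z" | "u_fun (At_Inf v) = 0"

definition hyp_atlas :: "complex poly \<Rightarrow> hpoint chart set" where
  "hyp_atlas P =
     {(U, z_fun) | U. hyp_open P U \<and> inj_on z_fun U \<and> U \<subseteq> {Aff z w | z w. w \<noteq> 0}} \<union>
     {(U, w_fun) | U. hyp_open P U \<and> inj_on w_fun U \<and>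
        U \<subseteq> {Aff z w | z w. poly (pderiv P) z \<noteq> 0}} \<union>
     {(U, u_fun) | U. hyp_open P U \<and> inj_on u_fun U \<and>
        U \<subseteq> {Aff z w | z w. z \<noteq> 0 \<and> w \<noteq> 0} \<union> range At_Inf}"

definition points_over_0 :: "complex poly \<Rightarrow> hpoint set" where
  "points_over_0 P = {Aff 0 w | w. w^2 = poly P 0}"

definition points_over_inf :: "complex poly \<Rightarrow> hpoint set" where
  "points_over_inf P = {At_Inf v | v. v^2 = lead_coeff P}"

section \<open>The Weierstrass data\<close>

text \<open>The coefficients of \<open>dz\<close> in the three forms, as functions of the values of \<open>z\<close>, \<open>w\<close> and \<open>g\<close>.\<close>

definition om1 :: "complex \<Rightarrow> complex \<Rightarrow> complex \<Rightarrow> complex \<Rightarrow> complex \<Rightarrow> complex" where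
  "om1 l1 l2 z w g = 1/2 * (1/g - g) * (1/z) + (l1 + l2 * z) / w"

definition om2 :: "complex \<Rightarrow> complex \<Rightarrow> complex \<Rightarrow> complex \<Rightarrow> complex \<Rightarrow> complex" where
  "om2 l3 l4 z w g = \<i>/2 * (1/g + g) * (1/z) + (l3 + l4 * z) / w"

definition om3 :: "complex \<Rightarrow> complex" where
  "om3 z = 1/z"

text \<open>\<open>Re \<integral>\<^sub>s\<^sup>t f(x) dx = v\<close>, including convergence of the integral.\<close>

definition re_integral_eq :: "(complex \<Rightarrow> complex) \<Rightarrow> real \<Rightarrow> real \<Rightarrow> real \<Rightarrow> bool" where
  "re_integral_eq f s t v \<longleftrightarrow>
     (\<lambda>x. f (complex_of_real x)) absolutely_integrable_on {s..t} \<and>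
     Re (integral {s..t} (\<lambda>x. f (complex_of_real x))) = v"

end

theory Submission
  imports Defs
begin

text \<open>
  Write \<open>N = (z - a\<^sub>1)(z - a\<^sub>4)(z - a\<^sub>5)\<close> and \<open>D = (z - a\<^sub>2)(z - a\<^sub>3)(z - b\<^sub>1)\<close>, so that \<open>g = N/w\<close>,
  \<open>1/g = D/w\<close> and \<open>\<omega>\<^sub>k = Q\<^sub>k dz/(zw)\<close> for \<open>k = 1, 2\<close>, where the polynomial \<open>Q\<^sub>1\<close> is real and \<open>Q\<^sub>2\<close> is \<open>\<i>\<close> times
  a real polynomial if \<open>\<lambda>\<^sub>1, \<lambda>\<^sub>2, \<i>\<lambda>\<^sub>3, \<i>\<lambda>\<^sub>4\<close> are real. On each real interval between branch points \<open>w\<close> is real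
  or imaginary, so half of the period equations hold for trivial reasons. The others are two linear systems
  in \<open>(\<lambda>\<^sub>1, \<lambda>\<^sub>2)\<close> and \<open>(\<lambda>\<^sub>3, \<lambda>\<^sub>4)\<close>, with nonzero determinants because the mean values of \<open>x\<close> over
  disjoint intervals are different.

  The choice of \<open>b\<^sub>1\<close> means \<open>D(0) = - N(0)\<close>. Hence \<open>Q\<^sub>2\<close> vanishes at \<open>0\<close>, while \<open>Q\<^sub>1\<close> has degree at most \<open>2\<close>: only
  \<open>\<omega>\<^sub>1\<close> of these two has poles at the bottom ends and only \<open>\<omega>\<^sub>2\<close> at the top ends, which makes the ends orthogonal.

  The surface without its ends is covered by four sheets, the two branches of \<open>w\<close> over each of the closed half-planes.
  Let \<open>F\<close> be a primitive of \<open>\<omega>\<^sub>k\<close> over the upper half-plane. By reflection \<open>\<plusminus>F\<close> and \<open>\<plusminus>cnj (F (cnj z))\<close> are primitives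
  on the four sheets, and the functions \<open>exp (\<i> Re F)\<close> match along the real axis if \<open>Re F\<close> is a multiple of \<open>\<pi>\<close> on the
  intervals where the reflection does not preserve the sheet. This follows from the period equations and,
  beyond \<open>0\<close> or \<open>\<infinity>\<close>, from half of the residue there. Thus all real periods are multiples of \<open>2\<pi>\<close>.
\<close>

section \<open>The topology of a hyperelliptic surface\<close>

text \<open>Periods range over all closed curves of the punctured surface and are controlled without
  a homology basis: a nowhere vanishing function that every path multiplies by \<open>exp\<close> of
  \<psi> of the integral returns to its value along a closed curve. With \<psi> = Re this also
  yields the shape of the ends, with \<psi> = \<i> Re the lattice.

  Two kinds of constants have to agree. The period equations fix Re F only at the positive branch
  points; the intervals beyond 0 and infinity are reached by a half turn, which adds \<i> \<pi>
  times a residue up to sign. Since |b1| a2 a3 = a1 a4 a5, the values of w over 0 are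
  \<plusminus>\<i> a1 a4 a5, while Q1(0) = a1 a4 a5; at infinity Q2 grows like \<i> z^3 and w like
  \<plusminus>z^3. Both half turns thus change Re F by \<plusminus>\<pi>, the number prescribed in
  the equations, and the same multiple of \<pi> serves everywhere.

  The genus is the dimension of the space of holomorphic forms, so these are classified outright: on
  w^2 = P(z) with deg P = 2m the quotient of such a form by dz/w is a polynomial in z of degree at
  most m - 2.\<close>

lemma holomorphic_square_root_at:
  fixes F :: "complex \<Rightarrow> complex"
  assumes F: "F holomorphic_on S" and S: "open S" "z0 \<in> S" and w0: "F z0 = w0\<^sup>2" "w0 \<noteq> 0"
  obtains r s where "r > 0" "ball z0 r \<subseteq> S" "s holomorphic_on ball z0 r" "s z0 = w0"
    "\<And>z. z \<in> ball z0 r \<Longrightarrow> (s z)\<^sup>2 = F z"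
proof -
  have nz: "F z0 \<noteq> 0" using w0 by simp
  have "open (S \<inter> F -` ball (F z0) (norm (F z0)))"
    by (intro continuous_open_preimage holomorphic_on_imp_continuous_on F S open_ball)
  moreover have "z0 \<in> S \<inter> F -` ball (F z0) (norm (F z0))" using S nz by simp
  ultimately obtain r where r: "r > 0" "ball z0 r \<subseteq> S \<inter> F -` ball (F z0) (norm (F z0))"
    using open_contains_ball by metis
  \<comment> \<open>Dividing by \<open>F z0\<close> brings the values near 1, away from the cut of
    \<open>csqrt\<close>; the factor \<open>w0\<close> below then selects the branch.\<close>
  have pos: "F z / F z0 \<notin> \<real>\<^sub>\<le>\<^sub>0" if "z \<in> ball z0 r" for z
  proof -
    have "norm (F z0 - F z) < norm (F z0)" using that r by (auto simp: dist_norm)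
    hence "norm ((F z0 - F z) / F z0) < 1" using nz by (simp add: norm_divide)
    hence "norm (1 - F z / F z0) < 1" using nz by (simp add: diff_divide_distrib)
    hence "Re (F z / F z0) > 0" using abs_Re_le_cmod[of "1 - F z / F z0"] by simp
    thus ?thesis using complex_nonpos_Reals_iff by force
  qed
  have "F holomorphic_on ball z0 r" using r holomorphic_on_subset[OF F] by blast
  hence "(\<lambda>z. w0 * csqrt (F z / F z0)) holomorphic_on ball z0 r"
    using pos nz by (intro holomorphic_intros) auto
  moreover have "(w0 * csqrt (F z / F z0))\<^sup>2 = F z" for z
    using nz w0 by (simp add: power_mult_distrib)
  moreover have "w0 * csqrt (F z0 / F z0) = w0" using nz by simp
  moreover have "ball z0 r \<subseteq> S" using r by blast
  ultimately show ?thesis using r(1) that by blast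
qed

lemma holomorphic_local_inverse_at:
  assumes f: "f holomorphic_on S" and S: "open S" "z0 \<in> S" and d: "deriv f z0 \<noteq> 0"
  obtains r g where "r > 0" "g holomorphic_on ball (f z0) r" "g (f z0) = z0"
    "\<And>y. y \<in> ball (f z0) r \<Longrightarrow> g y \<in> S \<and> f (g y) = y"
proof -
  obtain r where r: "r > 0" "ball z0 r \<subseteq> S" "inj_on f (ball z0 r)"
    using has_complex_derivative_locally_injective[OF f S(2,1) d] by metis
  have fb: "f holomorphic_on ball z0 r" using f r holomorphic_on_subset by blast
  obtain g where g: "g holomorphic_on (f ` ball z0 r)" "\<And>z. z \<in> ball z0 r \<Longrightarrow> g (f z) = z"
    using holomorphic_has_inverse[OF fb open_ball r(3)] by metis
  have op: "open (f ` ball z0 r)"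
    using open_mapping_thm3[OF fb open_ball r(3)] .
  obtain e where e: "e > 0" "ball (f z0) e \<subseteq> f ` ball z0 r"
    using op r(1) open_contains_ball by (metis centre_in_ball image_eqI)
  show ?thesis
  proof
    show "g holomorphic_on ball (f z0) e" using g(1) e(2) holomorphic_on_subset by blast
    fix y assume "y \<in> ball (f z0) e"
    then obtain z where "z \<in> ball z0 r" "y = f z" using e by auto
    thus "g y \<in> S \<and> f (g y) = y" using g(2) r(2) by auto
  qed (use e g r in auto)
qed

text \<open>A disc about \<open>w0\<close> of radius \<open>norm w0\<close> contains no pair of
  opposite points. This is how one of the two roots is singled out near a point that is not a branch
  point.\<close>

lemma square_eq_same_side:
  fixes w w' w0 :: complex
  assumes "w\<^sup>2 = w'\<^sup>2" "norm (w - w0) < norm w0" "norm (w' - w0) < norm w0"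
  shows "w = w'"
proof (rule ccontr)
  assume "w \<noteq> w'"
  hence "w' = - w" using assms(1) power2_eq_iff by metis
  hence "norm (2 * w0) \<le> norm (w - w0) + norm (w' - w0)"
    using norm_triangle_ineq[of "w - w0" "w' - w0"] by (simp add: norm_mult)
  thus False using assms(2,3) by (simp add: norm_mult)
qed

text \<open>Simple roots make the affine curve smooth, with w as coordinate at the branch points.
  Even degree keeps infinity unbranched: there are two points over it, and 1/z is a coordinate at
  both.\<close>

locale hyperelliptic =
  fixes P :: "complex poly" and m :: nat
  assumes degree_P: "degree P = 2 * m"
    and simple_roots: "poly P z = 0 \<Longrightarrow> poly (pderiv P) z \<noteq> 0"
begin

abbreviation "X \<equiv> hyp_top P"
abbreviation "A \<equiv> hyp_atlas P"
abbreviation "R \<equiv> reflect_poly P"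

lemma P_nonzero: "P \<noteq> 0"
  using simple_roots by force

lemma half_degree: "degree P div 2 = m"
  by (simp add: degree_P)

lemma poly_R: "u \<noteq> 0 \<Longrightarrow> poly R u = u ^ (2 * m) * poly P (1 / u)"
  by (simp add: poly_reflect_poly_nz degree_P inverse_eq_divide)

lemma inf_param_0 [simp]: "inf_param P (0, v) = At_Inf v"
  by (simp add: inf_param_def)

lemma inf_param_nz: "u \<noteq> 0 \<Longrightarrow> inf_param P (u, v) = Aff (1 / u) (v / u ^ m)"
  by (simp add: inf_param_def half_degree)

lemma u_fun_inf_param [simp]: "u_fun (inf_param P (u, v)) = u"
  by (cases "u = 0") (auto simp: inf_param_nz)

lemma inf_param_eq_iff [simp]: "inf_param P x = inf_param P y \<longleftrightarrow> x = y"
proof -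
  obtain u v u' v' where "x = (u, v)" "y = (u', v')" by (metis surj_pair)
  thus ?thesis by (cases "u = 0"; cases "u' = 0") (auto simp: inf_param_nz)
qed

lemma inf_param_mem: "(u, v) \<in> aff_curve R \<Longrightarrow> inf_param P (u, v) \<in> hyp_carrier P"
  by (cases "u = 0")
    (auto simp: aff_curve_def hyp_carrier_def inf_param_nz poly_R power_divide power_mult[symmetric] mult.commute)

lemma Aff_mem [simp]: "Aff z w \<in> hyp_carrier P \<longleftrightarrow> w\<^sup>2 = poly P z"
  by (simp add: hyp_carrier_def)

lemma At_Inf_mem [simp]: "At_Inf v \<in> hyp_carrier P \<longleftrightarrow> v\<^sup>2 = lead_coeff P"
  by (simp add: hyp_carrier_def)

lemma Aff_eq_inf_param: "z \<noteq> 0 \<Longrightarrow> Aff z w = inf_param P (1 / z, w / z ^ m)"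
  by (simp add: inf_param_nz power_divide)

lemma reciprocal_mem: "z \<noteq> 0 \<Longrightarrow> w\<^sup>2 = poly P z \<Longrightarrow> (1 / z, w / z ^ m) \<in> aff_curve R"
  by (simp add: aff_curve_def poly_R power_divide power_mult[symmetric] mult.commute)

lemma hyp_open_carrier: "hyp_open P (hyp_carrier P)"
proof -
  have "{x \<in> aff_curve P. case_prod Aff x \<in> hyp_carrier P} = aff_curve P"
    by (auto simp: aff_curve_def)
  moreover have "{x \<in> aff_curve R. inf_param P x \<in> hyp_carrier P} = aff_curve R"
    using inf_param_mem by auto
  ultimately show ?thesis by (simp add: hyp_open_def)
qed

lemma topspace_X [simp]: "topspace X = hyp_carrier P"
proof
  show "topspace X \<subseteq> hyp_carrier P"
    unfolding topspace_def openin_hyp_top by (auto simp: hyp_open_def)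
  show "hyp_carrier P \<subseteq> topspace X"
    using hyp_open_carrier openin_hyp_top openin_subset by metis
qed

lemma continuous_map_Aff: "continuous_map (top_of_set (aff_curve P)) X (case_prod Aff)"
  unfolding continuous_map openin_hyp_top by (auto simp: hyp_open_def aff_curve_def)

lemma continuous_map_inf_param: "continuous_map (top_of_set (aff_curve R)) X (inf_param P)"
  unfolding continuous_map openin_hyp_top using inf_param_mem by (auto simp: hyp_open_def)

text \<open>\<open>X\<close> carries the final topology of its two affine models, so continuity is
  tested after composition with the two parametrizations.\<close>

lemma continuous_map_from_X:
  fixes f :: "hpoint \<Rightarrow> 'b::topological_space"
  assumes U: "hyp_open P U"
    and aff: "continuous_on {x \<in> aff_curve P. case_prod Aff x \<in> U} (f \<circ> case_prod Aff)"
    and inf: "continuous_on {x \<in> aff_curve R. inf_param P x \<in> U} (f \<circ> inf_param P)"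
  shows "continuous_map (subtopology X U) euclidean f"
proof -
  have U': "U \<subseteq> hyp_carrier P" using U by (simp add: hyp_open_def)
  have "openin (subtopology X U) {x \<in> topspace (subtopology X U). f x \<in> V}" if V: "open V" for V
  proof -
    have *: "openin (top_of_set C) {x \<in> C. h x \<in> U \<and> f (h x) \<in> V}"
      if "openin (top_of_set C) {x \<in> C. h x \<in> U}"
        "continuous_on {x \<in> C. h x \<in> U} (f \<circ> h)" for C and h :: "complex \<times> complex \<Rightarrow> hpoint"
    proof -
      have "openin (top_of_set {x \<in> C. h x \<in> U}) ({x \<in> C. h x \<in> U} \<inter> (f \<circ> h) -` V)"
        using that(2) V continuous_openin_preimage_gen by blast
      hence "openin (top_of_set C) ({x \<in> C. h x \<in> U} \<inter> (f \<circ> h) -` V)"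
        using that(1) openin_trans by blast
      moreover have "{x \<in> C. h x \<in> U} \<inter> (f \<circ> h) -` V = {x \<in> C. h x \<in> U \<and> f (h x) \<in> V}" by auto
      ultimately show ?thesis by simp
    qed
    have "hyp_open P {x \<in> U. f x \<in> V}"
      using U *[OF _ aff] *[OF _ inf] unfolding hyp_open_def by auto
    moreover have "{x \<in> topspace (subtopology X U). f x \<in> V} = {x \<in> U. f x \<in> V}" using U' by auto
    ultimately show ?thesis
      using U by (auto simp: openin_open_subtopology openin_hyp_top)
  qed
  thus ?thesis unfolding continuous_map_def by simp
qed

lemma continuous_map_from_X':
  fixes f :: "hpoint \<Rightarrow> 'b::topological_space"
  assumes "continuous_on (aff_curve P) (f \<circ> case_prod Aff)" "continuous_on (aff_curve R) (f \<circ> inf_param P)"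
  shows "continuous_map X euclidean f"
proof -
  have "{x \<in> aff_curve P. case_prod Aff x \<in> hyp_carrier P} = aff_curve P"
       "{x \<in> aff_curve R. inf_param P x \<in> hyp_carrier P} = aff_curve R"
    using hyp_open_carrier inf_param_mem by (auto simp: aff_curve_def)
  thus ?thesis
    using continuous_map_from_X[OF hyp_open_carrier, of f] assms
    by (metis subtopology_topspace topspace_X)
qed

text \<open>In the model at infinity the set is the preimage of \<open>T\<close> under the gluing
  map, which is continuous where \<open>u \<noteq> 0\<close>; no affine point has
  \<open>u = 0\<close>.\<close>

lemma hyp_open_Aff_image:
  assumes "open T"
  shows "hyp_open P {Aff z w | z w. (z, w) \<in> T \<and> w\<^sup>2 = poly P z}" (is "hyp_open P ?U")
proof -
  have 1: "{x \<in> aff_curve P. case_prod Aff x \<in> ?U} = aff_curve P \<inter> T"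
    by (auto simp: aff_curve_def)
  have cont: "continuous_on {x. fst x \<noteq> 0} (\<lambda>x. (1 / fst x, snd x / fst x ^ m) :: complex \<times> complex)"
    by (intro continuous_intros) auto
  have "open ({x :: complex \<times> complex. fst x \<noteq> 0} \<inter> (\<lambda>x. (1 / fst x, snd x / fst x ^ m)) -` T)"
    by (rule continuous_open_preimage[OF cont _ assms])
      (auto intro!: open_Collect_neq continuous_intros)
  moreover have 2: "{x \<in> aff_curve R. inf_param P x \<in> ?U} =
      aff_curve R \<inter> ({x. fst x \<noteq> 0} \<inter> (\<lambda>x. (1 / fst x, snd x / fst x ^ m)) -` T)" (is "?L = ?R")
  proof (intro set_eqI)
    fix x :: "complex \<times> complex"
    obtain u v where x: "x = (u, v)" by force
    show "x \<in> ?L \<longleftrightarrow> x \<in> ?R"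
    proof (cases "u = 0")
      case False
      have "(v / u ^ m)\<^sup>2 = poly P (1 / u)" if "(u, v) \<in> aff_curve R"
        using inf_param_mem[OF that] False by (simp add: inf_param_nz)
      thus ?thesis using False by (auto simp: x inf_param_nz)
    qed (auto simp: x)
  qed
  ultimately have "openin (top_of_set (aff_curve R)) {x \<in> aff_curve R. inf_param P x \<in> ?U}"
    by (simp only: openin_open_Int)
  thus ?thesis unfolding hyp_open_def 1 using assms by (auto simp: openin_open_Int)
qed

text \<open>The gluing map is given by the same formula in both directions, so the previous argument
  applies with the models exchanged; affine points with z = 0 do not occur in the image.\<close>

lemma hyp_open_inf_image:
  assumes "open T"
  shows "hyp_open P {inf_param P (u, v) | u v. (u, v) \<in> T \<and> v\<^sup>2 = poly R u}" (is "hyp_open P ?U")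
proof -
  have 1: "{x \<in> aff_curve R. inf_param P x \<in> ?U} = aff_curve R \<inter> T"
    by (auto simp: aff_curve_def)
  have cont: "continuous_on {x. fst x \<noteq> 0} (\<lambda>x. (1 / fst x, snd x / fst x ^ m) :: complex \<times> complex)"
    by (intro continuous_intros) auto
  have "open ({x :: complex \<times> complex. fst x \<noteq> 0} \<inter> (\<lambda>x. (1 / fst x, snd x / fst x ^ m)) -` T)"
    by (rule continuous_open_preimage[OF cont _ assms])
      (auto intro!: open_Collect_neq continuous_intros)
  moreover have 2: "{x \<in> aff_curve P. case_prod Aff x \<in> ?U} =
      aff_curve P \<inter> ({x. fst x \<noteq> 0} \<inter> (\<lambda>x. (1 / fst x, snd x / fst x ^ m)) -` T)" (is "?L = ?R")
  proof (intro set_eqI)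
    fix x :: "complex \<times> complex"
    obtain z w where x: "x = (z, w)" by force
    show "x \<in> ?L \<longleftrightarrow> x \<in> ?R"
    proof (cases "z = 0")
      case False
      thus ?thesis using reciprocal_mem[OF False, of w]
        by (auto simp: x Aff_eq_inf_param[OF False] aff_curve_def)
    next
      case True
      have "Aff 0 w \<noteq> inf_param P (u, v)" for u v
        by (cases "u = 0") (auto simp: inf_param_nz)
      thus ?thesis by (auto simp: x True)
    qed
  qed
  ultimately have "openin (top_of_set (aff_curve P)) {x \<in> aff_curve P. case_prod Aff x \<in> ?U}"
    by (simp only: openin_open_Int)
  moreover have "?U \<subseteq> hyp_carrier P" using inf_param_mem by (auto simp: aff_curve_def)
  ultimately show ?thesis unfolding hyp_open_def 1 using assms by (auto simp: openin_open_Int)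
qed

section \<open>Compactness and the Hausdorff property\<close>

lemma compact_curve_piece:
  fixes Q :: "complex poly"
  shows "compact {x \<in> aff_curve Q. norm (fst x) \<le> 1}"
proof -
  have "bounded (poly Q ` cball 0 1)"
    by (intro compact_imp_bounded compact_continuous_image continuous_intros) auto
  then obtain B where B: "B \<ge> 0" "\<And>z. norm z \<le> 1 \<Longrightarrow> norm (poly Q z) \<le> B"
    unfolding bounded_pos by (meson image_eqI less_imp_le mem_cball_0)
  have sub: "{x \<in> aff_curve Q. norm (fst x) \<le> 1} \<subseteq> cball 0 1 \<times> cball 0 (sqrt B)"
  proof (clarsimp simp: aff_curve_def)
    fix z w :: complex assume "w\<^sup>2 = poly Q z" "norm z \<le> 1"
    hence "(norm w)\<^sup>2 \<le> B" using B by (metis norm_power)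
    thus "norm w \<le> sqrt B" by (simp add: real_le_rsqrt)
  qed
  have "closed {x :: complex \<times> complex. (snd x)\<^sup>2 = poly Q (fst x) \<and> norm (fst x) \<le> 1}"
    by (intro closed_Collect_conj closed_Collect_eq closed_Collect_le continuous_intros)
  moreover have "{x \<in> aff_curve Q. norm (fst x) \<le> 1} =
      {x. (snd x)\<^sup>2 = poly Q (fst x) \<and> norm (fst x) \<le> 1}"
    by (auto simp: aff_curve_def)
  moreover have "bounded (cball (0::complex) 1 \<times> cball (0::complex) (sqrt B))"
    by (intro bounded_Times) auto
  ultimately show ?thesis using bounded_subset[OF _ sub] by (simp add: compact_eq_bounded_closed)
qed

text \<open>Two compact pieces cover the surface: |z| \<le> 1 in the affine model and |1/z| \<le> 1
  in the model at infinity.\<close>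

lemma compact_X: "compact_space X"
proof -
  let ?A = "{x \<in> aff_curve P. norm (fst x) \<le> 1}" and ?B = "{x \<in> aff_curve R. norm (fst x) \<le> 1}"
  have "compactin X (case_prod Aff ` ?A)" "compactin X (inf_param P ` ?B)"
    by (rule image_compactin[OF _ continuous_map_Aff] image_compactin[OF _ continuous_map_inf_param];
        simp add: compactin_subtopology compact_curve_piece; blast)+
  hence c: "compactin X (case_prod Aff ` ?A \<union> inf_param P ` ?B)"
    by (rule compactin_Un)
  have "hyp_carrier P \<subseteq> case_prod Aff ` ?A \<union> inf_param P ` ?B"
  proof
    fix p assume p: "p \<in> hyp_carrier P"
    show "p \<in> case_prod Aff ` ?A \<union> inf_param P ` ?B"
    proof (cases p)
      case (Aff z w)
      hence zw: "w\<^sup>2 = poly P z" using p by simp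
      show ?thesis
      proof (cases "norm z \<le> 1")
        case True
        hence "(z, w) \<in> ?A" using zw by (simp add: aff_curve_def)
        thus ?thesis using Aff by force
      next
        case False
        hence z: "z \<noteq> 0" by auto
        hence "(1 / z, w / z ^ m) \<in> ?B"
          using reciprocal_mem[OF z zw] False by (simp add: norm_divide)
        from imageI[OF this, of "inf_param P"] show ?thesis unfolding Aff Aff_eq_inf_param[OF z, of w] by (rule UnI2)
      qed
    next
      case (At_Inf v)
      hence "(0, v) \<in> ?B" using p by (simp add: aff_curve_def)
      from imageI[OF this, of "inf_param P"] show ?thesis unfolding At_Inf inf_param_0 by (rule UnI2)
    qed
  qed
  hence "hyp_carrier P = case_prod Aff ` ?A \<union> inf_param P ` ?B"
    using compactin_subset_topspace[OF c] by (intro subset_antisym) auto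
  thus ?thesis using c by (simp add: compact_space_def)
qed

text \<open>Continuous functions separate the points. \<open>f1\<close> and \<open>f2\<close> amount
  to the stereographic coordinates of z on the sphere; \<open>f3\<close> and \<open>f4\<close>,
  which are w damped by powers of \<open>den\<close>, tell the two sheets apart over finite points
  and over infinity respectively.\<close>

lemma Hausdorff_X: "Hausdorff_space X"
proof -
  define den :: "complex \<Rightarrow> complex" where "den = (\<lambda>z. 1 + z * cnj z)"
  define f1 f2 f3 f4 :: "hpoint \<Rightarrow> complex" where
    "f1 = (\<lambda>p. case p of Aff z w \<Rightarrow> 1 / den z | At_Inf v \<Rightarrow> 0)"
    and "f2 = (\<lambda>p. case p of Aff z w \<Rightarrow> z / den z | At_Inf v \<Rightarrow> 0)"
    and "f3 = (\<lambda>p. case p of Aff z w \<Rightarrow> w / den z ^ Suc m | At_Inf v \<Rightarrow> 0)"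
    and "f4 = (\<lambda>p. case p of Aff z w \<Rightarrow> w * cnj z ^ m / den z ^ m | At_Inf v \<Rightarrow> v)"
  have nz: "den z \<noteq> 0" for z
  proof -
    have "Re (den z) = 1 + (Re z)\<^sup>2 + (Im z)\<^sup>2" by (simp add: den_def power2_eq_square)
    moreover have "\<dots> > 0" by (intro add_pos_nonneg) auto
    ultimately show ?thesis by (metis less_irrefl zero_complex.simps(1))
  qed
  have cden: "continuous_on S (\<lambda>x. den (h x))" if "continuous_on S h" for S and h :: "complex \<times> complex \<Rightarrow> complex"
    unfolding den_def by (intro continuous_intros that)
  have d: "den (1 / u) = den u / (u * cnj u)" if "u \<noteq> 0" for u
    using that by (simp add: den_def field_simps)
  have den0: "den 0 = 1" by (simp add: den_def)
  \<comment> \<open>Rewritten in u and v the four functions have no singularity at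
    \<open>u = 0\<close>; the exponents of \<open>den\<close> are chosen for this.\<close>
  have inf: "f1 (inf_param P (u, v)) = u * cnj u / den u" "f2 (inf_param P (u, v)) = cnj u / den u"
    "f3 (inf_param P (u, v)) = v * u * cnj u ^ Suc m / den u ^ Suc m"
    "f4 (inf_param P (u, v)) = v / den u ^ m" for u v
    by (cases "u = 0"; simp add: f1_def f2_def f3_def f4_def inf_param_nz d den0
          power_divide power_mult_distrib)+
  have cont: "continuous_map X euclidean f"
    if "\<And>z w. f (Aff z w) = h (z, w)" "\<And>u v. f (inf_param P (u, v)) = k (u, v)"
      "continuous_on UNIV h" "continuous_on UNIV k" for f :: "hpoint \<Rightarrow> complex" and h k
  proof (rule continuous_map_from_X')
    have "f \<circ> case_prod Aff = h" "f \<circ> inf_param P = k" using that by (auto simp: fun_eq_iff)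
    thus "continuous_on (aff_curve P) (f \<circ> case_prod Aff)" "continuous_on (aff_curve R) (f \<circ> inf_param P)"
      using that(3,4) continuous_on_subset by auto
  qed
  have c1: "continuous_map X euclidean f1"
    by (rule cont[of _ "\<lambda>x. 1 / den (fst x)" "\<lambda>x. fst x * cnj (fst x) / den (fst x)"])
      (auto simp: inf, auto simp: f1_def nz intro!: continuous_intros cden)
  have c2: "continuous_map X euclidean f2"
    by (rule cont[of _ "\<lambda>x. fst x / den (fst x)" "\<lambda>x. cnj (fst x) / den (fst x)"])
      (auto simp: inf, auto simp: f2_def nz intro!: continuous_intros cden)
  have c3: "continuous_map X euclidean f3"
    by (rule cont[of _ "\<lambda>x. snd x / den (fst x) ^ Suc m"
          "\<lambda>x. snd x * fst x * cnj (fst x) ^ Suc m / den (fst x) ^ Suc m"])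
      (simp_all only: inf prod.sel, simp_all add: f3_def del: power_Suc,
        (intro continuous_intros cden; simp add: nz)+)
  have c4: "continuous_map X euclidean f4"
    by (rule cont[of _ "\<lambda>x. snd x * cnj (fst x) ^ m / den (fst x) ^ m" "\<lambda>x. snd x / den (fst x) ^ m"])
      (auto simp: inf, auto simp: f4_def nz intro!: continuous_intros cden)
  have inj: "p = q" if e: "f1 p = f1 q" "f2 p = f2 q" "f3 p = f3 q" "f4 p = f4 q" for p q
  proof (cases p; cases q)
    fix z w z' w' assume pq: "p = Aff z w" "q = Aff z' w'"
    have "den z = den z'" using e(1) nz by (simp add: pq f1_def)
    thus "p = q" using e(2,3) nz[of z'] by (simp add: pq f2_def f3_def)
  qed (use e nz in \<open>auto simp: f1_def f4_def\<close>)
  show ?thesis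
    unfolding Hausdorff_space_def
  proof (intro allI impI)
    fix p q assume pq: "p \<in> topspace X \<and> q \<in> topspace X \<and> p \<noteq> q"
    then obtain f :: "hpoint \<Rightarrow> complex" where f: "continuous_map X euclidean f" "f p \<noteq> f q"
      using inj c1 c2 c3 c4 by metis
    obtain S T where "open S" "open T" "f p \<in> S" "f q \<in> T" "S \<inter> T = {}"
      using hausdorff[OF f(2)] by metis
    moreover have "openin X {x \<in> topspace X. f x \<in> V}" if "open V" for V
      using f(1) that openin_continuous_map_preimage[of X euclidean f V] by simp
    ultimately show "\<exists>U V. openin X U \<and> openin X V \<and> p \<in> U \<and> q \<in> V \<and> disjnt U V"
      using pq by (intro exI[of _ "{x \<in> topspace X. f x \<in> S}"] exI[of _ "{x \<in> topspace X. f x \<in> T}"])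
        (auto simp: disjnt_def)
  qed
qed

end

section \<open>Charts\<close>

lemma chart_functions_distinct [simp]:
  "z_fun \<noteq> u_fun" "u_fun \<noteq> z_fun" "w_fun \<noteq> u_fun" "u_fun \<noteq> w_fun"
proof -
  have "z_fun (Aff 2 0) \<noteq> u_fun (Aff 2 0)" "w_fun (Aff 2 0) \<noteq> u_fun (Aff 2 0)" by auto
  thus "z_fun \<noteq> u_fun" "u_fun \<noteq> z_fun" "w_fun \<noteq> u_fun" "u_fun \<noteq> w_fun" by metis+
qed

text \<open>Serves to shrink a parametrization \<open>k\<close> until it stays inside a chart
  domain; further open conditions, such as w being nonzero, are collected in
  \<open>S\<close>.\<close>

lemma param_in_open:
  fixes h :: "'b::topological_space \<Rightarrow> 'c" and k :: "'a::metric_space \<Rightarrow> 'b"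
  assumes "openin (top_of_set C) {x \<in> C. h x \<in> U}" "open S" "continuous_on (ball x0 r0) k"
    "k ` ball x0 r0 \<subseteq> C" "h (k x0) \<in> U" "k x0 \<in> S" "r0 > 0"
  shows "\<exists>r>0. r \<le> r0 \<and> (\<forall>x\<in>ball x0 r. h (k x) \<in> U \<and> k x \<in> S)"
proof -
  obtain T where T: "open T" "{x \<in> C. h x \<in> U} = C \<inter> T" using assms(1) by (auto simp: openin_open)
  have "k x0 \<in> C" using assms(4,7) by auto
  hence "k x0 \<in> C \<inter> T" unfolding T(2)[symmetric] using assms(5) by simp
  hence "x0 \<in> ball x0 r0 \<inter> k -` (T \<inter> S)" using assms by auto
  moreover have "open (ball x0 r0 \<inter> k -` (T \<inter> S))"
    by (intro continuous_open_preimage assms T open_ball open_Int)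
  ultimately obtain r where r: "r > 0" "ball x0 r \<subseteq> ball x0 r0 \<inter> k -` (T \<inter> S)"
    using open_contains_ball by metis
  have "h (k x) \<in> U \<and> k x \<in> S" if "x \<in> ball x0 (min r r0)" for x
  proof -
    have "x \<in> ball x0 r" "x \<in> ball x0 r0" using that by auto
    hence "k x \<in> C \<inter> T" "k x \<in> S" using assms(4) r by auto
    thus ?thesis unfolding T(2)[symmetric] by auto
  qed
  thus ?thesis using r assms(7) by (intro exI[of _ "min r r0"]) auto
qed

context hyperelliptic
begin

lemma z_fun_inf_param [simp]: "z_fun (inf_param P (u, v)) = 1 / u"
  by (cases "u = 0") (auto simp: inf_param_nz)

lemma hyp_open_chart: "c \<in> A \<Longrightarrow> hyp_open P (fst c)"
  by (auto simp: hyp_atlas_def)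

lemma inj_chart: "c \<in> A \<Longrightarrow> inj_on (snd c) (fst c)"
  by (auto simp: hyp_atlas_def)

lemma chart_inv_chart: "c \<in> A \<Longrightarrow> p \<in> fst c \<Longrightarrow> chart_inv c (snd c p) = p"
  by (simp add: chart_inv_def inj_chart)

lemma chart_cases:
  assumes "c \<in> A"
  obtains "snd c = z_fun" "fst c \<subseteq> {Aff z w | z w. w \<noteq> 0}"
    | "snd c = w_fun" "fst c \<subseteq> {Aff z w | z w. poly (pderiv P) z \<noteq> 0}"
    | "snd c = u_fun" "fst c \<subseteq> {Aff z w | z w. z \<noteq> 0 \<and> w \<noteq> 0} \<union> range At_Inf"
proof -
  obtain U f where "c = (U, f)" by force
  thus ?thesis using assms that unfolding hyp_atlas_def by (elim UnE CollectE exE conjE) simp_all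
qed

lemma chart_subset: "c \<in> A \<Longrightarrow> fst c \<subseteq> hyp_carrier P"
  using hyp_open_chart by (simp add: hyp_open_def)

lemma has_field_derivative_P: "(poly P has_field_derivative poly (pderiv P) z) (at z within S)"
  using poly_DERIV has_field_derivative_at_within by blast

text \<open>A holomorphic parametrization of a neighbourhood of an affine point, inverse to the chart \<open>c\<close>.
  The function \<open>N\<close> represents \<open>dz/w\<close>, which is holomorphic also where \<open>w = 0\<close>.\<close>

definition aff_param ::
    "hpoint chart \<Rightarrow> hpoint \<Rightarrow> real \<Rightarrow> (complex \<Rightarrow> complex) \<Rightarrow> (complex \<Rightarrow> complex) \<Rightarrow> (complex \<Rightarrow> complex) \<Rightarrow> bool"
  where "aff_param c p r Z W N \<longleftrightarrow> r > 0 \<and> ball (snd c p) r \<subseteq> chart_image c \<and>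
    Z holomorphic_on ball (snd c p) r \<and> W holomorphic_on ball (snd c p) r \<and>
    N holomorphic_on ball (snd c p) r \<and> Aff (Z (snd c p)) (W (snd c p)) = p \<and>
    (\<forall>\<zeta>\<in>ball (snd c p) r. chart_inv c \<zeta> = Aff (Z \<zeta>) (W \<zeta>) \<and> Aff (Z \<zeta>) (W \<zeta>) \<in> fst c \<and>
       snd c (Aff (Z \<zeta>) (W \<zeta>)) = \<zeta> \<and> (W \<zeta>)\<^sup>2 = poly P (Z \<zeta>) \<and>
       (Z has_field_derivative N \<zeta> * W \<zeta>) (at \<zeta>) \<and> (\<zeta> \<noteq> snd c p \<longrightarrow> W \<zeta> \<noteq> 0))"

text \<open>The counterpart of \<open>aff_param\<close> at a point over infinity, reached only by
  charts with coordinate u. There v is a nonvanishing holomorphic function \<open>V\<close> of u, so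
  one function describes the curve.\<close>

definition inf_param_at :: "hpoint chart \<Rightarrow> complex \<Rightarrow> real \<Rightarrow> (complex \<Rightarrow> complex) \<Rightarrow> bool"
  where "inf_param_at c v r V \<longleftrightarrow> snd c = u_fun \<and> r > 0 \<and> ball 0 r \<subseteq> chart_image c \<and>
    V holomorphic_on ball 0 r \<and> V 0 = v \<and>
    (\<forall>\<zeta>\<in>ball 0 r. chart_inv c \<zeta> = inf_param P (\<zeta>, V \<zeta>) \<and> inf_param P (\<zeta>, V \<zeta>) \<in> fst c \<and>
       (V \<zeta>)\<^sup>2 = poly R \<zeta> \<and> V \<zeta> \<noteq> 0)"

text \<open>Off the branch points \<open>N\<close> is Z'/W. Differentiating W^2 = P(Z) gives 2 W W'
  = P'(Z) Z', hence the second expression 2 W'/P'(Z), which stays finite at a branch point.\<close>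

lemma aff_param_from_inverse:
  assumes c: "c \<in> A" and p: "Aff z0 w0 \<in> fst c" and S: "open S" "(z0, w0) \<in> S"
    and z0: "snd c (Aff z0 w0) = \<zeta>0" and r0: "r0 > 0"
    and ZW: "Z holomorphic_on ball \<zeta>0 r0" "W holomorphic_on ball \<zeta>0 r0" "Z \<zeta>0 = z0" "W \<zeta>0 = w0"
    and sq: "\<And>\<zeta>. \<zeta> \<in> ball \<zeta>0 r0 \<Longrightarrow> (W \<zeta>)\<^sup>2 = poly P (Z \<zeta>)"
    and inv: "\<And>\<zeta>. \<zeta> \<in> ball \<zeta>0 r0 \<Longrightarrow> snd c (Aff (Z \<zeta>) (W \<zeta>)) = \<zeta>"
  shows "\<exists>r N. aff_param c (Aff z0 w0) r Z W N \<and> (\<forall>\<zeta>\<in>ball \<zeta>0 r. (Z \<zeta>, W \<zeta>) \<in> S)"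
proof -
  define K where "K = {z. poly P z = 0} - {z0}"
  have "finite K" unfolding K_def using P_nonzero poly_roots_finite by blast
  hence K: "open (- K)" using finite_imp_closed open_Compl by blast
  \<comment> \<open>Near an ordinary point W is kept away from 0. Near a branch point P' is kept
    away from 0 and all other roots of P are excluded, so that W vanishes at the centre
    only.\<close>
  define S' where "S' = S \<inter> (if w0 \<noteq> 0 then {x. snd x \<noteq> 0} else
     {x. poly (pderiv P) (fst x) \<noteq> 0} \<inter> (- K) \<times> UNIV)"
  have w0: "w0\<^sup>2 = poly P z0" using sq[of \<zeta>0] r0 ZW by simp
  have "open {x :: complex \<times> complex. snd x \<noteq> 0}" "open {x :: complex \<times> complex. poly (pderiv P) (fst x) \<noteq> 0}"
    by (intro open_Collect_neq continuous_intros)+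
  hence "open S'" using S K by (auto simp: S'_def intro!: open_Int open_Times)
  moreover have "(z0, w0) \<in> S'"
    using S simple_roots[of z0] w0 by (auto simp: S'_def K_def)
  moreover have "openin (top_of_set (aff_curve P)) {x \<in> aff_curve P. case_prod Aff x \<in> fst c}"
    using hyp_open_chart[OF c] by (simp add: hyp_open_def)
  moreover have "continuous_on (ball \<zeta>0 r0) (\<lambda>\<zeta>. (Z \<zeta>, W \<zeta>))"
    using ZW by (intro continuous_intros holomorphic_on_imp_continuous_on)
  moreover have im0: "(\<lambda>\<zeta>. (Z \<zeta>, W \<zeta>)) ` ball \<zeta>0 r0 \<subseteq> aff_curve P"
    using sq by (auto simp: aff_curve_def)
  ultimately obtain r where r: "r > 0" "r \<le> r0"
      "\<And>\<zeta>. \<zeta> \<in> ball \<zeta>0 r \<Longrightarrow> Aff (Z \<zeta>) (W \<zeta>) \<in> fst c \<and> (Z \<zeta>, W \<zeta>) \<in> S'"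
    using param_in_open[of "aff_curve P" "case_prod Aff" "fst c" S' \<zeta>0 r0 "\<lambda>\<zeta>. (Z \<zeta>, W \<zeta>)"] p r0 ZW im0
    by auto
  have sub: "ball \<zeta>0 r \<subseteq> ball \<zeta>0 r0" using r by auto
  note hol = holomorphic_on_subset[OF ZW(1) sub] holomorphic_on_subset[OF ZW(2) sub]
  have dZ: "(Z has_field_derivative deriv Z \<zeta>) (at \<zeta>)" and dW: "(W has_field_derivative deriv W \<zeta>) (at \<zeta>)"
    if "\<zeta> \<in> ball \<zeta>0 r" for \<zeta>
    using hol that holomorphic_derivI open_ball by blast+
  have rel: "2 * W \<zeta> * deriv W \<zeta> = poly (pderiv P) (Z \<zeta>) * deriv Z \<zeta>" if \<zeta>: "\<zeta> \<in> ball \<zeta>0 r" for \<zeta>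
  proof -
    have 1: "((\<lambda>x. (W x)\<^sup>2) has_field_derivative 2 * W \<zeta> * deriv W \<zeta>) (at \<zeta>)"
      using dW[OF \<zeta>] by (auto intro!: derivative_eq_intros)
    have "((\<lambda>x. poly P (Z x)) has_field_derivative poly (pderiv P) (Z \<zeta>) * deriv Z \<zeta>) (at \<zeta>)"
      using DERIV_chain2[OF has_field_derivative_P dZ[OF \<zeta>]] .
    hence "((\<lambda>x. (W x)\<^sup>2) has_field_derivative poly (pderiv P) (Z \<zeta>) * deriv Z \<zeta>) (at \<zeta>)"
      by (rule has_field_derivative_transform_within_open[OF _ open_ball \<zeta>]) (use sq sub in auto)
    thus ?thesis using 1 DERIV_unique by blast
  qed
  define N where "N = (\<lambda>\<zeta>. if w0 \<noteq> 0 then deriv Z \<zeta> / W \<zeta> else 2 * deriv W \<zeta> / poly (pderiv P) (Z \<zeta>))"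
  have nz: "w0 \<noteq> 0 \<Longrightarrow> W \<zeta> \<noteq> 0" "w0 = 0 \<Longrightarrow> poly (pderiv P) (Z \<zeta>) \<noteq> 0" if "\<zeta> \<in> ball \<zeta>0 r" for \<zeta>
    using r(3)[OF that] by (auto simp: S'_def)
  have hN: "N holomorphic_on ball \<zeta>0 r"
  proof (cases "w0 = 0")
    case True
    thus ?thesis unfolding N_def using nz hol by (auto intro!: holomorphic_intros)
  next
    case False
    thus ?thesis unfolding N_def using nz hol by (auto intro!: holomorphic_intros)
  qed
  have N: "N \<zeta> * W \<zeta> = deriv Z \<zeta>" if "\<zeta> \<in> ball \<zeta>0 r" for \<zeta>
    using nz[OF that] rel[OF that] by (auto simp: N_def field_simps)
  have W: "W \<zeta> \<noteq> 0" if \<zeta>: "\<zeta> \<in> ball \<zeta>0 r" "\<zeta> \<noteq> \<zeta>0" for \<zeta>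
  proof
    assume 0: "W \<zeta> = 0"
    hence "w0 = 0" using nz \<zeta> by blast
    moreover have "poly P (Z \<zeta>) = 0" using sq[of \<zeta>] \<zeta> sub 0 by auto
    ultimately have "Z \<zeta> = z0" using r(3)[OF \<zeta>(1)] by (auto simp: S'_def K_def)
    hence "snd c (Aff (Z \<zeta>) (W \<zeta>)) = snd c (Aff z0 w0)" using 0 \<open>w0 = 0\<close> by simp
    thus False using inv[of \<zeta>] z0 \<zeta> sub by auto
  qed
  have im: "snd c (Aff (Z \<zeta>) (W \<zeta>)) = \<zeta>" "Aff (Z \<zeta>) (W \<zeta>) \<in> fst c" if "\<zeta> \<in> ball \<zeta>0 r" for \<zeta>
    using inv r(3) sub that by blast+
  have "chart_inv c \<zeta> = Aff (Z \<zeta>) (W \<zeta>)" if "\<zeta> \<in> ball \<zeta>0 r" for \<zeta>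
    using chart_inv_chart[OF c im(2)[OF that]] im(1)[OF that] by simp
  moreover have "ball \<zeta>0 r \<subseteq> chart_image c"
    unfolding chart_image_def using im by (metis image_eqI subsetI)
  ultimately have "aff_param c (Aff z0 w0) r Z W N"
    unfolding aff_param_def z0 using r(1) hol hN ZW im W dZ N sq sub by auto
  moreover have "\<forall>\<zeta>\<in>ball \<zeta>0 r. (Z \<zeta>, W \<zeta>) \<in> S" using r(3) by (auto simp: S'_def)
  ultimately show ?thesis by blast
qed

text \<open>The local inverse depends on the coordinate: for z it is a root of P(z), for w the local
  inverse of P at w^2, for u the first one at 1/u. The open set \<open>S\<close> lets later
  arguments impose conditions on (z, w), for instance z nonzero.\<close>

lemma ex_aff_param:
  assumes c: "c \<in> A" and p: "Aff z0 w0 \<in> fst c" and S: "open S" "(z0, w0) \<in> S"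
  shows "\<exists>r Z W N. aff_param c (Aff z0 w0) r Z W N \<and> (\<forall>\<zeta>\<in>ball (snd c (Aff z0 w0)) r. (Z \<zeta>, W \<zeta>) \<in> S)"
proof -
  note core = aff_param_from_inverse[OF c p S]
  have w0: "w0\<^sup>2 = poly P z0" using chart_subset[OF c] p by auto
  have hP: "poly P holomorphic_on UNIV" by (intro holomorphic_intros)
  consider "snd c = z_fun" "w0 \<noteq> 0" | "snd c = w_fun" "poly (pderiv P) z0 \<noteq> 0"
    | "snd c = u_fun" "z0 \<noteq> 0" "w0 \<noteq> 0"
    by (rule chart_cases[OF c]) (use p in blast)+
  thus ?thesis
  proof cases
    case 1
    obtain r s where "r > 0" "s holomorphic_on ball z0 r" "s z0 = w0"
        "\<And>z. z \<in> ball z0 r \<Longrightarrow> (s z)\<^sup>2 = poly P z"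
      using holomorphic_square_root_at[OF hP open_UNIV UNIV_I w0[symmetric] 1(2)] by metis
    thus ?thesis using core[of z0 r "\<lambda>\<zeta>. \<zeta>" s] 1 by (metis holomorphic_on_ident z_fun.simps(1))
  next
    case 2
    have d: "deriv (poly P) z0 \<noteq> 0" using 2 has_field_derivative_P DERIV_imp_deriv by metis
    obtain r h where h: "r > 0" "h holomorphic_on ball (w0\<^sup>2) r" "h (w0\<^sup>2) = z0"
        "\<And>y. y \<in> ball (w0\<^sup>2) r \<Longrightarrow> poly P (h y) = y"
      using holomorphic_local_inverse_at[OF hP open_UNIV UNIV_I d] w0 by metis
    have "continuous (at w0) (\<lambda>w::complex. w\<^sup>2)" by (intro continuous_intros)
    then obtain e where e: "e > 0" "\<And>w. w \<in> ball w0 e \<Longrightarrow> w\<^sup>2 \<in> ball (w0\<^sup>2) r"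
      unfolding continuous_at_ball using h(1) by (metis image_subset_iff)
    have "(\<lambda>w. h (w\<^sup>2)) holomorphic_on ball w0 e"
      using e by (intro holomorphic_on_compose_gen[OF _ h(2), unfolded o_def] holomorphic_intros) auto
    thus ?thesis using core[of w0 e "\<lambda>w. h (w\<^sup>2)" "\<lambda>w. w"] 2 e h
      by (metis (no_types, lifting) holomorphic_on_ident w_fun.simps(1))
  next
    case 3
    obtain r s where s: "r > 0" "s holomorphic_on ball z0 r" "s z0 = w0"
        "\<And>z. z \<in> ball z0 r \<Longrightarrow> (s z)\<^sup>2 = poly P z"
      using holomorphic_square_root_at[OF hP open_UNIV UNIV_I w0[symmetric] 3(3)] by metis
    have "continuous (at (1 / z0)) (\<lambda>u. 1 / u)" using 3 by (intro continuous_intros) auto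
    then obtain e where e: "e > 0" "\<And>u. u \<in> ball (1 / z0) e \<Longrightarrow> 1 / u \<in> ball z0 r"
      unfolding continuous_at_ball using s(1) by (metis (no_types, lifting) div_by_1 divide_divide_eq_right image_subset_iff mult_1)
    \<comment> \<open>The second bound keeps 0 out of the disc about 1/z0.\<close>
    define e' where "e' = min e (norm (1 / z0))"
    have e': "e' > 0" "u \<noteq> 0" "1 / u \<in> ball z0 r" if "u \<in> ball (1 / z0) e'" for u
      using that e 3 by (auto simp: e'_def)
    have "e' > 0" using e 3 by (auto simp: e'_def)
    moreover have "(\<lambda>u. 1 / u) holomorphic_on ball (1 / z0) e'"
      using e' by (intro holomorphic_intros) auto
    moreover from this have "(\<lambda>u. s (1 / u)) holomorphic_on ball (1 / z0) e'"
      using e' by (intro holomorphic_on_compose_gen[OF _ s(2), unfolded o_def]) auto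
    ultimately have "\<exists>r N. aff_param c (Aff z0 w0) r (\<lambda>u. 1 / u) (\<lambda>u. s (1 / u)) N \<and>
        (\<forall>\<zeta>\<in>ball (1 / z0) r. (1 / \<zeta>, s (1 / \<zeta>)) \<in> S)"
      using e' s 3 by (intro core) auto
    thus ?thesis using 3 by auto
  qed
qed

text \<open>The value of the reflected polynomial at 0 is the leading coefficient of P, which is
  nonzero; hence v has a nonvanishing holomorphic branch near \<open>u = 0\<close>.\<close>

lemma ex_inf_param:
  assumes c: "c \<in> A" and p: "At_Inf v0 \<in> fst c"
  shows "\<exists>r V. inf_param_at c v0 r V"
proof -
  have f: "snd c = u_fun" using c p by (auto simp: hyp_atlas_def)
  have v0: "v0\<^sup>2 = lead_coeff P" using chart_subset[OF c] p by auto
  hence nz: "v0 \<noteq> 0" using P_nonzero by auto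
  have hR: "poly R holomorphic_on UNIV" by (intro holomorphic_intros)
  obtain r0 V where V: "r0 > 0" "V holomorphic_on ball 0 r0" "V 0 = v0"
      "\<And>u. u \<in> ball 0 r0 \<Longrightarrow> (V u)\<^sup>2 = poly R u"
    using holomorphic_square_root_at[OF hR open_UNIV UNIV_I, of 0 v0] v0 nz by auto
  have "openin (top_of_set (aff_curve R)) {x \<in> aff_curve R. inf_param P x \<in> fst c}"
    using hyp_open_chart[OF c] by (simp add: hyp_open_def)
  moreover have "open {x :: complex \<times> complex. snd x \<noteq> 0}"
    by (intro open_Collect_neq continuous_intros)+
  moreover have "continuous_on (ball 0 r0) (\<lambda>\<zeta>. (\<zeta>, V \<zeta>))"
    using V by (intro continuous_intros holomorphic_on_imp_continuous_on)
  moreover have im0: "(\<lambda>\<zeta>. (\<zeta>, V \<zeta>)) ` ball 0 r0 \<subseteq> aff_curve R"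
    using V by (auto simp: aff_curve_def)
  ultimately obtain r where r: "r > 0" "r \<le> r0"
      "\<And>\<zeta>. \<zeta> \<in> ball 0 r \<Longrightarrow> inf_param P (\<zeta>, V \<zeta>) \<in> fst c \<and> V \<zeta> \<noteq> 0"
    using param_in_open[of "aff_curve R" "inf_param P" "fst c" "{x. snd x \<noteq> 0}" 0 r0 "\<lambda>\<zeta>. (\<zeta>, V \<zeta>)"] p nz V im0
    by auto
  have sub: "ball 0 r \<subseteq> ball 0 r0" using r by auto
  have inv: "chart_inv c \<zeta> = inf_param P (\<zeta>, V \<zeta>)" if "\<zeta> \<in> ball 0 r" for \<zeta>
    using chart_inv_chart[OF c, of "inf_param P (\<zeta>, V \<zeta>)"] r(3)[OF that] by (simp add: f)
  have "ball 0 r \<subseteq> chart_image c"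
    unfolding chart_image_def using r(3) f u_fun_inf_param by (metis image_eqI subsetI)
  thus ?thesis unfolding inf_param_at_def
    using f r V inv sub holomorphic_on_subset[OF V(2) sub] by (intro exI[of _ r] exI[of _ V]) auto
qed

section \<open>The atlas: openness, covering, compatibility\<close>

lemma open_chart_image:
  assumes c: "c \<in> A" shows "open (chart_image c)"
  unfolding open_contains_ball
proof
  fix \<zeta> assume "\<zeta> \<in> chart_image c"
  then obtain p where p: "p \<in> fst c" "\<zeta> = snd c p" by (auto simp: chart_image_def)
  show "\<exists>e>0. ball \<zeta> e \<subseteq> chart_image c"
  proof (cases p)
    case (Aff z w)
    then show ?thesis using ex_aff_param[OF c, of z w UNIV] p by (auto simp: aff_param_def)
  next
    case (At_Inf v)
    then obtain r V where "inf_param_at c v r V" using ex_inf_param[OF c] p by blast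
    thus ?thesis using p At_Inf by (auto simp: inf_param_at_def)
  qed
qed

text \<open>The atlas contains every admissible domain, not a selection of them. This closure under
  restriction turns statements about chart images into statements about arbitrary open subsets of a
  chart.\<close>

lemma chart_restrict:
  assumes "c \<in> A" "hyp_open P U" "U \<subseteq> fst c"
  shows "(U, snd c) \<in> A"
proof -
  have inj: "inj_on (snd c) U" using inj_on_subset[OF inj_chart[OF assms(1)] assms(3)] .
  show ?thesis
    by (rule chart_cases[OF assms(1)]; use assms(2,3) inj in \<open>simp add: hyp_atlas_def\<close>; blast)
qed

text \<open>Restricting w to the disc about \<open>w0\<close> of radius \<open>norm w0\<close>
  leaves a single sheet, on which z is injective.\<close>

lemma ex_z_chart:
  assumes w0: "w0 \<noteq> 0" "w0\<^sup>2 = poly P z0"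
  shows "\<exists>c\<in>A. snd c = z_fun \<and> Aff z0 w0 \<in> fst c"
proof -
  define U where "U = {Aff z w | z w. (z, w) \<in> UNIV \<times> ball w0 (norm w0) \<and> w\<^sup>2 = poly P z}"
  have "hyp_open P U" unfolding U_def by (intro hyp_open_Aff_image open_Times) auto
  moreover have "inj_on z_fun U"
    using square_eq_same_side[of _ _ w0]
    by (auto simp: inj_on_def U_def dist_norm norm_minus_commute)
  moreover have "U \<subseteq> {Aff z w | z w. w \<noteq> 0}" by (auto simp: U_def)
  ultimately have "(U, z_fun) \<in> A" by (auto simp: hyp_atlas_def)
  moreover have "Aff z0 w0 \<in> U" using w0 by (auto simp: U_def)
  ultimately show ?thesis by force
qed

text \<open>P is injective near a simple root, so w determines z there through P(z) = w^2.\<close>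

lemma ex_w_chart:
  assumes P0: "poly P z0 = 0"
  shows "\<exists>c\<in>A. snd c = w_fun \<and> Aff z0 0 \<in> fst c"
proof -
  have d: "deriv (poly P) z0 \<noteq> 0" using simple_roots[OF P0] has_field_derivative_P DERIV_imp_deriv by metis
  have hP: "poly P holomorphic_on UNIV" by (intro holomorphic_intros)
  obtain r where r: "r > 0" "inj_on (poly P) (ball z0 r)"
    using has_complex_derivative_locally_injective[OF hP UNIV_I open_UNIV d] by metis
  define T where "T = (ball z0 r \<inter> {z. poly (pderiv P) z \<noteq> 0}) \<times> (UNIV :: complex set)"
  define U where "U = {Aff z w | z w. (z, w) \<in> T \<and> w\<^sup>2 = poly P z}"
  have "open T" unfolding T_def by (intro open_Times open_Int open_Collect_neq continuous_intros) auto
  hence "hyp_open P U" unfolding U_def by (rule hyp_open_Aff_image)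
  moreover have "inj_on w_fun U"
    using r(2) by (auto simp: inj_on_def U_def T_def)
  moreover have "U \<subseteq> {Aff z w | z w. poly (pderiv P) z \<noteq> 0}" by (auto simp: U_def T_def)
  ultimately have "(U, w_fun) \<in> A" by (auto simp: hyp_atlas_def)
  moreover have "Aff z0 0 \<in> U" using simple_roots[OF P0] P0 r by (auto simp: U_def T_def)
  ultimately show ?thesis by force
qed

lemma ex_u_chart:
  assumes v0: "v0\<^sup>2 = lead_coeff P"
  shows "\<exists>c\<in>A. snd c = u_fun \<and> At_Inf v0 \<in> fst c"
proof -
  have nz: "v0 \<noteq> 0" using v0 P_nonzero by auto
  define U where "U = {inf_param P (u, v) | u v. (u, v) \<in> UNIV \<times> ball v0 (norm v0) \<and> v\<^sup>2 = poly R u}"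
  have "hyp_open P U" unfolding U_def by (intro hyp_open_inf_image open_Times) auto
  moreover have "inj_on u_fun U"
    using square_eq_same_side[of _ _ v0]
    by (auto simp: inj_on_def U_def dist_norm norm_minus_commute)
  moreover have "U \<subseteq> {Aff z w | z w. z \<noteq> 0 \<and> w \<noteq> 0} \<union> range At_Inf"
  proof
    fix p assume "p \<in> U"
    then obtain u v where "p = inf_param P (u, v)" "v \<in> ball v0 (norm v0)" by (auto simp: U_def)
    moreover from this have "v \<noteq> 0" by auto
    ultimately
    show "p \<in> {Aff z w | z w. z \<noteq> 0 \<and> w \<noteq> 0} \<union> range At_Inf"
      by (cases "u = 0") (auto simp: inf_param_nz)
  qed
  ultimately have "(U, u_fun) \<in> A" by (auto simp: hyp_atlas_def)
  moreover have "At_Inf v0 \<in> U" unfolding U_def using v0 nz inf_param_0[of v0, symmetric]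
    by (force simp del: inf_param_0)
  ultimately show ?thesis by force
qed

lemma charts_cover: "\<Union> (fst ` A) = hyp_carrier P"
proof (intro equalityI subsetI)
  fix p assume p: "p \<in> hyp_carrier P"
  have "\<exists>c\<in>A. p \<in> fst c"
  proof (cases p)
    case (Aff z w)
    then show ?thesis using p ex_z_chart[of w z] ex_w_chart[of z] by (cases "w = 0") auto
  next
    case (At_Inf v)
    then show ?thesis using p ex_u_chart[of v] by auto
  qed
  thus "p \<in> \<Union> (fst ` A)" by blast
qed (use chart_subset in blast)

lemma continuous_map_chart:
  assumes c: "c \<in> A"
  shows "continuous_map (subtopology X (fst c)) euclidean (snd c)"
proof (rule continuous_map_from_X[OF hyp_open_chart[OF c]])
  let ?C = "{x \<in> aff_curve P. case_prod Aff x \<in> fst c}" and ?D = "{x \<in> aff_curve R. inf_param P x \<in> fst c}"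
  consider "snd c = z_fun" "\<And>v. At_Inf v \<notin> fst c" | "snd c = w_fun" "\<And>v. At_Inf v \<notin> fst c"
    | "snd c = u_fun" "\<And>w. Aff 0 w \<notin> fst c"
    by (rule chart_cases[OF c]) blast+
  hence "continuous_on ?C (snd c \<circ> case_prod Aff) \<and> continuous_on ?D (snd c \<circ> inf_param P)"
  proof cases
    case 1
    hence nz: "fst x \<noteq> 0" if "x \<in> ?D" for x using that by (cases x) auto
    have "continuous_on ?D (\<lambda>x. 1 / fst x)" using nz by (intro continuous_intros) auto
    hence "continuous_on ?D (snd c \<circ> inf_param P)"
      by (rule continuous_on_eq) (use 1 in auto)
    moreover have "continuous_on ?C (snd c \<circ> case_prod Aff)"
      using 1 by (auto simp: o_def case_prod_unfold intro!: continuous_intros)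
    ultimately show ?thesis by blast
  next
    case 2
    hence nz: "fst x \<noteq> 0" if "x \<in> ?D" for x using that by (cases x) auto
    have "continuous_on ?D (\<lambda>x. snd x / fst x ^ m)" using nz by (intro continuous_intros) auto
    moreover have "snd x / fst x ^ m = (snd c \<circ> inf_param P) x" if "x \<in> ?D" for x
      using nz[OF that] inf_param_nz[of "fst x" "snd x"] by (simp add: 2)
    ultimately have "continuous_on ?D (snd c \<circ> inf_param P)" by (rule continuous_on_eq)
    moreover have "continuous_on ?C (snd c \<circ> case_prod Aff)"
      using 2 by (auto simp: o_def case_prod_unfold intro!: continuous_intros)
    ultimately show ?thesis by blast
  next
    case 3
    hence nz: "fst x \<noteq> 0" if "x \<in> ?C" for x using that by (cases x) auto
    have "continuous_on ?C (snd c \<circ> case_prod Aff)"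
      using 3 nz by (auto simp: o_def case_prod_unfold intro!: continuous_intros)
    moreover have "continuous_on ?D (snd c \<circ> inf_param P)"
      by (rule continuous_on_eq[of _ fst]) (use 3 in \<open>auto intro!: continuous_intros\<close>)
    ultimately show ?thesis by blast
  qed
  thus "continuous_on ?C (snd c \<circ> case_prod Aff)" "continuous_on ?D (snd c \<circ> inf_param P)" by blast+
qed

text \<open>Openness of the map comes for free: an open subset of a chart domain is again a chart
  domain, and chart images are open.\<close>

lemma homeomorphic_map_chart:
  assumes c: "c \<in> A"
  shows "homeomorphic_map (subtopology X (fst c)) (top_of_set (chart_image c)) (snd c)"
proof (rule bijective_open_imp_homeomorphic_map)
  have ts: "topspace (subtopology X (fst c)) = fst c" using chart_subset[OF c] by auto
  show "continuous_map (subtopology X (fst c)) (top_of_set (chart_image c)) (snd c)"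
    using continuous_map_chart[OF c] by (auto simp: continuous_map_in_subtopology chart_image_def ts)
  show "open_map (subtopology X (fst c)) (top_of_set (chart_image c)) (snd c)"
    unfolding open_map_def
  proof (intro allI impI)
    fix U assume "openin (subtopology X (fst c)) U"
    hence U: "hyp_open P U" "U \<subseteq> fst c"
      using hyp_open_chart[OF c] by (auto simp: openin_open_subtopology openin_hyp_top)
    from open_chart_image[OF chart_restrict[OF c this]] have "open (snd c ` U)"
      by (simp add: chart_image_def)
    thus "openin (top_of_set (chart_image c)) (snd c ` U)"
      using U by (auto simp: chart_image_def intro!: open_openin_trans open_chart_image[OF c, unfolded chart_image_def])
  qed
qed (use inj_chart[OF c] chart_subset[OF c] in \<open>auto simp: chart_image_def Int_absorb1 Int_absorb2\<close>)

text \<open>In the parametrization belonging to \<open>c\<close> the transition is \<open>Z\<close>,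
  \<open>W\<close> or \<open>1 / Z\<close>; the set \<open>S\<close> keeps \<open>Z\<close> off 0 in
  the last case. Over infinity only u-charts meet, and the transition is the identity.\<close>

lemma transition_holomorphic:
  assumes c: "c \<in> A" and d: "d \<in> A"
  shows "transition c d holomorphic_on snd c ` (fst c \<inter> fst d)"
proof -
  have *: "transition c d field_differentiable at (snd c p)" if p: "p \<in> fst c" "p \<in> fst d" for p
  proof (cases p)
    case (Aff z0 w0)
    define S where "S = {x :: complex \<times> complex. snd d = u_fun \<longrightarrow> fst x \<noteq> 0}"
    have "open S" unfolding S_def by (auto intro!: open_Collect_neq continuous_intros simp: Collect_imp_eq)
    moreover have "(z0, w0) \<in> S"
      unfolding S_def by (rule chart_cases[OF d]) (use p Aff in auto)
    ultimately obtain r Z W N where a: "aff_param c p r Z W N" "\<And>\<zeta>. \<zeta> \<in> ball (snd c p) r \<Longrightarrow> (Z \<zeta>, W \<zeta>) \<in> S"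
      using ex_aff_param[OF c, of z0 w0 S] p Aff by blast
    let ?B = "ball (snd c p) r"
    have eq: "transition c d \<zeta> = snd d (Aff (Z \<zeta>) (W \<zeta>))" if "\<zeta> \<in> ?B" for \<zeta>
      using a(1) that by (auto simp: aff_param_def transition_def)
    have "snd d = z_fun \<or> snd d = w_fun \<or> snd d = u_fun" using d by (auto simp: hyp_atlas_def)
    hence "(\<lambda>\<zeta>. snd d (Aff (Z \<zeta>) (W \<zeta>))) holomorphic_on ?B"
      using a by (auto simp: aff_param_def S_def intro!: holomorphic_intros)
    hence "transition c d holomorphic_on ?B" by (rule holomorphic_transform) (simp add: eq)
    from holomorphic_on_imp_differentiable_at[OF this open_ball, of "snd c p"]
    show ?thesis using a(1) by (simp add: aff_param_def)
  next
    case (At_Inf v)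
    then obtain r V where V: "inf_param_at c v r V" using ex_inf_param[OF c] p by blast
    have d: "snd d = u_fun" using d p At_Inf by (auto simp: hyp_atlas_def)
    have "transition c d \<zeta> = \<zeta>" if "\<zeta> \<in> ball 0 r" for \<zeta>
      using V that d by (auto simp: inf_param_at_def transition_def)
    hence "transition c d holomorphic_on ball 0 r" by (intro holomorphic_transform[OF holomorphic_on_ident]) simp
    from holomorphic_on_imp_differentiable_at[OF this open_ball, of "snd c p"]
    show ?thesis using V At_Inf by (simp add: inf_param_at_def)
  qed
  show ?thesis
    unfolding holomorphic_on_def using * field_differentiable_at_within by blast
qed

lemma compact_riemann_surface_X:
  assumes "connected_space X"
  shows "compact_riemann_surface X A"
  unfolding compact_riemann_surface_def
  using assms compact_X Hausdorff_X charts_cover hyp_open_chart open_chart_image homeomorphic_map_chart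
    transition_holomorphic
  by (simp add: openin_hyp_top)

end

section \<open>Forms, periods and multipliers\<close>

text \<open>The function \<open>\<Phi>\<close> is multiplied by \<open>exp (\<psi> (\<integral>\<omega>))\<close> along every path as soon as this holds
  infinitesimally, for an additive \<open>\<psi>\<close> such as \<open>Re\<close> or \<open>\<i> Re\<close>.\<close>

definition has_multiplier ::
    "'a chart set \<Rightarrow> 'a form \<Rightarrow> 'a set \<Rightarrow> (complex \<Rightarrow> complex) \<Rightarrow> ('a \<Rightarrow> complex) \<Rightarrow> bool"
  where "has_multiplier A \<omega> S \<psi> \<Phi> \<longleftrightarrow> (\<forall>c\<in>A. \<forall>p\<in>fst c \<inter> S. \<exists>r>0. \<exists>G.
    (\<forall>\<zeta>\<in>ball (snd c p) r. (G has_field_derivative \<omega> c \<zeta>) (at \<zeta>)) \<and>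
    (\<forall>q\<in>fst c \<inter> S. snd c q \<in> ball (snd c p) r \<longrightarrow>
       \<Phi> q = \<Phi> p * exp (\<psi> (G (snd c q) - G (snd c p)))))"

text \<open>The function \<open>h\<close>, which is \<Phi> along the path divided by the expected
  factor, is locally constant on the interval: near each time the partial integral is a difference
  of the local primitive \<open>G\<close>. Connectedness of the interval then gives equality at the
  ends.\<close>

lemma multiplier_along_piece:
  fixes \<gamma> :: "real \<Rightarrow> 'a"
  assumes mult: "has_multiplier A \<omega> S \<psi> \<Phi>" and add: "\<And>x y. \<psi> (x + y) = \<psi> x + \<psi> y"
    and c: "c \<in> A" and ab: "a < b" and im: "\<gamma> ` {a..b} \<subseteq> fst c \<inter> S"
    and valid: "valid_path (subpath a b (snd c \<circ> \<gamma>))"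
    and int: "(\<omega> c has_contour_integral J) (subpath a b (snd c \<circ> \<gamma>))"
  shows "\<Phi> (\<gamma> b) = \<Phi> (\<gamma> a) * exp (\<psi> J)"
proof -
  define \<Gamma> where "\<Gamma> = (\<lambda>t. \<gamma> ((b - a) * t + a))"
  define \<delta> where "\<delta> = subpath a b (snd c \<circ> \<gamma>)"
  define Jt where "Jt = (\<lambda>t. contour_integral (subpath 0 t \<delta>) (\<omega> c))"
  define h where "h = (\<lambda>t. \<Phi> (\<Gamma> t) * exp (- \<psi> (Jt t)))"
  have \<psi>0: "\<psi> 0 = 0" using add[of 0 0] by simp
  have \<delta>: "\<delta> t = snd c (\<Gamma> t)" for t by (simp add: \<delta>_def \<Gamma>_def subpath_def)
  have \<Gamma>: "\<Gamma> t \<in> fst c \<inter> S" if "t \<in> {0..1}" for t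
  proof -
    have "0 \<le> (b - a) * t" "(b - a) * t \<le> (b - a) * 1"
      using that ab by (intro mult_nonneg_nonneg mult_left_mono; simp)+
    thus ?thesis using im unfolding \<Gamma>_def by (intro subsetD[OF im] imageI) simp
  qed
  note valid = valid[folded \<delta>_def] and int = int[folded \<delta>_def]
  have integ: "\<omega> c contour_integrable_on \<delta>" using int contour_integrable_on_def by blast
  have "h 0 = h 1"
  proof (rule connected_local_const[of "{0..1::real}"])
    show "\<forall>t0\<in>{0..1}. \<forall>\<^sub>F t in at t0 within {0..1}. h t0 = h t"
    proof
      fix t0 :: real assume t0: "t0 \<in> {0..1}"
      obtain r G where r: "r > 0" and
        G: "\<And>\<zeta>. \<zeta> \<in> ball (\<delta> t0) r \<Longrightarrow> (G has_field_derivative \<omega> c \<zeta>) (at \<zeta>)" and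
        q: "\<And>q. q \<in> fst c \<inter> S \<Longrightarrow> snd c q \<in> ball (\<delta> t0) r \<Longrightarrow>
              \<Phi> q = \<Phi> (\<Gamma> t0) * exp (\<psi> (G (snd c q) - G (\<delta> t0)))"
        using mult c \<Gamma>[OF t0] unfolding has_multiplier_def \<delta> by blast
      have "continuous_on {0..1} \<delta>" using valid valid_path_imp_path path_def by blast
      then obtain e where e: "e > 0" "\<And>t. t \<in> {0..1} \<Longrightarrow> dist t t0 < e \<Longrightarrow> dist (\<delta> t) (\<delta> t0) < r"
        using t0 r unfolding continuous_on_iff by metis
      have "h t0 = h t" if t: "t \<in> {0..1}" "dist t t0 < e" for t
      proof -
        have near: "\<delta> s \<in> ball (\<delta> t0) r" if "s \<in> closed_segment t0 t" for s
        proof -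
          have "s \<in> {0..1}" "dist s t0 < e"
            using that t t0 by (auto simp: closed_segment_eq_real_ivl dist_real_def split: if_splits)
          thus ?thesis using e(2)[of s] by (simp add: dist_commute)
        qed
        have "(\<omega> c has_contour_integral (G (pathfinish (subpath t0 t \<delta>)) - G (pathstart (subpath t0 t \<delta>))))
                (subpath t0 t \<delta>)"
          by (rule contour_integral_primitive[of "ball (\<delta> t0) r"])
            (use G near t t0 valid in \<open>auto simp: path_image_subpath_gen
               intro: has_field_derivative_at_within valid_path_subpath\<close>)
        hence "contour_integral (subpath t0 t \<delta>) (\<omega> c) = G (\<delta> t) - G (\<delta> t0)"
          by (simp add: contour_integral_unique)
        hence J: "Jt t = Jt t0 + (G (\<delta> t) - G (\<delta> t0))"
          using contour_integral_subpath_combine[OF integ valid, of 0 t0 t] t t0 by (simp add: Jt_def)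
        have "snd c (\<Gamma> t) \<in> ball (\<delta> t0) r" using near[of t] by (simp add: \<delta>)
        hence "\<Phi> (\<Gamma> t) = \<Phi> (\<Gamma> t0) * exp (\<psi> (G (\<delta> t) - G (\<delta> t0)))"
          using q[OF \<Gamma>[OF t(1)]] by (simp add: \<delta>)
        thus ?thesis unfolding h_def J add by (simp add: mult.assoc flip: exp_add)
      qed
      thus "\<forall>\<^sub>F t in at t0 within {0..1}. h t0 = h t"
        unfolding eventually_at using e(1) by blast
    qed
  qed auto
  moreover have "Jt 0 = 0" "Jt 1 = J"
    using int contour_integral_unique by (auto simp: Jt_def)
  ultimately show ?thesis by (simp add: h_def \<Gamma>_def \<psi>0 exp_minus field_simps)
qed

lemma multiplier_along_path:
  assumes mult: "has_multiplier A \<omega> S \<psi> \<Phi>" and add: "\<And>x y. \<psi> (x + y) = \<psi> x + \<psi> y"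
    and int: "has_form_integral A \<omega> \<gamma> I" and im: "\<gamma> ` {0..1} \<subseteq> S"
  shows "\<Phi> (\<gamma> 1) = \<Phi> (\<gamma> 0) * exp (\<psi> I)"
proof -
  obtain n and t :: "nat \<Rightarrow> real" and c J where t: "t 0 = 0" "t n = 1"
    and pc: "\<And>i. i < n \<Longrightarrow> t i < t (Suc i) \<and> c i \<in> A \<and> \<gamma> ` {t i..t (Suc i)} \<subseteq> fst (c i) \<and>
           valid_path (subpath (t i) (t (Suc i)) (snd (c i) \<circ> \<gamma>)) \<and>
           (\<omega> (c i) has_contour_integral J i) (subpath (t i) (t (Suc i)) (snd (c i) \<circ> \<gamma>))"
    and I: "I = (\<Sum>i<n. J i)"
    using int unfolding has_form_integral_def by metis
  have \<psi>0: "\<psi> 0 = 0" using add[of 0 0] by simp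
  have t0: "0 \<le> t k" if "k \<le> n" for k
    using that
  proof (induction k)
    case (Suc k)
    thus ?case using pc[of k] by simp
  qed (simp add: t)
  have t1: "t k \<le> 1" if "k \<le> n" for k
    using that
  proof (induction k rule: inc_induct)
    case (step k)
    thus ?case using pc[of k] by simp
  qed (simp add: t)
  have "\<Phi> (\<gamma> (t k)) = \<Phi> (\<gamma> 0) * exp (\<psi> (\<Sum>i<k. J i))" if "k \<le> n" for k
    using that
  proof (induction k)
    case (Suc k)
    have "\<gamma> ` {t k..t (Suc k)} \<subseteq> fst (c k) \<inter> S"
      using pc[of k] im t0[of k] t1[of "Suc k"] Suc.prems by fastforce
    hence "\<Phi> (\<gamma> (t (Suc k))) = \<Phi> (\<gamma> (t k)) * exp (\<psi> (J k))"
      using multiplier_along_piece[OF mult add, of "c k" "t k" "t (Suc k)" \<gamma> "J k"] pc[of k] Suc.prems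
      by simp
    thus ?case using Suc by (simp add: add exp_add)
  qed (simp add: t \<psi>0)
  from this[of n] show ?thesis using t I by simp
qed

section \<open>Forms of the type f dh in local parametrizations\<close>

context hyperelliptic
begin

lemma meromorphic_at_chartI:
  assumes c: "c \<in> A" and p: "p \<in> fst c" and F: "F meromorphic_on {snd c p}"
    and eq: "\<forall>\<^sub>F \<zeta> in at (snd c p). f (chart_inv c \<zeta>) = F \<zeta>"
  shows "(f \<circ> chart_inv c) meromorphic_on {snd c p}"
proof -
  have "(f \<circ> chart_inv c) meromorphic_on {snd c p} \<longleftrightarrow> F meromorphic_on {snd c p}"
    by (rule meromorphic_on_cong) (use eq in auto)
  thus ?thesis using F by simp
qed

lemma meromorphic_z_w_fun:
  assumes c: "c \<in> A"
  shows "(z_fun \<circ> chart_inv c) meromorphic_on chart_image c"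
    and "(w_fun \<circ> chart_inv c) meromorphic_on chart_image c"
proof -
  have "(z_fun \<circ> chart_inv c) meromorphic_on {snd c p} \<and> (w_fun \<circ> chart_inv c) meromorphic_on {snd c p}"
    if p: "p \<in> fst c" for p
  proof (cases p)
    case (Aff z0 w0)
    then obtain r Z W N where a: "aff_param c p r Z W N"
      using ex_aff_param[OF c, of z0 w0 UNIV] p by auto
    have "Z analytic_on {snd c p}" "W analytic_on {snd c p}"
      using a analytic_at_ball by (auto simp: aff_param_def analytic_at_ball)
    moreover have ev: "\<forall>\<^sub>F \<zeta> in at (snd c p). \<zeta> \<in> ball (snd c p) r"
      using a by (intro eventually_at_in_open') (auto simp: aff_param_def)
    have "\<forall>\<^sub>F \<zeta> in at (snd c p). z_fun (chart_inv c \<zeta>) = Z \<zeta>" "\<forall>\<^sub>F \<zeta> in at (snd c p). w_fun (chart_inv c \<zeta>) = W \<zeta>"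
      by (rule eventually_mono[OF ev]; use a in \<open>auto simp: aff_param_def\<close>)+
    ultimately show ?thesis
      by (auto intro: meromorphic_at_chartI[OF c p] analytic_on_imp_meromorphic_on)
  next
    case (At_Inf v)
    then obtain r V where V: "inf_param_at c v r V" using ex_inf_param[OF c] p by blast
    have p0: "snd c p = 0" using V At_Inf by (simp add: inf_param_at_def)
    have "V analytic_on {0}"
      using V by (auto simp: inf_param_at_def analytic_at_ball)
    hence mer: "(\<lambda>\<zeta>. 1 / \<zeta>) meromorphic_on {0}" "(\<lambda>\<zeta>. V \<zeta> / \<zeta> ^ m) meromorphic_on {0}"
      by (intro meromorphic_intros analytic_on_imp_meromorphic_on; simp)+
    have ev: "\<forall>\<^sub>F \<zeta> in at 0. \<zeta> \<in> ball 0 r - {0}"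
      using V by (intro eventually_at_in_open) (auto simp: inf_param_at_def)
    have "\<forall>\<^sub>F \<zeta> in at 0. z_fun (chart_inv c \<zeta>) = 1 / \<zeta>" "\<forall>\<^sub>F \<zeta> in at 0. w_fun (chart_inv c \<zeta>) = V \<zeta> / \<zeta> ^ m"
      by (rule eventually_mono[OF ev]; use V in \<open>auto simp: inf_param_at_def inf_param_nz\<close>)+
    thus ?thesis
      using meromorphic_at_chartI[OF c p, unfolded p0, OF mer(1), of z_fun]
        meromorphic_at_chartI[OF c p, unfolded p0, OF mer(2), of w_fun] by (simp add: p0)
  qed
  thus "(z_fun \<circ> chart_inv c) meromorphic_on chart_image c"
    "(w_fun \<circ> chart_inv c) meromorphic_on chart_image c"
    unfolding chart_image_def by (auto simp: meromorphic_on_meromorphic_at[of _ "_ ` _"])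
qed

text \<open>The transformation law is the chain rule for h, valid on a punctured neighbourhood where
  h is analytic in the chart \<open>d\<close> and where \<open>remove_sings\<close> changes nothing
  in either chart.\<close>

lemma meromorphic_form_fdh:
  assumes f: "\<And>c. c \<in> A \<Longrightarrow> (f \<circ> chart_inv c) meromorphic_on chart_image c"
    and h: "\<And>c. c \<in> A \<Longrightarrow> (h \<circ> chart_inv c) meromorphic_on chart_image c"
  shows "meromorphic_form A (fdh f h)"
proof -
  define F where "F = (\<lambda>c \<zeta>. f (chart_inv c \<zeta>) * deriv (h \<circ> chart_inv c) \<zeta>)"
  have fdh: "fdh f h c = remove_sings (F c)" for c by (simp add: fdh_def F_def)
  have mer: "F c meromorphic_on chart_image c" if "c \<in> A" for c
    unfolding F_def using f[OF that] h[OF that] by (auto intro!: meromorphic_intros simp: o_def)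
  have ev: "\<forall>\<^sub>F \<zeta> in at (snd c p). fdh f h c \<zeta> = F c \<zeta>" if "c \<in> A" "p \<in> fst c" for c p
    unfolding fdh
    using mer[OF that(1)] that(2)
    by (intro eventually_remove_sings_eq_at meromorphic_on_isolated_singularity)
      (auto intro: meromorphic_on_subset simp: chart_image_def)
  have "\<forall>\<^sub>F \<zeta> in at (snd c p). fdh f h c \<zeta> = fdh f h d (transition c d \<zeta>) * deriv (transition c d) \<zeta>"
    if c: "c \<in> A" and d: "d \<in> A" and p: "p \<in> fst c" "p \<in> fst d" for c d p
  proof -
    define O' where "O' = snd c ` (fst c \<inter> fst d)"
    define \<tau> where "\<tau> = transition c d"
    have "hyp_open P (fst c \<inter> fst d)"
      using openin_Int[of X] hyp_open_chart[OF c] hyp_open_chart[OF d] by (simp add: openin_hyp_top)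
    from open_chart_image[OF chart_restrict[OF c this]] have O': "open O'" "snd c p \<in> O'"
      using p by (auto simp: chart_image_def O'_def)
    have \<tau>_hol: "\<tau> holomorphic_on O'" unfolding \<tau>_def O'_def by (rule transition_holomorphic[OF c d])
    have \<tau>: "chart_inv d (\<tau> \<zeta>) = chart_inv c \<zeta>" "snd c (chart_inv c \<zeta>) = \<zeta>" "\<tau> \<zeta> = snd d (chart_inv c \<zeta>)" if "\<zeta> \<in> O'" for \<zeta>
      using that chart_inv_chart[OF c] chart_inv_chart[OF d]
      by (auto simp: \<tau>_def O'_def transition_def)
    have \<tau>p: "\<tau> (snd c p) = snd d p" using chart_inv_chart[OF c p(1)] by (simp add: \<tau>_def transition_def)
    have \<tau>_inj: "\<zeta> = \<zeta>'" if "\<zeta> \<in> O'" "\<zeta>' \<in> O'" "\<tau> \<zeta> = \<tau> \<zeta>'" for \<zeta> \<zeta>'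
      using \<tau>(1,2)[OF that(1)] \<tau>(1,2)[OF that(2)] that(3) by metis
    have evO: "\<forall>\<^sub>F \<zeta> in at (snd c p). \<zeta> \<in> O' - {snd c p}"
      using O' by (intro eventually_at_in_open)
    have "isCont \<tau> (snd c p)"
      using \<tau>_hol O' continuous_on_eq_continuous_at holomorphic_on_imp_continuous_on by blast
    moreover have "\<forall>\<^sub>F \<zeta> in at (snd c p). \<tau> \<zeta> \<noteq> snd d p"
      using evO by eventually_elim (use \<tau>_inj O' \<tau>p in auto)
    \<comment> \<open>Injectivity of \<tau> keeps its values off \<open>snd d p\<close>, so whatever
      holds on a punctured neighbourhood in the chart \<open>d\<close> pulls back to
      \<open>c\<close>.\<close>
    ultimately have lim: "filterlim \<tau> (at (snd d p)) (at (snd c p))"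
      using \<tau>p by (intro filterlim_atI) (auto simp: isCont_def)
    have "isolated_singularity_at (h \<circ> chart_inv d) (snd d p)"
      using h[OF d] p by (intro meromorphic_on_isolated_singularity)
        (auto intro: meromorphic_on_subset simp: chart_image_def)
    hence "\<forall>\<^sub>F \<eta> in at (snd d p). (h \<circ> chart_inv d) analytic_on {\<eta>}"
      using isolated_singularity_at_altdef by blast
    hence "\<forall>\<^sub>F \<zeta> in at (snd c p). fdh f h d (\<tau> \<zeta>) = F d (\<tau> \<zeta>) \<and> (h \<circ> chart_inv d) analytic_on {\<tau> \<zeta>}"
      using eventually_compose_filterlim[OF _ lim] ev[OF d p(2)] eventually_conj by fast
    moreover note ev[OF c p(1)] evO
    ultimately show ?thesis
    proof eventually_elim
      case (elim \<zeta>)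
      hence \<zeta>: "\<zeta> \<in> O'" by simp
      have "((h \<circ> chart_inv d) has_field_derivative deriv (h \<circ> chart_inv d) (\<tau> \<zeta>)) (at (\<tau> \<zeta>))"
        using elim analytic_at_imp_isCont analytic_on_imp_differentiable_at DERIV_deriv_iff_field_differentiable
        by (metis singletonI)
      moreover have "(\<tau> has_field_derivative deriv \<tau> \<zeta>) (at \<zeta>)"
        using \<tau>_hol O'(1) \<zeta> holomorphic_derivI by blast
      ultimately have "(((h \<circ> chart_inv d) \<circ> \<tau>) has_field_derivative
            deriv (h \<circ> chart_inv d) (\<tau> \<zeta>) * deriv \<tau> \<zeta>) (at \<zeta>)"
        by (rule DERIV_chain)
      hence "((h \<circ> chart_inv c) has_field_derivative deriv (h \<circ> chart_inv d) (\<tau> \<zeta>) * deriv \<tau> \<zeta>) (at \<zeta>)"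
        by (rule has_field_derivative_transform_within_open[OF _ O'(1) \<zeta>]) (use \<tau> in auto)
      hence "F c \<zeta> = F d (\<tau> \<zeta>) * deriv \<tau> \<zeta>"
        using \<tau>(1)[OF \<zeta>] by (simp add: F_def DERIV_imp_deriv)
      thus ?case using elim by (simp add: \<tau>_def)
    qed
  qed
  moreover have "fdh f h c nicely_meromorphic_on chart_image c" if "c \<in> A" for c
    unfolding fdh using mer[OF that] remove_sings_nicely_meromorphic by blast
  ultimately show ?thesis unfolding meromorphic_form_def by blast
qed

text \<open>Since dz = N W d\<zeta>, a factor 1/W of f cancels. The resulting formula has a limit
  where W vanishes, and \<open>fdh\<close> takes that limit as its value.\<close>

lemma fdh_affine:
  assumes a: "aff_param c p r Z W N"
    and k: "\<And>\<zeta>. \<zeta> \<in> ball (snd c p) r \<Longrightarrow> W \<zeta> \<noteq> 0 \<Longrightarrow> f (Aff (Z \<zeta>) (W \<zeta>)) * W \<zeta> = k \<zeta>"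
    and cont: "continuous_on (ball (snd c p) r) k" and \<zeta>: "\<zeta> \<in> ball (snd c p) r"
  shows "fdh f z_fun c \<zeta> = k \<zeta> * N \<zeta>"
proof -
  let ?B = "ball (snd c p) r"
  have 1: "f (chart_inv c \<xi>) * deriv (z_fun \<circ> chart_inv c) \<xi> = k \<xi> * N \<xi>" if \<xi>: "\<xi> \<in> ?B" "\<xi> \<noteq> snd c p" for \<xi>
  proof -
    have "(Z has_field_derivative N \<xi> * W \<xi>) (at \<xi>)" "W \<xi> \<noteq> 0" using a \<xi> by (auto simp: aff_param_def)
    moreover from this(1) have "((z_fun \<circ> chart_inv c) has_field_derivative N \<xi> * W \<xi>) (at \<xi>)"
      by (rule has_field_derivative_transform_within_open[OF _ open_ball \<xi>(1)])
        (use a in \<open>auto simp: aff_param_def\<close>)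
    ultimately show ?thesis using k[OF \<xi>(1)] a \<xi>(1) by (simp add: aff_param_def DERIV_imp_deriv)
  qed
  have "\<forall>\<^sub>F \<xi> in at \<zeta>. \<xi> \<in> ?B" using \<zeta> by (intro eventually_at_in_open') auto
  moreover have "\<forall>\<^sub>F \<xi> in at \<zeta>. \<xi> \<noteq> snd c p"
    by (rule eventually_neq_at_within)
  ultimately have ev: "\<forall>\<^sub>F \<xi> in at \<zeta>. k \<xi> * N \<xi> = f (chart_inv c \<xi>) * deriv (z_fun \<circ> chart_inv c) \<xi>"
    by eventually_elim (use 1 in simp)
  have "continuous_on ?B N" using a holomorphic_on_imp_continuous_on by (auto simp: aff_param_def)
  hence "continuous_on ?B (\<lambda>\<xi>. k \<xi> * N \<xi>)" using cont by (intro continuous_intros)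
  hence "isCont (\<lambda>\<xi>. k \<xi> * N \<xi>) \<zeta>" using \<zeta> continuous_on_eq_continuous_at by blast
  hence "(\<lambda>\<xi>. k \<xi> * N \<xi>) \<midarrow>\<zeta>\<rightarrow> k \<zeta> * N \<zeta>" by (simp add: isCont_def)
  hence "(\<lambda>\<xi>. f (chart_inv c \<xi>) * deriv (z_fun \<circ> chart_inv c) \<xi>) \<midarrow>\<zeta>\<rightarrow> k \<zeta> * N \<zeta>"
    using ev by (rule Lim_transform_eventually)
  thus ?thesis unfolding fdh_def by (rule remove_sings_eqI)
qed

text \<open>Here dz = - du/u^2. The set \<open>U\<close> is the full disc for a holomorphic form and
  the punctured disc for a form with a pole at the end.\<close>

lemma fdh_infinite:
  assumes V: "inf_param_at c v r V" and U: "open U" "U \<subseteq> ball 0 r" "\<zeta> \<in> U"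
    and k: "\<And>\<xi>. \<xi> \<in> U \<Longrightarrow> \<xi> \<noteq> 0 \<Longrightarrow> - f (inf_param P (\<xi>, V \<xi>)) / \<xi>\<^sup>2 = k \<xi>"
    and cont: "continuous_on U k"
  shows "fdh f z_fun c \<zeta> = k \<zeta>"
proof -
  have 1: "f (chart_inv c \<xi>) * deriv (z_fun \<circ> chart_inv c) \<xi> = k \<xi>" if \<xi>: "\<xi> \<in> U" "\<xi> \<noteq> 0" for \<xi>
  proof -
    have "((\<lambda>u. 1 / u) has_field_derivative - 1 / \<xi>\<^sup>2) (at \<xi>)"
      using \<xi> by (auto intro!: derivative_eq_intros simp: power2_eq_square)
    hence "((z_fun \<circ> chart_inv c) has_field_derivative - 1 / \<xi>\<^sup>2) (at \<xi>)"
      by (rule has_field_derivative_transform_within_open[OF _ U(1) \<xi>(1)])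
        (use V U in \<open>auto simp: inf_param_at_def\<close>)
    thus ?thesis using k[OF \<xi>] V U \<xi> by (auto simp: inf_param_at_def DERIV_imp_deriv)
  qed
  have "\<forall>\<^sub>F \<xi> in at \<zeta>. \<xi> \<in> U" using U by (intro eventually_at_in_open') auto
  moreover have "\<forall>\<^sub>F \<xi> in at \<zeta>. \<xi> \<noteq> 0"
    by (rule eventually_neq_at_within)
  ultimately have ev: "\<forall>\<^sub>F \<xi> in at \<zeta>. k \<xi> = f (chart_inv c \<xi>) * deriv (z_fun \<circ> chart_inv c) \<xi>"
    by eventually_elim (use 1 in simp)
  have "k \<midarrow>\<zeta>\<rightarrow> k \<zeta>" using cont U continuous_on_eq_continuous_at isCont_def by blast
  hence "(\<lambda>\<xi>. f (chart_inv c \<xi>) * deriv (z_fun \<circ> chart_inv c) \<xi>) \<midarrow>\<zeta>\<rightarrow> k \<zeta>"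
    using ev by (rule Lim_transform_eventually)
  thus ?thesis unfolding fdh_def by (rule remove_sings_eqI)
qed

end

section \<open>The genus\<close>

text \<open>Splitting off a root x leaves a factor q with q(x) = p'(x), which is nonzero, so x is
  not counted again.\<close>

lemma card_roots_eq_degree:
  fixes p :: "complex poly"
  assumes "\<And>z. poly p z = 0 \<Longrightarrow> poly (pderiv p) z \<noteq> 0"
  shows "card {z. poly p z = 0} = degree p"
  using assms
proof (induction "degree p" arbitrary: p)
  case 0
  have "p \<noteq> 0" using 0(2)[of 0] by auto
  moreover obtain c where "p = [:c:]" using 0(1) degree_eq_zeroE by metis
  ultimately show ?case by simp
next
  case (Suc n)
  have "coeff p (degree p) \<noteq> 0" using Suc(2) by (metis degree_0 leading_coeff_0_iff nat.distinct(1))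
  hence "coeff p 0 = 0 \<or> (\<exists>i\<in>{1..degree p}. coeff p i \<noteq> 0)" using Suc(2) by (auto intro!: bexI[of _ "degree p"])
  then obtain x where "poly p x = 0"
    using fundamental_theorem_of_algebra[of "coeff p" "degree p"] unfolding poly_altdef by blast
  then obtain q where q: "p = [:-x, 1:] * q" by (metis poly_eq_0_iff_dvd dvdE)
  hence "q \<noteq> 0" using Suc(2) by auto
  hence "degree p = degree [:-x, 1:] + degree q" unfolding q by (intro degree_mult_eq) auto
  hence deg: "degree q = n" using Suc(2) by simp
  have dp: "poly (pderiv p) z = (z - x) * poly (pderiv q) z + poly q z" for z
    unfolding q pderiv_mult by (simp add: pderiv_pCons algebra_simps)
  have qx: "poly q x \<noteq> 0" using Suc(3)[of x] dp \<open>poly p x = 0\<close> by auto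
  have "card {z. poly q z = 0} = degree q"
  proof (rule Suc(1))
    fix z assume z: "poly q z = 0"
    hence "poly (pderiv p) z \<noteq> 0" by (intro Suc(3)) (simp add: q)
    thus "poly (pderiv q) z \<noteq> 0" using z dp by auto
  qed (use deg in simp)
  moreover have "{z. poly p z = 0} = insert x {z. poly q z = 0}" by (auto simp: q)
  ultimately show ?case using qx deg Suc(2) poly_roots_finite[OF \<open>q \<noteq> 0\<close>] by simp
qed

text \<open>Riemann's removable singularity theorem, one point at a time. After a point has been
  filled in, the bounds at the remaining points persist because the extension agrees with
  \<open>f\<close> on punctured neighbourhoods of them.\<close>

lemma holomorphic_extend_bounded_finite:
  assumes "finite K" "open S" "f holomorphic_on (S - K)"
    and "\<And>z. z \<in> K \<Longrightarrow> z \<in> S \<Longrightarrow> \<exists>B. \<forall>\<^sub>F x in at z. norm (f x) \<le> B"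
  shows "\<exists>g. g holomorphic_on S \<and> (\<forall>z\<in>S - K. g z = f z)"
  using assms
proof (induction K arbitrary: f rule: finite_induct)
  case (insert a K)
  let ?S = "S - K"
  have op: "open ?S" using insert by (simp add: finite_imp_closed open_Diff)
  have "\<exists>g. g holomorphic_on ?S \<and> (\<forall>z\<in>?S - {a}. g z = f z)"
  proof (cases "a \<in> S")
    case True
    have "f holomorphic_on ?S - {a}" using insert.prems(2) by (metis Diff_insert)
    moreover have "a \<in> interior ?S" using True insert.hyps op by (simp add: interior_open)
    ultimately show ?thesis using holomorphic_on_extend_bounded[of f ?S a] insert.prems(3)[of a] True by simp
  next
    case False
    hence "S - insert a K = ?S" by auto
    thus ?thesis using insert.prems(2) by auto
  qed
  then obtain g where g: "g holomorphic_on ?S" "\<And>z. z \<in> ?S - {a} \<Longrightarrow> g z = f z" by blast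
  have "\<exists>B. \<forall>\<^sub>F x in at z. norm (g x) \<le> B" if z: "z \<in> K" "z \<in> S" for z
  proof -
    obtain B where "\<forall>\<^sub>F x in at z. norm (f x) \<le> B" using insert.prems(3) z by blast
    moreover have "open (S - (insert a K - {z}))" "z \<in> S - (insert a K - {z})"
      using insert.prems(1) insert.hyps z by (auto simp: finite_imp_closed open_Diff)
    hence "\<forall>\<^sub>F x in at z. x \<in> S - (insert a K - {z}) - {z}" by (intro eventually_at_in_open)
    ultimately have "\<forall>\<^sub>F x in at z. norm (g x) \<le> B"
      by eventually_elim (use g(2) in auto)
    thus ?thesis by blast
  qed
  then obtain h where "h holomorphic_on S" "\<And>z. z \<in> S - K \<Longrightarrow> h z = g z"
    using insert.IH[OF insert.prems(1) g(1)] by blast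
  thus ?case using g(2) by (intro exI[of _ h]) auto
qed auto

lemma continuous_on_compact_norm_bound:
  fixes f :: "'a::topological_space \<Rightarrow> 'b::real_normed_vector"
  assumes "compact S" "continuous_on S f"
  shows "\<exists>M. \<forall>x\<in>S. norm (f x) \<le> M"
  using compact_imp_bounded[OF compact_continuous_image[OF assms(2,1)]] by (auto simp: bounded_iff)

context hyperelliptic
begin

lemma aff_paramD:
  assumes "aff_param c p r Z W N" "\<zeta> \<in> ball (snd c p) r"
  shows "chart_inv c \<zeta> = Aff (Z \<zeta>) (W \<zeta>)" "Aff (Z \<zeta>) (W \<zeta>) \<in> fst c"
    "snd c (Aff (Z \<zeta>) (W \<zeta>)) = \<zeta>" "(W \<zeta>)\<^sup>2 = poly P (Z \<zeta>)"
    "(Z has_field_derivative N \<zeta> * W \<zeta>) (at \<zeta>)" "\<zeta> \<noteq> snd c p \<Longrightarrow> W \<zeta> \<noteq> 0"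
  using assms unfolding aff_param_def by blast+

lemma form_holomorphic_onI:
  assumes "\<And>c p. c \<in> A \<Longrightarrow> p \<in> fst c \<Longrightarrow> p \<in> S \<Longrightarrow>
    \<exists>r>0. \<exists>h. h holomorphic_on ball (snd c p) r \<and> (\<forall>\<zeta>\<in>ball (snd c p) r. \<omega> c \<zeta> = h \<zeta>)"
  shows "form_holomorphic_on A \<omega> S"
  unfolding form_holomorphic_on_def
proof (intro ballI)
  fix c assume c: "c \<in> A"
  have "\<omega> c field_differentiable at (snd c p)" if p: "p \<in> fst c" "p \<in> S" for p
  proof -
    obtain r h where h: "r > 0" "h holomorphic_on ball (snd c p) r" "\<And>\<zeta>. \<zeta> \<in> ball (snd c p) r \<Longrightarrow> \<omega> c \<zeta> = h \<zeta>"
      using assms[OF c p] by blast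
    have "\<omega> c holomorphic_on ball (snd c p) r"
      using h(2) by (rule holomorphic_transform) (simp add: h(3))
    from holomorphic_on_imp_differentiable_at[OF this open_ball, of "snd c p"]
    show ?thesis using h(1) by simp
  qed
  thus "\<omega> c holomorphic_on snd c ` (fst c \<inter> S)"
    unfolding holomorphic_on_def using field_differentiable_at_within by blast
qed

section \<open>Holomorphic forms and their density with respect to dz/w\<close>

definition holomorphic_form :: "hpoint form \<Rightarrow> bool"
  where "holomorphic_form \<omega> \<longleftrightarrow> meromorphic_form A \<omega> \<and> form_holomorphic_on A \<omega> (topspace X)"

lemma holomorphic_form_on_chart:
  "holomorphic_form \<omega> \<Longrightarrow> c \<in> A \<Longrightarrow> \<omega> c holomorphic_on chart_image c"
  using chart_subset[of c] by (auto simp: holomorphic_form_def form_holomorphic_on_def chart_image_def Int_absorb2)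

text \<open>The definition of a meromorphic form gives the law only near \<open>snd c p\<close>, not
  at it. On \<open>S\<close> both sides are continuous, so it passes to the point itself.\<close>

lemma form_transition:
  assumes \<omega>: "meromorphic_form A \<omega>" "form_holomorphic_on A \<omega> S" and S: "openin X S"
    and c: "c \<in> A" and d: "d \<in> A" and p: "p \<in> fst c" "p \<in> fst d" "p \<in> S"
  shows "\<omega> c (snd c p) = \<omega> d (snd d p) * deriv (transition c d) (snd c p)"
proof -
  define \<tau> where "\<tau> = transition c d"
  define O' where "O' = snd c ` (fst c \<inter> fst d \<inter> S)"
  have "hyp_open P (fst c \<inter> fst d \<inter> S)"
    using hyp_open_chart[OF c] hyp_open_chart[OF d] S by (simp add: openin_Int flip: openin_hyp_top)
  from open_chart_image[OF chart_restrict[OF c this]] have O': "open O'" "snd c p \<in> O'"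
    using p by (auto simp: chart_image_def O'_def)
  have \<tau>: "\<tau> holomorphic_on O'"
    unfolding \<tau>_def O'_def by (rule holomorphic_on_subset[OF transition_holomorphic[OF c d]]) auto
  have im: "\<tau> ` O' \<subseteq> snd d ` (fst d \<inter> S)"
    using chart_inv_chart[OF c] by (auto simp: \<tau>_def O'_def transition_def)
  have hol: "\<omega> c holomorphic_on O'" "\<omega> d holomorphic_on snd d ` (fst d \<inter> S)"
    using \<omega>(2) c d holomorphic_on_subset[of "\<omega> c" "snd c ` (fst c \<inter> S)" O']
    by (auto simp: form_holomorphic_on_def O'_def)
  have "(\<lambda>\<zeta>. \<omega> d (\<tau> \<zeta>)) holomorphic_on O'"
    using holomorphic_on_compose_gen[OF \<tau> hol(2) im] by (simp add: o_def)
  hence "continuous_on O' (\<lambda>\<zeta>. \<omega> d (\<tau> \<zeta>) * deriv \<tau> \<zeta>)"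
    using \<tau> O' by (intro holomorphic_on_imp_continuous_on holomorphic_intros)
  hence "isCont (\<lambda>\<zeta>. \<omega> d (\<tau> \<zeta>) * deriv \<tau> \<zeta>) (snd c p)" "isCont (\<omega> c) (snd c p)"
    using O' hol(1) continuous_on_eq_continuous_at holomorphic_on_imp_continuous_on by blast+
  hence 1: "(\<lambda>\<zeta>. \<omega> d (\<tau> \<zeta>) * deriv \<tau> \<zeta>) \<midarrow>snd c p\<rightarrow> \<omega> d (\<tau> (snd c p)) * deriv \<tau> (snd c p)"
    and 2: "\<omega> c \<midarrow>snd c p\<rightarrow> \<omega> c (snd c p)"
    by (simp_all add: isCont_def)
  have "\<forall>\<^sub>F \<zeta> in at (snd c p). \<omega> c \<zeta> = \<omega> d (\<tau> \<zeta>) * deriv \<tau> \<zeta>"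
    using \<omega>(1) c d p unfolding meromorphic_form_def \<tau>_def by blast
  hence "(\<lambda>\<zeta>. \<omega> d (\<tau> \<zeta>) * deriv \<tau> \<zeta>) \<midarrow>snd c p\<rightarrow> \<omega> c (snd c p)"
    by (rule Lim_transform_eventually[OF 2])
  from LIM_unique[OF this 1] show ?thesis using chart_inv_chart[OF c p(1)] by (simp add: \<tau>_def transition_def)
qed

lemma holomorphic_form_transition:
  assumes "holomorphic_form \<omega>" "c \<in> A" "d \<in> A" "p \<in> fst c" "p \<in> fst d"
  shows "\<omega> c (snd c p) = \<omega> d (snd d p) * deriv (transition c d) (snd c p)"
  using assms chart_subset[of c] openin_topspace[of X] unfolding holomorphic_form_def
  by (intro form_transition[of \<omega> "topspace X"]) auto

text \<open>The function \<open>\<omega> / (dz/w)\<close>.\<close>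

definition density :: "hpoint form \<Rightarrow> hpoint \<Rightarrow> complex"
  where "density \<omega> p = \<omega> (SOME d. d \<in> A \<and> snd d = z_fun \<and> p \<in> fst d) (z_fun p) * w_fun p"

text \<open>Passing from the z-chart used in \<open>density\<close> to \<open>c\<close> multiplies
  the coefficient by Z' = N W; the factor W is the one already contained in the density.\<close>

lemma form_eq_density:
  assumes \<omega>: "holomorphic_form \<omega>" and c: "c \<in> A" and a: "aff_param c p r Z W N"
    and \<zeta>: "\<zeta> \<in> ball (snd c p) r" "W \<zeta> \<noteq> 0"
  shows "\<omega> c \<zeta> = density \<omega> (Aff (Z \<zeta>) (W \<zeta>)) * N \<zeta>"
proof -
  define q where "q = Aff (Z \<zeta>) (W \<zeta>)"
  define d where "d = (SOME d. d \<in> A \<and> snd d = z_fun \<and> q \<in> fst d)"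
  have "(W \<zeta>)\<^sup>2 = poly P (Z \<zeta>)" using a \<zeta> by (auto simp: aff_param_def)
  from ex_z_chart[OF \<zeta>(2) this] have "\<exists>d. d \<in> A \<and> snd d = z_fun \<and> q \<in> fst d"
    by (auto simp: q_def)
  from someI_ex[OF this] have d: "d \<in> A \<and> snd d = z_fun \<and> q \<in> fst d"
    unfolding d_def .
  have q: "q \<in> fst c" "snd c q = \<zeta>" using a \<zeta> by (auto simp: aff_param_def q_def)
  have "(Z has_field_derivative N \<zeta> * W \<zeta>) (at \<zeta>)" using a \<zeta> by (auto simp: aff_param_def)
  hence "(transition c d has_field_derivative N \<zeta> * W \<zeta>) (at \<zeta>)"
    by (rule has_field_derivative_transform_within_open[OF _ open_ball \<zeta>(1)])
      (use a d in \<open>auto simp: aff_param_def transition_def\<close>)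
  hence "\<omega> c \<zeta> = \<omega> d (Z \<zeta>) * (N \<zeta> * W \<zeta>)"
    using holomorphic_form_transition[OF \<omega> c _ q(1), of d] d q(2)
    by (simp add: DERIV_imp_deriv) (simp add: q_def)
  thus ?thesis unfolding density_def by (simp add: d_def q_def)
qed

text \<open>\<open>density\<close> chooses a chart anew at every point. In one fixed z-chart Z is
  the identity and N = 1/W, so along a local branch the density equals
  \<open>\<omega> c z * W z\<close>, which is holomorphic.\<close>

lemma density_in_z_chart:
  assumes \<omega>: "holomorphic_form \<omega>" and w0: "w0 \<noteq> 0" "w0\<^sup>2 = poly P z0"
  shows "\<exists>r>0. \<exists>s D. s holomorphic_on ball z0 r \<and> D holomorphic_on ball z0 r \<and>
    (\<forall>z\<in>ball z0 r. (s z)\<^sup>2 = poly P z \<and> norm (s z - w0) < norm w0 \<and> density \<omega> (Aff z (s z)) = D z)"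
proof -
  obtain c where c: "c \<in> A" "snd c = z_fun" "Aff z0 w0 \<in> fst c" using ex_z_chart[OF w0] by blast
  obtain r Z W N where a: "aff_param c (Aff z0 w0) r Z W N"
      and S: "\<And>\<zeta>. \<zeta> \<in> ball z0 r \<Longrightarrow> (Z \<zeta>, W \<zeta>) \<in> UNIV \<times> ball w0 (norm w0)"
    using ex_aff_param[OF c(1,3), of "UNIV \<times> ball w0 (norm w0)"] w0 c(2) by (auto simp: open_Times)
  have Z: "Z z = z" if "z \<in> ball z0 r" for z using a that c(2) by (auto simp: aff_param_def)
  have near: "norm (W z - w0) < norm w0" if "z \<in> ball z0 r" for z
    using S[OF that] by (simp add: dist_norm norm_minus_commute)
  hence W: "W z \<noteq> 0" if "z \<in> ball z0 r" for z using that by fastforce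
  have N: "N z * W z = 1" if z: "z \<in> ball z0 r" for z
  proof -
    have "(Z has_field_derivative N z * W z) (at z)" using a z c(2) by (auto simp: aff_param_def)
    moreover have "(Z has_field_derivative 1) (at z)"
      by (rule has_field_derivative_transform_within_open[OF DERIV_ident open_ball z]) (simp add: Z)
    ultimately show ?thesis using DERIV_unique by blast
  qed
  have "density \<omega> (Aff z (W z)) = \<omega> c z * W z" if z: "z \<in> ball z0 r" for z
    using form_eq_density[OF \<omega> c(1) a, of z] W[OF z] N[OF z] Z[OF z] z c(2) by simp
  moreover have "\<omega> c holomorphic_on ball z0 r"
    using holomorphic_form_on_chart[OF \<omega> c(1)] a c(2) holomorphic_on_subset
    by (auto simp: aff_param_def)
  moreover have "W holomorphic_on ball z0 r" "r > 0" "\<And>z. z \<in> ball z0 r \<Longrightarrow> (W z)\<^sup>2 = poly P z"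
    using a c(2) Z by (auto simp: aff_param_def)
  ultimately show ?thesis using near
    by (intro exI[of _ r] conjI exI[of _ W] exI[of _ "\<lambda>z. \<omega> c z * W z"]) (auto intro!: holomorphic_intros)
qed

text \<open>With w as coordinate, dz/w = 2 dw/P'(z) has no zero at the branch point, so the density
  is the coefficient of the form times P'(z)/2.\<close>

lemma density_bounded_at_root:
  assumes \<omega>: "holomorphic_form \<omega>" and z0: "poly P z0 = 0"
  shows "\<exists>\<delta>>0. \<exists>M. \<forall>z w. z \<in> ball z0 \<delta> - {z0} \<longrightarrow> w\<^sup>2 = poly P z \<longrightarrow> norm (density \<omega> (Aff z w)) \<le> M"
proof -
  obtain c where c: "c \<in> A" "snd c = w_fun" "Aff z0 0 \<in> fst c" using ex_w_chart[OF z0] by blast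
  obtain r Z W N where a: "aff_param c (Aff z0 0) r Z W N"
    using ex_aff_param[OF c(1,3), of UNIV] by auto
  have B: "snd c (Aff z0 0) = 0" using c(2) by simp
  have W: "W w = w" "(W w)\<^sup>2 = poly P (Z w)" if "w \<in> ball 0 r" for w
    using aff_paramD(3,4)[OF a, unfolded B, OF that] c(2) by (simp, blast)
  hence PZ: "poly P (Z w) = w\<^sup>2" if "w \<in> ball 0 r" for w
    using that by metis
  have N: "poly (pderiv P) (Z w) * N w = 2" if w: "w \<in> ball 0 r" "w \<noteq> 0" for w
  proof -
    have "(Z has_field_derivative N w * W w) (at w)" using a w c(2) by (auto simp: aff_param_def)
    hence "((\<lambda>x. poly P (Z x)) has_field_derivative poly (pderiv P) (Z w) * (N w * W w)) (at w)"
      using DERIV_chain2[OF has_field_derivative_P] by blast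
    moreover have "((\<lambda>x. x\<^sup>2) has_field_derivative 2 * w) (at w)"
      by (auto intro!: derivative_eq_intros)
    hence "((\<lambda>x. poly P (Z x)) has_field_derivative 2 * w) (at w)"
      by (rule has_field_derivative_transform_within_open[OF _ open_ball w(1)]) (simp add: PZ)
    ultimately have "poly (pderiv P) (Z w) * (N w * W w) = 2 * w" by (rule DERIV_unique)
    thus ?thesis using W(1)[OF w(1)] w(2) by simp
  qed
  have r: "r > 0" using a by (simp add: aff_param_def)
  have "\<omega> c holomorphic_on ball 0 r" "Z holomorphic_on ball 0 r"
    using holomorphic_form_on_chart[OF \<omega> c(1)] a c(2) holomorphic_on_subset
    by (auto simp: aff_param_def)
  hence "continuous_on (ball 0 r) (\<lambda>w. \<omega> c w * poly (pderiv P) (Z w) / 2)"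
    by (intro continuous_intros holomorphic_on_imp_continuous_on) auto
  hence "continuous_on (cball 0 (r/2)) (\<lambda>w. \<omega> c w * poly (pderiv P) (Z w) / 2)"
    by (rule continuous_on_subset) (use r in auto)
  then obtain M where M: "\<And>w. w \<in> cball 0 (r/2) \<Longrightarrow> norm (\<omega> c w * poly (pderiv P) (Z w) / 2) \<le> M"
    using continuous_on_compact_norm_bound[OF compact_cball] by blast
  \<comment> \<open>Both points over a z near \<open>z0\<close> must lie in this chart; this holds
    because |w|^2 = |P(z)| is small for either of them.\<close>
  have "openin (top_of_set (aff_curve P)) {x \<in> aff_curve P. case_prod Aff x \<in> fst c}"
    using hyp_open_chart[OF c(1)] by (simp add: hyp_open_def)
  then obtain T where T: "open T" "{x \<in> aff_curve P. case_prod Aff x \<in> fst c} = aff_curve P \<inter> T"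
    by (auto simp: openin_open)
  have "(z0, 0) \<in> aff_curve P \<inter> T" unfolding T(2)[symmetric] using z0 c by (simp add: aff_curve_def)
  then obtain T1 T2 where T12: "open T1" "open T2" "(z0, 0) \<in> T1 \<times> T2" "T1 \<times> T2 \<subseteq> T"
    using open_prod_elim[OF T(1)] by blast
  obtain e where e: "e > 0" "ball 0 e \<subseteq> T2" using T12 open_contains_ball by blast
  define e' where "e' = min e (r/2)"
  have "open (T1 \<inter> poly P -` ball 0 (e'\<^sup>2))"
    by (intro continuous_open_preimage T12 continuous_intros) auto
  moreover have "z0 \<in> T1 \<inter> poly P -` ball 0 (e'\<^sup>2)" using T12 z0 e r by (auto simp: e'_def)
  ultimately obtain \<delta> where \<delta>: "\<delta> > 0" "ball z0 \<delta> \<subseteq> T1 \<inter> poly P -` ball 0 (e'\<^sup>2)"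
    using open_contains_ball by blast
  have "norm (density \<omega> (Aff z w)) \<le> M" if z: "z \<in> ball z0 \<delta> - {z0}" and w: "w\<^sup>2 = poly P z" for z w
  proof -
    have "norm (poly P z) < e'\<^sup>2" "z \<in> T1" using \<delta>(2) z by auto
    hence "(norm w)\<^sup>2 < e'\<^sup>2" using w by (metis norm_power)
    hence nw: "norm w < e'" by (rule power_less_imp_less_base) (use e r in \<open>auto simp: e'_def\<close>)
    hence "(z, w) \<in> aff_curve P \<inter> T" using T12 e \<open>z \<in> T1\<close> w by (auto simp: e'_def aff_curve_def)
    hence q: "Aff z w \<in> fst c" unfolding T(2)[symmetric] by simp
    have wr: "w \<in> ball 0 r" "w \<in> cball 0 (r/2)" using nw r by (auto simp: e'_def)
    have "Aff (Z w) (W w) = Aff z w"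
      using chart_inv_chart[OF c(1) q] a wr c(2) by (auto simp: aff_param_def)
    hence ZW: "Z w = z" "W w = w" by auto
    have "w \<noteq> 0"
    proof
      assume "w = 0"
      hence "Z w = z0" using a c(2) by (simp add: aff_param_def)
      thus False using ZW z by simp
    qed
    have "\<omega> c w = density \<omega> (Aff z w) * N w"
      using form_eq_density[OF \<omega> c(1) a, of w] wr ZW \<open>w \<noteq> 0\<close> c(2) by simp
    hence "\<omega> c w * poly (pderiv P) (Z w) / 2 = density \<omega> (Aff z w)"
      using N[OF wr(1) \<open>w \<noteq> 0\<close>] by (simp add: mult.assoc mult.commute[of "N w"])
    thus ?thesis using M[OF wr(2)] by simp
  qed
  thus ?thesis using \<delta>(1) by blast
qed

text \<open>From z = 1/u and w = V/u^m one gets dz/w = - u^(m-2) du/V, so the density is - \<omega>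
  V u^(2-m). Powers stand on both sides of the estimate to avoid subtraction in the
  exponent.\<close>

lemma density_at_infinity:
  assumes \<omega>: "holomorphic_form \<omega>" and v0: "v0\<^sup>2 = lead_coeff P"
  shows "\<exists>r>0. \<exists>V M. \<forall>\<xi>\<in>ball 0 r - {0}. (V \<xi>)\<^sup>2 = poly R \<xi> \<and> norm (V \<xi> - v0) < norm v0 \<and>
    norm (density \<omega> (inf_param P (\<xi>, V \<xi>))) * norm \<xi> ^ m \<le> M * norm \<xi> ^ 2"
proof -
  have nz: "v0 \<noteq> 0" using v0 P_nonzero by auto
  obtain c where c: "c \<in> A" "At_Inf v0 \<in> fst c" using ex_u_chart[OF v0] by blast
  obtain r V where V: "inf_param_at c v0 r V" using ex_inf_param[OF c] by blast
  have hol: "\<omega> c holomorphic_on ball 0 r" "V holomorphic_on ball 0 r"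
    using holomorphic_form_on_chart[OF \<omega> c(1)] V holomorphic_on_subset by (auto simp: inf_param_at_def)
  hence cV: "continuous_on (ball 0 r) V" "continuous_on (ball 0 r) (\<lambda>\<xi>. \<omega> c \<xi> * V \<xi>)"
    by (intro continuous_intros holomorphic_on_imp_continuous_on; simp)+
  have r: "r > 0" using V by (simp add: inf_param_at_def)
  have "open (ball 0 r \<inter> V -` ball v0 (norm v0))"
    using cV by (intro continuous_open_preimage) auto
  moreover have "0 \<in> ball 0 r \<inter> V -` ball v0 (norm v0)" using V nz by (auto simp: inf_param_at_def)
  ultimately obtain r' where r': "r' > 0" "ball 0 r' \<subseteq> ball 0 r \<inter> V -` ball v0 (norm v0)"
    using open_contains_ball by blast
  have "continuous_on (cball 0 (r/2)) (\<lambda>\<xi>. \<omega> c \<xi> * V \<xi>)"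
    by (rule continuous_on_subset[OF cV(2)]) (use r in auto)
  then obtain M where M: "\<And>\<xi>. \<xi> \<in> cball 0 (r/2) \<Longrightarrow> norm (\<omega> c \<xi> * V \<xi>) \<le> M"
    using continuous_on_compact_norm_bound[OF compact_cball] by blast
  have "(V \<xi>)\<^sup>2 = poly R \<xi> \<and> norm (V \<xi> - v0) < norm v0 \<and>
    norm (density \<omega> (inf_param P (\<xi>, V \<xi>))) * norm \<xi> ^ m \<le> M * norm \<xi> ^ 2"
    if \<xi>: "\<xi> \<in> ball 0 (min r' (r/2)) - {0}" for \<xi>
  proof -
    have \<xi>r: "\<xi> \<in> ball 0 r" "\<xi> \<in> cball 0 (r/2)" "\<xi> \<noteq> 0" "\<xi> \<in> ball 0 r'" using \<xi> r by auto
    define p where "p = Aff (1 / \<xi>) (V \<xi> / \<xi> ^ m)"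
    have p: "inf_param P (\<xi>, V \<xi>) = p" using \<xi>r by (simp add: p_def inf_param_nz)
    hence pc: "p \<in> fst c" "snd c p = \<xi>" "V \<xi> \<noteq> 0"
      using V \<xi>r(1) u_fun_inf_param[of \<xi> "V \<xi>"] by (auto simp: inf_param_at_def)
    obtain r1 Z W N where a: "aff_param c p r1 Z W N"
      using ex_aff_param[OF c(1), of "1 / \<xi>" "V \<xi> / \<xi> ^ m" UNIV] pc by (auto simp: p_def)
    hence in1: "\<xi> \<in> ball (snd c p) r1" and ZW: "Z \<xi> = 1 / \<xi>" "W \<xi> = V \<xi> / \<xi> ^ m"
      using pc by (auto simp: aff_param_def p_def)
    have "(Z has_field_derivative N \<xi> * W \<xi>) (at \<xi>)" using a in1 by (auto simp: aff_param_def)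
    moreover have "(Z has_field_derivative - 1 / \<xi>\<^sup>2) (at \<xi>)"
    proof (rule has_field_derivative_transform_within_open[of "\<lambda>u. 1 / u"])
      show "((\<lambda>u. 1 / u) has_field_derivative - 1 / \<xi>\<^sup>2) (at \<xi>)"
        using \<xi>r by (auto intro!: derivative_eq_intros simp: power2_eq_square)
      show "\<xi> \<in> ball 0 r \<inter> ball (snd c p) r1" using \<xi>r in1 by auto
      fix u assume u: "u \<in> ball 0 r \<inter> ball (snd c p) r1"
      hence "chart_inv c u = inf_param P (u, V u)" using V by (simp add: inf_param_at_def)
      hence "Aff (Z u) (W u) = inf_param P (u, V u)" using aff_paramD(1)[OF a, of u] u by simp
      thus "1 / u = Z u" by (metis z_fun.simps(1) z_fun_inf_param)
    qed auto
    ultimately have NW: "N \<xi> * W \<xi> = - 1 / \<xi>\<^sup>2" by (rule DERIV_unique)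
    have "\<omega> c \<xi> = density \<omega> p * N \<xi>"
      using form_eq_density[OF \<omega> c(1) a in1] ZW pc \<xi>r by (simp add: p_def)
    hence "\<omega> c \<xi> * V \<xi> = density \<omega> p * (N \<xi> * W \<xi>) * \<xi> ^ m"
      using ZW \<xi>r by (simp add: field_simps)
    hence "\<omega> c \<xi> * V \<xi> * \<xi>\<^sup>2 = - (density \<omega> p * \<xi> ^ m)" using NW \<xi>r by (simp add: field_simps)
    hence "norm (density \<omega> p) * norm \<xi> ^ m = norm (\<omega> c \<xi> * V \<xi>) * norm \<xi> ^ 2"
      by (metis norm_minus_cancel norm_mult norm_power)
    also have "\<dots> \<le> M * norm \<xi> ^ 2" using M[OF \<xi>r(2)] by (intro mult_right_mono) auto
    finally have "norm (density \<omega> p) * norm \<xi> ^ m \<le> M * norm \<xi> ^ 2" .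
    moreover have "norm (V \<xi> - v0) < norm v0"
      using r'(2) \<xi>r(4) by (auto simp: dist_norm norm_minus_commute)
    ultimately show ?thesis using V \<xi>r(1) p by (auto simp: inf_param_at_def)
  qed
  thus ?thesis using r r' by (intro exI[of _ "min r' (r/2)"] conjI exI[of _ V] exI[of _ M] ballI) auto
qed

text \<open>The estimates at the two points over infinity together cover both sheets over every
  large z.\<close>

lemma density_growth:
  assumes \<omega>: "holomorphic_form \<omega>" and m: "m \<ge> 2"
  shows "\<exists>B M. B > 0 \<and> (\<forall>z w. norm z \<ge> B \<longrightarrow> w\<^sup>2 = poly P z \<longrightarrow> w \<noteq> 0 \<and> norm (density \<omega> (Aff z w)) \<le> M * norm z ^ (m - 2))"
proof -
  define v0 where "v0 = csqrt (lead_coeff P)"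
  have v0: "v0\<^sup>2 = lead_coeff P" "(- v0)\<^sup>2 = lead_coeff P" by (auto simp: v0_def)
  hence nz: "v0 \<noteq> 0" using P_nonzero by auto
  obtain r1 V1 M1 where 1: "r1 > 0" "\<And>\<xi>. \<xi> \<in> ball 0 r1 - {0} \<Longrightarrow> (V1 \<xi>)\<^sup>2 = poly R \<xi> \<and> norm (V1 \<xi> - v0) < norm v0 \<and>
    norm (density \<omega> (inf_param P (\<xi>, V1 \<xi>))) * norm \<xi> ^ m \<le> M1 * norm \<xi> ^ 2"
    using density_at_infinity[OF \<omega> v0(1)] by blast
  obtain r2 V2 M2 where 2: "r2 > 0" "\<And>\<xi>. \<xi> \<in> ball 0 r2 - {0} \<Longrightarrow> (V2 \<xi>)\<^sup>2 = poly R \<xi> \<and> norm (V2 \<xi> - - v0) < norm (- v0) \<and>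
    norm (density \<omega> (inf_param P (\<xi>, V2 \<xi>))) * norm \<xi> ^ m \<le> M2 * norm \<xi> ^ 2"
    using density_at_infinity[OF \<omega> v0(2)] by blast
  define B where "B = 2 / min r1 r2"
  have B: "B > 0" using 1 2 by (simp add: B_def)
  have "w \<noteq> 0 \<and> norm (density \<omega> (Aff z w)) \<le> max M1 M2 * norm z ^ (m - 2)"
    if z: "norm z \<ge> B" and w: "w\<^sup>2 = poly P z" for z w
  proof -
    define \<xi> where "\<xi> = 1 / z"
    have z0: "z \<noteq> 0" using z B by auto
    have "1 / norm z \<le> 1 / B" using z B by (intro divide_left_mono mult_pos_pos) auto
    hence "norm \<xi> \<le> min r1 r2 / 2" by (simp add: \<xi>_def norm_divide B_def)
    hence in12: "\<xi> \<in> ball 0 r1 - {0}" "\<xi> \<in> ball 0 r2 - {0}" using 1(1) 2(1) z0 by (auto simp: \<xi>_def)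
    note a = 1(2)[OF in12(1)] 2(2)[OF in12(2)]
    define v where "v = w / z ^ m"
    have v: "v\<^sup>2 = poly R \<xi>" using reciprocal_mem[OF z0 w] by (simp add: aff_curve_def v_def \<xi>_def)
    \<comment> \<open>\<open>V1\<close> and \<open>V2\<close> stay in the disjoint discs about
      \<open>v0\<close> and \<open>- v0\<close>; hence they are the two square roots of the
      reflected polynomial, and w/z^m is one of them.\<close>
    have "V1 \<xi> \<noteq> V2 \<xi>"
    proof
      assume eq: "V1 \<xi> = V2 \<xi>"
      have "norm (2 * v0) \<le> norm (V1 \<xi> - v0) + norm (V2 \<xi> - - v0)"
        using norm_triangle_ineq4[of "V2 \<xi> - - v0" "V1 \<xi> - v0"] by (simp add: eq algebra_simps)
      thus False using a by (simp add: norm_mult)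
    qed
    moreover have "v\<^sup>2 = (V1 \<xi>)\<^sup>2" "(V2 \<xi>)\<^sup>2 = (V1 \<xi>)\<^sup>2" using a v by auto
    ultimately have "v = V1 \<xi> \<or> v = V2 \<xi>" by (metis power2_eq_iff)
    hence "norm (density \<omega> (inf_param P (\<xi>, v))) * norm \<xi> ^ m \<le> max M1 M2 * norm \<xi> ^ 2"
      using a by (auto intro: order_trans[OF _ mult_right_mono])
    moreover have "inf_param P (\<xi>, v) = Aff z w"
      using Aff_eq_inf_param[OF z0, of w] by (simp add: v_def \<xi>_def)
    moreover have m2: "2 + (m - 2) = m" using m by simp
    have "norm \<xi> ^ m = norm \<xi> ^ 2 * norm \<xi> ^ (m - 2)" unfolding power_add[symmetric] m2 ..
    ultimately have "norm (density \<omega> (Aff z w)) * norm \<xi> ^ (m - 2) * norm \<xi> ^ 2 \<le> max M1 M2 * norm \<xi> ^ 2"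
      by (simp add: mult_ac)
    hence "norm (density \<omega> (Aff z w)) * norm \<xi> ^ (m - 2) \<le> max M1 M2"
      using z0 by (simp add: \<xi>_def norm_divide)
    hence "norm (density \<omega> (Aff z w)) \<le> max M1 M2 * norm z ^ (m - 2)"
      using z0 by (simp add: \<xi>_def norm_divide power_divide field_simps)
    moreover have "w \<noteq> 0"
    proof
      assume "w = 0"
      hence "V1 \<xi> = 0" using v a by (auto simp: v_def)
      thus False using a by simp
    qed
    ultimately show ?thesis by blast
  qed
  thus ?thesis using B by blast
qed

text \<open>Exchanging the two roots does not change the sum, so it is a single-valued function of
  z: holomorphic where the two branches can be followed, and bounded near the roots of P, where it
  extends. Only the exponents e = 0 and e = 1 are applied.\<close>

lemma sheet_sum_entire:
  assumes \<omega>: "holomorphic_form \<omega>"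
  shows "\<exists>g. g holomorphic_on UNIV \<and> (\<forall>z w. poly P z \<noteq> 0 \<longrightarrow> w\<^sup>2 = poly P z \<longrightarrow>
       g z = density \<omega> (Aff z w) * w ^ e + density \<omega> (Aff z (- w)) * (- w) ^ e)"
proof -
  define T where "T = (\<lambda>z w. density \<omega> (Aff z w) * w ^ e + density \<omega> (Aff z (- w)) * (- w) ^ e)"
  define f where "f = (\<lambda>z. T z (csqrt (poly P z)))"
  define K where "K = {z. poly P z = 0}"
  have fT: "f z = T z w" if "w\<^sup>2 = poly P z" for z w
  proof -
    have "w\<^sup>2 = (csqrt (poly P z))\<^sup>2" using that by simp
    hence "w = csqrt (poly P z) \<or> w = - csqrt (poly P z)" by (rule power2_eq_iff[THEN iffD1])
    thus ?thesis by (auto simp: f_def T_def)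
  qed
  have K: "finite K" unfolding K_def using P_nonzero poly_roots_finite by blast
  have "f field_differentiable at z0" if z0: "z0 \<in> UNIV - K" for z0
  proof -
    define w0 where "w0 = csqrt (poly P z0)"
    have w0: "w0 \<noteq> 0" "w0\<^sup>2 = poly P z0" "- w0 \<noteq> 0" "(- w0)\<^sup>2 = poly P z0"
      using z0 by (auto simp: w0_def K_def)
    obtain r1 s1 D1 where 1: "r1 > 0" "s1 holomorphic_on ball z0 r1" "D1 holomorphic_on ball z0 r1"
      "\<And>z. z \<in> ball z0 r1 \<Longrightarrow> (s1 z)\<^sup>2 = poly P z \<and> norm (s1 z - w0) < norm w0 \<and> density \<omega> (Aff z (s1 z)) = D1 z"
      using density_in_z_chart[OF \<omega> w0(1,2)] by blast
    obtain r2 s2 D2 where 2: "r2 > 0" "s2 holomorphic_on ball z0 r2" "D2 holomorphic_on ball z0 r2"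
      "\<And>z. z \<in> ball z0 r2 \<Longrightarrow> (s2 z)\<^sup>2 = poly P z \<and> norm (s2 z - - w0) < norm (- w0) \<and> density \<omega> (Aff z (s2 z)) = D2 z"
      using density_in_z_chart[OF \<omega> w0(3,4)] by blast
    let ?r = "min r1 r2"
    have s2: "s2 z = - s1 z" if z: "z \<in> ball z0 ?r" for z
    proof (rule square_eq_same_side[of _ _ "- w0"])
      have "norm (- s1 z - - w0) = norm (s1 z - w0)" using norm_minus_commute by simp
      thus "norm (- s1 z - - w0) < norm (- w0)" using 1(4)[of z] z by simp
    qed (use 1(4)[of z] 2(4)[of z] z in auto)
    have "f z = D1 z * s1 z ^ e + D2 z * (- s1 z) ^ e" if z: "z \<in> ball z0 ?r" for z
      using fT[of "s1 z" z] 1(4)[of z] 2(4)[of z] s2[OF z] z by (simp add: T_def)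
    moreover have "(\<lambda>z. D1 z * s1 z ^ e + D2 z * (- s1 z) ^ e) holomorphic_on ball z0 ?r"
      by (intro holomorphic_intros holomorphic_on_subset[OF 1(2)] holomorphic_on_subset[OF 1(3)]
          holomorphic_on_subset[OF 2(3)]) auto
    ultimately have "f holomorphic_on ball z0 ?r"
      by (metis (no_types, lifting) holomorphic_transform)
    from holomorphic_on_imp_differentiable_at[OF this open_ball, of z0] show ?thesis
      using 1(1) 2(1) by simp
  qed
  hence hol: "f holomorphic_on UNIV - K"
    unfolding holomorphic_on_def using field_differentiable_at_within by blast
  have "\<exists>B. \<forall>\<^sub>F z in at z0. norm (f z) \<le> B" if z0: "z0 \<in> K" for z0
  proof -
    obtain \<delta> M where M: "\<delta> > 0" "\<And>z w. z \<in> ball z0 \<delta> - {z0} \<Longrightarrow> w\<^sup>2 = poly P z \<Longrightarrow> norm (density \<omega> (Aff z w)) \<le> M"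
      using density_bounded_at_root[OF \<omega>, of z0] z0 unfolding K_def by blast
    obtain C where C: "\<And>z. z \<in> cball z0 \<delta> \<Longrightarrow> norm (poly P z) \<le> C"
      using continuous_on_compact_norm_bound[OF compact_cball continuous_on_poly[OF continuous_on_id]] by metis
    have "norm (f z) \<le> M * sqrt C ^ e + M * sqrt C ^ e" if z: "z \<in> ball z0 \<delta> - {z0}" for z
    proof -
      let ?w = "csqrt (poly P z)"
      have "(norm ?w)\<^sup>2 \<le> C" using C[of z] z by (simp flip: norm_power)
      hence "norm ?w \<le> sqrt C" by (rule real_le_rsqrt)
      hence w: "norm ?w ^ e \<le> sqrt C ^ e" by (intro power_mono) auto
      have "norm (f z) \<le> norm (density \<omega> (Aff z ?w)) * norm ?w ^ e + norm (density \<omega> (Aff z (- ?w))) * norm ?w ^ e"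
        unfolding f_def T_def by (rule order_trans[OF norm_triangle_ineq]) (simp add: norm_mult norm_power)
      also have "\<dots> \<le> M * sqrt C ^ e + M * sqrt C ^ e"
        using M(2)[OF z, of ?w] M(2)[OF z, of "- ?w"] w order_trans[OF norm_ge_zero]
        by (intro add_mono mult_mono) auto
      finally show ?thesis .
    qed
    moreover have "\<forall>\<^sub>F z in at z0. z \<in> ball z0 \<delta> - {z0}" using M(1) by (intro eventually_at_in_open) auto
    ultimately show ?thesis by (metis (mono_tags, lifting) eventually_mono)
  qed
  then obtain g where g: "g holomorphic_on UNIV" "\<And>z. z \<in> UNIV - K \<Longrightarrow> g z = f z"
    using holomorphic_extend_bounded_finite[OF K open_UNIV hol] by blast
  show ?thesis
    using g fT by (intro exI[of _ g]) (auto simp: K_def T_def)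
qed

lemma entire_polynomial_growth:
  assumes "g holomorphic_on UNIV" "\<And>z. norm z \<ge> B \<Longrightarrow> norm (g z) \<le> M * norm z ^ n"
  shows "\<exists>q. degree q \<le> n \<and> (\<forall>z. g z = poly q z)"
proof -
  define q where "q = (\<Sum>k\<le>n. monom ((deriv ^^ k) g 0 / fact k) k)"
  have "degree q \<le> n"
    unfolding q_def by (intro degree_sum_le) (auto intro: order_trans[OF degree_monom_le])
  moreover have "g z = poly q z" for z
    using Liouville_polynomial[OF assms] by (simp add: q_def poly_sum poly_monom)
  ultimately show ?thesis by blast
qed

text \<open>The sum of the density over the two sheets is a polynomial in \<open>z\<close>; its product with \<open>w\<close>,
  summed over the sheets, vanishes at the \<open>2m\<close> roots and has smaller degree.\<close>

lemma density_polynomial: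
  assumes \<omega>: "holomorphic_form \<omega>" and m: "m \<ge> 2"
  obtains q where "degree q \<le> m - 2"
    "\<And>z w. w \<noteq> 0 \<Longrightarrow> w\<^sup>2 = poly P z \<Longrightarrow> density \<omega> (Aff z w) = poly q z"
proof -
  obtain B M where BM: "B > 0" "\<And>z w. norm z \<ge> B \<Longrightarrow> w\<^sup>2 = poly P z \<Longrightarrow>
      w \<noteq> 0 \<and> norm (density \<omega> (Aff z w)) \<le> M * norm z ^ (m - 2)"
    using density_growth[OF \<omega> m] by blast
  obtain C where C: "\<And>z. norm z \<ge> B \<Longrightarrow> norm (poly P z) \<le> C * norm z ^ (2 * m)"
  proof -
    obtain C where "\<And>u. u \<in> cball 0 (1 / B) \<Longrightarrow> norm (poly R u) \<le> C"
      using continuous_on_compact_norm_bound[OF compact_cball continuous_on_poly[OF continuous_on_id]] by metis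
    hence "norm (poly P z) \<le> C * norm z ^ (2 * m)" if "norm z \<ge> B" for z
    proof -
      have z: "z \<noteq> 0" using that BM(1) by auto
      have "norm (poly R (1 / z)) \<le> C"
        using that BM(1) \<open>\<And>u. u \<in> cball 0 (1 / B) \<Longrightarrow> norm (poly R u) \<le> C\<close>[of "1 / z"] z
        by (simp add: norm_divide frac_le)
      thus ?thesis using poly_R[of "1 / z"] z by (simp add: norm_mult norm_power norm_divide field_simps)
    qed
    thus ?thesis using that by blast
  qed
  have gr: "norm (g z) \<le> (2 * M * sqrt C ^ e) * norm z ^ (m - 2 + m * e)"
    if g: "\<And>z w. poly P z \<noteq> 0 \<Longrightarrow> w\<^sup>2 = poly P z \<Longrightarrow>
       g z = density \<omega> (Aff z w) * w ^ e + density \<omega> (Aff z (- w)) * (- w) ^ e" and z: "norm z \<ge> B" for g z e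
  proof -
    define w where "w = csqrt (poly P z)"
    have w: "w\<^sup>2 = poly P z" "(- w)\<^sup>2 = poly P z" by (auto simp: w_def)
    note b = BM(2)[OF z w(1)] BM(2)[OF z w(2)]
    have "(norm w)\<^sup>2 \<le> C * norm z ^ (2 * m)" using C[OF z] w(1) by (metis norm_power)
    hence "norm w \<le> sqrt (C * norm z ^ (2 * m))" by (rule real_le_rsqrt)
    also have "\<dots> = sqrt C * norm z ^ m" by (simp add: real_sqrt_mult power_mult power2_eq_square[symmetric] mult.commute[of 2])
    finally have "norm w ^ e \<le> (sqrt C * norm z ^ m) ^ e" by (intro power_mono) auto
    hence we: "norm w ^ e \<le> sqrt C ^ e * norm z ^ (m * e)" by (simp add: power_mult_distrib power_mult)
    have nz: "poly P z \<noteq> 0" using w(1) b(1) by (metis power_not_zero)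
    have M0: "0 \<le> M * norm z ^ (m - 2)" using b(1) norm_ge_zero order_trans by blast
    have "norm (g z) = norm (density \<omega> (Aff z w) * w ^ e + density \<omega> (Aff z (- w)) * (- w) ^ e)"
      by (simp only: g[OF nz w(1)])
    also have "\<dots> \<le> norm (density \<omega> (Aff z w)) * norm w ^ e + norm (density \<omega> (Aff z (- w))) * norm w ^ e"
      by (rule order_trans[OF norm_triangle_ineq]) (simp add: norm_mult norm_power)
    also have "\<dots> \<le> (M * norm z ^ (m - 2)) * (sqrt C ^ e * norm z ^ (m * e)) + (M * norm z ^ (m - 2)) * (sqrt C ^ e * norm z ^ (m * e))"
      using b we M0 by (intro add_mono mult_mono) auto
    finally show ?thesis by (simp add: power_add mult_ac)
  qed
  obtain g0 where "g0 holomorphic_on UNIV \<and> (\<forall>z w. poly P z \<noteq> 0 \<longrightarrow> w\<^sup>2 = poly P z \<longrightarrow>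
       g0 z = density \<omega> (Aff z w) * w ^ 0 + density \<omega> (Aff z (- w)) * (- w) ^ 0)"
    using sheet_sum_entire[OF \<omega>, of 0] by (rule exE)
  note g0 = conjunct1[OF this] conjunct2[OF this, rule_format]
  obtain g1 where "g1 holomorphic_on UNIV \<and> (\<forall>z w. poly P z \<noteq> 0 \<longrightarrow> w\<^sup>2 = poly P z \<longrightarrow>
       g1 z = density \<omega> (Aff z w) * w ^ 1 + density \<omega> (Aff z (- w)) * (- w) ^ 1)"
    using sheet_sum_entire[OF \<omega>, of 1] by (rule exE)
  note g1 = conjunct1[OF this] conjunct2[OF this, rule_format]
  have "\<exists>q. degree q \<le> m - 2 + m * 0 \<and> (\<forall>z. g0 z = poly q z)"
  proof (rule entire_polynomial_growth[OF g0(1)])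
    fix z :: complex assume z: "B \<le> norm z"
    show "norm (g0 z) \<le> (2 * M * sqrt C ^ 0) * norm z ^ (m - 2 + m * 0)" by (rule gr[OF g0(2) z])
  qed
  then obtain q0 where "degree q0 \<le> m - 2 + m * 0 \<and> (\<forall>z. g0 z = poly q0 z)" by (rule exE)
  note q0 = conjunct1[OF this] conjunct2[OF this, rule_format]
  have "\<exists>q. degree q \<le> m - 2 + m * 1 \<and> (\<forall>z. g1 z = poly q z)"
  proof (rule entire_polynomial_growth[OF g1(1)])
    fix z :: complex assume z: "B \<le> norm z"
    show "norm (g1 z) \<le> (2 * M * sqrt C ^ 1) * norm z ^ (m - 2 + m * 1)" by (rule gr[OF g1(2) z])
  qed
  then obtain q1 where "degree q1 \<le> m - 2 + m * 1 \<and> (\<forall>z. g1 z = poly q1 z)" by (rule exE)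
  note q1 = conjunct1[OF this] conjunct2[OF this, rule_format]
  \<comment> \<open>At a root of P the density stays bounded while the factor w tends to 0.\<close>
  have root: "poly q1 z0 = 0" if z0: "poly P z0 = 0" for z0
  proof -
    obtain \<delta> M' where M': "\<delta> > 0" "\<And>z w. z \<in> ball z0 \<delta> - {z0} \<Longrightarrow> w\<^sup>2 = poly P z \<Longrightarrow> norm (density \<omega> (Aff z w)) \<le> M'"
      using density_bounded_at_root[OF \<omega> z0] by blast
    have "open (- ({z. poly P z = 0} - {z0}))"
      using P_nonzero poly_roots_finite[of P] by (intro open_Compl finite_imp_closed) auto
    hence "\<forall>\<^sub>F z in at z0. z \<in> - ({z. poly P z = 0} - {z0}) - {z0}" by (intro eventually_at_in_open) auto
    moreover have "\<forall>\<^sub>F z in at z0. z \<in> ball z0 \<delta> - {z0}" using M'(1) by (intro eventually_at_in_open) auto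
    ultimately have "\<forall>\<^sub>F z in at z0. norm (poly q1 z) \<le> 2 * M' * sqrt (norm (poly P z))"
    proof eventually_elim
      case (elim z)
      define w where "w = csqrt (poly P z)"
      have w: "w\<^sup>2 = poly P z" "(- w)\<^sup>2 = poly P z" by (auto simp: w_def)
      have nw: "norm w = sqrt (norm (poly P z))"
        using w(1) by (metis norm_ge_zero norm_power real_sqrt_unique)
      have "poly q1 z = density \<omega> (Aff z w) * w + density \<omega> (Aff z (- w)) * (- w)"
        using g1(2)[of z w] w q1(2)[of z] elim by simp
      hence "norm (poly q1 z) \<le> norm (density \<omega> (Aff z w)) * norm w + norm (density \<omega> (Aff z (- w))) * norm w"
        using norm_triangle_ineq[of "density \<omega> (Aff z w) * w" "density \<omega> (Aff z (- w)) * (- w)"]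
        by (simp add: norm_mult)
      also have "\<dots> \<le> M' * norm w + M' * norm w"
        using M'(2)[of z w] M'(2)[of z "- w"] w elim by (intro add_mono mult_right_mono) auto
      finally show ?case by (simp add: nw)
    qed
    moreover have "((\<lambda>z. 2 * M' * sqrt (norm (poly P z))) \<longlongrightarrow> 2 * M' * sqrt (norm (poly P z0))) (at z0)"
      by (intro tendsto_intros)
    hence "((\<lambda>z. 2 * M' * sqrt (norm (poly P z))) \<longlongrightarrow> 0) (at z0)" using z0 by simp
    ultimately have "(poly q1 \<longlongrightarrow> 0) (at z0)" by (rule Lim_null_comparison)
    moreover have "(poly q1 \<longlongrightarrow> poly q1 z0) (at z0)" by (intro tendsto_intros)
    ultimately show ?thesis using LIM_unique by blast
  qed
  have q1_0: "q1 = 0"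
  proof (rule poly_eqI_degree[of "{z. poly P z = 0}"])
    have c: "card {z. poly P z = 0} = 2 * m"
      using card_roots_eq_degree[OF simple_roots] degree_P by simp
    show "degree q1 < card {z. poly P z = 0}" "degree (0 :: complex poly) < card {z. poly P z = 0}"
      using q1(1) m by (auto simp: c)
  qed (use root in auto)
  have "density \<omega> (Aff z w) = poly (smult (1/2) q0) z" if w: "w \<noteq> 0" "w\<^sup>2 = poly P z" for z w
  proof -
    have nz: "poly P z \<noteq> 0" using w by (metis power_not_zero)
    \<comment> \<open>Vanishing of the second sum says that the densities on the two sheets agree,
      so each is half of the first sum.\<close>
    have "density \<omega> (Aff z w) * w - density \<omega> (Aff z (- w)) * w = 0"
      using g1(2)[OF nz w(2)] q1(2)[of z] by (simp add: q1_0)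
    hence "density \<omega> (Aff z w) = density \<omega> (Aff z (- w))" using w by simp
    thus ?thesis using g0(2)[OF nz w(2)] q0(2)[of z] by simp
  qed
  thus ?thesis using that[of "smult (1/2) q0"] q0(1) by simp
qed

section \<open>The basis z^i dz/w\<close>

lemma fdh_basis_affine:
  assumes "aff_param c p r Z W N" "\<zeta> \<in> ball (snd c p) r"
  shows "fdh (\<lambda>q. z_fun q ^ i / w_fun q) z_fun c \<zeta> = Z \<zeta> ^ i * N \<zeta>"
proof (rule fdh_affine[OF assms(1) _ _ assms(2)])
  show "continuous_on (ball (snd c p) r) (\<lambda>\<zeta>. Z \<zeta> ^ i)"
    using assms(1) by (intro continuous_intros holomorphic_on_imp_continuous_on) (simp add: aff_param_def)
qed simp

text \<open>Over infinity the form reads - u^(m-2-i) du/v, which has no pole exactly in the given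
  range of i; over finite points dz/w is already holomorphic.\<close>

lemma holomorphic_basis:
  assumes i: "i + 2 \<le> m"
  shows "holomorphic_form (fdh (\<lambda>q. z_fun q ^ i / w_fun q) z_fun)"
  unfolding holomorphic_form_def
proof
  show "meromorphic_form A (fdh (\<lambda>q. z_fun q ^ i / w_fun q) z_fun)"
  proof (rule meromorphic_form_fdh)
    fix c assume c: "c \<in> A"
    show "((\<lambda>q. z_fun q ^ i / w_fun q) \<circ> chart_inv c) meromorphic_on chart_image c"
      using meromorphic_z_w_fun[OF c] by (auto simp: o_def intro!: meromorphic_intros)
  qed (rule meromorphic_z_w_fun)
  show "form_holomorphic_on A (fdh (\<lambda>q. z_fun q ^ i / w_fun q) z_fun) (topspace X)"
  proof (rule form_holomorphic_onI)
    fix c p assume c: "c \<in> A" "p \<in> fst c"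
    show "\<exists>r>0. \<exists>h. h holomorphic_on ball (snd c p) r \<and>
        (\<forall>\<zeta>\<in>ball (snd c p) r. fdh (\<lambda>q. z_fun q ^ i / w_fun q) z_fun c \<zeta> = h \<zeta>)"
    proof (cases p)
      case (Aff z w)
      then obtain r Z W N where a: "aff_param c p r Z W N"
        using ex_aff_param[OF c(1), of z w UNIV] c by auto
      have "(\<lambda>\<zeta>. Z \<zeta> ^ i * N \<zeta>) holomorphic_on ball (snd c p) r"
        using a by (intro holomorphic_intros) (auto simp: aff_param_def)
      thus ?thesis using fdh_basis_affine[OF a] a
        by (intro exI[of _ r]) (auto simp: aff_param_def)
    next
      case (At_Inf v)
      then obtain r V where V: "inf_param_at c v r V" using ex_inf_param c by blast
      hence p0: "snd c p = 0" and Vnz: "\<And>\<zeta>. \<zeta> \<in> ball 0 r \<Longrightarrow> V \<zeta> \<noteq> 0"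
        using At_Inf by (auto simp: inf_param_at_def)
      have hol: "(\<lambda>\<zeta>. - (\<zeta> ^ (m - 2 - i)) / V \<zeta>) holomorphic_on ball 0 r"
        using V Vnz by (intro holomorphic_intros) (auto simp: inf_param_at_def)
      have "fdh (\<lambda>q. z_fun q ^ i / w_fun q) z_fun c \<zeta> = - (\<zeta> ^ (m - 2 - i)) / V \<zeta>" if "\<zeta> \<in> ball 0 r" for \<zeta>
      proof (rule fdh_infinite[OF V open_ball _ that])
        fix \<xi> :: complex assume \<xi>: "\<xi> \<in> ball 0 r" "\<xi> \<noteq> 0"
        have mi: "(m - 2 - i) + 2 + i = m" using i by simp
        have "\<xi> ^ m = \<xi> ^ (m - 2 - i) * \<xi>\<^sup>2 * \<xi> ^ i" unfolding power_add[symmetric] mi ..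
        thus "- (z_fun (inf_param P (\<xi>, V \<xi>)) ^ i / w_fun (inf_param P (\<xi>, V \<xi>))) / \<xi>\<^sup>2 = - (\<xi> ^ (m - 2 - i)) / V \<xi>"
          using \<xi> Vnz[OF \<xi>(1)] by (simp add: inf_param_nz power_divide field_simps)
      qed (use hol holomorphic_on_imp_continuous_on in auto)
      thus ?thesis unfolding p0 using hol V
        by (intro exI[of _ r] exI[of _ "\<lambda>\<zeta>. - (\<zeta> ^ (m - 2 - i)) / V \<zeta>"] conjI ballI)
          (auto simp: inf_param_at_def)
    qed
  qed
qed

text \<open>Branch points and points over infinity are isolated, so an identity at the affine points
  with w nonzero extends to them by continuity.\<close>

lemma holomorphic_forms_eqI:
  assumes \<omega>: "holomorphic_form \<omega>" and c: "c \<in> A" and \<zeta>0: "\<zeta>0 \<in> chart_image c"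
    and h: "continuous_on (chart_image c) h"
    and eq: "\<And>p r Z W N \<zeta>. aff_param c p r Z W N \<Longrightarrow> \<zeta> \<in> ball (snd c p) r \<Longrightarrow> W \<zeta> \<noteq> 0 \<Longrightarrow> \<omega> c \<zeta> = h \<zeta>"
  shows "\<omega> c \<zeta>0 = h \<zeta>0"
proof -
  obtain p where p: "p \<in> fst c" "\<zeta>0 = snd c p" using \<zeta>0 by (auto simp: chart_image_def)
  have "\<exists>r>0. \<forall>\<zeta>\<in>ball \<zeta>0 r - {\<zeta>0}. \<omega> c \<zeta> = h \<zeta>"
  proof (cases p)
    case (Aff z w)
    then obtain r Z W N where a: "aff_param c p r Z W N"
      using ex_aff_param[OF c(1), of z w UNIV] p by auto
    thus ?thesis using eq[OF a] aff_paramD(6)[OF a] p(2) by (intro exI[of _ r]) (auto simp: aff_param_def)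
  next
    case (At_Inf v)
    then obtain r V where V: "inf_param_at c v r V" using ex_inf_param c p by blast
    have "\<omega> c \<zeta> = h \<zeta>" if \<zeta>: "\<zeta> \<in> ball 0 r - {0}" for \<zeta>
    proof -
      define q where "q = Aff (1 / \<zeta>) (V \<zeta> / \<zeta> ^ m)"
      have q: "q = inf_param P (\<zeta>, V \<zeta>)" using \<zeta> by (simp add: q_def inf_param_nz)
      hence qc: "q \<in> fst c" "snd c q = \<zeta>" "V \<zeta> \<noteq> 0"
        using V \<zeta> by (auto simp: inf_param_at_def)
      obtain r1 Z W N where a: "aff_param c q r1 Z W N"
        using ex_aff_param[OF c(1), of "1 / \<zeta>" "V \<zeta> / \<zeta> ^ m" UNIV] qc by (auto simp: q_def)
      have "W \<zeta> = V \<zeta> / \<zeta> ^ m" using a qc by (auto simp: aff_param_def q_def)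
      thus ?thesis using eq[OF a, of \<zeta>] a qc \<zeta> by (auto simp: aff_param_def)
    qed
    thus ?thesis using V p At_Inf by (intro exI[of _ r]) (auto simp: inf_param_at_def)
  qed
  then obtain r where r: "r > 0" "\<And>\<zeta>. \<zeta> \<in> ball \<zeta>0 r - {\<zeta>0} \<Longrightarrow> \<omega> c \<zeta> = h \<zeta>" by blast
  have "\<forall>\<^sub>F \<zeta> in at \<zeta>0. \<zeta> \<in> ball \<zeta>0 r - {\<zeta>0}" using r by (intro eventually_at_in_open) auto
  hence "\<forall>\<^sub>F \<zeta> in at \<zeta>0. \<omega> c \<zeta> = h \<zeta>" by eventually_elim (rule r(2))
  moreover have "continuous_on (chart_image c) (\<omega> c)"
    using holomorphic_form_on_chart[OF \<omega> c] holomorphic_on_imp_continuous_on by blast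
  hence "isCont (\<omega> c) \<zeta>0" "isCont h \<zeta>0"
    using h open_chart_image[OF c] \<zeta>0 continuous_on_eq_continuous_at by blast+
  hence 1: "\<omega> c \<midarrow>\<zeta>0\<rightarrow> \<omega> c \<zeta>0" and 2: "h \<midarrow>\<zeta>0\<rightarrow> h \<zeta>0" by (auto simp: isCont_def)
  ultimately have "h \<midarrow>\<zeta>0\<rightarrow> \<omega> c \<zeta>0" using Lim_transform_eventually[OF 1] by blast
  from LIM_unique[OF this 2] show ?thesis .
qed

text \<open>The coefficients of the polynomial density are the coordinates in the basis z^i dz/w.
  They are unique because two polynomials that agree off the finitely many roots of P
  coincide.\<close>

theorem has_genus_X:
  assumes m: "m \<ge> 2"
  shows "has_genus X A (m - 1)"
proof -
  define B where "B = (\<lambda>i. fdh (\<lambda>q. z_fun q ^ i / w_fun q) z_fun)"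
  have hB: "holomorphic_form (B i)" if "i < m - 1" for i
    unfolding B_def using that by (intro holomorphic_basis) auto
  have cB: "continuous_on (chart_image c) (\<lambda>\<zeta>. \<Sum>i<m - 1. k i * B i c \<zeta>)" if "c \<in> A" for c and k :: "nat \<Rightarrow> complex"
    using holomorphic_form_on_chart[OF hB that]
    by (intro continuous_intros holomorphic_on_imp_continuous_on) auto
  have "\<exists>!k. (\<forall>i\<ge>m - 1. k i = 0) \<and> (\<forall>c\<in>A. \<forall>\<zeta>\<in>chart_image c. \<omega> c \<zeta> = (\<Sum>i<m - 1. k i * B i c \<zeta>))"
    if \<omega>: "holomorphic_form \<omega>" for \<omega>
  proof -
    obtain q where q: "degree q \<le> m - 2"
        "\<And>z w. w \<noteq> 0 \<Longrightarrow> w\<^sup>2 = poly P z \<Longrightarrow> density \<omega> (Aff z w) = poly q z"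
      using density_polynomial[OF \<omega> m] by blast
    have qs: "poly q z = (\<Sum>i<m - 1. coeff q i * z ^ i)" for z
    proof -
      have "poly q z = (\<Sum>i\<le>degree q. coeff q i * z ^ i)" by (rule poly_altdef)
      also have "\<dots> = (\<Sum>i<m - 1. coeff q i * z ^ i)"
        using q(1) m by (intro sum.mono_neutral_left) (auto simp: coeff_eq_0)
      finally show ?thesis .
    qed
    show ?thesis
    proof (rule ex1I[of _ "coeff q"], intro conjI ballI)
      show "\<forall>i\<ge>m - 1. coeff q i = 0" using q(1) m by (auto intro!: coeff_eq_0)
      fix c \<zeta>0 assume c: "c \<in> A" "\<zeta>0 \<in> chart_image c"
      show "\<omega> c \<zeta>0 = (\<Sum>i<m - 1. coeff q i * B i c \<zeta>0)"
      proof (rule holomorphic_forms_eqI[OF \<omega> c cB[OF c(1)]])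
        fix p r Z W N \<zeta>
        assume a: "aff_param c p r Z W N" "\<zeta> \<in> ball (snd c p) r" "W \<zeta> \<noteq> 0"
        have "\<omega> c \<zeta> = poly q (Z \<zeta>) * N \<zeta>"
          using form_eq_density[OF \<omega> c(1) a] q(2)[OF a(3) aff_paramD(4)[OF a(1,2)]] by simp
        thus "\<omega> c \<zeta> = (\<Sum>i<m - 1. coeff q i * B i c \<zeta>)"
          by (simp add: qs B_def fdh_basis_affine[OF a(1,2)] sum_distrib_right mult.assoc)
      qed
    next
      fix k assume k: "(\<forall>i\<ge>m - 1. k i = 0) \<and> (\<forall>c\<in>A. \<forall>\<zeta>\<in>chart_image c. \<omega> c \<zeta> = (\<Sum>i<m - 1. k i * B i c \<zeta>))"
      define q' where "q' = (\<Sum>i<m - 1. monom (k i) i)"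
      have q': "poly q' z = (\<Sum>i<m - 1. k i * z ^ i)" for z
        by (simp add: q'_def poly_sum poly_monom)
      have "coeff q' i = k i" for i
        using k by (simp add: q'_def coeff_sum sum.delta)
      moreover have "q' = q"
      proof (rule ccontr)
        assume ne: "q' \<noteq> q"
        have "poly q' z = poly q z" if z: "poly P z \<noteq> 0" for z
        proof -
          define w where "w = csqrt (poly P z)"
          have w: "w \<noteq> 0" "w\<^sup>2 = poly P z" using z by (auto simp: w_def)
          obtain c where c: "c \<in> A" "snd c = z_fun" "Aff z w \<in> fst c" using ex_z_chart[OF w] by blast
          obtain r Z W N where a: "aff_param c (Aff z w) r Z W N"
            using ex_aff_param[OF c(1,3), of UNIV] by auto
          have in1: "z \<in> ball (snd c (Aff z w)) r" and ZW: "Z z = z" "W z = w" using a c(2) by (auto simp: aff_param_def)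
          have N: "N z \<noteq> 0"
          proof
            assume "N z = 0"
            hence "(Z has_field_derivative 0) (at z)" using aff_paramD(5)[OF a in1] by simp
            moreover have "(Z has_field_derivative 1) (at z)"
              by (rule has_field_derivative_transform_within_open[OF DERIV_ident open_ball in1])
                (use aff_paramD(3)[OF a] c(2) in auto)
            ultimately show False using DERIV_unique by fastforce
          qed
          have "\<omega> c z = (\<Sum>i<m - 1. k i * B i c z)"
            using k c(1) in1 a by (auto simp: aff_param_def)
          also have "\<dots> = poly q' z * N z"
            by (simp add: q' B_def fdh_basis_affine[OF a in1] ZW sum_distrib_right mult.assoc)
          finally have 1: "\<omega> c z = poly q' z * N z" .
          have 2: "\<omega> c z = poly q z * N z"
            using form_eq_density[OF \<omega> c(1) a in1] q(2)[OF w] ZW w by simp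
          from trans[OF 1[symmetric] 2] show ?thesis unfolding mult_right_cancel[OF N] .
        qed
        hence "UNIV \<subseteq> {z. poly P z = 0} \<union> {z. poly (q' - q) z = 0}" by auto
        moreover have "finite ({z. poly P z = 0} \<union> {z. poly (q' - q) z = 0})"
          using P_nonzero ne poly_roots_finite[of P] poly_roots_finite[of "q' - q"] by simp
        ultimately show False using infinite_UNIV_char_0 finite_subset by blast
      qed
      ultimately show "k = coeff q" by (metis ext)
    qed
  qed
  thus ?thesis
    unfolding has_genus_def using hB
    by (intro exI[of _ B]) (simp add: holomorphic_form_def)
qed

end

section \<open>Scherk ends\<close>

lemma valid_path_if_eq_smooth:
  assumes eq: "\<And>t. t \<in> {0..1} \<Longrightarrow> \<gamma> t = g t"
    and g: "\<And>t. (g has_vector_derivative g' t) (at t)" and g': "continuous_on UNIV g'"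
  shows "valid_path \<gamma>"
  unfolding valid_path_def piecewise_C1_differentiable_on_def C1_differentiable_on_def
proof (intro conjI exI[of _ "{0, 1}"] exI[of _ g'] ballI)
  have "continuous_on {0..1} g"
    using g has_vector_derivative_continuous continuous_at_imp_continuous_on by blast
  thus "continuous_on {0..1} \<gamma>" by (rule continuous_on_eq) (simp add: eq)
  fix t :: real assume "t \<in> {0..1} - {0, 1}"
  hence t: "t \<in> {0<..<1}" by auto
  show "(\<gamma> has_vector_derivative g' t) (at t)"
    by (rule has_vector_derivative_transform_within_open[OF g open_greaterThanLessThan t]) (use eq in auto)
qed (use g' continuous_on_subset in auto)

lemma simple_pole_principal_part:
  assumes F: "\<And>\<zeta>. \<zeta> \<in> ball 0 \<rho> - {0} \<Longrightarrow> F \<zeta> = C / \<zeta> + h \<zeta>"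
    and h: "h holomorphic_on ball 0 \<rho>" and \<rho>: "\<rho> > 0"
  shows "residue F 0 = C" "C \<noteq> 0 \<Longrightarrow> is_pole F 0" "is_pole F 0 \<Longrightarrow> zorder F 0 = -1"
proof -
  define f where "f = (\<lambda>\<zeta>. C + \<zeta> * h \<zeta>)"
  have f: "f holomorphic_on ball 0 \<rho>" unfolding f_def using h by (intro holomorphic_intros)
  have f0: "f 0 = C" by (simp add: f_def)
  have eq: "F \<zeta> = f \<zeta> / \<zeta>" if "\<zeta> \<in> ball 0 \<rho> - {0}" for \<zeta>
    using F[OF that] that by (simp add: f_def field_simps)
  have ev: "\<forall>\<^sub>F \<zeta> in at 0. \<zeta> \<in> ball 0 \<rho> - {0}" using \<rho> by (intro eventually_at_in_open) auto
  have evf: "\<forall>\<^sub>F \<zeta> in at 0. F \<zeta> = f \<zeta> / (\<zeta> - 0) ^ 1" using ev by eventually_elim (simp add: eq)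
  show "residue F 0 = C"
    using residue_cong[OF evf refl] residue_simple[OF open_ball _ f, of 0] \<rho> by (simp add: f0)
  show "is_pole F 0" if "C \<noteq> 0"
    using is_pole_cong[OF evf refl] is_pole_basic[OF f open_ball, of 0 1] \<rho> that f0 by simp
  show "zorder F 0 = -1" if pole: "is_pole F 0"
  proof -
    have "C \<noteq> 0"
    proof
      assume C0: "C = 0"
      from ev have e: "\<forall>\<^sub>F \<zeta> in at 0. h \<zeta> = F \<zeta>" by eventually_elim (simp add: F C0)
      have "continuous_on (ball 0 \<rho>) h" using h by (rule holomorphic_on_imp_continuous_on)
      hence "h \<midarrow>0\<rightarrow> h 0"
        using continuous_on_eq_continuous_at[OF open_ball, of 0 \<rho> h] \<rho> by (simp add: isCont_def)
      from Lim_transform_eventually[OF this e] have "F \<midarrow>0\<rightarrow> h 0" .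
      thus False using pole not_tendsto_and_filterlim_at_infinity[of "at 0" F "h 0"] by (auto simp: is_pole_def)
    qed
    thus ?thesis using \<rho> f0 eq
      by (intro zorder_eqI[OF open_ball _ f, of 0]) (auto simp: power_int_minus field_simps)
  qed
qed

text \<open>The path is a straight segment in the logarithmic coordinate. There the polar term
  integrates linearly, and the imaginary part of \<open>L1 - L0\<close> carries the winding.\<close>

lemma exp_spiral_integral:
  fixes L0 L1 :: complex
  assumes \<eta>: "\<And>t. t \<in> {0..1} \<Longrightarrow> \<eta> t = exp (L0 + of_real t * (L1 - L0))"
    and in_ball: "\<And>t. t \<in> {0..1} \<Longrightarrow> \<eta> t \<in> ball 0 \<rho>"
    and F: "\<And>\<zeta>. \<zeta> \<in> ball 0 \<rho> - {0} \<Longrightarrow> F \<zeta> = C / \<zeta> + h \<zeta>"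
    and H: "\<And>\<zeta>. \<zeta> \<in> ball 0 \<rho> \<Longrightarrow> (H has_field_derivative h \<zeta>) (at \<zeta>)"
  shows "valid_path \<eta>" "(F has_contour_integral (C * (L1 - L0) + (H (exp L1) - H (exp L0)))) \<eta>"
proof -
  define g where "g = (\<lambda>t. exp (L0 + complex_of_real t * (L1 - L0)))"
  have dg: "(g has_vector_derivative (L1 - L0) * g t) (at t)" for t
    unfolding g_def
    by (rule has_vector_derivative_real_field) (auto intro!: derivative_eq_intros)
  show "valid_path \<eta>"
    by (rule valid_path_if_eq_smooth[OF _ dg]) (auto simp: \<eta> g_def intro!: continuous_intros)
  define K where "K = (\<lambda>t. C * (of_real t * (L1 - L0)) + H (g t))"
  have dK: "(K has_vector_derivative F (\<eta> t) * vector_derivative \<eta> (at t within {0..1})) (at t within {0..1})"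
    if t: "t \<in> {0..1}" for t
  proof -
    have eq: "\<eta> t = g t" if "t \<in> {0..1}" for t using \<eta>[OF that] by (simp add: g_def)
    have "(\<eta> has_vector_derivative (L1 - L0) * g t) (at t within {0..1})"
      by (rule has_vector_derivative_transform[OF t _ has_vector_derivative_at_within[OF dg]]) (simp add: eq)
    hence vd: "vector_derivative \<eta> (at t within {0..1}) = (L1 - L0) * g t"
      using t by (intro vector_derivative_within_cbox[of 0 1, unfolded cbox_interval]) auto
    have gt: "g t \<in> ball 0 \<rho> - {0}" using in_ball[OF t] eq[OF t] by (simp add: g_def)
    have "((\<lambda>t. H (g t)) has_vector_derivative (L1 - L0) * g t * h (g t)) (at t within {0..1})"
      using field_vector_diff_chain_within[OF has_vector_derivative_at_within[OF dg], of H "h (g t)" t "{0..1}"]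
        H[of "g t"] gt by (auto simp: o_def intro: has_field_derivative_at_within)
    moreover have "((\<lambda>t. C * (of_real t * (L1 - L0))) has_vector_derivative C * (L1 - L0)) (at t within {0..1})"
      by (auto intro!: derivative_eq_intros)
    ultimately have "(K has_vector_derivative C * (L1 - L0) + (L1 - L0) * g t * h (g t)) (at t within {0..1})"
      unfolding K_def by (intro has_vector_derivative_add)
    moreover have "C * (L1 - L0) + (L1 - L0) * g t * h (g t) = F (\<eta> t) * ((L1 - L0) * g t)"
      using F[OF gt] gt eq[OF t] by (simp add: field_simps)
    ultimately show ?thesis by (simp add: vd)
  qed
  have "((\<lambda>t. F (\<eta> t) * vector_derivative \<eta> (at t within {0..1})) has_integral K 1 - K 0) {0..1}"
    using fundamental_theorem_of_calculus[OF zero_le_one dK] by blast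
  moreover have "K 1 - K 0 = C * (L1 - L0) + (H (exp L1) - H (exp L0))"
    by (simp add: K_def g_def)
  ultimately show "(F has_contour_integral (C * (L1 - L0) + (H (exp L1) - H (exp L0)))) \<eta>"
    by (simp add: has_contour_integral_def)
qed

context hyperelliptic
begin

text \<open>The residue is real, so the real part of C log \<zeta> + H is single-valued; its
  exponential |\<zeta>|^C exp(Re H) is the multiplier.\<close>

lemma multiplier_principal_part:
  fixes C :: real
  assumes \<omega>: "meromorphic_form A \<omega>" "form_holomorphic_on A \<omega> S" and S: "openin X S"
    and c: "c \<in> A" and D: "D \<subseteq> fst c \<inter> S" "snd c ` D \<subseteq> ball 0 \<rho> - {0}"
    and F: "\<And>\<zeta>. \<zeta> \<in> ball 0 \<rho> - {0} \<Longrightarrow> \<omega> c \<zeta> = of_real C / \<zeta> + h \<zeta>"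
    and H: "\<And>\<zeta>. \<zeta> \<in> ball 0 \<rho> \<Longrightarrow> (H has_field_derivative h \<zeta>) (at \<zeta>)"
  shows "has_multiplier A \<omega> D (\<lambda>x. of_real (Re x)) (\<lambda>q. of_real (norm (snd c q) powr C * exp (Re (H (snd c q)))))"
  unfolding has_multiplier_def
proof (intro ballI)
  fix d p assume d: "d \<in> A" and p: "p \<in> fst d \<inter> D"
  define \<tau> where "\<tau> = transition d c"
  define O' where "O' = snd d ` (fst d \<inter> fst c \<inter> S)"
  define \<eta> where "\<eta> = snd c p"
  have \<eta>: "\<eta> \<in> ball 0 \<rho>" "\<eta> \<noteq> 0" using D p by (auto simp: \<eta>_def)
  have "hyp_open P (fst d \<inter> fst c \<inter> S)"
    using hyp_open_chart[OF c] hyp_open_chart[OF d] S by (simp add: openin_Int flip: openin_hyp_top)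
  from open_chart_image[OF chart_restrict[OF d this]] have O': "open O'" "snd d p \<in> O'"
    using p D by (auto simp: chart_image_def O'_def)
  have \<tau>: "\<tau> holomorphic_on O'"
    unfolding \<tau>_def O'_def by (rule holomorphic_on_subset[OF transition_holomorphic[OF d c]]) auto
  have \<tau>q: "\<tau> (snd d q) = snd c q" if "q \<in> fst d" for q
    using chart_inv_chart[OF d that] by (simp add: \<tau>_def transition_def)
  have "open (O' \<inter> \<tau> -` (ball \<eta> (norm \<eta>) \<inter> ball 0 \<rho>))"
    using \<tau> O' by (intro continuous_open_preimage holomorphic_on_imp_continuous_on) auto
  moreover have "snd d p \<in> O' \<inter> \<tau> -` (ball \<eta> (norm \<eta>) \<inter> ball 0 \<rho>)"
    using O' \<eta> \<tau>q[of p] p by (auto simp: \<eta>_def)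
  ultimately obtain r where r: "r > 0" "ball (snd d p) r \<subseteq> O' \<inter> \<tau> -` (ball \<eta> (norm \<eta>) \<inter> ball 0 \<rho>)"
    using open_contains_ball by blast
  \<comment> \<open>The logarithm is taken of the quotient by \<eta>, which is near 1, so the
    principal branch is holomorphic on the whole disc.\<close>
  define G where "G = (\<lambda>\<zeta>. of_real C * Ln (\<tau> \<zeta> / \<eta>) + H (\<tau> \<zeta>))"
  have near: "\<tau> \<zeta> \<in> ball 0 \<rho>" "\<tau> \<zeta> \<noteq> 0" "\<tau> \<zeta> / \<eta> \<notin> \<real>\<^sub>\<le>\<^sub>0" if "\<zeta> \<in> ball (snd d p) r" for \<zeta>
  proof -
    have *: "\<tau> \<zeta> \<in> ball \<eta> (norm \<eta>)" "\<tau> \<zeta> \<in> ball 0 \<rho>" using r(2) that by auto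
    hence "norm ((\<eta> - \<tau> \<zeta>) / \<eta>) < 1" using \<eta> by (simp add: norm_divide dist_norm)
    hence "norm (1 - \<tau> \<zeta> / \<eta>) < 1" using \<eta> by (simp add: diff_divide_distrib)
    hence "Re (\<tau> \<zeta> / \<eta>) > 0" using abs_Re_le_cmod[of "1 - \<tau> \<zeta> / \<eta>"] by simp
    thus "\<tau> \<zeta> / \<eta> \<notin> \<real>\<^sub>\<le>\<^sub>0" "\<tau> \<zeta> \<noteq> 0" "\<tau> \<zeta> \<in> ball 0 \<rho>"
      using * complex_nonpos_Reals_iff by force+
  qed
  show "\<exists>r>0. \<exists>G. (\<forall>\<zeta>\<in>ball (snd d p) r. (G has_field_derivative \<omega> d \<zeta>) (at \<zeta>)) \<and>
      (\<forall>q\<in>fst d \<inter> D. snd d q \<in> ball (snd d p) r \<longrightarrow>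
         complex_of_real (norm (snd c q) powr C * exp (Re (H (snd c q)))) =
         of_real (norm (snd c p) powr C * exp (Re (H (snd c p)))) * exp (of_real (Re (G (snd d q) - G (snd d p)))))"
  proof (rule exI[of _ r], intro conjI exI[of _ G] ballI impI)
    fix \<zeta> assume \<zeta>: "\<zeta> \<in> ball (snd d p) r"
    then obtain q where q: "q \<in> fst d" "q \<in> fst c" "q \<in> S" "\<zeta> = snd d q" using r(2) by (auto simp: O'_def)
    have d\<tau>: "(\<tau> has_field_derivative deriv \<tau> \<zeta>) (at \<zeta>)"
      using \<tau> O'(1) r(2) \<zeta> holomorphic_derivI by blast
    note nr = near[OF \<zeta>]
    have "((\<lambda>\<zeta>. H (\<tau> \<zeta>)) has_field_derivative h (\<tau> \<zeta>) * deriv \<tau> \<zeta>) (at \<zeta>)"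
      using DERIV_chain2[OF H[OF nr(1)] d\<tau>] .
    hence "(G has_field_derivative of_real C * (deriv \<tau> \<zeta> / \<eta> / (\<tau> \<zeta> / \<eta>)) + h (\<tau> \<zeta>) * deriv \<tau> \<zeta>) (at \<zeta>)"
      unfolding G_def using nr d\<tau> \<eta>
      by (auto intro!: derivative_eq_intros simp: field_simps)
    moreover have "of_real C * (deriv \<tau> \<zeta> / \<eta> / (\<tau> \<zeta> / \<eta>)) + h (\<tau> \<zeta>) * deriv \<tau> \<zeta> = \<omega> c (\<tau> \<zeta>) * deriv \<tau> \<zeta>"
      by (subst F[of "\<tau> \<zeta>"]) (use nr \<eta> in \<open>auto simp: field_simps\<close>)
    moreover have "\<omega> d \<zeta> = \<omega> c (\<tau> \<zeta>) * deriv \<tau> \<zeta>"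
      using form_transition[OF \<omega> S d c q(1,2,3)] \<tau>q[OF q(1)] by (simp add: q(4) \<tau>_def)
    ultimately show "(G has_field_derivative \<omega> d \<zeta>) (at \<zeta>)" by simp
  next
    fix q assume q: "q \<in> fst d \<inter> D" "snd d q \<in> ball (snd d p) r"
    define \<xi> where "\<xi> = snd c q"
    have \<xi>0: "\<xi> \<noteq> 0" using near(2)[OF q(2)] \<tau>q[of q] q by (simp add: \<xi>_def)
    have "Re (G (snd d q) - G (snd d p)) = C * ln (norm \<xi> / norm \<eta>) + (Re (H \<xi>) - Re (H \<eta>))"
      using \<tau>q[of q] \<tau>q[of p] p q \<eta>(2) \<xi>0 by (simp add: G_def \<xi>_def[symmetric] \<eta>_def[symmetric] norm_divide)
    moreover have "norm \<xi> powr C = norm \<eta> powr C * exp (C * ln (norm \<xi> / norm \<eta>))"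
      using \<eta>(2) \<xi>0 by (simp add: powr_def ln_div exp_diff algebra_simps)
    moreover have "exp (Re (H \<xi>)) = exp (Re (H \<eta>)) * exp (Re (H \<xi>) - Re (H \<eta>))"
      by (simp flip: exp_add)
    ultimately have "norm \<xi> powr C * exp (Re (H \<xi>)) =
        norm \<eta> powr C * exp (Re (H \<eta>)) * exp (Re (G (snd d q) - G (snd d p)))"
      by (simp add: exp_add)
    thus "complex_of_real (norm (snd c q) powr C * exp (Re (H (snd c q)))) =
         of_real (norm (snd c p) powr C * exp (Re (H (snd c p)))) * exp (of_real (Re (G (snd d q) - G (snd d p))))"
      unfolding \<xi>_def[symmetric] \<eta>_def[symmetric] exp_of_real by simp
  qed (use r in auto)
qed

text \<open>The logarithm of the multiplier identity. This makes coordinates with real or zero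
  residue independent of the path from the base point.\<close>

lemma Re_integral_principal_part:
  fixes C :: real
  assumes \<omega>: "meromorphic_form A \<omega>" "form_holomorphic_on A \<omega> S" and S: "openin X S"
    and c: "c \<in> A" and D: "D \<subseteq> fst c \<inter> S" "snd c ` D \<subseteq> ball 0 \<rho> - {0}"
    and F: "\<And>\<zeta>. \<zeta> \<in> ball 0 \<rho> - {0} \<Longrightarrow> \<omega> c \<zeta> = of_real C / \<zeta> + h \<zeta>"
    and H: "\<And>\<zeta>. \<zeta> \<in> ball 0 \<rho> \<Longrightarrow> (H has_field_derivative h \<zeta>) (at \<zeta>)"
    and \<gamma>: "has_form_integral A \<omega> \<gamma> I" "\<gamma> ` {0..1} \<subseteq> D"
  shows "Re I = C * (ln (norm (snd c (\<gamma> 1))) - ln (norm (snd c (\<gamma> 0)))) +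
    Re (H (snd c (\<gamma> 1)) - H (snd c (\<gamma> 0)))"
proof -
  let ?\<xi> = "snd c (\<gamma> 1)" and ?\<eta> = "snd c (\<gamma> 0)"
  have "\<gamma> 1 \<in> D" "\<gamma> 0 \<in> D" using \<gamma>(2) by auto
  hence nz: "?\<xi> \<noteq> 0" "?\<eta> \<noteq> 0" using D(2) by blast+
  have "complex_of_real (norm ?\<xi> powr C * exp (Re (H ?\<xi>))) =
      of_real (norm ?\<eta> powr C * exp (Re (H ?\<eta>))) * exp (of_real (Re I))"
    by (rule multiplier_along_path[OF multiplier_principal_part[OF assms(1-8)] _ \<gamma>]) auto
  hence "complex_of_real (norm ?\<xi> powr C * exp (Re (H ?\<xi>))) =
      of_real (norm ?\<eta> powr C * exp (Re (H ?\<eta>)) * exp (Re I))"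
    by (simp add: exp_of_real)
  hence "norm ?\<xi> powr C * exp (Re (H ?\<xi>)) = norm ?\<eta> powr C * exp (Re (H ?\<eta>)) * exp (Re I)"
    using of_real_eq_iff by blast
  hence "ln (exp (C * ln (norm ?\<xi>) + Re (H ?\<xi>))) = ln (exp (C * ln (norm ?\<eta>) + Re (H ?\<eta>) + Re I))"
    using nz by (simp add: powr_def exp_add)
  thus ?thesis by (simp add: algebra_simps)
qed

end

text \<open>Three components of size \<epsilon>/4 add up to less than \<epsilon>.\<close>

lemma dist_less_if_components:
  fixes x y :: "real^3"
  assumes "\<And>k. \<bar>x $ k - y $ k\<bar> \<le> \<epsilon> / 4" "\<epsilon> > 0"
  shows "dist x y < \<epsilon>"
proof -
  have "dist x y \<le> (\<Sum>k\<in>UNIV. \<bar>(x - y) $ k\<bar>)" unfolding dist_norm by (rule norm_le_l1_cart)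
  also have "\<dots> \<le> of_nat (card (UNIV :: 3 set)) * (\<epsilon> / 4)"
    by (rule sum_bounded_above) (use assms in simp)
  also have "\<dots> < \<epsilon>" using assms(2) by simp
  finally show ?thesis .
qed

text \<open>Up to functions continuous at the puncture, the third coordinate is -\<sigma> log
  |\<zeta>|, coordinate \<open>j\<close> is -\<kappa> arg \<zeta> on the universal cover, and the
  remaining one tends to a constant. So the surface approaches a half-plane, and winding around the
  puncture reaches every part of it.\<close>

lemma (in hyperelliptic) scherk_endI:
  fixes \<omega> :: "3 \<Rightarrow> hpoint form" and \<sigma> \<kappa> :: real and C :: "3 \<Rightarrow> complex" and j :: 3
  assumes \<omega>: "\<And>k. meromorphic_form A (\<omega> k)" "\<And>k. form_holomorphic_on A (\<omega> k) S" and S: "openin X S"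
    and c: "c \<in> A" "p \<in> fst c" "snd c p = 0" and \<rho>: "\<rho> > 0" "ball 0 \<rho> \<subseteq> chart_image c"
    and D_S: "\<And>q. q \<in> fst c \<Longrightarrow> snd c q \<in> ball 0 \<rho> \<Longrightarrow> q \<noteq> p \<Longrightarrow> q \<in> S"
    and F: "\<And>k \<zeta>. \<zeta> \<in> ball 0 \<rho> - {0} \<Longrightarrow> \<omega> k c \<zeta> = C k / \<zeta> + h k \<zeta>"
    and H: "\<And>k \<zeta>. \<zeta> \<in> ball 0 \<rho> \<Longrightarrow> (H k has_field_derivative h k \<zeta>) (at \<zeta>)"
    and \<sigma>: "\<sigma> = 1 \<or> \<sigma> = -1" and C3: "C 3 = - of_real \<sigma>"
    and j: "j \<noteq> 3" "C j = \<i> * of_real \<kappa>" "\<kappa> \<noteq> 0" and C0: "\<And>k. k \<noteq> 3 \<Longrightarrow> k \<noteq> j \<Longrightarrow> C k = 0"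
  shows "scherk_end A \<omega> p \<sigma> (\<chi> k. if k = j then - 2 * pi * \<kappa> else 0)"
proof -
  define T :: "real^3" where "T = (\<chi> k. if k = j then - 2 * pi * \<kappa> else 0)"
  define D where "D = {q \<in> fst c. q \<noteq> p \<and> snd c q \<in> ball (snd c p) \<rho>}"
  define \<eta>0 where "\<eta>0 = complex_of_real (\<rho> / 2)"
  define q0 where "q0 = chart_inv c \<eta>0"
  define L0 where "L0 = complex_of_real (ln (\<rho> / 2))"
  \<comment> \<open>The limit of the bounded parts relative to the base point \<open>q0\<close>; the
    logarithm of |\<eta>0| = \<rho>/2 is absorbed into the third component. With this choice the
    height above the edge of the half-plane corresponds to - ln |\<zeta>|.\<close>
  define v :: "real^3" where "v = (\<chi> k. Re (H k 0 - H k \<eta>0) + (if k = 3 then \<sigma> * ln (\<rho> / 2) else 0))"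
  define f where "f = real_integrals A \<omega> D q0"
  have h: "h k holomorphic_on ball 0 \<rho>" for k
  proof -
    have "H k holomorphic_on ball 0 \<rho>" using H by (intro holomorphic_onI) (auto simp: field_differentiable_def intro: has_field_derivative_at_within)
    hence "deriv (H k) holomorphic_on ball 0 \<rho>" by (intro holomorphic_deriv) auto
    thus ?thesis by (rule holomorphic_transform) (use H DERIV_imp_deriv in blast)
  qed
  have chart: "chart_inv c \<zeta> \<in> fst c \<and> snd c (chart_inv c \<zeta>) = \<zeta>" if "\<zeta> \<in> ball 0 \<rho>" for \<zeta>
  proof -
    have "\<zeta> \<in> snd c ` fst c" using \<rho>(2) that unfolding chart_image_def by blast
    then obtain q where "q \<in> fst c" "\<zeta> = snd c q" by blast
    thus ?thesis using chart_inv_chart[OF c(1)] by simp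
  qed
  have in_D: "chart_inv c \<zeta> \<in> D" if "\<zeta> \<in> ball 0 \<rho> - {0}" for \<zeta>
    using chart[of \<zeta>] that c by (auto simp: D_def)
  have "q = p" if "q \<in> fst c" "snd c q = 0" for q
    using chart_inv_chart[OF c(1)] that c(2,3) by metis
  hence D: "D \<subseteq> fst c \<inter> S" "snd c ` D \<subseteq> ball 0 \<rho> - {0}"
    using D_S c(3) by (auto simp: D_def)
  have \<eta>0: "\<eta>0 \<in> ball 0 \<rho> - {0}" "norm \<eta>0 = \<rho> / 2" "exp L0 = \<eta>0"
    using \<rho> by (auto simp: \<eta>0_def L0_def exp_of_real norm_divide)
  have q0: "q0 \<in> D" "snd c q0 = \<eta>0" using in_D chart \<eta>0 by (auto simp: q0_def)
  have poles: "residue (\<omega> k c) 0 = C k" "C k \<noteq> 0 \<Longrightarrow> is_pole (\<omega> k c) 0"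
    "is_pole (\<omega> k c) 0 \<Longrightarrow> zorder (\<omega> k c) 0 = -1" for k
    using simple_pole_principal_part[OF F h \<rho>(1)] by blast+
  have C3nz: "C 3 \<noteq> 0" using C3 \<sigma> by auto
  have Tk: "T $ k = (if k = j then - 2 * pi * \<kappa> else 0)" for k by (simp add: T_def)
  have T: "T = (\<chi> k. Re (2 * pi * \<i> * residue (\<omega> k c) (snd c p)))"
  proof -
    have "Re (2 * pi * \<i> * C k) = (if k = j then - 2 * pi * \<kappa> else 0)" for k
      using C3 C0[of k] j by (cases "k = 3"; cases "k = j") auto
    thus ?thesis by (simp add: T_def c(3) poles(1) vec_eq_iff)
  qed
  have contH: "\<exists>\<delta>>0. \<forall>\<xi>. norm \<xi> < \<delta> \<longrightarrow> (\<forall>k. norm (H k \<xi> - H k 0) < \<epsilon>)" if "\<epsilon> > 0" for \<epsilon>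
  proof -
    have "isCont (H k) 0" for k using H[of 0 k] \<rho>(1) DERIV_isCont by auto
    hence "(H k \<longlongrightarrow> H k 0) (nhds 0)" for k by (simp add: continuous_at tendsto_nhds_iff isCont_def)
    hence "\<forall>\<^sub>F \<xi> in nhds 0. dist (H k \<xi>) (H k 0) < \<epsilon>" for k using that tendstoD by blast
    hence "\<forall>\<^sub>F \<xi> in nhds 0. \<forall>k. dist (H k \<xi>) (H k 0) < \<epsilon>" by (rule eventually_all_finite)
    thus ?thesis unfolding eventually_nhds_metric by (auto simp: dist_norm)
  qed
  \<comment> \<open>Coordinate \<open>j\<close> is left out, as its value depends on how often the
    path winds around the puncture.\<close>
  have fq: "x $ 3 = - \<sigma> * (ln (norm (snd c q)) - ln (\<rho> / 2)) + Re (H 3 (snd c q) - H 3 \<eta>0)"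
      "\<And>k. k \<noteq> 3 \<Longrightarrow> k \<noteq> j \<Longrightarrow> x $ k = Re (H k (snd c q) - H k \<eta>0)" if x: "x \<in> f q" for x :: "real^3" and q
  proof -
    obtain I \<gamma> where I: "x = (\<chi> k. Re (I k))" "\<gamma> ` {0..1} \<subseteq> D" "\<gamma> 0 = q0" "\<gamma> 1 = q"
        "\<And>k. has_form_integral A (\<omega> k) \<gamma> (I k)"
      using x unfolding f_def real_integrals_def by blast
    have *: "Re (I k) = C' * (ln (norm (snd c (\<gamma> 1))) - ln (norm (snd c (\<gamma> 0)))) +
        Re (H k (snd c (\<gamma> 1)) - H k (snd c (\<gamma> 0)))" if "C k = of_real C'" for k C'
      by (rule Re_integral_principal_part[OF \<omega> S c(1) D _ H I(5,2)]) (use F that in auto)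
    show "x $ 3 = - \<sigma> * (ln (norm (snd c q)) - ln (\<rho> / 2)) + Re (H 3 (snd c q) - H 3 \<eta>0)"
      using *[of 3 "- \<sigma>"] C3 I q0 \<eta>0 by simp
    show "x $ k = Re (H k (snd c q) - H k \<eta>0)" if "k \<noteq> 3" "k \<noteq> j" for k
      using *[of k 0] C0[OF that] I q0 \<eta>0 by simp
  qed
  have \<sigma>2: "\<sigma> * \<sigma> = 1" and \<sigma>1: "\<bar>\<sigma>\<bar> = 1" using \<sigma> by auto
  have c1: "\<exists>\<delta>>0. \<forall>q\<in>D. snd c q \<in> ball (snd c p) \<delta> \<longrightarrow> (\<forall>x\<in>f q. \<sigma> * x $ 3 > M)" for M
  proof -
    obtain \<delta> where \<delta>: "\<delta> > 0" "\<And>\<xi> k. norm \<xi> < \<delta> \<Longrightarrow> norm (H k \<xi> - H k 0) < 1"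
      using contH[of 1] by auto
    define B where "B = norm (H 3 0 - H 3 \<eta>0)"
    define \<delta>' where "\<delta>' = min \<delta> (exp (ln (\<rho> / 2) - B - 1 - M))"
    have "\<sigma> * x $ 3 > M" if q: "q \<in> D" "snd c q \<in> ball (snd c p) \<delta>'" and x: "x \<in> f q" for q and x :: "real^3"
    proof -
      define \<xi> where "\<xi> = snd c q"
      have \<xi>: "norm \<xi> < \<delta>" "norm \<xi> < exp (ln (\<rho> / 2) - B - 1 - M)" "\<xi> \<noteq> 0"
        using q D c(3) by (auto simp: \<xi>_def \<delta>'_def)
      hence "ln (norm \<xi>) < ln (exp (ln (\<rho> / 2) - B - 1 - M))" by (subst ln_less_cancel_iff) auto
      hence l: "ln (norm \<xi>) < ln (\<rho> / 2) - B - 1 - M" by simp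
      have "\<bar>\<sigma> * Re (H 3 \<xi> - H 3 \<eta>0)\<bar> \<le> norm (H 3 \<xi> - H 3 \<eta>0)"
        using abs_Re_le_cmod[of "H 3 \<xi> - H 3 \<eta>0"] by (simp add: abs_mult \<sigma>1)
      also have "\<dots> \<le> norm (H 3 \<xi> - H 3 0) + B"
        unfolding B_def by (rule order_trans[OF _ norm_triangle_ineq]) simp
      also have "\<dots> < 1 + B" using \<delta>(2)[OF \<xi>(1), of 3] by simp
      finally have "\<sigma> * Re (H 3 \<xi> - H 3 \<eta>0) > - 1 - B" by linarith
      moreover have "\<sigma> * x $ 3 = - (\<sigma> * \<sigma>) * (ln (norm \<xi>) - ln (\<rho> / 2)) + \<sigma> * Re (H 3 \<xi> - H 3 \<eta>0)"
        unfolding fq(1)[OF x] \<xi>_def by (simp add: algebra_simps)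
      ultimately show ?thesis using l \<sigma>2 by simp
    qed
    thus ?thesis using \<delta>(1) by (intro exI[of _ \<delta>']) (auto simp: \<delta>'_def)
  qed
  have c2: "\<exists>\<delta>>0. \<forall>q\<in>D. snd c q \<in> ball (snd c p) \<delta> \<longrightarrow> (\<forall>x\<in>f q. \<exists>y\<in>vertical_half_plane v T \<sigma>. dist x y < \<epsilon>)"
    if \<epsilon>: "\<epsilon> > 0" for \<epsilon>
  proof -
    obtain \<delta>1 where \<delta>1: "\<delta>1 > 0" "\<And>q (x :: real^3). q \<in> D \<Longrightarrow> snd c q \<in> ball (snd c p) \<delta>1 \<Longrightarrow> x \<in> f q \<Longrightarrow> \<sigma> * x $ 3 > \<sigma> * v $ 3"
      using c1 by metis
    obtain \<delta>2 where \<delta>2: "\<delta>2 > 0" "\<And>\<xi> k. norm \<xi> < \<delta>2 \<Longrightarrow> norm (H k \<xi> - H k 0) < \<epsilon> / 4"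
      using contH[of "\<epsilon> / 4"] \<epsilon> by auto
    have "\<exists>y\<in>vertical_half_plane v T \<sigma>. dist x y < \<epsilon>"
      if q: "q \<in> D" "snd c q \<in> ball (snd c p) (min \<delta>1 \<delta>2)" and x: "x \<in> f q" for q and x :: "real^3"
    proof -
      \<comment> \<open>The nearby point of the half-plane is given the same coordinates
        \<open>j\<close> and 3 as x, so only the remaining coordinate has to be estimated.\<close>
      define s where "s = (x $ j - v $ j) / T $ j"
      define t where "t = \<sigma> * (x $ 3 - v $ 3)"
      define y where "y = v + s *\<^sub>R T + (\<sigma> * t) *\<^sub>R axis 3 1"
      have "t \<ge> 0" using \<delta>1(2)[OF q(1) _ x] q(2) by (simp add: t_def algebra_simps)
      hence "y \<in> vertical_half_plane v T \<sigma>" by (auto simp: vertical_half_plane_def y_def)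
      moreover have "\<bar>x $ k - y $ k\<bar> \<le> \<epsilon> / 4" for k
      proof -
        consider "k = j" | "k = 3" | "k \<noteq> j" "k \<noteq> 3" by blast
        thus ?thesis
        proof cases
          case 1
          have "y $ k = v $ j + s * T $ j" using j(1) by (simp add: y_def 1 axis_def)
          also have "\<dots> = x $ j" using j(3) by (simp add: s_def Tk)
          finally show ?thesis using 1 \<epsilon> by simp
        next
          case 2
          have "y $ k = v $ 3 + (\<sigma> * \<sigma>) * (x $ 3 - v $ 3)" using j(1) by (simp add: y_def 2 axis_def Tk t_def)
          thus ?thesis using 2 \<epsilon> by (simp add: \<sigma>2)
        next
          case 3
          have "y $ k = Re (H k 0 - H k \<eta>0)" using 3 by (simp add: y_def axis_def Tk v_def)
          hence "\<bar>x $ k - y $ k\<bar> = \<bar>Re (H k (snd c q) - H k 0)\<bar>" using fq(2)[OF x 3(2,1)] by simp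
          also have "\<dots> \<le> \<epsilon> / 4"
            using \<delta>2(2)[of "snd c q" k] abs_Re_le_cmod[of "H k (snd c q) - H k 0"] q(2) c(3) by (simp del: minus_complex.simps)
          finally show ?thesis .
        qed
      qed
      ultimately show ?thesis using dist_less_if_components \<epsilon> by blast
    qed
    thus ?thesis using \<delta>1(1) \<delta>2(1) by (intro exI[of _ "min \<delta>1 \<delta>2"]) auto
  qed
  have c3: "\<exists>M. \<forall>y\<in>vertical_half_plane v T \<sigma>. \<sigma> * y $ 3 > M \<longrightarrow> (\<exists>q\<in>D. \<exists>x\<in>f q. dist x y < \<epsilon>)"
    if \<epsilon>: "\<epsilon> > 0" for \<epsilon>
  proof -
    obtain \<delta> where \<delta>: "\<delta> > 0" "\<And>\<xi> k. norm \<xi> < \<delta> \<Longrightarrow> norm (H k \<xi> - H k 0) < \<epsilon> / 4"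
      using contH[of "\<epsilon> / 4"] \<epsilon> by auto
    define \<delta>' where "\<delta>' = min \<delta> \<rho>"
    have "\<exists>q\<in>D. \<exists>x\<in>f q. dist x y < \<epsilon>"
      if y: "y \<in> vertical_half_plane v T \<sigma>" and M: "\<sigma> * y $ 3 > \<sigma> * v $ 3 - ln \<delta>'" for y :: "real^3"
    proof -
      obtain s t where st: "y = v + s *\<^sub>R T + (\<sigma> * t) *\<^sub>R axis 3 1"
        using y by (auto simp: vertical_half_plane_def)
      have "\<sigma> * y $ 3 = \<sigma> * v $ 3 + (\<sigma> * \<sigma>) * t" using j(1) by (simp add: st axis_def Tk algebra_simps)
      hence "- t < ln \<delta>'" using M \<sigma>2 by simp
      hence "exp (- t) < exp (ln \<delta>')" by simp
      hence et: "exp (- t) < \<delta>" "exp (- t) < \<rho>" using \<delta>(1) \<rho>(1) by (auto simp: \<delta>'_def)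
      \<comment> \<open>The logarithm of the end point of the spiral: modulus exp(-t) produces the
        height t, and argument 2 \<pi> s produces the shift s T, since T has component - 2 \<pi>
        \<kappa>.\<close>
      define L1 where "L1 = Complex (- t) (2 * pi * s)"
      define \<gamma> where "\<gamma> = (\<lambda>u::real. chart_inv c (exp (L0 + of_real u * (L1 - L0))))"
      have nL1: "norm (exp L1) = exp (- t)" by (simp add: L1_def norm_exp_eq_Re)
      have inb: "exp (L0 + of_real u * (L1 - L0)) \<in> ball 0 \<rho> - {0}" if u: "u \<in> {0..1}" for u :: real
      proof -
        have "ln (\<rho> / 2) < ln \<rho>" using \<rho>(1) by simp
        moreover have "- t < ln \<rho>" using et(2) \<rho>(1) by (metis exp_less_cancel_iff exp_ln)
        ultimately have "(1 - u) * ln (\<rho> / 2) + u * (- t) < ln \<rho>"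
          using u by (intro convex_bound_lt) auto
        moreover have "Re (L0 + of_real u * (L1 - L0)) = (1 - u) * ln (\<rho> / 2) + u * (- t)"
          by (simp add: L0_def L1_def algebra_simps)
        ultimately have "exp (Re (L0 + of_real u * (L1 - L0))) < exp (ln \<rho>)" by (simp only: exp_less_cancel_iff)
        thus ?thesis using \<rho>(1) by (simp add: norm_exp_eq_Re)
      qed
      have \<gamma>D: "\<gamma> ` {0..1} \<subseteq> D" using in_D[OF inb] by (auto simp: \<gamma>_def)
      have c\<gamma>: "(snd c \<circ> \<gamma>) u = exp (L0 + of_real u * (L1 - L0))" if "u \<in> {0..1}" for u
        using chart inb[OF that] by (simp add: \<gamma>_def)
      have c\<gamma>b: "(snd c \<circ> \<gamma>) u \<in> ball 0 \<rho>" if "u \<in> {0..1}" for u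
        using inb[OF that] c\<gamma>[OF that] by simp
      define I where "I = (\<lambda>k. C k * (L1 - L0) + (H k (exp L1) - H k (exp L0)))"
      have vp: "valid_path (snd c \<circ> \<gamma>)" and ci: "(\<omega> k c has_contour_integral I k) (snd c \<circ> \<gamma>)" for k
        unfolding I_def by (rule exp_spiral_integral[OF c\<gamma> c\<gamma>b F H]; assumption)+
      have "has_form_integral A (\<omega> k) \<gamma> (I k)" for k
        unfolding has_form_integral_def
        by (rule exI[of _ 1], rule exI[of _ real], rule exI[of _ "\<lambda>_. c"], rule exI[of _ "\<lambda>_. I k"])
          (use vp ci[of k] \<gamma>D D(1) c(1) in auto)
      moreover have "\<gamma> 0 = q0" using \<eta>0(3) by (simp add: \<gamma>_def q0_def)
      ultimately have "(\<chi> k. Re (I k)) \<in> f (\<gamma> 1)"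
        using \<gamma>D unfolding f_def real_integrals_def by blast
      moreover have "\<bar>(\<chi> k. Re (I k)) $ k - y $ k\<bar> \<le> \<epsilon> / 4" for k
      proof -
        have "Re (C k * (L1 - L0)) = y $ k - Re (H k 0 - H k \<eta>0)"
        proof -
          consider "k = j" | "k = 3" | "k \<noteq> j" "k \<noteq> 3" by blast
          thus ?thesis
            using j C3 C0[of k] by cases (auto simp: st L0_def L1_def axis_def Tk v_def algebra_simps)
        qed
        hence "(\<chi> k. Re (I k)) $ k - y $ k = Re (H k (exp L1) - H k 0)"
          by (simp add: I_def \<eta>0(3))
        also have "\<bar>\<dots>\<bar> \<le> norm (H k (exp L1) - H k 0)" by (rule abs_Re_le_cmod)
        also have "\<dots> \<le> \<epsilon> / 4" using \<delta>(2)[of "exp L1" k] et(1) nL1 by simp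
        finally show ?thesis .
      qed
      hence "dist (\<chi> k. Re (I k)) y < \<epsilon>" using dist_less_if_components \<epsilon> by blast
      moreover have "\<gamma> 1 \<in> D" using \<gamma>D by auto
      ultimately show ?thesis by blast
    qed
    thus ?thesis by blast
  qed
  show ?thesis
    unfolding scherk_end_def T_def[symmetric]
  proof (rule bexI[OF _ c(1)], intro conjI)
    show "is_pole (\<omega> 3 c) (snd c p)" "zorder (\<omega> 3 c) (snd c p) = -1" "residue (\<omega> 3 c) (snd c p) \<in> \<real>"
      "\<forall>k\<in>{1, 2}. is_pole (\<omega> k c) (snd c p) \<longrightarrow> zorder (\<omega> k c) (snd c p) = -1"
      using poles C3nz C3 unfolding c(3) by auto
    have "T $ j \<noteq> 0" using j(3) by (simp add: Tk)
    thus "T \<noteq> 0" by auto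
    show "T $ 3 = 0" using j(1) by (simp add: Tk)
    show "\<exists>r>0. ball (snd c p) r \<subseteq> chart_image c \<and>
           (let D = {q \<in> fst c. q \<noteq> p \<and> snd c q \<in> ball (snd c p) r} in
            \<exists>q0\<in>D. \<exists>v.
              (let H = vertical_half_plane v T \<sigma>; f = real_integrals A \<omega> D q0 in
               (\<forall>M. \<exists>\<delta>>0. \<forall>q\<in>D. snd c q \<in> ball (snd c p) \<delta> \<longrightarrow> (\<forall>x\<in>f q. \<sigma> * x $ 3 > M)) \<and>
               (\<forall>\<epsilon>>0. \<exists>\<delta>>0. \<forall>q\<in>D. snd c q \<in> ball (snd c p) \<delta> \<longrightarrow> (\<forall>x\<in>f q. \<exists>h\<in>H. dist x h < \<epsilon>)) \<and>
               (\<forall>\<epsilon>>0. \<exists>M. \<forall>h\<in>H. \<sigma> * h $ 3 > M \<longrightarrow> (\<exists>q\<in>D. \<exists>x\<in>f q. dist x h < \<epsilon>))))"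
      unfolding Let_def
      using \<rho> c(3) c1 c2 c3 q0(1) unfolding D_def f_def
      by (intro exI[of _ \<rho>] conjI bexI[of _ q0] exI[of _ v]) auto
  qed (use c(2) T in auto)
qed

section \<open>Periods from primitives on sheets\<close>

lemma islimpt_closure_open:
  fixes z :: "'a::{perfect_space,t1_space}"
  assumes "open H" "z \<in> closure H" shows "z islimpt H"
  using assms by (cases "z \<in> H") (auto simp: closure_def interior_limit_point interior_open)

definition boundary_value :: "complex set \<Rightarrow> (complex \<Rightarrow> complex) \<Rightarrow> complex \<Rightarrow> complex"
  where "boundary_value H F z = Lim (at z within H) F"

lemma boundary_value_eqI:
  assumes "open H" "z \<in> closure H" "(F \<longlongrightarrow> l) (at z within H)"
  shows "boundary_value H F z = l"
  unfolding boundary_value_def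
  using assms islimpt_closure_open[OF assms(1,2)] by (intro tendsto_Lim) (simp_all add: trivial_limit_within)

lemma boundary_value_local:
  assumes H: "open H" "z \<in> closure H" and B: "open B" "z \<in> B"
    and K: "continuous_on (B \<inter> closure H) K" and eq: "\<And>x. x \<in> B \<inter> H \<Longrightarrow> F x = K x"
  shows "boundary_value H F z = K z" "(F \<longlongrightarrow> K z) (at z within H)"
proof -
  have "(K \<longlongrightarrow> K z) (at z within (B \<inter> closure H))"
    using K H B by (auto simp: continuous_on_def)
  hence "(K \<longlongrightarrow> K z) (at z within (B \<inter> H))"
    by (rule tendsto_within_subset) (use closure_subset[of H] in auto)
  moreover have "\<forall>\<^sub>F x in at z within (B \<inter> H). K x = F x"
    using eq by (auto simp: eventually_at_filter)
  ultimately have "(F \<longlongrightarrow> K z) (at z within (B \<inter> H))"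
    by (rule Lim_transform_eventually)
  moreover have "at z within (B \<inter> H) = at z within H"
    using at_within_nhd[OF B(2,1), of "B \<inter> H" H] by auto
  ultimately show "(F \<longlongrightarrow> K z) (at z within H)" by simp
  thus "boundary_value H F z = K z" by (rule boundary_value_eqI[OF H])
qed

context hyperelliptic
begin

text \<open>A branch of w over a closed convex region together with a primitive of \<rho> dz/w. The
  derivative of \<open>F\<close> is demanded only in the interior, because \<rho>/w may be infinite
  at branch points on the edge.\<close>

definition sheet :: "(complex \<Rightarrow> complex) \<Rightarrow> complex set \<times> (complex \<Rightarrow> complex) \<times> (complex \<Rightarrow> complex) \<Rightarrow> bool"
  where "sheet \<rho> s \<longleftrightarrow> (case s of (H, w, F) \<Rightarrow> open H \<and> convex H \<and> continuous_on (closure H) w \<and>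
    w holomorphic_on H \<and> (\<forall>z\<in>closure H. (w z)\<^sup>2 = poly P z) \<and> (\<forall>z\<in>H. w z \<noteq> 0) \<and>
    (\<forall>z\<in>H. (F has_field_derivative \<rho> z / w z) (at z)))"

text \<open>On the convex set ball \<inter> \<open>H\<close> the function \<open>F\<close> and the
  local primitive \<open>G\<close>, read in the coordinate of the chart, have the same derivative
  and differ by a constant. The coordinate is continuous up to the edge, even at a branch point, so
  boundary values obey the same formula.\<close>

lemma sheet_coordinate:
  assumes s: "sheet \<rho> (H, w, F)" and z0: "z0 \<in> closure H" and c: "c \<in> A"
    and a: "aff_param c (Aff z0 (w z0)) r Z W N"
    and G: "\<And>\<zeta>. \<zeta> \<in> ball (snd c (Aff z0 (w z0))) r \<Longrightarrow> (G has_field_derivative \<rho> (Z \<zeta>) * N \<zeta>) (at \<zeta>)"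
  shows "\<exists>\<delta>>0. \<exists>C. continuous_on (ball z0 \<delta> \<inter> closure H) (\<lambda>z. snd c (Aff z (w z))) \<and>
    (\<forall>z\<in>ball z0 \<delta> \<inter> closure H. Aff z (w z) \<in> fst c \<and>
      snd c (Aff z (w z)) \<in> ball (snd c (Aff z0 (w z0))) r \<and>
      boundary_value H F z = G (snd c (Aff z (w z))) + C)"
proof -
  define \<kappa> where "\<kappa> = (\<lambda>z. snd c (Aff z (w z)))"
  let ?p = "Aff z0 (w z0)"
  have H: "open H" "convex H" and wc: "continuous_on (closure H) w" and wh: "w holomorphic_on H"
    and sq: "\<And>z. z \<in> closure H \<Longrightarrow> (w z)\<^sup>2 = poly P z" and wnz: "\<And>z. z \<in> H \<Longrightarrow> w z \<noteq> 0"
    and F: "\<And>z. z \<in> H \<Longrightarrow> (F has_field_derivative \<rho> z / w z) (at z)"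
    using s by (auto simp: sheet_def)
  have sub: "H \<subseteq> closure H" by (rule closure_subset)
  have r: "r > 0" "Aff (Z (snd c ?p)) (W (snd c ?p)) = ?p" using a unfolding aff_param_def by blast+
  hence p: "?p \<in> fst c" using aff_paramD(2)[OF a, of "snd c ?p"] by simp
  have "openin (top_of_set (aff_curve P)) {x \<in> aff_curve P. case_prod Aff x \<in> fst c}"
    using hyp_open_chart[OF c] by (simp add: hyp_open_def)
  then obtain T where T: "open T" "{x \<in> aff_curve P. case_prod Aff x \<in> fst c} = aff_curve P \<inter> T"
    by (auto simp: openin_open)
  have j: "continuous_on (closure H) (\<lambda>z. (z, w z))" using wc by (intro continuous_intros)
  have in_T: "(z, w z) \<in> T \<longleftrightarrow> Aff z (w z) \<in> fst c" if "z \<in> closure H" for z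
  proof -
    have "(z, w z) \<in> aff_curve P" using sq[OF that] by (simp add: aff_curve_def)
    thus ?thesis using T(2) by (metis (mono_tags, lifting) IntI Int_iff case_prod_conv mem_Collect_eq)
  qed
  have "(z0, w z0) \<in> T" using in_T[OF z0] p by simp
  then obtain \<epsilon> where \<epsilon>: "\<epsilon> > 0" "ball (z0, w z0) \<epsilon> \<subseteq> T" using T(1) open_contains_ball by blast
  obtain \<delta>1 where \<delta>1: "\<delta>1 > 0" "\<And>z. z \<in> closure H \<Longrightarrow> dist z z0 < \<delta>1 \<Longrightarrow> dist (z, w z) (z0, w z0) < \<epsilon>"
    using j z0 \<epsilon>(1) unfolding continuous_on_iff by metis
  have U: "Aff z (w z) \<in> fst c" if "z \<in> ball z0 \<delta>1 \<inter> closure H" for z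
  proof -
    have "dist (z, w z) (z0, w z0) < \<epsilon>" using \<delta>1(2)[of z] that by (simp add: dist_commute)
    hence "(z, w z) \<in> T" using \<epsilon>(2) by (auto simp: dist_commute)
    thus ?thesis using in_T that by blast
  qed
  have \<kappa>: "continuous_on (ball z0 \<delta>1 \<inter> closure H) \<kappa> \<and> \<kappa> holomorphic_on (ball z0 \<delta>1 \<inter> H)"
  proof (rule chart_cases[OF c])
    assume "snd c = z_fun"
    thus ?thesis by (auto simp: \<kappa>_def intro!: continuous_intros holomorphic_intros)
  next
    assume "snd c = w_fun"
    thus ?thesis using wc wh by (auto simp: \<kappa>_def intro: continuous_on_subset holomorphic_on_subset)
  next
    assume c3: "snd c = u_fun" "fst c \<subseteq> {Aff z w |z w. z \<noteq> 0 \<and> w \<noteq> 0} \<union> range At_Inf"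
    have nz: "\<forall>z\<in>ball z0 \<delta>1 \<inter> closure H. z \<noteq> 0" using U c3(2) by blast
    hence "continuous_on (ball z0 \<delta>1 \<inter> closure H) (\<lambda>z. 1 / z)" by (intro continuous_intros)
    moreover have "(\<lambda>z. 1 / z) holomorphic_on (ball z0 \<delta>1 \<inter> H)"
      using nz sub by (intro holomorphic_intros) blast
    ultimately show ?thesis using c3(1) by (simp add: \<kappa>_def)
  qed
  have z0B: "z0 \<in> ball z0 \<delta>1 \<inter> closure H" using z0 \<delta>1 by simp
  obtain \<delta>2 where \<delta>2: "\<delta>2 > 0" "\<And>z. z \<in> ball z0 \<delta>1 \<inter> closure H \<Longrightarrow> dist z z0 < \<delta>2 \<Longrightarrow> dist (\<kappa> z) (\<kappa> z0) < r"
    using \<kappa> z0B a unfolding continuous_on_iff aff_param_def by metis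
  define \<delta> where "\<delta> = min \<delta>1 \<delta>2"
  let ?B = "ball z0 \<delta>"
  have B1: "?B \<inter> closure H \<subseteq> ball z0 \<delta>1 \<inter> closure H" "?B \<inter> H \<subseteq> ball z0 \<delta>1 \<inter> H" by (auto simp: \<delta>_def)
  have \<kappa>r: "\<kappa> z \<in> ball (snd c ?p) r" if "z \<in> ?B \<inter> closure H" for z
    using \<delta>2(2)[of z] that by (auto simp: \<delta>_def \<kappa>_def dist_commute)
  have ZW: "Z (\<kappa> z) = z" "W (\<kappa> z) = w z" if "z \<in> ?B \<inter> closure H" for z
  proof -
    have "chart_inv c (\<kappa> z) = Aff z (w z)"
      unfolding \<kappa>_def using chart_inv_chart[OF c U] B1 that by blast
    thus "Z (\<kappa> z) = z" "W (\<kappa> z) = w z" using aff_paramD(1)[OF a \<kappa>r[OF that]] by auto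
  qed
  have "((\<lambda>z. F z - G (\<kappa> z)) has_field_derivative 0) (at z within (?B \<inter> H))" if z: "z \<in> ?B \<inter> H" for z
  proof -
    have zc: "z \<in> ?B \<inter> closure H" using z sub by auto
    have op: "open (?B \<inter> H)" using H by auto
    have d\<kappa>: "(\<kappa> has_field_derivative deriv \<kappa> z) (at z)"
      using \<kappa> B1 z H holomorphic_derivI[of \<kappa> "ball z0 \<delta>1 \<inter> H"] by blast
    \<comment> \<open>Z inverts \<kappa> along the sheet, so the chain rule yields N(\<kappa>)
      \<kappa>' = 1/w.\<close>
    have "((\<lambda>x. Z (\<kappa> x)) has_field_derivative N (\<kappa> z) * W (\<kappa> z) * deriv \<kappa> z) (at z)"
      using DERIV_chain2[OF aff_paramD(5)[OF a \<kappa>r[OF zc]] d\<kappa>] .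
    moreover have "((\<lambda>x. Z (\<kappa> x)) has_field_derivative 1) (at z)"
      by (rule has_field_derivative_transform_within_open[OF DERIV_ident op z]) (use ZW sub in auto)
    ultimately have "N (\<kappa> z) * W (\<kappa> z) * deriv \<kappa> z = 1" by (rule DERIV_unique)
    hence N: "N (\<kappa> z) * deriv \<kappa> z = 1 / w z" using ZW(2)[OF zc] wnz z by (simp add: field_simps)
    have "((\<lambda>x. G (\<kappa> x)) has_field_derivative \<rho> (Z (\<kappa> z)) * N (\<kappa> z) * deriv \<kappa> z) (at z)"
      using DERIV_chain2[OF G[OF \<kappa>r[OF zc]] d\<kappa>] .
    hence "((\<lambda>x. G (\<kappa> x)) has_field_derivative \<rho> z / w z) (at z)"
      using ZW(1)[OF zc] N by (simp add: mult.assoc)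
    from DERIV_diff[OF F this] z have "((\<lambda>z. F z - G (\<kappa> z)) has_field_derivative 0) (at z)" by simp
    thus ?thesis by (rule has_field_derivative_at_within)
  qed
  from has_field_derivative_zero_constant[OF convex_Int[OF convex_ball H(2)] this]
  obtain C where C: "\<And>z. z \<in> ?B \<inter> H \<Longrightarrow> F z - G (\<kappa> z) = C" by blast
  have "continuous_on (ball (snd c ?p) r) G"
    using G DERIV_isCont continuous_at_imp_continuous_on by blast
  moreover have \<kappa>c: "continuous_on (?B \<inter> closure H) \<kappa>" using \<kappa> B1 continuous_on_subset by blast
  ultimately have "continuous_on (?B \<inter> closure H) (\<lambda>z. G (\<kappa> z) + C)"
    using \<kappa>r by (intro continuous_intros continuous_on_compose2[of _ G _ \<kappa>]) auto
  hence "boundary_value H F z = G (\<kappa> z) + C" if "z \<in> ?B \<inter> closure H" for z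
    using that H C sub
    by (intro boundary_value_local(1)[where B = ?B and K = "\<lambda>z. G (\<kappa> z) + C"]) (auto simp: algebra_simps)
  hence "\<forall>z\<in>?B \<inter> closure H. Aff z (w z) \<in> fst c \<and> \<kappa> z \<in> ball (snd c ?p) r \<and> boundary_value H F z = G (\<kappa> z) + C"
    using U B1 \<kappa>r by blast
  thus ?thesis using \<kappa>c \<delta>1 \<delta>2 unfolding \<kappa>_def by (intro exI[of _ \<delta>]) (auto simp: \<delta>_def)
qed

lemma primitive_in_chart:
  assumes a: "aff_param c p r Z W N" and \<rho>: "\<rho> holomorphic_on \<Omega>" and Z: "\<And>\<zeta>. \<zeta> \<in> ball (snd c p) r \<Longrightarrow> Z \<zeta> \<in> \<Omega>"
  obtains G where "\<And>\<zeta>. \<zeta> \<in> ball (snd c p) r \<Longrightarrow> (G has_field_derivative \<rho> (Z \<zeta>) * N \<zeta>) (at \<zeta>)"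
proof -
  have "(\<lambda>\<zeta>. \<rho> (Z \<zeta>)) holomorphic_on ball (snd c p) r"
    using a Z by (intro holomorphic_on_compose_gen[OF _ \<rho>, unfolded o_def]) (auto simp: aff_param_def)
  hence "(\<lambda>\<zeta>. \<rho> (Z \<zeta>) * N \<zeta>) holomorphic_on ball (snd c p) r"
    using a by (intro holomorphic_intros) (auto simp: aff_param_def)
  then obtain G where G: "\<And>\<zeta>. \<zeta> \<in> ball (snd c p) r \<Longrightarrow>
      (G has_field_derivative \<rho> (Z \<zeta>) * N \<zeta>) (at \<zeta> within ball (snd c p) r)"
    by (rule holomorphic_convex_primitive'[OF convex_ball open_ball]) blast
  have "(G has_field_derivative \<rho> (Z \<zeta>) * N \<zeta>) (at \<zeta>)" if "\<zeta> \<in> ball (snd c p) r" for \<zeta>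
    using G[OF that] at_within_open[OF that open_ball] by simp
  thus ?thesis by (rule that)
qed

text \<open>If the exponentials of the primitives on a finite family of sheets match along the edges, then they
  glue to a global multiplier, hence the periods of the form are trivial.\<close>

lemma trivial_period_if_sheets_match:
  fixes \<psi> :: "complex \<Rightarrow> complex"
  assumes \<psi>: "\<And>x y. \<psi> (x + y) = \<psi> x + \<psi> y"
    and \<rho>: "\<rho> holomorphic_on \<Omega>" "open \<Omega>"
    and \<omega>: "\<And>c p r Z W N \<zeta>. c \<in> A \<Longrightarrow> aff_param c p r Z W N \<Longrightarrow> (\<And>\<zeta>. \<zeta> \<in> ball (snd c p) r \<Longrightarrow> Z \<zeta> \<in> \<Omega>) \<Longrightarrow>
       \<zeta> \<in> ball (snd c p) r \<Longrightarrow> \<omega> c \<zeta> = \<rho> (Z \<zeta>) * N \<zeta>"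
    and fin: "finite \<S>" and sheets: "\<And>s. s \<in> \<S> \<Longrightarrow> sheet \<rho> s"
    and match: "\<And>H w F H' w' F' z. (H, w, F) \<in> \<S> \<Longrightarrow> (H', w', F') \<in> \<S> \<Longrightarrow> z \<in> closure H \<Longrightarrow> z \<in> closure H' \<Longrightarrow>
       z \<in> \<Omega> \<Longrightarrow> w z = w' z \<Longrightarrow> exp (\<psi> (boundary_value H F z)) = exp (\<psi> (boundary_value H' F' z))"
    and cover: "\<And>z0 w0. z0 \<in> \<Omega> \<Longrightarrow> w0\<^sup>2 = poly P z0 \<Longrightarrow> \<exists>\<delta>>0. \<forall>z w. z \<in> ball z0 \<delta> \<longrightarrow> w \<in> ball w0 \<delta> \<longrightarrow> w\<^sup>2 = poly P z \<longrightarrow>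
       (\<exists>H wH F. (H, wH, F) \<in> \<S> \<and> z \<in> closure H \<and> z0 \<in> closure H \<and> wH z = w \<and> wH z0 = w0)"
    and \<gamma>: "has_form_integral A \<omega> \<gamma> I" "\<gamma> ` {0..1} \<subseteq> {Aff z w | z w. z \<in> \<Omega> \<and> w\<^sup>2 = poly P z}" "\<gamma> 1 = \<gamma> 0"
  shows "exp (\<psi> I) = 1"
proof -
  define S where "S = {Aff z w | z w. z \<in> \<Omega> \<and> w\<^sup>2 = poly P z}"
  \<comment> \<open>The value does not depend on the chosen sheet: sheets through the same point
    have equal exponentials by \<open>match\<close>.\<close>
  define E where "E = (\<lambda>q. SOME e. \<exists>H w F z. (H, w, F) \<in> \<S> \<and> z \<in> closure H \<and> z \<in> \<Omega> \<and> q = Aff z (w z) \<and>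
      e = exp (\<psi> (boundary_value H F z)))"
  have E: "E (Aff z (w z)) = exp (\<psi> (boundary_value H F z))"
    if "(H, w, F) \<in> \<S>" "z \<in> closure H" "z \<in> \<Omega>" for H w F z
    unfolding E_def
  proof (rule some_equality)
    show "\<exists>H' w' F' z'. (H', w', F') \<in> \<S> \<and> z' \<in> closure H' \<and> z' \<in> \<Omega> \<and> Aff z (w z) = Aff z' (w' z') \<and>
        exp (\<psi> (boundary_value H F z)) = exp (\<psi> (boundary_value H' F' z'))"
      using that by blast
    fix e assume "\<exists>H' w' F' z'. (H', w', F') \<in> \<S> \<and> z' \<in> closure H' \<and> z' \<in> \<Omega> \<and> Aff z (w z) = Aff z' (w' z') \<and>
        e = exp (\<psi> (boundary_value H' F' z'))"
    then obtain H' w' F' where "(H', w', F') \<in> \<S>" "z \<in> closure H'" "w z = w' z" "e = exp (\<psi> (boundary_value H' F' z))"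
      by auto
    thus "e = exp (\<psi> (boundary_value H F z))" using match[OF that(1) _ that(2) _ that(3)] by simp
  qed
  have mult: "has_multiplier A \<omega> S \<psi> E"
    unfolding has_multiplier_def
  proof (intro ballI)
    fix c p assume c: "c \<in> A" and p: "p \<in> fst c \<inter> S"
    obtain z0 w0 where p0: "p = Aff z0 w0" "z0 \<in> \<Omega>" "w0\<^sup>2 = poly P z0" using p by (auto simp: S_def)
    obtain \<delta>c where \<delta>c: "\<delta>c > 0" "\<And>z w. z \<in> ball z0 \<delta>c \<Longrightarrow> w \<in> ball w0 \<delta>c \<Longrightarrow> w\<^sup>2 = poly P z \<Longrightarrow>
       (\<exists>H wH F. (H, wH, F) \<in> \<S> \<and> z \<in> closure H \<and> z0 \<in> closure H \<and> wH z = w \<and> wH z0 = w0)"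
      using cover[OF p0(2,3)] by blast
    obtain r Z W N where a: "aff_param c p r Z W N" and ZW: "\<And>\<zeta>. \<zeta> \<in> ball (snd c p) r \<Longrightarrow> (Z \<zeta>, W \<zeta>) \<in> \<Omega> \<times> UNIV"
      using ex_aff_param[OF c, of z0 w0 "\<Omega> \<times> UNIV"] p p0 \<rho>(2) by (auto simp: open_Times)
    have Z\<Omega>: "Z \<zeta> \<in> \<Omega>" if "\<zeta> \<in> ball (snd c p) r" for \<zeta> using ZW[OF that] by simp
    obtain G where G: "\<And>\<zeta>. \<zeta> \<in> ball (snd c p) r \<Longrightarrow> (G has_field_derivative \<rho> (Z \<zeta>) * N \<zeta>) (at \<zeta>)"
      using primitive_in_chart[OF a \<rho>(1) Z\<Omega>] by blast
    \<comment> \<open>As there are finitely many sheets, a single radius \<delta> is good for all of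
      those through (z0, w0).\<close>
    define good where "good = (\<lambda>\<delta> s. case s of (H, w, F) \<Rightarrow> z0 \<in> closure H \<longrightarrow> w z0 = w0 \<longrightarrow>
       (\<exists>C. \<forall>z\<in>ball z0 \<delta> \<inter> closure H. boundary_value H F z = G (snd c (Aff z (w z))) + C))"
    have ev: "\<forall>\<^sub>F \<delta> in at_right 0. good \<delta> s" if s: "s \<in> \<S>" for s
    proof -
      obtain H w F where hw: "s = (H, w, F)" using prod_cases3 by blast
      show ?thesis
      proof (cases "z0 \<in> closure H \<and> w z0 = w0")
        case True
        have "\<exists>\<delta>>0. \<exists>C. \<forall>z\<in>ball z0 \<delta> \<inter> closure H. boundary_value H F z = G (snd c (Aff z (w z))) + C"
          using sheet_coordinate[of \<rho> H w F z0 c r Z W N G] sheets[OF s] hw True c a G p0 by auto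
        then obtain \<delta> C where d: "\<delta> > 0" "\<And>z. z \<in> ball z0 \<delta> \<inter> closure H \<Longrightarrow> boundary_value H F z = G (snd c (Aff z (w z))) + C"
          by blast
        have "good \<delta>' s" if "0 < \<delta>'" "\<delta>' < \<delta>" for \<delta>'
          unfolding good_def hw using d(2) that by (auto intro!: exI[of _ C])
        thus ?thesis unfolding eventually_at_right[OF zero_less_one] using d(1) by blast
      qed (auto simp: good_def hw)
    qed
    have "\<forall>\<^sub>F \<delta> in at_right 0. \<forall>s\<in>\<S>. good \<delta> s" using fin ev by (rule eventually_ball_finite[rule_format])
    then obtain \<delta>0 where "\<delta>0 > 0" "\<And>\<delta>. 0 < \<delta> \<Longrightarrow> \<delta> < \<delta>0 \<Longrightarrow> \<forall>s\<in>\<S>. good \<delta> s"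
      unfolding eventually_at_right[OF zero_less_one] by blast
    then obtain \<delta> where \<delta>: "\<delta> > 0" "\<forall>s\<in>\<S>. good \<delta> s" using dense by blast
    define T where "T = (ball z0 \<delta> \<inter> ball z0 \<delta>c) \<times> ball w0 \<delta>c"
    have "open T" unfolding T_def by (intro open_Times open_Int open_ball)
    have "(z0, w0) \<in> T" using \<delta> \<delta>c by (simp add: T_def)
    have ZWp: "Z (snd c p) = z0" "W (snd c p) = w0" and r: "r > 0" using a p0 by (auto simp: aff_param_def)
    have "continuous_on (ball (snd c p) r) (\<lambda>\<zeta>. (Z \<zeta>, W \<zeta>))"
      using a by (intro continuous_intros holomorphic_on_imp_continuous_on) (auto simp: aff_param_def)
    hence "open (ball (snd c p) r \<inter> (\<lambda>\<zeta>. (Z \<zeta>, W \<zeta>)) -` T)"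
      using \<open>open T\<close> by (intro continuous_open_preimage) auto
    moreover have "snd c p \<in> ball (snd c p) r \<inter> (\<lambda>\<zeta>. (Z \<zeta>, W \<zeta>)) -` T"
      using ZWp r \<open>(z0, w0) \<in> T\<close> by simp
    ultimately obtain r' where r': "r' > 0" "ball (snd c p) r' \<subseteq> ball (snd c p) r \<inter> (\<lambda>\<zeta>. (Z \<zeta>, W \<zeta>)) -` T"
      using open_contains_ball by blast
    have "E q = E p * exp (\<psi> (G (snd c q) - G (snd c p)))" if q: "q \<in> fst c \<inter> S" "snd c q \<in> ball (snd c p) r'" for q
    proof -
      define \<zeta> where "\<zeta> = snd c q"
      have \<zeta>: "\<zeta> \<in> ball (snd c p) r" "(Z \<zeta>, W \<zeta>) \<in> T" using q(2) r'(2) by (auto simp: \<zeta>_def)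
      have q': "q = Aff (Z \<zeta>) (W \<zeta>)" using aff_paramD(1)[OF a \<zeta>(1)] chart_inv_chart[OF c, of q] q(1) by (simp add: \<zeta>_def)
      \<comment> \<open>\<open>cover\<close> provides one sheet through both p and q, so both values
        of \<open>E\<close> come from the same primitive and its additive constant cancels.\<close>
      obtain H w F where s: "(H, w, F) \<in> \<S>" "Z \<zeta> \<in> closure H" "z0 \<in> closure H" "w (Z \<zeta>) = W \<zeta>" "w z0 = w0"
        using \<delta>c(2)[of "Z \<zeta>" "W \<zeta>"] \<zeta> aff_paramD(4)[OF a \<zeta>(1)] by (auto simp: T_def)
      then obtain C where C: "\<And>z. z \<in> ball z0 \<delta> \<inter> closure H \<Longrightarrow> boundary_value H F z = G (snd c (Aff z (w z))) + C"
        using \<delta>(2) unfolding good_def by fast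
      have "Z \<zeta> \<in> ball z0 \<delta> \<inter> closure H" using s(2) \<zeta>(2) by (simp add: T_def)
      from C[OF this] have "boundary_value H F (Z \<zeta>) = G \<zeta> + C"
        unfolding s(4) aff_paramD(3)[OF a \<zeta>(1)] .
      hence "E q = exp (\<psi> (G \<zeta> + C))"
        using E[OF s(1,2) Z\<Omega>[OF \<zeta>(1)]] unfolding s(4) q' by simp
      moreover have "z0 \<in> ball z0 \<delta> \<inter> closure H" using s(3) \<delta>(1) by simp
      from C[OF this] have "boundary_value H F z0 = G (snd c p) + C"
        unfolding s(5) p0(1) .
      hence "E p = exp (\<psi> (G (snd c p) + C))"
        using E[OF s(1,3) p0(2)] unfolding s(5) p0(1) by simp
      moreover have "\<psi> (G \<zeta> + C) = \<psi> (G (snd c p) + C) + \<psi> (G \<zeta> - G (snd c p))"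
        unfolding \<psi>[symmetric] by (simp add: algebra_simps)
      ultimately show ?thesis by (simp add: exp_add \<zeta>_def)
    qed
    moreover have "(G has_field_derivative \<omega> c \<zeta>) (at \<zeta>)" if "\<zeta> \<in> ball (snd c p) r'" for \<zeta>
      using G[of \<zeta>] \<omega>[OF c a Z\<Omega>, of \<zeta>] r'(2) that by auto
    ultimately show "\<exists>r>0. \<exists>G. (\<forall>\<zeta>\<in>ball (snd c p) r. (G has_field_derivative \<omega> c \<zeta>) (at \<zeta>)) \<and>
      (\<forall>q\<in>fst c \<inter> S. snd c q \<in> ball (snd c p) r \<longrightarrow> E q = E p * exp (\<psi> (G (snd c q) - G (snd c p))))"
      using r'(1) by blast
  qed
  have "E (\<gamma> 1) = E (\<gamma> 0) * exp (\<psi> I)"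
    using multiplier_along_path[OF mult \<psi> \<gamma>(1)] \<gamma>(2) by (simp add: S_def)
  moreover have "E (\<gamma> 0) \<noteq> 0"
  proof -
    have "\<gamma> 0 \<in> \<gamma> ` {0..1}" by simp
    then obtain z0 w0 where z0: "\<gamma> 0 = Aff z0 w0" "z0 \<in> \<Omega>" "w0\<^sup>2 = poly P z0" using \<gamma>(2) by blast
    obtain H w F where "(H, w, F) \<in> \<S>" "z0 \<in> closure H" "w z0 = w0"
      using cover[OF z0(2,3)] z0(3) by (metis centre_in_ball)
    thus ?thesis using E[of H w F z0] z0 by auto
  qed
  ultimately show ?thesis using \<gamma>(3) by simp
qed

end

section \<open>Real branch points\<close>

definition upper :: "complex set" where "upper = {z. Im z > 0}"
definition lower :: "complex set" where "lower = {z. Im z < 0}"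

lemma half_planes:
  "open upper" "open lower" "convex upper" "convex lower"
  "closure upper = {z. Im z \<ge> 0}" "closure lower = {z. Im z \<le> 0}"
  unfolding upper_def lower_def
  using closure_halfspace_gt[of \<i> 0] closure_halfspace_lt[of \<i> 0]
  by (auto simp: open_halfspace_Im_gt open_halfspace_Im_lt convex_halfspace_Im_gt convex_halfspace_Im_lt)

lemma cnj_upper [simp]: "cnj z \<in> upper \<longleftrightarrow> z \<in> lower" "cnj z \<in> lower \<longleftrightarrow> z \<in> upper"
  by (auto simp: upper_def lower_def)

text \<open>On the closed upper half-plane the imaginary part of \<open>csqrt\<close> is the
  nonnegative root, so there is no sign to choose: the principal root is continuous onto its cut
  from above.\<close>

lemma continuous_on_csqrt_upper: "continuous_on {z. Im z \<ge> 0} csqrt"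
proof (rule continuous_on_eq)
  show "continuous_on {z. Im z \<ge> 0} (\<lambda>z. Complex (sqrt ((cmod z + Re z) / 2)) (sqrt ((cmod z - Re z) / 2)))"
    unfolding Complex_eq by (intro continuous_intros) auto
  fix z assume "z \<in> {z. Im z \<ge> 0}"
  thus "Complex (sqrt ((cmod z + Re z) / 2)) (sqrt ((cmod z - Re z) / 2)) = csqrt z"
    by (auto simp: complex_eq_iff)
qed

lemma exp_i_eq_uminus:
  assumes "exp (2 * \<i> * of_real t) = 1"
  shows "exp (\<i> * of_real (- t)) = exp (\<i> * of_real t)"
proof -
  have "exp (\<i> * of_real t) = exp (\<i> * of_real (- t)) * exp (2 * \<i> * of_real t)"
    by (simp flip: exp_add)
  thus ?thesis using assms by simp
qed

context hyperelliptic
begin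

text \<open>The local formula G + C of \<open>sheet_coordinate\<close> gives the continuity, at
  branch points as well as at ordinary points of the edge.\<close>

lemma boundary_value_sheet:
  assumes s: "sheet \<rho> (H, w, F)" and \<rho>: "\<rho> holomorphic_on \<Omega>" "open \<Omega>"
  shows "continuous_on (closure H \<inter> \<Omega>) (boundary_value H F)"
    and "z \<in> H \<Longrightarrow> boundary_value H F z = F z"
    and "z \<in> closure H \<Longrightarrow> z \<in> \<Omega> \<Longrightarrow> (F \<longlongrightarrow> boundary_value H F z) (at z within H)"
proof -
  have op: "open H" and sq: "\<And>z. z \<in> closure H \<Longrightarrow> (w z)\<^sup>2 = poly P z"
    and F: "\<And>z. z \<in> H \<Longrightarrow> (F has_field_derivative \<rho> z / w z) (at z)"
    using s by (auto simp: sheet_def)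
  have inH: "boundary_value H F z = F z" if z: "z \<in> H" for z
  proof (rule boundary_value_eqI[OF op])
    show "z \<in> closure H" using z closure_subset by blast
    have "isCont F z" using F[OF z] DERIV_isCont by blast
    thus "(F \<longlongrightarrow> F z) (at z within H)"
      unfolding isCont_def by (rule tendsto_within_subset) simp
  qed
  thus "z \<in> H \<Longrightarrow> boundary_value H F z = F z" .
  have loc: "\<exists>\<delta>>0. continuous_on (ball z0 \<delta> \<inter> closure H) (boundary_value H F)" if z0: "z0 \<in> closure H" "z0 \<in> \<Omega>" for z0
  proof -
    have "Aff z0 (w z0) \<in> hyp_carrier P" using sq[OF z0(1)] by simp
    then obtain c where c: "c \<in> A" "Aff z0 (w z0) \<in> fst c" using charts_cover by blast
    obtain r Z W N where a: "aff_param c (Aff z0 (w z0)) r Z W N"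
        and ZW: "\<And>\<zeta>. \<zeta> \<in> ball (snd c (Aff z0 (w z0))) r \<Longrightarrow> (Z \<zeta>, W \<zeta>) \<in> \<Omega> \<times> UNIV"
      using ex_aff_param[OF c, of "\<Omega> \<times> UNIV"] z0(2) \<rho>(2) by (auto simp: open_Times)
    have "Z \<zeta> \<in> \<Omega>" if "\<zeta> \<in> ball (snd c (Aff z0 (w z0))) r" for \<zeta> using ZW[OF that] by simp
    from primitive_in_chart[OF a \<rho>(1) this]
    obtain G where G: "\<And>\<zeta>. \<zeta> \<in> ball (snd c (Aff z0 (w z0))) r \<Longrightarrow> (G has_field_derivative \<rho> (Z \<zeta>) * N \<zeta>) (at \<zeta>)"
      by blast
    obtain \<delta> C where \<delta>: "\<delta> > 0" "continuous_on (ball z0 \<delta> \<inter> closure H) (\<lambda>z. snd c (Aff z (w z)))"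
      "\<And>z. z \<in> ball z0 \<delta> \<inter> closure H \<Longrightarrow> snd c (Aff z (w z)) \<in> ball (snd c (Aff z0 (w z0))) r"
      "\<And>z. z \<in> ball z0 \<delta> \<inter> closure H \<Longrightarrow> boundary_value H F z = G (snd c (Aff z (w z))) + C"
      using sheet_coordinate[OF s z0(1) c(1) a G] by blast
    have "continuous_on (ball (snd c (Aff z0 (w z0))) r) G"
      using G DERIV_isCont continuous_at_imp_continuous_on by blast
    hence "continuous_on (ball z0 \<delta> \<inter> closure H) (\<lambda>z. G (snd c (Aff z (w z))) + C)"
      using \<delta>(2,3) by (intro continuous_intros continuous_on_compose2[of _ G _ "\<lambda>z. snd c (Aff z (w z))"]) auto
    hence "continuous_on (ball z0 \<delta> \<inter> closure H) (boundary_value H F)"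
      by (rule continuous_on_eq) (use \<delta>(4) in auto)
    thus ?thesis using \<delta>(1) by blast
  qed
  have lim: "(boundary_value H F \<longlongrightarrow> boundary_value H F z0) (at z0 within closure H)"
    if z0: "z0 \<in> closure H" "z0 \<in> \<Omega>" for z0
  proof -
    obtain \<delta> where d: "\<delta> > 0" "continuous_on (ball z0 \<delta> \<inter> closure H) (boundary_value H F)"
      using loc[OF z0] by blast
    hence "(boundary_value H F \<longlongrightarrow> boundary_value H F z0) (at z0 within (ball z0 \<delta> \<inter> closure H))"
      using z0 by (auto simp: continuous_on_def)
    moreover have "at z0 within (ball z0 \<delta> \<inter> closure H) = at z0 within closure H"
      using d(1) by (intro at_within_nhd[of _ "ball z0 \<delta>"]) auto
    ultimately show ?thesis by simp
  qed
  show "continuous_on (closure H \<inter> \<Omega>) (boundary_value H F)"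
    unfolding continuous_on_def
  proof
    fix z assume "z \<in> closure H \<inter> \<Omega>"
    thus "(boundary_value H F \<longlongrightarrow> boundary_value H F z) (at z within closure H \<inter> \<Omega>)"
      using lim[of z] by (auto intro: tendsto_within_subset)
  qed
  assume z: "z \<in> closure H" "z \<in> \<Omega>"
  have "(boundary_value H F \<longlongrightarrow> boundary_value H F z) (at z within H)"
    using lim[OF z] closure_subset by (rule tendsto_within_subset)
  moreover have "\<forall>\<^sub>F x in at z within H. boundary_value H F x = F x"
    by (auto simp: eventually_at_filter inH)
  ultimately show "(F \<longlongrightarrow> boundary_value H F z) (at z within H)"
    by (rule Lim_transform_eventually)
qed

end

locale real_hyperelliptic = hyperelliptic +
  fixes B :: "real set"
  assumes finite_B: "finite B" and P_prod: "P = (\<Prod>r\<in>B. [:- of_real r, 1:])"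
begin

text \<open>The root of P that is continued from the upper half-plane: each factor is continuous on
  the closed half-plane, and its value on the real axis is the limit from above.\<close>

definition branch :: "complex \<Rightarrow> complex" where "branch z = (\<Prod>r\<in>B. csqrt (z - of_real r))"

lemma poly_P: "poly P z = (\<Prod>r\<in>B. z - of_real r)"
  by (simp add: P_prod poly_prod)

lemma branch_square: "(branch z)\<^sup>2 = poly P z"
  by (simp add: branch_def poly_P prod_power_distrib)

lemma branch_eq_0_iff: "branch z = 0 \<longleftrightarrow> z \<in> of_real ` B"
  using finite_B by (auto simp: branch_def)

lemma branch_nonzero: "Im z \<noteq> 0 \<Longrightarrow> branch z \<noteq> 0"
  by (auto simp: branch_eq_0_iff)

lemma poly_P_cnj: "poly P (cnj z) = cnj (poly P z)"
  by (simp add: poly_P)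

lemma continuous_on_branch: "continuous_on (closure upper) branch"
  unfolding branch_def half_planes
proof (intro continuous_intros)
  fix r assume "r \<in> B"
  show "continuous_on {z. 0 \<le> Im z} (\<lambda>z. csqrt (z - of_real r))"
    by (rule continuous_on_compose2[OF continuous_on_csqrt_upper]) (auto intro: continuous_intros)
qed

lemma holomorphic_on_branch: "branch holomorphic_on upper"
  unfolding branch_def
proof (intro holomorphic_intros)
  fix r z assume "z \<in> upper"
  thus "z - complex_of_real r \<notin> \<real>\<^sub>\<le>\<^sub>0" by (auto simp: upper_def complex_nonpos_Reals_iff)
qed

lemma sheet_upper:
  assumes "\<And>z. z \<in> upper \<Longrightarrow> (F has_field_derivative \<rho> z / branch z) (at z)"
  shows "sheet \<rho> (upper, branch, F)"
  unfolding sheet_def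
  using assms half_planes continuous_on_branch holomorphic_on_branch branch_square branch_nonzero
  by (auto simp: upper_def)

lemma sheet_uminus:
  assumes "sheet \<rho> (H, w, F)"
  shows "sheet \<rho> (H, \<lambda>z. - w z, \<lambda>z. - F z)"
  using assms unfolding sheet_def by (auto intro!: continuous_intros holomorphic_intros derivative_eq_intros)

text \<open>Schwarz reflection. The sign \<epsilon> records whether \<rho> is real or imaginary on
  the real axis; it is 1 for the first form and -1 for the second.\<close>

lemma sheet_cnj:
  assumes s: "sheet \<rho> (upper, w, F)" and \<rho>: "\<And>z. \<rho> (cnj z) = of_real \<epsilon> * cnj (\<rho> z)" and \<epsilon>: "\<epsilon> = 1 \<or> \<epsilon> = -1"
  shows "sheet \<rho> (lower, \<lambda>z. cnj (w (cnj z)), \<lambda>z. of_real \<epsilon> * cnj (F (cnj z)))"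
proof -
  have "continuous_on (closure upper) w" and wh: "w holomorphic_on upper"
    and "\<And>z. z \<in> closure upper \<Longrightarrow> (w z)\<^sup>2 = poly P z" and "\<And>z. z \<in> upper \<Longrightarrow> w z \<noteq> 0"
    and F: "\<And>z. z \<in> upper \<Longrightarrow> (F has_field_derivative \<rho> z / w z) (at z)"
    using s by (auto simp: sheet_def)
  note * = this
  have "cnj ` lower = upper"
    by (auto simp: upper_def lower_def image_iff) (metis complex_cnj_cnj complex_cnj neg_less_0_iff_less complex.sel cnj.simps)
  hence "cnj \<circ> w \<circ> cnj holomorphic_on lower"
    using wh half_planes by (intro holomorphic_on_compose_cnj_cnj) auto
  hence "(\<lambda>z. cnj (w (cnj z))) holomorphic_on lower" by (simp add: o_def)
  moreover have "continuous_on (closure lower) (\<lambda>z. cnj (w (cnj z)))"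
    using *(1) by (intro continuous_intros continuous_on_compose2[OF *(1)]) (auto simp: half_planes)
  moreover have "(cnj (w (cnj z)))\<^sup>2 = poly P z" if "z \<in> closure lower" for z
  proof -
    have "(w (cnj z))\<^sup>2 = poly P (cnj z)" using *(3)[of "cnj z"] that by (simp add: half_planes)
    hence "cnj ((w (cnj z))\<^sup>2) = poly P z" by (simp add: poly_P_cnj del: complex_cnj_power)
    thus ?thesis unfolding complex_cnj_power .
  qed
  moreover have "((\<lambda>z. of_real \<epsilon> * cnj (F (cnj z))) has_field_derivative \<rho> z / cnj (w (cnj z))) (at z)" if "z \<in> lower" for z
  proof -
    have "((cnj \<circ> F \<circ> cnj) has_field_derivative cnj (\<rho> (cnj z) / w (cnj z))) (at z)"
      using F[of "cnj z"] that by (intro has_field_derivative_cnj_cnj) simp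
    hence "((\<lambda>z. cnj (F (cnj z))) has_field_derivative cnj (\<rho> (cnj z) / w (cnj z))) (at z)"
      by (simp add: o_def)
    hence "((\<lambda>z. of_real \<epsilon> * cnj (F (cnj z))) has_field_derivative of_real \<epsilon> * cnj (\<rho> (cnj z) / w (cnj z))) (at z)"
      by (rule DERIV_cmult)
    also have "of_real \<epsilon> * cnj (\<rho> (cnj z) / w (cnj z)) = \<rho> z / cnj (w (cnj z))"
      using \<epsilon> by (auto simp: \<rho>)
    finally show ?thesis .
  qed
  moreover have "cnj (w (cnj z)) \<noteq> 0" if "z \<in> lower" for z using *(4)[of "cnj z"] that by simp
  ultimately show ?thesis using half_planes by (simp add: sheet_def)
qed

lemma boundary_value_uminus:
  assumes "sheet \<rho> (H, w, F)" "\<rho> holomorphic_on \<Omega>" "open \<Omega>" "z \<in> closure H" "z \<in> \<Omega>"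
  shows "boundary_value H (\<lambda>z. - F z) z = - boundary_value H F z"
  using boundary_value_sheet(3)[OF assms] assms(1,4)
  by (intro boundary_value_eqI tendsto_minus) (auto simp: sheet_def)

lemma boundary_value_cnj:
  assumes "sheet \<rho> (upper, w, F)" "\<rho> holomorphic_on \<Omega>" "open \<Omega>" "z \<in> closure lower" "cnj z \<in> \<Omega>"
  shows "boundary_value lower (\<lambda>z. of_real \<epsilon> * cnj (F (cnj z))) z = of_real \<epsilon> * cnj (boundary_value upper F (cnj z))"
proof (rule boundary_value_eqI)
  have "(F \<longlongrightarrow> boundary_value upper F (cnj z)) (at (cnj z) within upper)"
    using assms by (intro boundary_value_sheet(3)) (auto simp: half_planes)
  moreover have "filterlim cnj (at (cnj z) within upper) (at z within lower)"
    unfolding filterlim_at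
    by (auto simp: eventually_at_filter intro!: tendsto_intros)
  ultimately have "((\<lambda>z. F (cnj z)) \<longlongrightarrow> boundary_value upper F (cnj z)) (at z within lower)"
    by (rule filterlim_compose)
  thus "((\<lambda>z. of_real \<epsilon> * cnj (F (cnj z))) \<longlongrightarrow> of_real \<epsilon> * cnj (boundary_value upper F (cnj z))) (at z within lower)"
    by (intro tendsto_intros)
qed (use assms half_planes in auto)

text \<open>By continuity a root y near \<open>w0\<close> is \<plusminus>w with the same sign over z
  and over \<open>z0\<close>. If \<open>w0\<close> is 0, either sign fits at
  \<open>z0\<close>.\<close>

lemma sheet_branch_near:
  assumes "continuous_on (closure H) w" "\<And>z. z \<in> closure H \<Longrightarrow> (w z)\<^sup>2 = poly P z" and w0: "w0\<^sup>2 = poly P z0"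
  shows "\<exists>\<delta>>0. \<forall>z\<in>ball z0 \<delta> \<inter> closure H. \<forall>y\<in>ball w0 \<delta>. y\<^sup>2 = poly P z \<longrightarrow>
    z0 \<in> closure H \<and> ((w z = y \<and> w z0 = w0) \<or> (- w z = y \<and> - w z0 = w0))"
proof (cases "z0 \<in> closure H")
  case False
  then obtain \<delta> where "\<delta> > 0" "ball z0 \<delta> \<subseteq> - closure H"
    using open_contains_ball[of "- closure H"] by auto
  thus ?thesis by (intro exI[of _ \<delta>]) auto
next
  case z0: True
  have pm: "y = x \<or> y = - x" if "y\<^sup>2 = x\<^sup>2" for x y :: complex using that power2_eq_iff by blast
  show ?thesis
  proof (cases "w0 = 0")
    case True
    hence "w z0 = 0" using assms(2)[OF z0] w0 by simp
    thus ?thesis using True z0 assms(2) pm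
      by (intro exI[of _ 1]) (auto, metis)
  next
    case False
    obtain \<delta> where \<delta>: "\<delta> > 0" "\<And>z. z \<in> closure H \<Longrightarrow> dist z z0 < \<delta> \<Longrightarrow> dist (w z) (w z0) < norm w0"
      using assms(1) z0 False unfolding continuous_on_iff by (metis zero_less_norm_iff)
    have main: "w z = y \<and> w z0 = w0 \<or> - w z = y \<and> - w z0 = w0"
      if z: "z \<in> closure H" "dist z0 z < \<delta>" and y: "dist w0 y < norm w0" "y\<^sup>2 = poly P z" for z y
    proof -
      have n: "norm (w z - w z0) < norm w0" "norm (y - w0) < norm w0"
        using \<delta>(2)[OF z(1)] z(2) y(1) by (auto simp: dist_norm norm_minus_commute)
      have sq: "y\<^sup>2 = (w z)\<^sup>2" "y\<^sup>2 = (- w z)\<^sup>2" using assms(2)[OF z(1)] y(2) by auto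
      have "w0 = w z0 \<or> w0 = - w z0" using pm[of w0 "w z0"] assms(2)[OF z0] w0 by simp
      thus ?thesis
      proof
        assume e: "w0 = w z0"
        hence "y = w z" using square_eq_same_side[OF sq(1) n(2)] n(1) by simp
        thus ?thesis using e by simp
      next
        assume e: "w0 = - w z0"
        have "norm (- w z - w0) = norm (w z - w z0)" unfolding e using norm_minus_commute[of "w z" "w z0"] by simp
        hence "y = - w z" using square_eq_same_side[OF sq(2) n(2)] n(1) by simp
        thus ?thesis using e by simp
      qed
    qed
    thus ?thesis using z0 \<delta>(1) False by (intro exI[of _ "min \<delta> (norm w0)"]) auto
  qed
qed

text \<open>With real branch points the sheets are the two branches over the upper and the lower half-plane; the
  latter are the mirror images of the former. They match along a real interval automatically or if
  \<open>Re F\<close> is an integer multiple of \<open>\<pi>\<close> there.\<close>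

lemma real_period_in_lattice:
  assumes \<rho>: "\<rho> holomorphic_on (- {0})" and refl: "\<And>z. \<rho> (cnj z) = of_real \<epsilon> * cnj (\<rho> z)" and \<epsilon>: "\<epsilon> = 1 \<or> \<epsilon> = -1"
    and F: "\<And>z. z \<in> upper \<Longrightarrow> (F has_field_derivative \<rho> z / branch z) (at z)"
    and edge: "\<And>x. x \<noteq> 0 \<Longrightarrow> cnj (branch (of_real x)) = - of_real \<epsilon> * branch (of_real x) \<Longrightarrow>
       exp (2 * \<i> * of_real (Re (boundary_value upper F (of_real x)))) = 1"
    and \<omega>: "\<And>c p r Z W N \<zeta>. c \<in> A \<Longrightarrow> aff_param c p r Z W N \<Longrightarrow> (\<And>\<zeta>. \<zeta> \<in> ball (snd c p) r \<Longrightarrow> Z \<zeta> \<noteq> 0) \<Longrightarrow>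
       \<zeta> \<in> ball (snd c p) r \<Longrightarrow> \<omega> c \<zeta> = \<rho> (Z \<zeta>) * N \<zeta>"
    and \<gamma>: "has_form_integral A \<omega> \<gamma> I" "\<gamma> ` {0..1} \<subseteq> {Aff z w | z w. z \<noteq> 0 \<and> w\<^sup>2 = poly P z}" "\<gamma> 1 = \<gamma> 0"
  obtains n :: int where "Re I = 2 * pi * of_int n"
proof -
  define wl where "wl = (\<lambda>z. cnj (branch (cnj z)))"
  define Fl where "Fl = (\<lambda>z. of_real \<epsilon> * cnj (F (cnj z)))"
  define f where "f = boundary_value upper F"
  define \<S> where "\<S> = {(upper, branch, F), (upper, \<lambda>z. - branch z, \<lambda>z. - F z), (lower, wl, Fl), (lower, \<lambda>z. - wl z, \<lambda>z. - Fl z)}"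
  have op: "open (- {0 :: complex})" by auto
  have su: "sheet \<rho> (upper, branch, F)" using F by (rule sheet_upper)
  have sl: "sheet \<rho> (lower, wl, Fl)" unfolding wl_def Fl_def using sheet_cnj[OF su refl \<epsilon>] .
  note bvu = boundary_value_uminus[OF su \<rho> op] and bvl = boundary_value_uminus[OF sl \<rho> op]
    and bvc = boundary_value_cnj[OF su \<rho> op, of _ \<epsilon>, folded Fl_def f_def]
  define \<psi> where "\<psi> = (\<lambda>x. \<i> * of_real (Re x))"
  have val: "\<exists>\<eta>::real. (\<eta> = 1 \<or> \<eta> = -1) \<and> (z \<in> closure upper \<and> w z = of_real \<eta> * branch z \<and> Re (boundary_value H F' z) = \<eta> * Re (f z) \<or>
      z \<in> closure lower \<and> w z = of_real \<eta> * wl z \<and> Re (boundary_value H F' z) = \<eta> * \<epsilon> * Re (f (cnj z)))"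
    if s: "(H, w, F') \<in> \<S>" and z: "z \<in> closure H" "z \<noteq> 0" for H w F' z
  proof -
    consider "(H, w, F') = (upper, branch, F)" | "(H, w, F') = (upper, \<lambda>z. - branch z, \<lambda>z. - F z)"
      | "(H, w, F') = (lower, wl, Fl)" | "(H, w, F') = (lower, \<lambda>z. - wl z, \<lambda>z. - Fl z)"
      using s unfolding \<S>_def by blast
    thus ?thesis
    proof cases
      case 1 thus ?thesis using z by (intro exI[of _ 1]) (simp add: f_def)
    next
      case 2 thus ?thesis using z bvu[of z] by (intro exI[of _ "-1"]) (simp add: f_def)
    next
      case 3 thus ?thesis using z bvc[of z] by (intro exI[of _ 1]) simp
    next
      case 4 thus ?thesis using z bvl[of z] bvc[of z] by (intro exI[of _ "-1"]) simp
    qed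
  qed
  have edge': "exp (\<i> * of_real (- (Re (f (of_real x))))) = exp (\<i> * of_real (Re (f (of_real x))))"
    if "x \<noteq> 0" "cnj (branch (of_real x)) = - of_real \<epsilon> * branch (of_real x)" for x
    using exp_i_eq_uminus[OF edge[OF that]] by (simp add: f_def)
  \<comment> \<open>At a branch point both signs of w give the same point, so the exponentials of F
    and - F must agree there. The hypothesis of \<open>edge\<close> holds trivially, as the branch
    vanishes.\<close>
  have edge0: "exp (\<i> * of_real (- (Re (f z)))) = exp (\<i> * of_real (Re (f z)))" if "branch z = 0" "z \<noteq> 0" for z
  proof -
    have "z \<in> of_real ` B" using that(1) by (simp only: branch_eq_0_iff)
    then obtain x where x: "z = of_real x" by (rule imageE)
    show ?thesis unfolding x by (rule edge') (use that x in simp_all)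
  qed
  have pm: "exp (\<i> * of_real (\<eta> * t)) = exp (\<i> * of_real (\<eta>' * t))"
    if "\<eta> = 1 \<or> \<eta> = -1" "\<eta>' = 1 \<or> \<eta>' = -1" "\<eta> = \<eta>' \<or> exp (\<i> * of_real (- t)) = exp (\<i> * of_real t)" for \<eta> \<eta>' t :: real
    using that by auto
  \<comment> \<open>An upper and a lower sheet meet over a real point. Either the reflected
    primitive already carries the matching sign, or the branch changes by -\<epsilon> under
    conjugation, which is the case covered by \<open>edge\<close>.\<close>
  have mixed: "exp (\<i> * of_real (\<eta> * Re (f z))) = exp (\<i> * of_real (\<eta>' * \<epsilon> * Re (f (cnj z))))"
    if e: "\<eta> = 1 \<or> \<eta> = -1" "\<eta>' = 1 \<or> \<eta>' = -1" and z: "z \<in> closure upper" "z \<in> closure lower" "z \<noteq> 0"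
      and eq: "of_real \<eta> * branch z = of_real \<eta>' * wl z" for \<eta> \<eta>' :: real and z
  proof -
    have "Im z = 0" using z by (simp add: half_planes)
    then obtain x where x: "z = of_real x" by (metis complex_is_Real_iff Reals_cases)
    have sw: "cnj (branch (of_real x)) = - branch (of_real x) \<longleftrightarrow> branch (of_real x) = - cnj (branch (of_real x))"
      by (metis minus_minus)
    have "\<eta> = \<eta>' * \<epsilon> \<or> cnj (branch (of_real x)) = - of_real \<epsilon> * branch (of_real x)"
      using e \<epsilon> eq sw by (auto simp: wl_def x)
    thus ?thesis using pm[of \<eta> "\<eta>' * \<epsilon>" "Re (f z)"] e \<epsilon> edge'[of x] z(3) x by auto
  qed
  have "exp (\<psi> I) = 1"
  proof (rule trivial_period_if_sheets_match[where \<psi> = \<psi> and I = I and \<rho> = \<rho> and \<Omega> = "- {0}" and \<S> = \<S> and \<omega> = \<omega> and \<gamma> = \<gamma>])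
    show "\<psi> (x + y) = \<psi> x + \<psi> y" for x y by (simp add: \<psi>_def algebra_simps)
    show "finite \<S>" by (simp add: \<S>_def)
    show "sheet \<rho> s" if "s \<in> \<S>" for s
      using that su sl sheet_uminus[OF su] sheet_uminus[OF sl] by (auto simp: \<S>_def)
    show "\<gamma> ` {0..1} \<subseteq> {Aff z w | z w. z \<in> - {0} \<and> w\<^sup>2 = poly P z}" using \<gamma>(2) by simp
  next
    fix H w F1 H' w' F1' z
    assume s: "(H, w, F1) \<in> \<S>" "(H', w', F1') \<in> \<S>" and z: "z \<in> closure H" "z \<in> closure H'" "z \<in> - {0}" and eq: "w z = w' z"
    have z0: "z \<noteq> 0" using z by simp
    obtain \<eta> :: real where 1: "\<eta> = 1 \<or> \<eta> = -1" "z \<in> closure upper \<and> w z = of_real \<eta> * branch z \<and> Re (boundary_value H F1 z) = \<eta> * Re (f z) \<or>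
      z \<in> closure lower \<and> w z = of_real \<eta> * wl z \<and> Re (boundary_value H F1 z) = \<eta> * \<epsilon> * Re (f (cnj z))"
      using val[OF s(1) z(1) z0] by blast
    obtain \<eta>' :: real where 2: "\<eta>' = 1 \<or> \<eta>' = -1" "z \<in> closure upper \<and> w' z = of_real \<eta>' * branch z \<and> Re (boundary_value H' F1' z) = \<eta>' * Re (f z) \<or>
      z \<in> closure lower \<and> w' z = of_real \<eta>' * wl z \<and> Re (boundary_value H' F1' z) = \<eta>' * \<epsilon> * Re (f (cnj z))"
      using val[OF s(2) z(2) z0] by blast
    have same: "\<eta> = \<eta>' \<or> v = 0" if "of_real \<eta> * v = of_real \<eta>' * v" for v :: complex
      using that by (simp add: disj_commute)
    have uu: "exp (\<i> * of_real (\<eta> * Re (f z))) = exp (\<i> * of_real (\<eta>' * Re (f z)))"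
      if "of_real \<eta> * branch z = of_real \<eta>' * branch z"
      using same[OF that] edge0[of z] z0 by (intro pm 1 2) blast
    have ll: "exp (\<i> * of_real (\<eta> * (\<epsilon> * Re (f (cnj z))))) = exp (\<i> * of_real (\<eta>' * (\<epsilon> * Re (f (cnj z)))))"
      if "of_real \<eta> * wl z = of_real \<eta>' * wl z"
    proof (rule pm[OF 1(1) 2(1)])
      have "exp (\<i> * of_real (- (\<epsilon> * Re (f (cnj z))))) = exp (\<i> * of_real (\<epsilon> * Re (f (cnj z))))" if "wl z = 0"
        using edge0[of "cnj z"] that z0 \<epsilon> by (auto simp: wl_def)
      thus "\<eta> = \<eta>' \<or> exp (\<i> * of_real (- (\<epsilon> * Re (f (cnj z))))) = exp (\<i> * of_real (\<epsilon> * Re (f (cnj z))))"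
        using same[OF \<open>of_real \<eta> * wl z = of_real \<eta>' * wl z\<close>] by blast
    qed
    from 1(2) 2(2) eq show "exp (\<psi> (boundary_value H F1 z)) = exp (\<psi> (boundary_value H' F1' z))"
      unfolding \<psi>_def
      using uu ll mixed[OF 1(1) 2(1) _ _ z0] mixed[OF 2(1) 1(1) _ _ z0]
      by (elim disjE conjE) (simp_all add: mult.assoc)
  next
    fix z0 w0 assume z0: "z0 \<in> - {0 :: complex}" and w0: "w0\<^sup>2 = poly P z0"
    obtain \<delta>1 where 1: "\<delta>1 > 0" "\<forall>z\<in>ball z0 \<delta>1 \<inter> closure upper. \<forall>y\<in>ball w0 \<delta>1. y\<^sup>2 = poly P z \<longrightarrow>
        z0 \<in> closure upper \<and> ((branch z = y \<and> branch z0 = w0) \<or> (- branch z = y \<and> - branch z0 = w0))"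
      using sheet_branch_near[of upper branch w0 z0] su w0 by (auto simp: sheet_def)
    obtain \<delta>2 where 2: "\<delta>2 > 0" "\<forall>z\<in>ball z0 \<delta>2 \<inter> closure lower. \<forall>y\<in>ball w0 \<delta>2. y\<^sup>2 = poly P z \<longrightarrow>
        z0 \<in> closure lower \<and> ((wl z = y \<and> wl z0 = w0) \<or> (- wl z = y \<and> - wl z0 = w0))"
      using sheet_branch_near[of lower wl w0 z0] sl w0 by (auto simp: sheet_def)
    have "\<exists>H wH F. (H, wH, F) \<in> \<S> \<and> z \<in> closure H \<and> z0 \<in> closure H \<and> wH z = y \<and> wH z0 = w0"
      if z: "z \<in> ball z0 (min \<delta>1 \<delta>2)" and y: "y \<in> ball w0 (min \<delta>1 \<delta>2)" "y\<^sup>2 = poly P z" for z y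
    proof -
      have "z \<in> closure upper \<or> z \<in> closure lower" by (auto simp: half_planes)
      thus ?thesis
      proof
        assume zu: "z \<in> closure upper"
        have "z0 \<in> closure upper \<and> ((branch z = y \<and> branch z0 = w0) \<or> (- branch z = y \<and> - branch z0 = w0))"
          using bspec[OF bspec[OF 1(2), of z], of y] z y zu by simp
        thus ?thesis using zu unfolding \<S>_def by blast
      next
        assume zu: "z \<in> closure lower"
        have "z0 \<in> closure lower \<and> ((wl z = y \<and> wl z0 = w0) \<or> (- wl z = y \<and> - wl z0 = w0))"
          using bspec[OF bspec[OF 2(2), of z], of y] z y zu by simp
        thus ?thesis using zu unfolding \<S>_def by blast
      qed
    qed
    thus "\<exists>\<delta>>0. \<forall>z w. z \<in> ball z0 \<delta> \<longrightarrow> w \<in> ball w0 \<delta> \<longrightarrow> w\<^sup>2 = poly P z \<longrightarrow>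
       (\<exists>H wH F. (H, wH, F) \<in> \<S> \<and> z \<in> closure H \<and> z0 \<in> closure H \<and> wH z = w \<and> wH z0 = w0)"
      using 1(1) 2(1) by (intro exI[of _ "min \<delta>1 \<delta>2"]) auto
  qed (use \<rho> op \<omega> \<gamma> in auto)
  then obtain n :: int where "Im (\<i> * of_real (Re I)) = of_int (2 * n) * pi"
    unfolding exp_eq_1 \<psi>_def by blast
  thus ?thesis using that[of n] by (simp add: mult_ac)
qed

end

section \<open>Half residues\<close>

lemma simple_pole_split:
  assumes k: "k holomorphic_on ball 0 \<rho>"
  obtains h H where "\<And>z. z \<in> ball 0 \<rho> - {0} \<Longrightarrow> k z / z = k 0 / z + h z"
    "\<And>z. z \<in> ball 0 \<rho> \<Longrightarrow> (H has_field_derivative h z) (at z)"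
proof -
  define h where "h = (\<lambda>z. if z = 0 then deriv k 0 else (k z - k 0) / (z - 0))"
  have "h holomorphic_on ball 0 \<rho>"
    unfolding h_def by (rule pole_lemma_open[OF k open_ball])
  then obtain H where H: "\<And>z. z \<in> ball 0 \<rho> \<Longrightarrow> (H has_field_derivative h z) (at z within ball 0 \<rho>)"
    by (rule holomorphic_convex_primitive'[OF convex_ball open_ball]) blast
  have "(H has_field_derivative h z) (at z)" if "z \<in> ball 0 \<rho>" for z
    using H[OF that] at_within_open[OF that open_ball] by simp
  moreover have "k z / z = k 0 / z + h z" if "z \<in> ball 0 \<rho> - {0}" for z
    using that by (simp add: h_def diff_divide_distrib)
  ultimately show ?thesis using that by blast
qed

text \<open>\<open>reflect_poly\<close> reverses with respect to the actual degree; the extra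
  monomial raises the exponent to m, so that the value at 0 is the coefficient of degree m, possibly
  zero.\<close>

lemma padded_reflection:
  fixes q :: "complex poly"
  assumes "degree q \<le> m"
  obtains q' where "\<And>u. u \<noteq> 0 \<Longrightarrow> poly q' u = u ^ m * poly q (1 / u)" "poly q' 0 = coeff q m"
proof
  fix u :: complex assume "u \<noteq> 0"
  have "m - degree q + degree q = m" using assms by simp
  hence "u ^ m = u ^ (m - degree q) * u ^ degree q" by (metis power_add)
  thus "poly (monom 1 (m - degree q) * reflect_poly q) u = u ^ m * poly q (1 / u)"
    using \<open>u \<noteq> 0\<close> by (simp add: poly_monom poly_reflect_poly_nz inverse_eq_divide)
next
  show "poly (monom 1 (m - degree q) * reflect_poly q) 0 = coeff q m"
    using assms by (cases "degree q = m") (auto simp: poly_monom coeff_eq_0)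
qed

text \<open>On a half disc a primitive of \<open>c/u + h\<close> is \<open>c log u\<close> up to a function continuous at \<open>0\<close>, where the
  logarithm is cut along the other half-plane.\<close>

lemma boundary_value_jump:
  fixes \<tau> :: real
  assumes H: "H = upper \<and> \<tau> = 1 \<or> H = lower \<and> \<tau> = -1" and \<rho>: "\<rho> > 0"
    and \<Phi>: "\<And>u. u \<in> ball 0 \<rho> \<inter> H \<Longrightarrow> (\<Phi> has_field_derivative c / u + h u) (at u)"
    and H0: "\<And>u. u \<in> ball 0 \<rho> \<Longrightarrow> (H0 has_field_derivative h u) (at u)"
  shows "((\<lambda>t. boundary_value H \<Phi> (of_real (- t)) - boundary_value H \<Phi> (of_real t)) \<longlongrightarrow> \<i> * of_real (\<tau> * pi) * c) (at_right 0)"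
proof -
  \<comment> \<open>The factor - \<i> \<tau> turns \<open>H\<close> into the right half-plane, so
    the principal logarithm is holomorphic at every nonzero point of the closure of
    \<open>H\<close>.\<close>
  define l where "l = (\<lambda>u. Ln (- \<i> * of_real \<tau> * u))"
  have op: "open H" "convex H" and cl: "closure H = {u. \<tau> * Im u \<ge> 0}" and H': "H = {u. \<tau> * Im u > 0}"
    using H half_planes by (auto simp: upper_def lower_def)
  have \<tau>: "\<tau> \<noteq> 0" "\<tau> * \<tau> = 1" using H by auto
  have cut: "- \<i> * of_real \<tau> * u \<notin> \<real>\<^sub>\<le>\<^sub>0" if "u \<noteq> 0" "\<tau> * Im u \<ge> 0" for u
  proof
    assume "- \<i> * of_real \<tau> * u \<in> \<real>\<^sub>\<le>\<^sub>0"
    hence "\<tau> * Im u \<le> 0" "\<tau> * Re u = 0" by (auto simp: complex_nonpos_Reals_iff)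
    hence "Im u = 0" "Re u = 0" using that \<tau> by auto
    thus False using that by (simp add: complex_eq_iff)
  qed
  have dl: "(l has_field_derivative 1 / u) (at u)" if "u \<noteq> 0" "\<tau> * Im u \<ge> 0" for u
    unfolding l_def using cut[OF that] that \<tau> by (auto intro!: derivative_eq_intros simp: field_simps)
  have "((\<lambda>u. \<Phi> u - (c * l u + H0 u)) has_field_derivative 0) (at u within (ball 0 \<rho> \<inter> H))" if u: "u \<in> ball 0 \<rho> \<inter> H" for u
  proof -
    have "u \<noteq> 0" "\<tau> * Im u \<ge> 0" using u by (auto simp: H')
    hence "((\<lambda>u. c * l u + H0 u) has_field_derivative c / u + h u) (at u)"
      using dl H0 u by (auto intro!: derivative_eq_intros)
    from DERIV_diff[OF \<Phi>[OF u] this] show ?thesis by (simp add: has_field_derivative_at_within)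
  qed
  from has_field_derivative_zero_constant[OF convex_Int[OF convex_ball op(2)] this]
  obtain C where C: "\<And>u. u \<in> ball 0 \<rho> \<inter> H \<Longrightarrow> \<Phi> u - (c * l u + H0 u) = C" by blast
  define K where "K = (\<lambda>u. c * l u + H0 u + C)"
  have "isCont l u" if "u \<in> (ball 0 \<rho> - {0}) \<inter> closure H" for u
    using dl[of u] that DERIV_isCont by (auto simp: cl)
  moreover have "isCont H0 u" if "u \<in> ball 0 \<rho>" for u using H0[OF that] DERIV_isCont by blast
  ultimately have "continuous_on ((ball 0 \<rho> - {0}) \<inter> closure H) K"
    unfolding K_def by (intro continuous_intros continuous_at_imp_continuous_on) auto
  hence bv: "boundary_value H \<Phi> u = K u" if "u \<in> (ball 0 \<rho> - {0}) \<inter> closure H" for u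
    using that op C
    by (intro boundary_value_local(1)[where B = "ball 0 \<rho> - {0}"]) (auto simp: K_def algebra_simps open_Diff)
  \<comment> \<open>After that rotation the arguments at - t and t are \<tau>\<pi>/2 and
    -\<tau>\<pi>/2.\<close>
  have l2: "l (of_real (- t)) - l (of_real t) = \<i> * of_real (\<tau> * pi)" if "t > 0" for t
    using H Ln_times_of_real[OF that, of \<i>] Ln_times_of_real[OF that, of "- \<i>"]
    by (auto simp: l_def mult_ac)
  have "\<forall>\<^sub>F t in at_right 0. t \<in> {0<..<\<rho>}" using \<rho> by (rule eventually_at_right_real)
  hence ev: "\<forall>\<^sub>F t in at_right 0. c * (\<i> * of_real (\<tau> * pi)) + (H0 (of_real (- t)) - H0 (of_real t)) =
      boundary_value H \<Phi> (of_real (- t)) - boundary_value H \<Phi> (of_real t)"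
  proof eventually_elim
    case (elim t)
    have "boundary_value H \<Phi> (of_real (- t)) = K (of_real (- t))" "boundary_value H \<Phi> (of_real t) = K (of_real t)"
      using elim by (intro bv; simp add: cl)+
    moreover have "K (of_real (- t)) - K (of_real t) =
        c * (l (of_real (- t)) - l (of_real t)) + (H0 (of_real (- t)) - H0 (of_real t))"
      by (simp add: K_def algebra_simps)
    ultimately show ?case using l2[of t] elim by simp
  qed
  have "isCont H0 0" using H0[of 0] \<rho> DERIV_isCont by auto
  hence "((\<lambda>t. H0 (of_real (- t)) - H0 (of_real t)) \<longlongrightarrow> H0 0 - H0 0) (at_right (0::real))"
    by (intro tendsto_diff isCont_tendsto_compose[of 0 H0]) (auto intro!: tendsto_eq_intros)
  hence "((\<lambda>t. c * (\<i> * of_real (\<tau> * pi)) + (H0 (of_real (- t)) - H0 (of_real t))) \<longlongrightarrow>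
      c * (\<i> * of_real (\<tau> * pi)) + (H0 0 - H0 0)) (at_right (0::real))"
    by (intro tendsto_add tendsto_const)
  from Lim_transform_eventually[OF this ev] show ?thesis by (simp add: mult_ac)
qed

section \<open>Connectedness, and primitives along the real axis\<close>

context real_hyperelliptic
begin

lemma connectedin_graph:
  assumes "connected S" "continuous_on S w" "\<And>z. z \<in> S \<Longrightarrow> (w z)\<^sup>2 = poly P z"
  shows "connectedin X ((\<lambda>z. Aff z (w z)) ` S)"
proof -
  have "continuous_map (top_of_set S) (top_of_set (aff_curve P)) (\<lambda>z. (z, w z))"
    using assms(2,3) by (auto simp: aff_curve_def continuous_map_in_subtopology intro!: continuous_intros)
  from continuous_map_compose[OF this continuous_map_Aff]
  have "continuous_map (top_of_set S) X (\<lambda>z. Aff z (w z))" by (simp add: o_def)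
  moreover have "connectedin (top_of_set S) S" using assms(1) by (simp add: connectedin_subtopology)
  ultimately show ?thesis by (rule connectedin_continuous_map_image)
qed

text \<open>The graphs of the four closed sheets are connected and all contain the branch point over
  \<open>a\<close>; their union is the affine curve, whose closure also contains the points over
  infinity.\<close>

lemma connected_X:
  assumes "B \<noteq> {}"
  shows "connected_space X"
proof -
  define wl where "wl = (\<lambda>z. cnj (branch (cnj z)))"
  define AF where "AF = {Aff z w | z w. w\<^sup>2 = poly P z}"
  define \<U> where "\<U> = {(\<lambda>z. Aff z (branch z)) ` closure upper, (\<lambda>z. Aff z (- branch z)) ` closure upper,
    (\<lambda>z. Aff z (wl z)) ` closure lower, (\<lambda>z. Aff z (- wl z)) ` closure lower}"
  obtain a where a: "a \<in> B" using assms by blast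
  have cu: "connected (closure upper)" and cl: "connected (closure lower)"
    by (intro convex_connected convex_closure half_planes)+
  have wl2: "(wl z)\<^sup>2 = poly P z" for z
  proof -
    have "cnj ((branch (cnj z))\<^sup>2) = poly P z" unfolding branch_square poly_P_cnj by simp
    thus ?thesis unfolding wl_def complex_cnj_power .
  qed
  have wlc: "continuous_on (closure lower) wl"
    unfolding wl_def
    by (intro continuous_intros continuous_on_compose2[OF continuous_on_branch]) (auto simp: half_planes)
  have conn: "connectedin X S" if "S \<in> \<U>" for S
    using that unfolding \<U>_def
    by (auto intro!: connectedin_graph cu cl continuous_intros continuous_on_branch wlc simp: branch_square wl2)
  have b0: "branch (of_real a) = 0" using a branch_eq_0_iff by blast
  hence "Aff (of_real a) 0 \<in> S" if "S \<in> \<U>" for S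
  proof -
    have "of_real a \<in> closure upper" "of_real a \<in> closure lower" by (auto simp: half_planes)
    moreover have "wl (of_real a) = 0" using b0 by (simp add: wl_def)
    ultimately show ?thesis using that b0 unfolding \<U>_def by (auto simp: image_iff intro!: bexI[of _ "of_real a"])
  qed
  hence "\<Inter> \<U> \<noteq> {}" by blast
  hence "connectedin X (\<Union> \<U>)" by (intro connectedin_Union conn)
  moreover have "\<Union> \<U> = AF"
  proof
    show "\<Union> \<U> \<subseteq> AF" by (auto simp: \<U>_def AF_def branch_square wl2)
    show "AF \<subseteq> \<Union> \<U>"
    proof
      fix q assume "q \<in> AF"
      then obtain z w where q: "q = Aff z w" "w\<^sup>2 = poly P z" by (auto simp: AF_def)
      have "w\<^sup>2 = (branch z)\<^sup>2" using q(2) branch_square by simp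
      hence "w = branch z \<or> w = - branch z" by (rule power2_eq_iff[THEN iffD1])
      moreover have "w\<^sup>2 = (wl z)\<^sup>2" using q(2) wl2 by simp
      hence "w = wl z \<or> w = - wl z" by (rule power2_eq_iff[THEN iffD1])
      moreover have "z \<in> closure upper \<or> z \<in> closure lower" by (auto simp: half_planes)
      ultimately show "q \<in> \<Union> \<U>" unfolding \<U>_def q(1) by blast
    qed
  qed
  ultimately have "connectedin X (X closure_of AF)" using connectedin_closure_of by simp
  moreover have "X closure_of AF = topspace X"
  proof (intro equalityI closure_of_subset_topspace subsetI)
    fix p assume p: "p \<in> topspace X"
    show "p \<in> X closure_of AF"
      unfolding in_closure_of
    proof (intro conjI allI impI p)
      fix T assume T: "p \<in> T \<and> openin X T"
      show "\<exists>y. y \<in> AF \<and> y \<in> T"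
      proof (cases p)
        case (Aff z w)
        thus ?thesis using T p by (intro exI[of _ p]) (auto simp: AF_def)
      next
        case (At_Inf v)
        have "p \<in> \<Union> (fst ` A)" unfolding charts_cover using p by simp
        then obtain c where c: "c \<in> A" "p \<in> fst c" by blast
        have "hyp_open P (fst c \<inter> T)" using T hyp_open_chart[OF c(1)] by (simp add: openin_Int flip: openin_hyp_top)
        from chart_restrict[OF c(1) this] have c': "(fst c \<inter> T, snd c) \<in> A" by simp
        obtain r V where V: "inf_param_at (fst c \<inter> T, snd c) v r V"
          using ex_inf_param[OF c', of v] T c(2) At_Inf by auto
        define u where "u = complex_of_real (r / 2)"
        have u: "u \<in> ball 0 r" "u \<noteq> 0" using V by (auto simp: u_def inf_param_at_def norm_divide)
        have "inf_param P (u, V u) \<in> fst c \<inter> T" using V u(1) by (simp add: inf_param_at_def)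
        moreover from this have "inf_param P (u, V u) \<in> hyp_carrier P" using chart_subset[OF c(1)] by blast
        hence "inf_param P (u, V u) \<in> AF" using u(2) by (auto simp: AF_def inf_param_nz)
        ultimately show ?thesis by blast
      qed
    qed
  qed
  ultimately show ?thesis by (simp add: connectedin_topspace del: topspace_X)
qed

text \<open>Away from the branch points z is a coordinate, so the local primitive continues across
  the real axis and may be differentiated along it.\<close>

lemma boundary_value_real_derivative:
  assumes \<rho>: "\<rho> holomorphic_on \<Omega>" "open \<Omega>" and F: "\<And>z. z \<in> upper \<Longrightarrow> (F has_field_derivative \<rho> z / branch z) (at z)"
    and x: "of_real x \<in> \<Omega>" "x \<notin> B"
  shows "((\<lambda>t. boundary_value upper F (of_real t)) has_vector_derivative \<rho> (of_real x) / branch (of_real x)) (at x)"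
proof -
  let ?x = "complex_of_real x"
  have s: "sheet \<rho> (upper, branch, F)" using F by (rule sheet_upper)
  have xu: "?x \<in> closure upper" by (simp add: half_planes)
  have w0: "branch ?x \<noteq> 0" "(branch ?x)\<^sup>2 = poly P ?x" using x(2) branch_square by (auto simp: branch_eq_0_iff)
  obtain c where c: "c \<in> A" "snd c = z_fun" "Aff ?x (branch ?x) \<in> fst c" using ex_z_chart[OF w0] by blast
  obtain r Z W N where a: "aff_param c (Aff ?x (branch ?x)) r Z W N"
      and ZW: "\<And>\<zeta>. \<zeta> \<in> ball (snd c (Aff ?x (branch ?x))) r \<Longrightarrow> (Z \<zeta>, W \<zeta>) \<in> \<Omega> \<times> UNIV"
    using ex_aff_param[OF c(1,3), of "\<Omega> \<times> UNIV"] x(1) \<rho>(2) by (auto simp: open_Times)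
  have "Z \<zeta> \<in> \<Omega>" if "\<zeta> \<in> ball (snd c (Aff ?x (branch ?x))) r" for \<zeta> using ZW[OF that] by simp
  from primitive_in_chart[OF a \<rho>(1) this]
  obtain G where G: "\<And>\<zeta>. \<zeta> \<in> ball (snd c (Aff ?x (branch ?x))) r \<Longrightarrow> (G has_field_derivative \<rho> (Z \<zeta>) * N \<zeta>) (at \<zeta>)"
    by blast
  obtain \<delta> C where \<delta>: "\<delta> > 0" "\<And>z. z \<in> ball ?x \<delta> \<inter> closure upper \<Longrightarrow> boundary_value upper F z = G z + C"
    using sheet_coordinate[OF s xu c(1) a G] c(2) by auto
  have in1: "?x \<in> ball (snd c (Aff ?x (branch ?x))) r" and ZWx: "Z ?x = ?x" "W ?x = branch ?x"
    using a c(2) by (auto simp: aff_param_def)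
  have "(Z has_field_derivative N ?x * W ?x) (at ?x)" using aff_paramD(5)[OF a in1] .
  moreover have "(Z has_field_derivative 1) (at ?x)"
    by (rule has_field_derivative_transform_within_open[OF DERIV_ident open_ball in1])
      (use aff_paramD(3)[OF a] c(2) in auto)
  ultimately have "N ?x * branch ?x = 1" using DERIV_unique ZWx by metis
  hence "N ?x = 1 / branch ?x" using w0 by (simp add: field_simps)
  hence "(G has_field_derivative \<rho> ?x / branch ?x) (at ?x)" using G[OF in1] ZWx by simp
  hence "((\<lambda>t. G (of_real t)) has_vector_derivative \<rho> ?x / branch ?x) (at x)"
    by (rule has_vector_derivative_real_field)
  hence d: "((\<lambda>t. G (of_real t) + C) has_vector_derivative \<rho> ?x / branch ?x) (at x)"
    by (auto intro!: derivative_eq_intros)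
  show ?thesis
  proof (rule has_vector_derivative_transform_within_open[OF d open_ball, of x \<delta>])
    fix t assume "t \<in> ball x \<delta>"
    hence "of_real t \<in> ball ?x \<delta> \<inter> closure upper" by (simp add: half_planes dist_real_def dist_norm norm_of_real flip: of_real_diff)
    thus "G (of_real t) + C = boundary_value upper F (of_real t)" using \<delta>(2) by simp
  qed (use \<delta> in simp)
qed

text \<open>The integrand may be unbounded at the end points when these are branch points. The
  boundary values are nevertheless continuous there, and the fundamental theorem needs the
  derivative only in the interior.\<close>

lemma boundary_value_FTC:
  assumes \<rho>: "\<rho> holomorphic_on \<Omega>" "open \<Omega>" and F: "\<And>z. z \<in> upper \<Longrightarrow> (F has_field_derivative \<rho> z / branch z) (at z)"
    and ab: "a \<le> b" "\<And>t. t \<in> {a..b} \<Longrightarrow> of_real t \<in> \<Omega>" "\<And>t. a < t \<Longrightarrow> t < b \<Longrightarrow> t \<notin> B"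
  shows "((\<lambda>t. \<rho> (of_real t) / branch (of_real t)) has_integral
    (boundary_value upper F (of_real b) - boundary_value upper F (of_real a))) {a..b}"
proof (rule fundamental_theorem_of_calculus_interior[OF ab(1)])
  have "continuous_on (closure upper \<inter> \<Omega>) (boundary_value upper F)"
    using boundary_value_sheet(1)[OF sheet_upper[OF F] \<rho>] .
  thus "continuous_on {a..b} (\<lambda>t. boundary_value upper F (of_real t))"
    using ab(2) by (intro continuous_on_compose2[of _ "boundary_value upper F" _ complex_of_real] continuous_intros)
      (auto simp: half_planes)
  fix t assume "t \<in> {a<..<b}"
  thus "((\<lambda>t. boundary_value upper F (of_real t)) has_vector_derivative \<rho> (of_real t) / branch (of_real t)) (at t)"
    using ab by (intro boundary_value_real_derivative[OF \<rho> F]) auto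
qed

lemma Re_boundary_value_constant:
  assumes \<rho>: "\<rho> holomorphic_on \<Omega>" "open \<Omega>" and F: "\<And>z. z \<in> upper \<Longrightarrow> (F has_field_derivative \<rho> z / branch z) (at z)"
    and ab: "a \<le> b" "\<And>t. t \<in> {a..b} \<Longrightarrow> of_real t \<in> \<Omega>" "\<And>t. a < t \<Longrightarrow> t < b \<Longrightarrow> t \<notin> B"
    and Re0: "\<And>t. a < t \<Longrightarrow> t < b \<Longrightarrow> Re (\<rho> (of_real t) / branch (of_real t)) = 0"
  shows "Re (boundary_value upper F (of_real b)) = Re (boundary_value upper F (of_real a))"
proof -
  have "((\<lambda>t. Re (\<rho> (of_real t) / branch (of_real t))) has_integral
      Re (boundary_value upper F (of_real b) - boundary_value upper F (of_real a))) {a..b}"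
    using has_integral_linear[OF boundary_value_FTC[OF assms(1-6)] bounded_linear_Re] by (simp add: o_def)
  moreover have "((\<lambda>t. Re (\<rho> (of_real t) / branch (of_real t))) has_integral 0) {a..b}"
    by (rule has_integral_spike_interior[of "\<lambda>_. 0" 0 a b, unfolded cbox_interval box_real]) (use Re0 in auto)
  ultimately have "Re (boundary_value upper F (of_real b) - boundary_value upper F (of_real a)) = 0"
    by (rule has_integral_unique)
  thus ?thesis by simp
qed

end

section \<open>Forms with simple poles at the ends\<close>

text \<open>The left side jumps across the real axis left of r, the right side does not: it is the
  continuation of the upper branch into a full disc.\<close>

lemma csqrt_minus_upper:
  assumes "Im z \<ge> 0" "Re z < r"
  shows "csqrt (z - of_real r) = \<i> * csqrt (of_real r - z)"
proof (rule csqrt_unique)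
  show "(\<i> * csqrt (of_real r - z))\<^sup>2 = z - of_real r" by (simp add: power_mult_distrib)
  show "0 < Re (\<i> * csqrt (of_real r - z)) \<or> Re (\<i> * csqrt (of_real r - z)) = 0 \<and> 0 \<le> Im (\<i> * csqrt (of_real r - z))"
  proof (cases "Im z = 0")
    case True
    hence "Im (of_real r - z) = 0" "Re (of_real r - z) \<ge> 0" using assms by auto
    hence "csqrt (of_real r - z) = sqrt (Re (of_real r - z))" by (rule csqrt_of_real_nonneg)
    thus ?thesis using assms True by simp
  next
    case False
    hence "Im z > 0" using assms by simp
    hence "(Re (of_real r - z))\<^sup>2 < (norm (of_real r - z))\<^sup>2" by (simp add: cmod_power2)
    hence "norm (of_real r - z) > Re (of_real r - z)" by (rule power2_less_imp_less) simp
    thus ?thesis using \<open>Im z > 0\<close> by (simp add: csqrt.simps)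
  qed
qed

text \<open>Squares agree, so only the sign is at stake. The roots of 1/u - r and 1/u lie in the
  open first quadrant, hence their quotient has positive real part; so does the last factor.\<close>

lemma csqrt_reciprocal_lower:
  assumes u: "Im u < 0" and r: "norm (of_real r * u) < 1"
  shows "csqrt (1 / u - of_real r) = csqrt (1 / u) * csqrt (1 - of_real r * u)"
proof -
  have u0: "u \<noteq> 0" using u by auto
  have "(Re u)\<^sup>2 + (Im u)\<^sup>2 > 0" using u by (simp add: sum_power2_gt_zero_iff)
  hence "Im (1 / u) > 0" using u by (simp add: Im_divide divide_neg_pos)
  hence im: "Im (1 / u) > 0" "Im (1 / u - of_real r) > 0" by auto
  have quad: "Re (csqrt x) > 0 \<and> Im (csqrt x) > 0" if "Im x > 0" for x
  proof -
    have "Im ((csqrt x)\<^sup>2) > 0" using that by simp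
    hence "Re (csqrt x) * Im (csqrt x) > 0"
      unfolding power2_eq_square times_complex.sel by (simp add: mult.commute del: csqrt.simps)
    moreover have "Re (csqrt x) \<ge> 0" using csqrt_principal[of x] by auto
    ultimately show ?thesis by (auto simp: zero_less_mult_iff simp del: csqrt.simps)
  qed
  define a where "a = csqrt (1 / u)"
  define b where "b = csqrt (1 / u - of_real r)"
  define d where "d = csqrt (1 - of_real r * u)"
  have a: "Re a > 0" "Im a > 0" and b: "Re b > 0" "Im b > 0" using quad im by (auto simp: a_def b_def simp del: csqrt.simps)
  have "Re (1 - of_real r * u) > 0" using abs_Re_le_cmod[of "of_real r * u"] r by simp
  hence "norm (1 - of_real r * u) + Re (1 - of_real r * u) > 0" using norm_ge_zero add_nonneg_pos by blast
  hence d: "Re d > 0" by (simp add: d_def)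
  have "b\<^sup>2 = (a * d)\<^sup>2" using u0 by (simp add: a_def b_def d_def power_mult_distrib field_simps del: csqrt.simps)
  hence "b = a * d \<or> b = - (a * d)" by (rule power2_eq_iff[THEN iffD1])
  moreover have "b \<noteq> - (a * d)"
  proof
    assume e: "b = - (a * d)"
    have "b * cnj a = - (of_real ((norm a)\<^sup>2) * d)"
      unfolding e complex_norm_square by simp
    hence "Re (b * cnj a) = - ((norm a)\<^sup>2 * Re d)" by simp
    moreover have "Re (b * cnj a) > 0" using a b by (simp add: add_pos_pos)
    moreover have "(norm a)\<^sup>2 * Re d \<ge> 0" using d by simp
    ultimately show False by linarith
  qed
  ultimately show ?thesis by (simp add: a_def b_def d_def)
qed

context hyperelliptic
begin

definition affine_ends_removed :: "hpoint set"
  where "affine_ends_removed = {Aff z w | z w. z \<noteq> 0 \<and> w\<^sup>2 = poly P z}"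

lemma affine_ends_removed_eq: "affine_ends_removed = topspace X - (points_over_0 P \<union> points_over_inf P)"
proof (intro set_eqI)
  fix p show "p \<in> affine_ends_removed \<longleftrightarrow> p \<in> topspace X - (points_over_0 P \<union> points_over_inf P)"
    by (cases p) (auto simp: affine_ends_removed_def points_over_0_def points_over_inf_def)
qed

lemma finite_ends: "finite (points_over_0 P)" "finite (points_over_inf P)"
proof -
  have fin: "finite {w :: complex. w\<^sup>2 = x}" for x
  proof -
    have "{w. w\<^sup>2 = x} \<subseteq> {csqrt x, - csqrt x}"
    proof
      fix w assume "w \<in> {w. w\<^sup>2 = x}"
      hence "w\<^sup>2 = (csqrt x)\<^sup>2" by simp
      hence "w = csqrt x \<or> w = - csqrt x" by (rule power2_eq_iff[THEN iffD1])
      thus "w \<in> {csqrt x, - csqrt x}" by simp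
    qed
    thus ?thesis using finite_subset by blast
  qed
  show "finite (points_over_0 P)" "finite (points_over_inf P)"
    using finite_imageI[OF fin, of "Aff 0"] finite_imageI[OF fin, of At_Inf]
    by (auto simp: points_over_0_def points_over_inf_def setcompr_eq_image)
qed

lemma ends_subset: "points_over_0 P \<union> points_over_inf P \<subseteq> topspace X"
  by (auto simp: points_over_0_def points_over_inf_def)

lemma openin_affine_ends_removed: "openin X affine_ends_removed"
proof -
  have "closedin X (points_over_0 P \<union> points_over_inf P)"
    using Hausdorff_X finite_ends ends_subset by (intro closedin_Hausdorff_finite) auto
  thus ?thesis unfolding affine_ends_removed_eq by (rule openin_diff[OF openin_topspace])
qed

text \<open>Encodes the form q(z) dz/(z w). Only points off the ends and the branch points are
  constrained, because elsewhere the value of f is a convention of division by zero.\<close>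

definition represents :: "(hpoint \<Rightarrow> complex) \<Rightarrow> complex poly \<Rightarrow> bool"
  where "represents f q \<longleftrightarrow> (\<forall>z w. z \<noteq> 0 \<longrightarrow> w \<noteq> 0 \<longrightarrow> w\<^sup>2 = poly P z \<longrightarrow> f (Aff z w) = poly q z / (z * w))"

lemma fdh_represents:
  assumes f: "represents f q" and a: "aff_param c p r Z W N" and Z: "\<And>\<zeta>. \<zeta> \<in> ball (snd c p) r \<Longrightarrow> Z \<zeta> \<noteq> 0"
    and \<zeta>: "\<zeta> \<in> ball (snd c p) r"
  shows "fdh f z_fun c \<zeta> = poly q (Z \<zeta>) / Z \<zeta> * N \<zeta>"
proof (rule fdh_affine[OF a _ _ \<zeta>])
  show "continuous_on (ball (snd c p) r) (\<lambda>\<zeta>. poly q (Z \<zeta>) / Z \<zeta>)"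
    using a Z by (intro continuous_intros holomorphic_on_imp_continuous_on) (auto simp: aff_param_def)
  fix \<xi> assume \<xi>: "\<xi> \<in> ball (snd c p) r" "W \<xi> \<noteq> 0"
  thus "f (Aff (Z \<xi>) (W \<xi>)) * W \<xi> = poly q (Z \<xi>) / Z \<xi>"
    using f Z[OF \<xi>(1)] aff_paramD(4)[OF a \<xi>(1)] unfolding represents_def by simp
qed

lemma fdh_dz_over_z:
  assumes f: "\<And>z w. f (Aff z w) = 1 / z" and a: "aff_param c p r Z W N" and Z: "\<And>\<zeta>. \<zeta> \<in> ball (snd c p) r \<Longrightarrow> Z \<zeta> \<noteq> 0"
    and \<zeta>: "\<zeta> \<in> ball (snd c p) r"
  shows "fdh f z_fun c \<zeta> = W \<zeta> / Z \<zeta> * N \<zeta>"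
proof (rule fdh_affine[OF a _ _ \<zeta>])
  show "continuous_on (ball (snd c p) r) (\<lambda>\<zeta>. W \<zeta> / Z \<zeta>)"
    using a Z by (intro continuous_intros holomorphic_on_imp_continuous_on) (auto simp: aff_param_def)
qed (simp add: f)

lemma ex_aff_param_nonzero:
  assumes "c \<in> A" "p \<in> fst c" "p \<in> affine_ends_removed"
  obtains r Z W N where "aff_param c p r Z W N" "\<And>\<zeta>. \<zeta> \<in> ball (snd c p) r \<Longrightarrow> Z \<zeta> \<noteq> 0"
proof -
  obtain z w where p: "p = Aff z w" "z \<noteq> 0" using assms(3) by (auto simp: affine_ends_removed_def)
  have "open ((- {0}) \<times> UNIV :: (complex \<times> complex) set)" by (intro open_Times) auto
  from ex_aff_param[OF assms(1) _ this, of z w] obtain r Z W N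
    where "aff_param c p r Z W N" "\<forall>\<zeta>\<in>ball (snd c p) r. (Z \<zeta>, W \<zeta>) \<in> (- {0}) \<times> UNIV"
    using p assms(2) by auto
  thus ?thesis using that by auto
qed

lemma represents_holomorphic:
  assumes "represents f q" shows "form_holomorphic_on A (fdh f z_fun) affine_ends_removed"
proof (rule form_holomorphic_onI)
  fix c p assume c: "c \<in> A" "p \<in> fst c" "p \<in> affine_ends_removed"
  obtain r Z W N where a: "aff_param c p r Z W N" and Z: "\<And>\<zeta>. \<zeta> \<in> ball (snd c p) r \<Longrightarrow> Z \<zeta> \<noteq> 0"
    using ex_aff_param_nonzero[OF c] by blast
  have "(\<lambda>\<zeta>. poly q (Z \<zeta>) / Z \<zeta> * N \<zeta>) holomorphic_on ball (snd c p) r"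
    using a Z by (intro holomorphic_intros) (auto simp: aff_param_def)
  thus "\<exists>r>0. \<exists>h. h holomorphic_on ball (snd c p) r \<and> (\<forall>\<zeta>\<in>ball (snd c p) r. fdh f z_fun c \<zeta> = h \<zeta>)"
    using fdh_represents[OF assms a Z] a by (intro exI[of _ r]) (auto simp: aff_param_def)
qed

lemma dz_over_z_holomorphic:
  assumes "\<And>z w. f (Aff z w) = 1 / z" shows "form_holomorphic_on A (fdh f z_fun) affine_ends_removed"
proof (rule form_holomorphic_onI)
  fix c p assume c: "c \<in> A" "p \<in> fst c" "p \<in> affine_ends_removed"
  obtain r Z W N where a: "aff_param c p r Z W N" and Z: "\<And>\<zeta>. \<zeta> \<in> ball (snd c p) r \<Longrightarrow> Z \<zeta> \<noteq> 0"
    using ex_aff_param_nonzero[OF c] by blast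
  have "(\<lambda>\<zeta>. W \<zeta> / Z \<zeta> * N \<zeta>) holomorphic_on ball (snd c p) r"
    using a Z by (intro holomorphic_intros) (auto simp: aff_param_def)
  thus "\<exists>r>0. \<exists>h. h holomorphic_on ball (snd c p) r \<and> (\<forall>\<zeta>\<in>ball (snd c p) r. fdh f z_fun c \<zeta> = h \<zeta>)"
    using fdh_dz_over_z[OF assms a Z] a by (intro exI[of _ r]) (auto simp: aff_param_def)
qed

text \<open>The real part of the integral of dz/z is log |z|, which is single-valued away from the
  ends.\<close>

lemma dz_over_z_multiplier:
  assumes f: "\<And>z w. f (Aff z w) = 1 / z"
  shows "has_multiplier A (fdh f z_fun) affine_ends_removed (\<lambda>x. of_real (Re x)) (\<lambda>q. of_real (norm (z_fun q)))"
  unfolding has_multiplier_def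
proof (intro ballI)
  fix c p assume c: "c \<in> A" and p: "p \<in> fst c \<inter> affine_ends_removed"
  obtain z0 w0 where p0: "p = Aff z0 w0" "z0 \<noteq> 0" using p by (auto simp: affine_ends_removed_def)
  have "open (ball z0 (norm z0) \<times> UNIV :: (complex \<times> complex) set)" by (intro open_Times) auto
  from ex_aff_param[OF c _ this, of z0 w0] obtain r Z W N
    where a: "aff_param c p r Z W N" and b: "\<forall>\<zeta>\<in>ball (snd c p) r. (Z \<zeta>, W \<zeta>) \<in> ball z0 (norm z0) \<times> UNIV"
    using p p0 by auto
  define G where "G = (\<lambda>\<zeta>. Ln (Z \<zeta> / z0))"
  have near: "Z \<zeta> \<noteq> 0" "Z \<zeta> / z0 \<notin> \<real>\<^sub>\<le>\<^sub>0" if "\<zeta> \<in> ball (snd c p) r" for \<zeta>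
  proof -
    have "norm (z0 - Z \<zeta>) < norm z0" using b that by (auto simp: dist_norm)
    hence "norm ((z0 - Z \<zeta>) / z0) < 1" using p0 by (simp add: norm_divide)
    hence "norm (1 - Z \<zeta> / z0) < 1" using p0 by (simp add: diff_divide_distrib)
    hence "Re (Z \<zeta> / z0) > 0" using abs_Re_le_cmod[of "1 - Z \<zeta> / z0"] by simp
    thus "Z \<zeta> / z0 \<notin> \<real>\<^sub>\<le>\<^sub>0" "Z \<zeta> \<noteq> 0" using complex_nonpos_Reals_iff by force+
  qed
  have r: "r > 0" and Zp: "Z (snd c p) = z0" using a p0 by (auto simp: aff_param_def)
  have "(G has_field_derivative fdh f z_fun c \<zeta>) (at \<zeta>)" if \<zeta>: "\<zeta> \<in> ball (snd c p) r" for \<zeta>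
  proof -
    have d: "(G has_field_derivative N \<zeta> * W \<zeta> / z0 / (Z \<zeta> / z0)) (at \<zeta>)"
      unfolding G_def using aff_paramD(5)[OF a \<zeta>] near[OF \<zeta>] p0(2)
      by (auto intro!: derivative_eq_intros simp: field_simps)
    have "fdh f z_fun c \<zeta> = W \<zeta> / Z \<zeta> * N \<zeta>" by (rule fdh_dz_over_z[OF f a near(1) \<zeta>])
    also have "\<dots> = N \<zeta> * W \<zeta> / z0 / (Z \<zeta> / z0)" using p0(2) near[OF \<zeta>] by (simp add: field_simps)
    finally show ?thesis using d by simp
  qed
  moreover have "complex_of_real (norm (z_fun q)) = of_real (norm (z_fun p)) * exp (of_real (Re (G (snd c q) - G (snd c p))))"
    if q: "q \<in> fst c" "snd c q \<in> ball (snd c p) r" for q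
  proof -
    have "q = Aff (Z (snd c q)) (W (snd c q))" using aff_paramD(1)[OF a q(2)] chart_inv_chart[OF c q(1)] by simp
    hence zq: "z_fun q = Z (snd c q)" by (metis z_fun.simps(1))
    have "Re (G (snd c q) - G (snd c p)) = ln (norm (z_fun q) / norm z0)"
      using near[OF q(2)] p0(2) by (simp add: G_def Zp zq norm_divide)
    moreover have "norm (z_fun q) = norm z0 * exp (ln (norm (z_fun q) / norm z0))"
      using near[OF q(2)] p0(2) by (simp add: zq)
    ultimately show ?thesis using p0(1) by (simp add: exp_of_real flip: of_real_mult)
  qed
  ultimately show "\<exists>r>0. \<exists>G. (\<forall>\<zeta>\<in>ball (snd c p) r. (G has_field_derivative fdh f z_fun c \<zeta>) (at \<zeta>)) \<and>
      (\<forall>q\<in>fst c \<inter> affine_ends_removed. snd c q \<in> ball (snd c p) r \<longrightarrow>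
         complex_of_real (norm (z_fun q)) = of_real (norm (z_fun p)) * exp (of_real (Re (G (snd c q) - G (snd c p)))))"
    using r by blast
qed

lemma dz_over_z_period:
  assumes f: "\<And>z w. f (Aff z w) = 1 / z"
    and \<gamma>: "has_form_integral A (fdh f z_fun) \<gamma> I" "\<gamma> ` {0..1} \<subseteq> affine_ends_removed" "\<gamma> 1 = \<gamma> 0"
  shows "Re I = 0"
proof -
  have "complex_of_real (norm (z_fun (\<gamma> 1))) = of_real (norm (z_fun (\<gamma> 0))) * exp (of_real (Re I))"
    by (rule multiplier_along_path[OF dz_over_z_multiplier[OF f] _ \<gamma>(1,2)]) auto
  moreover have "\<gamma> 0 \<in> affine_ends_removed" using \<gamma>(2) by auto
  hence "z_fun (\<gamma> 0) \<noteq> 0" by (auto simp: affine_ends_removed_def)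
  ultimately show ?thesis using \<gamma>(3) by (simp add: exp_of_real)
qed

text \<open>In the z-chart the forms are q(z)/W(z) dz/z with W nonzero, so the residue is q(0)/w0.
  The index \<open>j\<close> marks the one horizontal coordinate with a pole; its imaginary residue
  is what gives a real period.\<close>

lemma scherk_end_over_0:
  fixes f :: "3 \<Rightarrow> hpoint \<Rightarrow> complex" and q :: "3 \<Rightarrow> complex poly" and \<kappa> :: real and j :: 3
  assumes mero: "\<And>k. meromorphic_form A (fdh (f k) z_fun)"
    and f: "\<And>k. k \<noteq> 3 \<Longrightarrow> represents (f k) (q k)" and f3: "\<And>z w. f 3 (Aff z w) = 1 / z"
    and w0: "w0 \<noteq> 0" "w0\<^sup>2 = poly P 0"
    and j: "j \<noteq> 3" "poly (q j) 0 / w0 = \<i> * of_real \<kappa>" "\<kappa> \<noteq> 0"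
    and q0: "\<And>k. k \<noteq> 3 \<Longrightarrow> k \<noteq> j \<Longrightarrow> poly (q k) 0 = 0"
  shows "scherk_end A (\<lambda>k. fdh (f k) z_fun) (Aff 0 w0) (-1) (\<chi> k. if k = j then - 2 * pi * \<kappa> else 0)"
proof -
  obtain c where c: "c \<in> A" "snd c = z_fun" "Aff 0 w0 \<in> fst c" using ex_z_chart[OF w0] by blast
  have "open (UNIV \<times> (- {0}) :: (complex \<times> complex) set)" by (intro open_Times) auto
  from ex_aff_param[OF c(1,3) this] obtain r Z W N
    where a: "aff_param c (Aff 0 w0) r Z W N"
      and b: "\<forall>\<zeta>\<in>ball (snd c (Aff 0 w0)) r. (Z \<zeta>, W \<zeta>) \<in> UNIV \<times> (- {0})"
    using w0 by auto
  have p0: "snd c (Aff 0 w0) = 0" using c(2) by simp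
  have Z: "Z \<zeta> = \<zeta>" and W: "W \<zeta> \<noteq> 0" if "\<zeta> \<in> ball 0 r" for \<zeta>
    using aff_paramD(3)[OF a, unfolded p0, OF that] c(2) b that by (auto simp: p0)
  have r: "r > 0" "ball 0 r \<subseteq> chart_image c" "W holomorphic_on ball 0 r" "W 0 = w0"
    using a by (auto simp: aff_param_def p0)
  have NW: "N \<zeta> * W \<zeta> = 1" if \<zeta>: "\<zeta> \<in> ball 0 r" for \<zeta>
  proof -
    have "(Z has_field_derivative 1) (at \<zeta>)"
      by (rule has_field_derivative_transform_within_open[OF DERIV_ident open_ball \<zeta>]) (simp add: Z)
    with aff_paramD(5)[OF a, unfolded p0, OF \<zeta>] show ?thesis by (rule DERIV_unique)
  qed
  have form: "fdh (f k) z_fun c \<zeta> = f k (Aff \<zeta> (W \<zeta>))"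
    if \<zeta>: "\<zeta> \<in> ball 0 r - {0}" and g: "continuous_on (ball 0 r - {0}) (\<lambda>\<zeta>. f k (Aff \<zeta> (W \<zeta>)))" for k \<zeta>
    unfolding fdh_def
  proof (rule remove_sings_eqI)
    have op: "open (ball 0 r - {0 :: complex})" by auto
    have "isCont (\<lambda>\<zeta>. f k (Aff \<zeta> (W \<zeta>))) \<zeta>" using g \<zeta> op continuous_on_eq_continuous_at by blast
    hence "(\<lambda>\<zeta>. f k (Aff \<zeta> (W \<zeta>))) \<midarrow>\<zeta>\<rightarrow> f k (Aff \<zeta> (W \<zeta>))" by (simp add: isCont_def)
    moreover have "\<forall>\<^sub>F \<xi> in at \<zeta>. \<xi> \<in> ball 0 r - {0}" using op \<zeta> by (rule eventually_at_in_open')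
    hence "\<forall>\<^sub>F \<xi> in at \<zeta>. f k (Aff \<xi> (W \<xi>)) = f k (chart_inv c \<xi>) * deriv (z_fun \<circ> chart_inv c) \<xi>"
    proof eventually_elim
      case (elim \<xi>)
      hence \<xi>: "\<xi> \<in> ball 0 r" by simp
      have "((z_fun \<circ> chart_inv c) has_field_derivative 1) (at \<xi>)"
        by (rule has_field_derivative_transform_within_open[OF DERIV_ident open_ball \<xi>])
          (use aff_paramD(1)[OF a, unfolded p0] Z in auto)
      thus ?case using aff_paramD(1)[OF a, unfolded p0, OF \<xi>] Z[OF \<xi>] by (simp add: DERIV_imp_deriv)
    qed
    ultimately show "(\<lambda>\<xi>. f k (chart_inv c \<xi>) * deriv (z_fun \<circ> chart_inv c) \<xi>) \<midarrow>\<zeta>\<rightarrow> f k (Aff \<zeta> (W \<zeta>))"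
      by (rule Lim_transform_eventually)
  qed
  have "\<exists>h H. (\<forall>\<zeta>\<in>ball 0 r - {0}. fdh (f k) z_fun c \<zeta> = (if k = 3 then 1 else poly (q k) 0 / w0) / \<zeta> + h \<zeta>) \<and>
      (\<forall>\<zeta>\<in>ball 0 r. (H has_field_derivative h \<zeta>) (at \<zeta>))" for k
  proof (cases "k = 3")
    case True
    have "fdh (f 3) z_fun c \<zeta> = 1 / \<zeta>" if "\<zeta> \<in> ball 0 r - {0}" for \<zeta>
      using form[of \<zeta> 3] that by (simp add: f3 continuous_on_divide)
    thus ?thesis using True by (intro exI[of _ "\<lambda>_. 0"]) auto
  next
    case False
    have val: "f k (Aff \<zeta> (W \<zeta>)) = poly (q k) \<zeta> / W \<zeta> / \<zeta>" if \<zeta>: "\<zeta> \<in> ball 0 r - {0}" for \<zeta>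
    proof -
      have "(W \<zeta>)\<^sup>2 = poly P \<zeta>" using aff_paramD(4)[OF a, unfolded p0, of \<zeta>] Z[of \<zeta>] \<zeta> by simp
      thus ?thesis using f[OF False] \<zeta> W[of \<zeta>] unfolding represents_def by (simp add: mult.commute)
    qed
    have hol: "(\<lambda>\<zeta>. poly (q k) \<zeta> / W \<zeta>) holomorphic_on ball 0 r"
      using r(3) W by (intro holomorphic_intros) auto
    have "continuous_on (ball 0 r - {0}) (\<lambda>\<zeta>. poly (q k) \<zeta> / W \<zeta> / \<zeta>)"
      by (rule continuous_on_divide[OF continuous_on_subset[OF holomorphic_on_imp_continuous_on[OF hol]] continuous_on_id]) auto
    hence "continuous_on (ball 0 r - {0}) (\<lambda>\<zeta>. f k (Aff \<zeta> (W \<zeta>)))"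
      by (rule continuous_on_eq) (simp add: val)
    hence fk: "fdh (f k) z_fun c \<zeta> = poly (q k) \<zeta> / W \<zeta> / \<zeta>" if "\<zeta> \<in> ball 0 r - {0}" for \<zeta>
      using form[OF that] val[OF that] by simp
    obtain h H where "\<And>\<zeta>. \<zeta> \<in> ball 0 r - {0} \<Longrightarrow> poly (q k) \<zeta> / W \<zeta> / \<zeta> = poly (q k) 0 / W 0 / \<zeta> + h \<zeta>"
        "\<And>\<zeta>. \<zeta> \<in> ball 0 r \<Longrightarrow> (H has_field_derivative h \<zeta>) (at \<zeta>)"
      using simple_pole_split[OF hol] by blast
    thus ?thesis using fk False r(4) by (intro exI[of _ h] exI[of _ H]) auto
  qed
  then obtain h H where hH: "\<And>k \<zeta>. \<zeta> \<in> ball 0 r - {0} \<Longrightarrow> fdh (f k) z_fun c \<zeta> = (if k = 3 then 1 else poly (q k) 0 / w0) / \<zeta> + h k \<zeta>"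
      "\<And>k \<zeta>. \<zeta> \<in> ball 0 r \<Longrightarrow> (H k has_field_derivative h k \<zeta>) (at \<zeta>)"
    by metis
  have hol: "form_holomorphic_on A (fdh (f k) z_fun) affine_ends_removed" for k
    using represents_holomorphic[OF f] dz_over_z_holomorphic[of "f 3", OF f3] by (cases "k = 3") auto
  have "q' \<in> affine_ends_removed" if q': "q' \<in> fst c" "snd c q' \<in> ball 0 r" "q' \<noteq> Aff 0 w0" for q'
  proof -
    define x where "x = snd c q'"
    have x: "x \<in> ball 0 r" using q'(2) by (simp add: x_def)
    have "q' = Aff (Z x) (W x)"
      using chart_inv_chart[OF c(1) q'(1)] aff_paramD(1)[OF a, unfolded p0, OF x] by (simp add: x_def)
    hence e: "q' = Aff x (W x)" using Z[OF x] by simp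
    hence "x \<noteq> 0" using q'(3) r(4) by auto
    moreover have "(W x)\<^sup>2 = poly P x" using chart_subset[OF c(1)] q'(1) unfolding e by auto
    ultimately show ?thesis unfolding e affine_ends_removed_def by blast
  qed
  from scherk_endI[OF mero hol openin_affine_ends_removed c(1,3) p0 r(1,2) this hH, where \<sigma> = "-1" and \<kappa> = \<kappa> and j = j]
  show ?thesis using j q0 by auto
qed

text \<open>With z = 1/u one has dz/z = - du/u and w = V/u^m, so the form is - q'(u)/V du/u, where
  q' is the reflection of q to degree m. Hence the residue is minus the coefficient of degree m,
  divided by \<open>v0\<close>.\<close>

lemma scherk_end_over_inf:
  fixes f :: "3 \<Rightarrow> hpoint \<Rightarrow> complex" and q :: "3 \<Rightarrow> complex poly" and \<kappa> :: real and j :: 3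
  assumes mero: "\<And>k. meromorphic_form A (fdh (f k) z_fun)"
    and f: "\<And>k. k \<noteq> 3 \<Longrightarrow> represents (f k) (q k)" and f3: "\<And>z w. f 3 (Aff z w) = 1 / z"
    and deg: "\<And>k. k \<noteq> 3 \<Longrightarrow> degree (q k) \<le> m"
    and v0: "v0\<^sup>2 = lead_coeff P"
    and j: "j \<noteq> 3" "- coeff (q j) m / v0 = \<i> * of_real \<kappa>" "\<kappa> \<noteq> 0"
    and q0: "\<And>k. k \<noteq> 3 \<Longrightarrow> k \<noteq> j \<Longrightarrow> coeff (q k) m = 0"
  shows "scherk_end A (\<lambda>k. fdh (f k) z_fun) (At_Inf v0) 1 (\<chi> k. if k = j then - 2 * pi * \<kappa> else 0)"
proof -
  obtain c where c: "c \<in> A" "snd c = u_fun" "At_Inf v0 \<in> fst c" using ex_u_chart[OF v0] by blast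
  obtain r V where V: "inf_param_at c v0 r V" using ex_inf_param[OF c(1,3)] by blast
  have p0: "snd c (At_Inf v0) = 0" using c(2) by simp
  have r: "r > 0" "ball 0 r \<subseteq> chart_image c" "V holomorphic_on ball 0 r" "V 0 = v0"
    and Vnz: "\<And>\<zeta>. \<zeta> \<in> ball 0 r \<Longrightarrow> V \<zeta> \<noteq> 0"
    and inv: "\<And>\<zeta>. \<zeta> \<in> ball 0 r \<Longrightarrow> chart_inv c \<zeta> = inf_param P (\<zeta>, V \<zeta>)"
    and inc: "\<And>\<zeta>. \<zeta> \<in> ball 0 r \<Longrightarrow> inf_param P (\<zeta>, V \<zeta>) \<in> fst c"
    using V by (auto simp: inf_param_at_def)
  have op: "open (ball 0 r - {0 :: complex})" by auto
  have memP: "(V \<xi> / \<xi> ^ m)\<^sup>2 = poly P (1 / \<xi>)" if "\<xi> \<in> ball 0 r - {0}" for \<xi>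
    using inc[of \<xi>] chart_subset[OF c(1)] that by (auto simp: inf_param_nz)
  have "\<exists>h H. (\<forall>\<zeta>\<in>ball 0 r - {0}. fdh (f k) z_fun c \<zeta> = (if k = 3 then -1 else - coeff (q k) m / v0) / \<zeta> + h \<zeta>) \<and>
      (\<forall>\<zeta>\<in>ball 0 r. (H has_field_derivative h \<zeta>) (at \<zeta>))" for k
  proof (cases "k = 3")
    case True
    have "fdh (f 3) z_fun c \<zeta> = - 1 / \<zeta>" if "\<zeta> \<in> ball 0 r - {0}" for \<zeta>
    proof (rule fdh_infinite[OF V op _ that])
      fix \<xi> :: complex assume "\<xi> \<in> ball 0 r - {0}" "\<xi> \<noteq> 0"
      thus "- f 3 (inf_param P (\<xi>, V \<xi>)) / \<xi>\<^sup>2 = - 1 / \<xi>"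
        by (simp add: inf_param_nz f3 power2_eq_square)
    qed (auto intro!: continuous_intros)
    thus ?thesis using True by (intro exI[of _ "\<lambda>_. 0"]) auto
  next
    case False
    obtain q' where q': "\<And>u. u \<noteq> 0 \<Longrightarrow> poly q' u = u ^ m * poly (q k) (1 / u)" "poly q' 0 = coeff (q k) m"
      using padded_reflection[OF deg[OF False]] by blast
    have hol: "(\<lambda>\<zeta>. - poly q' \<zeta> / V \<zeta>) holomorphic_on ball 0 r"
      using r(3) Vnz by (intro holomorphic_intros) auto
    have fk: "fdh (f k) z_fun c \<zeta> = - poly q' \<zeta> / V \<zeta> / \<zeta>" if "\<zeta> \<in> ball 0 r - {0}" for \<zeta>
    proof (rule fdh_infinite[OF V op _ that])
      fix \<xi> :: complex assume \<xi>: "\<xi> \<in> ball 0 r - {0}" "\<xi> \<noteq> 0"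
      have "f k (Aff (1 / \<xi>) (V \<xi> / \<xi> ^ m)) = poly (q k) (1 / \<xi>) / (1 / \<xi> * (V \<xi> / \<xi> ^ m))"
        using f[OF False] \<xi> Vnz[of \<xi>] memP[of \<xi>] unfolding represents_def by simp
      thus "- f k (inf_param P (\<xi>, V \<xi>)) / \<xi>\<^sup>2 = - poly q' \<xi> / V \<xi> / \<xi>"
        using \<xi> Vnz[of \<xi>] by (simp add: inf_param_nz q'(1) power2_eq_square field_simps)
    next
      show "continuous_on (ball 0 r - {0}) (\<lambda>\<zeta>. - poly q' \<zeta> / V \<zeta> / \<zeta>)"
        by (rule continuous_on_divide[OF continuous_on_subset[OF holomorphic_on_imp_continuous_on[OF hol]] continuous_on_id]) auto
    qed auto
    obtain h H where "\<And>\<zeta>. \<zeta> \<in> ball 0 r - {0} \<Longrightarrow> - poly q' \<zeta> / V \<zeta> / \<zeta> = - poly q' 0 / V 0 / \<zeta> + h \<zeta>"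
        "\<And>\<zeta>. \<zeta> \<in> ball 0 r \<Longrightarrow> (H has_field_derivative h \<zeta>) (at \<zeta>)"
      using simple_pole_split[OF hol] by blast
    thus ?thesis using fk False r(4) q'(2) by (intro exI[of _ h] exI[of _ H]) auto
  qed
  then obtain h H where hH: "\<And>k \<zeta>. \<zeta> \<in> ball 0 r - {0} \<Longrightarrow> fdh (f k) z_fun c \<zeta> = (if k = 3 then -1 else - coeff (q k) m / v0) / \<zeta> + h k \<zeta>"
      "\<And>k \<zeta>. \<zeta> \<in> ball 0 r \<Longrightarrow> (H k has_field_derivative h k \<zeta>) (at \<zeta>)"
    by metis
  have hol: "form_holomorphic_on A (fdh (f k) z_fun) affine_ends_removed" for k
    using represents_holomorphic[OF f] dz_over_z_holomorphic[of "f 3", OF f3] by (cases "k = 3") auto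
  have "p \<in> affine_ends_removed" if p: "p \<in> fst c" "snd c p \<in> ball 0 r" "p \<noteq> At_Inf v0" for p
  proof -
    define x where "x = snd c p"
    have x: "x \<in> ball 0 r" using p(2) by (simp add: x_def)
    have e: "p = inf_param P (x, V x)"
      using chart_inv_chart[OF c(1) p(1)] inv[OF x] by (simp add: x_def)
    hence nz: "x \<noteq> 0" using p(3) r(4) by auto
    thus ?thesis using memP[of x] x unfolding e inf_param_nz[OF nz] affine_ends_removed_def by auto
  qed
  from scherk_endI[OF mero hol openin_affine_ends_removed c(1,3) p0 r(1,2) this hH, where \<sigma> = 1 and \<kappa> = \<kappa> and j = j]
  show ?thesis using j q0 by auto
qed

end

section \<open>Moment integrals between branch points\<close>

text \<open>The modulus of \<open>branch\<close> on the real axis, the weight of all moment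
  integrals.\<close>

definition root_dist :: "real set \<Rightarrow> real \<Rightarrow> real"
  where "root_dist B x = (\<Prod>r\<in>B. sqrt \<bar>x - r\<bar>)"

lemma root_dist_nonneg: "root_dist B x \<ge> 0"
  by (simp add: root_dist_def prod_nonneg)

lemma root_dist_pos: "finite B \<Longrightarrow> x \<notin> B \<Longrightarrow> root_dist B x > 0"
  unfolding root_dist_def by (intro prod_pos) auto

lemma continuous_on_root_dist: "continuous_on S (root_dist B)"
  unfolding root_dist_def by (intro continuous_intros)

text \<open>A primitive is the arcsine after the affine map that takes the interval to
  [-1, 1].\<close>

lemma arcsine_density_integrable:
  fixes a b :: real
  assumes "a < b"
  shows "(\<lambda>x. 1 / (sqrt \<bar>x - a\<bar> * sqrt \<bar>x - b\<bar>)) absolutely_integrable_on {a..b}"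
proof (rule nonnegative_absolutely_integrable_1)
  define y where "y = (\<lambda>x. (2 * x - a - b) / (b - a))"
  have "((\<lambda>x. 1 / (sqrt \<bar>x - a\<bar> * sqrt \<bar>x - b\<bar>)) has_integral arcsin (y b) - arcsin (y a)) {a..b}"
  proof (rule fundamental_theorem_of_calculus_interior)
    show "continuous_on {a..b} (\<lambda>x. arcsin (y x))"
      using assms by (intro continuous_on_arcsin) (auto simp: y_def field_simps intro!: continuous_intros)
    fix x assume x: "x \<in> {a<..<b}"
    have y: "- 1 < y x" "y x < 1" using x assms by (auto simp: y_def field_simps)
    have "(y has_real_derivative 2 / (b - a)) (at x)"
      unfolding y_def by (rule DERIV_cdivide) (auto intro!: derivative_eq_intros)
    from DERIV_chain2[OF DERIV_arcsin[OF y] this]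
    have "((\<lambda>x. arcsin (y x)) has_real_derivative inverse (sqrt (1 - (y x)\<^sup>2)) * (2 / (b - a))) (at x)" .
    moreover have "inverse (sqrt (1 - (y x)\<^sup>2)) * (2 / (b - a)) = 1 / (sqrt \<bar>x - a\<bar> * sqrt \<bar>x - b\<bar>)"
    proof -
      have gen: "1 - (n / d)\<^sup>2 = (d\<^sup>2 - n\<^sup>2) / d\<^sup>2" if "d \<noteq> 0" for n d :: real
        using that by (simp add: power_divide diff_divide_distrib)
      have "1 - (y x)\<^sup>2 = ((b - a)\<^sup>2 - (2 * x - a - b)\<^sup>2) / (b - a)\<^sup>2"
        unfolding y_def by (rule gen) (use assms in simp)
      also have "(b - a)\<^sup>2 - (2 * x - a - b)\<^sup>2 = 2\<^sup>2 * (\<bar>x - a\<bar> * \<bar>x - b\<bar>)"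
        using x by (simp add: abs_if power2_eq_square algebra_simps)
      finally have e: "sqrt (1 - (y x)\<^sup>2) = 2 * (sqrt \<bar>x - a\<bar> * sqrt \<bar>x - b\<bar>) / (b - a)"
        using assms by (simp add: real_sqrt_divide real_sqrt_mult)
      have g: "inverse (2 * s / d) * (2 / d) = 1 / s" if "s \<noteq> 0" "d \<noteq> 0" for s d :: real
        using that by (simp add: field_simps)
      show ?thesis unfolding e by (rule g) (use assms x in auto)
    qed
    ultimately show "((\<lambda>x. arcsin (y x)) has_vector_derivative 1 / (sqrt \<bar>x - a\<bar> * sqrt \<bar>x - b\<bar>)) (at x)"
      by (simp add: has_real_derivative_iff_has_vector_derivative)
  qed (use assms in simp)
  thus "(\<lambda>x. 1 / (sqrt \<bar>x - a\<bar> * sqrt \<bar>x - b\<bar>)) integrable_on {a..b}" by blast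
qed simp

text \<open>The factors belonging to the two end points form the arcsine density; the remaining
  quotient is continuous, hence bounded, on the closed interval.\<close>

lemma root_dist_integrable:
  fixes p :: "real \<Rightarrow> real"
  assumes B: "finite B" "a \<in> B" "b \<in> B" and ab: "a < b" "\<And>x. a < x \<Longrightarrow> x < b \<Longrightarrow> x \<notin> B"
    and p: "continuous_on {a..b} p"
  shows "(\<lambda>x. p x / root_dist B x) absolutely_integrable_on {a..b}"
proof -
  define B' where "B' = B - {a, b}"
  have B': "B = insert a (insert b B')" "finite B'" "a \<notin> insert b B'" "b \<notin> B'"
    using B ab(1) by (auto simp: B'_def)
  have split: "root_dist B x = sqrt \<bar>x - a\<bar> * sqrt \<bar>x - b\<bar> * root_dist B' x" for x
    unfolding root_dist_def B'(1) using B'(2-4) by (simp add: mult.assoc)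
  have "x \<notin> B'" if "x \<in> {a..b}" for x using that ab(2)[of x] by (force simp: B'_def)
  hence nz: "root_dist B' x \<noteq> 0" if "x \<in> {a..b}" for x using root_dist_pos[OF B'(2), of x] that by force
  have cont: "continuous_on {a..b} (\<lambda>x. p x / root_dist B' x)"
    using nz by (intro continuous_intros p continuous_on_root_dist) auto
  have "(\<lambda>x. p x / root_dist B' x * (1 / (sqrt \<bar>x - a\<bar> * sqrt \<bar>x - b\<bar>))) absolutely_integrable_on {a..b}"
    by (intro absolutely_integrable_bounded_measurable_product_real arcsine_density_integrable ab(1)
        continuous_imp_measurable_on_sets_lebesgue cont compact_imp_bounded compact_continuous_image) auto
  moreover have "(\<lambda>x. p x / root_dist B' x * (1 / (sqrt \<bar>x - a\<bar> * sqrt \<bar>x - b\<bar>))) = (\<lambda>x. p x / root_dist B x)"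
    by (simp add: split mult_ac)
  ultimately show ?thesis by simp
qed

lemma root_dist_moments:
  assumes B: "finite B" "a \<in> B" "b \<in> B" and ab: "a < b" "\<And>x. a < x \<Longrightarrow> x < b \<Longrightarrow> x \<notin> B"
  defines "M \<equiv> \<lambda>p. integral {a..b} (\<lambda>x. p x / root_dist B x)"
  shows "M (\<lambda>_. 1) > 0" "M (\<lambda>x. x) \<le> b * M (\<lambda>_. 1)" "a * M (\<lambda>_. 1) \<le> M (\<lambda>x. x)"
proof -
  have int: "(\<lambda>x. p x / root_dist B x) integrable_on {a..b}" if "continuous_on {a..b} p" for p
    using root_dist_integrable[OF assms(1-5) that] by (simp add: absolutely_integrable_on_def)
  have i1: "(\<lambda>x. 1 / root_dist B x) integrable_on {a..b}" and ix: "(\<lambda>x. x / root_dist B x) integrable_on {a..b}"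
    by (intro int continuous_intros)+
  have ic: "(\<lambda>x. k * (1 / root_dist B x)) integrable_on {a..b}" for k
    using integrable_on_cmult_left[OF i1, of k] by simp
  show "M (\<lambda>x. x) \<le> b * M (\<lambda>_. 1)"
    unfolding M_def integral_mult_right[symmetric]
    by (rule integral_le[OF ix ic]) (use root_dist_nonneg in \<open>auto intro!: divide_right_mono\<close>)
  show "a * M (\<lambda>_. 1) \<le> M (\<lambda>x. x)"
    unfolding M_def integral_mult_right[symmetric]
    by (rule integral_le[OF ic ix]) (use root_dist_nonneg in \<open>auto intro!: divide_right_mono\<close>)
  obtain C where C: "\<And>x. x \<in> {a..b} \<Longrightarrow> root_dist B x \<le> C"
    using continuous_on_compact_norm_bound[OF compact_Icc continuous_on_root_dist] by (metis abs_le_D1 real_norm_def)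
  have "(a + b) / 2 \<notin> B" using ab by (intro ab(2)) auto
  hence "C > 0" using root_dist_pos[OF B(1)] C[of "(a + b) / 2"] ab(1) by (force intro: less_le_trans)
  \<comment> \<open>At the end points \<open>root_dist\<close> is 0 and its reciprocal is 0 as well,
    so the constant lower bound 1/C holds only in the interior and is replaced by 0 at the
    ends.\<close>
  define g where "g = (\<lambda>x. if x \<in> {a<..<b} then 1 / C else 0)"
  have "((\<lambda>_. 1 / C) has_integral (b - a) *\<^sub>R (1 / C)) {a..b}" using has_integral_const_real[of "1 / C" a b] ab(1) by simp
  hence g: "(g has_integral (b - a) *\<^sub>R (1 / C)) {a..b}"
    using has_integral_spike_interior[of "\<lambda>_. 1 / C" _ a b g] by (auto simp: g_def)
  have "(b - a) *\<^sub>R (1 / C) \<le> M (\<lambda>_. 1)"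
  proof (rule has_integral_le[OF g])
    show "((\<lambda>x. 1 / root_dist B x) has_integral M (\<lambda>_. 1)) {a..b}"
      using i1 by (simp add: M_def has_integral_integral)
    fix x assume "x \<in> {a..b}"
    thus "g x \<le> 1 / root_dist B x"
      using C[of x] root_dist_pos[OF B(1), of x] root_dist_nonneg[of B x] ab(2)[of x]
      by (auto simp: g_def intro!: divide_left_mono mult_pos_pos \<open>C > 0\<close>)
  qed
  moreover have "(b - a) *\<^sub>R (1 / C) > 0" using ab(1) \<open>C > 0\<close> by simp
  ultimately show "M (\<lambda>_. 1) > 0" by linarith
qed

text \<open>The weighted means of \<open>x\<close> over the two intervals are separated by \<open>[b, c]\<close>, so the determinant of
  the system is positive.\<close>

lemma moment_system_solvable:
  fixes p :: "real \<Rightarrow> real"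
  assumes B: "finite B" "a \<in> B" "b \<in> B" "c \<in> B" "d \<in> B" and ab: "a < b" "\<And>x. a < x \<Longrightarrow> x < b \<Longrightarrow> x \<notin> B"
    and cd: "c < d" "\<And>x. c < x \<Longrightarrow> x < d \<Longrightarrow> x \<notin> B" and bc: "b < c"
    and p: "continuous_on {a..b} p" "continuous_on {c..d} p"
  shows "\<exists>l m. integral {a..b} (\<lambda>x. (p x + l + m * x) / root_dist B x) = s \<and>
    integral {c..d} (\<lambda>x. (p x + l + m * x) / root_dist B x) = t"
proof -
  define M where "M = (\<lambda>a b p. integral {a..b} (\<lambda>x. p x / root_dist B x))"
  define A1 A2 M1 M2 where "A1 = M a b (\<lambda>_. 1)" and "A2 = M c d (\<lambda>_. 1)" and "M1 = M a b (\<lambda>x. x)" and "M2 = M c d (\<lambda>x. x)"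
  have lin: "M a' b' (\<lambda>x. p x + l + m * x) = M a' b' p + l * M a' b' (\<lambda>_. 1) + m * M a' b' (\<lambda>x. x)"
    if "a' \<in> B" "b' \<in> B" "a' < b'" "\<And>x. a' < x \<Longrightarrow> x < b' \<Longrightarrow> x \<notin> B" "continuous_on {a'..b'} p" for a' b' l m
  proof -
    have i: "(\<lambda>x. f x / root_dist B x) integrable_on {a'..b'}" if "continuous_on {a'..b'} f" for f
      using root_dist_integrable[OF B(1) \<open>a' \<in> B\<close> \<open>b' \<in> B\<close> \<open>a' < b'\<close> \<open>\<And>x. a' < x \<Longrightarrow> x < b' \<Longrightarrow> x \<notin> B\<close> that]
      by (simp add: absolutely_integrable_on_def)
    have "(\<lambda>x. (p x + l + m * x) / root_dist B x) =
        (\<lambda>x. p x / root_dist B x + l * (1 / root_dist B x) + m * (x / root_dist B x))"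
      by (simp add: add_divide_distrib)
    moreover have "(\<lambda>x. p x / root_dist B x) integrable_on {a'..b'}" "(\<lambda>x. 1 / root_dist B x) integrable_on {a'..b'}"
      "(\<lambda>x. x / root_dist B x) integrable_on {a'..b'}"
      by (intro i that continuous_intros)+
    hence "((\<lambda>x. p x / root_dist B x + l * (1 / root_dist B x) + m * (x / root_dist B x)) has_integral
        (M a' b' p + l * M a' b' (\<lambda>_. 1) + m * M a' b' (\<lambda>x. x))) {a'..b'}"
      unfolding M_def by (intro has_integral_add has_integral_mult_right integrable_integral)
    ultimately show ?thesis unfolding M_def by (metis (no_types, lifting) integral_unique)
  qed
  note m1 = root_dist_moments[OF B(1-3) ab] and m2 = root_dist_moments[OF B(1,4,5) cd]
  have pos: "A1 > 0" "A2 > 0" and le: "M1 \<le> b * A1" "c * A2 \<le> M2"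
    using m1 m2 by (auto simp: A1_def A2_def M1_def M2_def M_def)
  have "A2 * M1 \<le> A2 * (b * A1)" using le(1) pos(2) by (intro mult_left_mono) auto
  also have "\<dots> < A1 * (c * A2)" using bc pos by (simp add: mult_ac)
  also have "\<dots> \<le> A1 * M2" using le(2) pos(1) by (intro mult_left_mono) auto
  finally have det: "A1 * M2 - A2 * M1 \<noteq> 0" by simp
  define S T where "S = s - M a b p" and "T = t - M c d p"
  define l m where "l = (S * M2 - T * M1) / (A1 * M2 - A2 * M1)" and "m = (A1 * T - A2 * S) / (A1 * M2 - A2 * M1)"
  have "l * A1 + m * M1 = (S * (A1 * M2 - A2 * M1)) / (A1 * M2 - A2 * M1)"
    unfolding l_def m_def by (simp add: algebra_simps flip: add_divide_distrib diff_divide_distrib)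
  hence 1: "l * A1 + m * M1 = S" using det by simp
  have "l * A2 + m * M2 = (T * (A1 * M2 - A2 * M1)) / (A1 * M2 - A2 * M1)"
    unfolding l_def m_def by (simp add: algebra_simps flip: add_divide_distrib diff_divide_distrib)
  hence 2: "l * A2 + m * M2 = T" using det by simp
  have "M a b (\<lambda>x. p x + l + m * x) = s" "M c d (\<lambda>x. p x + l + m * x) = t"
    using lin[OF B(2,3) ab p(1), of l m] lin[OF B(4,5) cd p(2), of l m] 1 2
    by (simp_all add: S_def T_def A1_def A2_def M1_def M2_def)
  thus ?thesis unfolding M_def by blast
qed

lemma boundary_value_diff_const:
  assumes "open H" "z \<in> closure H" "(F \<longlongrightarrow> boundary_value H F z) (at z within H)"
  shows "boundary_value H (\<lambda>z. F z - c) z = boundary_value H F z - c"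
  using assms by (intro boundary_value_eqI tendsto_intros)

lemma real_hyperellipticI:
  assumes B: "finite B" "card B = 2 * m" and P: "P = (\<Prod>r\<in>B. [:- complex_of_real r, 1:])"
  shows "real_hyperelliptic P m B"
proof
  show "degree P = 2 * m" by (simp add: P degree_prod_sum_eq B)
  fix z assume "poly P z = 0"
  then obtain r where r: "r \<in> B" "z = of_real r" using B(1) by (auto simp: P poly_prod)
  define Q where "Q = (\<Prod>s\<in>B - {r}. [:- complex_of_real s, 1:])"
  have PQ: "P = [:- complex_of_real r, 1:] * Q" unfolding P Q_def by (rule prod.remove[OF B(1) r(1)])
  have "poly (pderiv P) z = poly Q z"
    unfolding PQ pderiv_mult by (simp add: r(2) pderiv_pCons)
  moreover have "poly Q z \<noteq> 0" using B(1) by (auto simp: Q_def poly_prod r(2))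
  ultimately show "poly (pderiv P) z \<noteq> 0" by simp
qed (use assms in auto)

section \<open>The branch of w on the real axis, near 0 and near infinity\<close>

context real_hyperelliptic
begin

lemma card_B: "card B = 2 * m"
proof -
  have "{z. poly P z = 0} = of_real ` B" using finite_B by (auto simp: poly_P)
  hence "card {z. poly P z = 0} = card B" by (simp add: card_image inj_on_def)
  thus ?thesis using card_roots_eq_degree[OF simple_roots] degree_P by simp
qed

text \<open>Every root above x gives a negative radicand and so a factor \<i>. The parity of their
  number decides whether w is real or imaginary.\<close>

lemma branch_of_real:
  "branch (of_real x) = \<i> ^ card {r \<in> B. x < r} * of_real (root_dist B x)"
proof -
  have "csqrt (of_real x - of_real r) = (if x < r then \<i> else 1) * of_real (sqrt \<bar>x - r\<bar>)" for r
    by (cases "x < r") (auto simp flip: of_real_diff)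
  hence "branch (of_real x) = (\<Prod>r\<in>B. if x < r then \<i> else 1) * of_real (root_dist B x)"
    by (simp add: branch_def root_dist_def prod.distrib)
  also have "(\<Prod>r\<in>B. if x < r then \<i> else 1) = \<i> ^ card {r \<in> B. x < r}"
    using finite_B by (simp add: prod.If_cases Int_def)
  finally show ?thesis .
qed

text \<open>The factors with positive r are replaced by \<i> csqrt(r - z), which agrees with them
  from above and is holomorphic across the axis; \<rho> does not exceed the distance from 0 to any
  root.\<close>

lemma branch_near_0:
  assumes B0: "0 \<notin> B"
  obtains \<rho> b where "\<rho> > 0" "b holomorphic_on ball 0 \<rho>" "\<And>z. z \<in> ball 0 \<rho> \<Longrightarrow> b z \<noteq> 0"
    "\<And>z. z \<in> ball 0 \<rho> \<inter> closure upper \<Longrightarrow> branch z = b z"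
proof -
  define \<rho> where "\<rho> = Min (insert 1 (abs ` B))"
  define b where "b = (\<lambda>z. \<Prod>r\<in>B. if r > 0 then \<i> * csqrt (of_real r - z) else csqrt (z - of_real r))"
  have \<rho>: "\<rho> > 0" using finite_B B0 unfolding \<rho>_def by (subst Min_gr_iff) auto
  have le: "\<rho> \<le> \<bar>r\<bar>" if "r \<in> B" for r unfolding \<rho>_def using finite_B that by (intro Min_le) auto
  have rez: "\<bar>Re z\<bar> < \<bar>r\<bar>" if "z \<in> ball 0 \<rho>" "r \<in> B" for z r
    using abs_Re_le_cmod[of z] le[OF that(2)] that(1) by simp
  have rp: "Re z < r" if "z \<in> ball 0 \<rho>" "r \<in> B" "r > 0" for z r using rez[OF that(1,2)] that(3) by simp
  have rn: "r < Re z" if "z \<in> ball 0 \<rho>" "r \<in> B" "\<not> r > 0" for z r using rez[OF that(1,2)] that(3) by simp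
  have "(\<lambda>z. if r > 0 then \<i> * csqrt (of_real r - z) else csqrt (z - of_real r)) holomorphic_on ball 0 \<rho>" if r: "r \<in> B" for r
  proof (cases "r > 0")
    case True
    have "of_real r - z \<notin> \<real>\<^sub>\<le>\<^sub>0" if "z \<in> ball 0 \<rho>" for z :: complex
      using rp[OF that r True] by (auto simp: complex_nonpos_Reals_iff)
    thus ?thesis using True by (auto intro!: holomorphic_intros)
  next
    case False
    have "z - of_real r \<notin> \<real>\<^sub>\<le>\<^sub>0" if "z \<in> ball 0 \<rho>" for z :: complex
      using rn[OF that r False] by (auto simp: complex_nonpos_Reals_iff)
    thus ?thesis using False by (auto intro!: holomorphic_intros)
  qed
  hence "b holomorphic_on ball 0 \<rho>" unfolding b_def by (intro holomorphic_on_prod)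
  moreover have "b z \<noteq> 0" if z: "z \<in> ball 0 \<rho>" for z
    unfolding b_def using finite_B rp[OF z] rn[OF z] by (fastforce simp: prod_zero_iff)
  moreover have "branch z = b z" if z: "z \<in> ball 0 \<rho> \<inter> closure upper" for z
    unfolding b_def branch_def
    using csqrt_minus_upper rp z by (intro prod.cong) (auto simp: half_planes)
  ultimately show ?thesis using that \<rho> by blast
qed

text \<open>Each of the 2m factors splits off csqrt(1/u), and the power 2m of that root is u^(-m).
  The normalization \<open>V 0 = 1\<close> fixes which sheet at infinity continues
  \<open>branch\<close>.\<close>

lemma branch_near_infinity:
  obtains \<rho> V where "\<rho> > 0" "V holomorphic_on ball 0 \<rho>" "V 0 = 1" "\<And>u. u \<in> ball 0 \<rho> \<Longrightarrow> V u \<noteq> 0"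
    "\<And>u. u \<in> ball 0 \<rho> \<inter> lower \<Longrightarrow> branch (1 / u) = V u / u ^ m"
proof -
  define \<rho> where "\<rho> = Min (insert 1 ((\<lambda>r. 1 / (\<bar>r\<bar> + 1)) ` B))"
  define V where "V = (\<lambda>u. \<Prod>r\<in>B. csqrt (1 - of_real r * u))"
  have \<rho>: "\<rho> > 0" using finite_B unfolding \<rho>_def by (subst Min_gr_iff) auto
  have small: "norm (of_real r * u) < 1" if "u \<in> ball 0 \<rho>" "r \<in> B" for u :: complex and r
  proof -
    have "\<rho> \<le> 1 / (\<bar>r\<bar> + 1)" unfolding \<rho>_def using finite_B that by (intro Min_le) auto
    hence "norm u < 1 / (\<bar>r\<bar> + 1)" using that by simp
    hence "norm u * (\<bar>r\<bar> + 1) < 1" by (simp add: field_simps)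
    thus ?thesis by (simp add: norm_mult algebra_simps) (use norm_ge_zero[of u] in linarith)
  qed
  have pos: "Re (1 - of_real r * u) > 0" if "u \<in> ball 0 \<rho>" "r \<in> B" for u r
    using abs_Re_le_cmod[of "of_real r * u"] small[OF that] by simp
  have "(\<lambda>u. csqrt (1 - of_real r * u)) holomorphic_on ball 0 \<rho>" if r: "r \<in> B" for r
  proof -
    have "1 - of_real r * u \<notin> \<real>\<^sub>\<le>\<^sub>0" if "u \<in> ball 0 \<rho>" for u :: complex
      using pos[OF that r] unfolding complex_nonpos_Reals_iff by linarith
    thus ?thesis by (intro holomorphic_intros)
  qed
  hence "V holomorphic_on ball 0 \<rho>" unfolding V_def by (intro holomorphic_on_prod)
  moreover have "V u \<noteq> 0" if u: "u \<in> ball 0 \<rho>" for u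
  proof -
    have "csqrt (1 - of_real r * u) \<noteq> 0" if "r \<in> B" for r
    proof -
      have "1 - of_real r * u \<noteq> 0" using pos[OF u that] by (metis less_irrefl zero_complex.sel(1))
      thus ?thesis by (simp only: csqrt_eq_0 not_False_eq_True)
    qed
    thus ?thesis unfolding V_def using finite_B by (simp add: prod_zero_iff)
  qed
  moreover have "branch (1 / u) = V u / u ^ m" if u: "u \<in> ball 0 \<rho> \<inter> lower" for u
  proof -
    have "branch (1 / u) = (\<Prod>r\<in>B. csqrt (1 / u) * csqrt (1 - of_real r * u))"
      unfolding branch_def
      by (intro prod.cong refl csqrt_reciprocal_lower) (use u small in \<open>auto simp: lower_def\<close>)
    also have "\<dots> = csqrt (1 / u) ^ (2 * m) * V u" by (simp add: prod.distrib V_def card_B)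
    also have "csqrt (1 / u) ^ (2 * m) = 1 / u ^ m" by (simp add: power_mult power_divide)
    finally show ?thesis by simp
  qed
  moreover have "V 0 = 1" by (simp add: V_def)
  ultimately show ?thesis using that \<rho> by blast
qed

text \<open>Passing above 0 from t to - t is a half turn, which contributes \<i> \<pi> times the
  residue of the form on this sheet.\<close>

lemma jump_at_0:
  assumes B0: "0 \<notin> B" and F: "\<And>z. z \<in> upper \<Longrightarrow> (F has_field_derivative poly q z / z / branch z) (at z)"
  shows "((\<lambda>t. boundary_value upper F (of_real (- t)) - boundary_value upper F (of_real t)) \<longlongrightarrow>
    \<i> * pi * (poly q 0 / branch 0)) (at_right 0)"
proof -
  obtain \<rho> b where b: "\<rho> > 0" "b holomorphic_on ball 0 \<rho>" "\<And>z. z \<in> ball 0 \<rho> \<Longrightarrow> b z \<noteq> 0"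
    "\<And>z. z \<in> ball 0 \<rho> \<inter> closure upper \<Longrightarrow> branch z = b z"
    using branch_near_0[OF B0] by blast
  have hol: "(\<lambda>z. poly q z / b z) holomorphic_on ball 0 \<rho>" using b by (intro holomorphic_intros) auto
  obtain h H where h: "\<And>z. z \<in> ball 0 \<rho> - {0} \<Longrightarrow> poly q z / b z / z = poly q 0 / b 0 / z + h z"
    "\<And>z. z \<in> ball 0 \<rho> \<Longrightarrow> (H has_field_derivative h z) (at z)"
    using simple_pole_split[OF hol] by blast
  have "(F has_field_derivative poly q 0 / b 0 / z + h z) (at z)" if z: "z \<in> ball 0 \<rho> \<inter> upper" for z
  proof -
    have "z \<in> ball 0 \<rho> - {0}" "z \<in> ball 0 \<rho> \<inter> closure upper" "z \<in> upper" using z by (auto simp: half_planes) (auto simp: upper_def)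
    hence "poly q z / z / branch z = poly q 0 / b 0 / z + h z" using h(1)[of z] b(4)[of z] by (simp add: field_simps)
    with F[of z] z show ?thesis by simp
  qed
  from boundary_value_jump[of upper 1, OF _ b(1) this h(2)]
  have "((\<lambda>t. boundary_value upper F (of_real (- t)) - boundary_value upper F (of_real t)) \<longlongrightarrow>
    \<i> * of_real (1 * pi) * (poly q 0 / b 0)) (at_right 0)" by simp
  moreover have "branch 0 = b 0" using b(1) by (intro b(4)) (auto simp: half_planes)
  ultimately show ?thesis by simp
qed

text \<open>The substitution z = 1/u exchanges the half-planes and turns dz/z into - du/u; the two
  signs cancel in the jump.\<close>

lemma jump_at_infinity:
  assumes deg: "degree q \<le> m" and F: "\<And>z. z \<in> upper \<Longrightarrow> (F has_field_derivative poly q z / z / branch z) (at z)"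
  shows "((\<lambda>t. boundary_value upper F (of_real (- 1 / t)) - boundary_value upper F (of_real (1 / t))) \<longlongrightarrow>
    \<i> * pi * coeff q m) (at_right 0)"
proof -
  obtain \<rho> V where V: "\<rho> > 0" "V holomorphic_on ball 0 \<rho>" "V 0 = 1" "\<And>u. u \<in> ball 0 \<rho> \<Longrightarrow> V u \<noteq> 0"
    "\<And>u. u \<in> ball 0 \<rho> \<inter> lower \<Longrightarrow> branch (1 / u) = V u / u ^ m"
    using branch_near_infinity by blast
  obtain q' where q': "\<And>u. u \<noteq> 0 \<Longrightarrow> poly q' u = u ^ m * poly q (1 / u)" "poly q' 0 = coeff q m"
    using padded_reflection[OF deg] by blast
  have hol: "(\<lambda>u. - poly q' u / V u) holomorphic_on ball 0 \<rho>" using V by (intro holomorphic_intros) auto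
  obtain h H where h: "\<And>u. u \<in> ball 0 \<rho> - {0} \<Longrightarrow> - poly q' u / V u / u = - poly q' 0 / V 0 / u + h u"
    "\<And>u. u \<in> ball 0 \<rho> \<Longrightarrow> (H has_field_derivative h u) (at u)"
    using simple_pole_split[OF hol] by blast
  have lu: "1 / u \<in> upper \<and> u \<noteq> 0" if "u \<in> lower" for u
  proof -
    have "(Re u)\<^sup>2 + (Im u)\<^sup>2 > 0" "u \<noteq> 0" using that by (auto simp: lower_def sum_power2_gt_zero_iff)
    thus ?thesis using that by (simp add: upper_def lower_def Im_divide divide_neg_pos)
  qed
  have "((\<lambda>u. F (1 / u)) has_field_derivative - coeff q m / u + h u) (at u)" if u: "u \<in> ball 0 \<rho> \<inter> lower" for u
  proof -
    have u0: "u \<noteq> 0" "1 / u \<in> upper" using lu u by auto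
    have "((\<lambda>u. 1 / u) has_field_derivative - 1 / u\<^sup>2) (at u)"
      using u0 by (auto intro!: derivative_eq_intros simp: power2_eq_square)
    from DERIV_chain2[OF F[OF u0(2)] this]
    have "((\<lambda>u. F (1 / u)) has_field_derivative poly q (1 / u) / (1 / u) / branch (1 / u) * (- 1 / u\<^sup>2)) (at u)" .
    also have "poly q (1 / u) / (1 / u) / branch (1 / u) * (- 1 / u\<^sup>2) = - poly q' u / V u / u"
      unfolding V(5)[OF u] using u0(1) V(4)[of u] u q'(1)[OF u0(1)] by (simp add: power2_eq_square field_simps)
    also have "\<dots> = - coeff q m / u + h u" using h(1)[of u] u u0 q'(2) V(3) by simp
    finally show ?thesis .
  qed
  from boundary_value_jump[of lower "-1", OF _ V(1) this h(2)]
  have j: "((\<lambda>t. boundary_value lower (\<lambda>u. F (1 / u)) (of_real (- t)) - boundary_value lower (\<lambda>u. F (1 / u)) (of_real t)) \<longlongrightarrow>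
    \<i> * of_real (- 1 * pi) * (- coeff q m)) (at_right 0)" by simp
  have bv: "boundary_value lower (\<lambda>u. F (1 / u)) (of_real t) = boundary_value upper F (of_real (1 / t))" if t: "t \<noteq> 0" for t :: real
  proof (rule boundary_value_eqI)
    have "(\<lambda>z. poly q z / z) holomorphic_on - {0}" by (intro holomorphic_intros) auto
    hence "(F \<longlongrightarrow> boundary_value upper F (of_real (1 / t))) (at (of_real (1 / t)) within upper)"
      using t by (intro boundary_value_sheet(3)[OF sheet_upper[OF F]]) (auto simp: half_planes)
    moreover have "filterlim (\<lambda>u. 1 / u) (at (of_real (1 / t)) within upper) (at (complex_of_real t) within lower)"
      unfolding filterlim_at
    proof
      show "\<forall>\<^sub>F u in at (complex_of_real t) within lower. 1 / u \<in> upper \<and> 1 / u \<noteq> of_real (1 / t)"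
        using lu t by (auto simp: eventually_at_filter divide_eq_eq intro!: always_eventually)
      show "((\<lambda>u. 1 / u) \<longlongrightarrow> of_real (1 / t)) (at (complex_of_real t) within lower)"
        using t by (auto intro!: tendsto_eq_intros)
    qed
    ultimately show "((\<lambda>u. F (1 / u)) \<longlongrightarrow> boundary_value upper F (of_real (1 / t))) (at (of_real t) within lower)"
      by (rule filterlim_compose)
  qed (auto simp: half_planes)
  have "\<forall>\<^sub>F t in at_right 0. boundary_value lower (\<lambda>u. F (1 / u)) (of_real (- t)) - boundary_value lower (\<lambda>u. F (1 / u)) (of_real t) =
      boundary_value upper F (of_real (- 1 / t)) - boundary_value upper F (of_real (1 / t))"
    using eventually_at_right_less[of "0::real"]
  proof eventually_elim
    case (elim t)
    thus ?case using bv[of t] bv[of "- t"] by simp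
  qed
  from Lim_transform_eventually[OF j this] show ?thesis by (simp add: mult_ac)
qed

end

section \<open>The Weierstrass data\<close>

locale doubly_periodic_data =
  fixes a1 a2 a3 a4 a5 b1 :: real
  assumes a: "0 < a1" "a1 < a2" "a2 < a3" "a3 < a4" "a4 < a5"
    and b1: "b1 = - (a1 * a4 * a5) / (a2 * a3)"
begin

definition B :: "real set" where "B = {b1, a1, a2, a3, a4, a5}"
definition P :: "complex poly" where "P = (\<Prod>r\<in>B. [:- complex_of_real r, 1:])"

lemma b1_neg: "b1 < 0"
  using a unfolding b1 by (simp add: field_simps)

lemma distinct: "b1 < a1" "b1 < a2" "b1 < a3" "b1 < a4" "b1 < a5" "a1 < a3" "a1 < a4" "a1 < a5" "a2 < a4" "a2 < a5" "a3 < a5"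
  using a b1_neg by linarith+

sublocale real_hyperelliptic P 3 B
  by (rule real_hyperellipticI) (use a distinct in \<open>auto simp: B_def P_def\<close>)

definition NP :: "complex poly" where "NP = [:- of_real a1, 1:] * [:- of_real a4, 1:] * [:- of_real a5, 1:]"
definition DP :: "complex poly" where "DP = [:- of_real a2, 1:] * [:- of_real a3, 1:] * [:- of_real b1, 1:]"
definition NR :: "real \<Rightarrow> real" where "NR x = (x - a1) * (x - a4) * (x - a5)"
definition DR :: "real \<Rightarrow> real" where "DR x = (x - a2) * (x - a3) * (x - b1)"

lemma P_factors: "P = [:- of_real b1, 1:] * [:- of_real a1, 1:] * [:- of_real a2, 1:] *
                [:- of_real a3, 1:] * [:- of_real a4, 1:] * [:- of_real a5, 1:]"
  unfolding P_def B_def using a distinct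
  by (simp add: prod.insert_if mult.assoc del: mult_pCons_left mult_pCons_right)

lemma P_eq: "poly P z = poly DP z * poly NP z"
  by (simp only: P_factors NP_def DP_def poly_mult mult_ac)

lemma poly_NP: "poly NP z = (z - a1) * (z - a4) * (z - a5)"
  by (simp add: NP_def poly_mult del: mult_pCons_left mult_pCons_right)

lemma poly_NP_DP_of_real: "poly NP (of_real x) = of_real (NR x)" "poly DP (of_real x) = of_real (DR x)"
  by (simp_all add: NP_def DP_def NR_def DR_def poly_mult del: mult_pCons_left mult_pCons_right)

lemma poly_NP_DP_cnj: "poly NP (cnj z) = cnj (poly NP z)" "poly DP (cnj z) = cnj (poly DP z)"
  by (simp_all add: NP_def DP_def poly_mult del: mult_pCons_left mult_pCons_right)

text \<open>Numerators over the common denominator z w. The correction term acquires a factor z, so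
  it affects neither the value at 0 nor the coefficient of degree 3: the ends do not depend on the
  parameters.\<close>

definition Q1 :: "real \<Rightarrow> real \<Rightarrow> complex poly"
  where "Q1 l m = smult (1/2) (DP - NP) + [:0, of_real l, of_real m:]"
definition Q2 :: "real \<Rightarrow> real \<Rightarrow> complex poly"
  where "Q2 l m = smult (\<i>/2) (DP + NP) + [:0, \<i> * of_real l, \<i> * of_real m:]"

lemma NP_DP_values: "DR 0 = a1 * a4 * a5" "NR 0 = - (a1 * a4 * a5)"
proof -
  have "b1 * (a2 * a3) = - (a1 * a4 * a5)" using a by (simp add: b1)
  thus "DR 0 = a1 * a4 * a5" by (simp add: DR_def mult_ac)
  show "NR 0 = - (a1 * a4 * a5)" by (simp add: NR_def)
qed

lemma Q_at_0: "poly (Q1 l m) 0 = of_real (a1 * a4 * a5)" "poly (Q2 l m) 0 = 0"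
  using poly_NP_DP_of_real[of 0] by (simp_all add: Q1_def Q2_def NP_DP_values)

lemma degree_NP_DP: "degree NP = 3" "degree DP = 3" "coeff NP 3 = 1" "coeff DP 3 = 1"
  by (simp_all add: NP_def DP_def numeral_3_eq_3)

lemma Q_degree: "degree (Q1 l m) \<le> 3" "degree (Q2 l m) \<le> 3" "coeff (Q1 l m) 3 = 0" "coeff (Q2 l m) 3 = \<i>"
proof -
  show "degree (Q1 l m) \<le> 3"
    unfolding Q1_def using degree_NP_DP
    by (intro degree_add_le order_trans[OF degree_smult_le] degree_diff_le) auto
  show "degree (Q2 l m) \<le> 3"
    unfolding Q2_def using degree_NP_DP
    by (intro degree_add_le order_trans[OF degree_smult_le]) auto
  show "coeff (Q1 l m) 3 = 0" "coeff (Q2 l m) 3 = \<i>"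
    using degree_NP_DP by (simp_all add: Q1_def Q2_def numeral_3_eq_3)
qed

lemma Q_cnj: "poly (Q1 l m) (cnj z) = cnj (poly (Q1 l m) z)" "poly (Q2 l m) (cnj z) = - cnj (poly (Q2 l m) z)"
  by (simp_all add: Q1_def Q2_def poly_NP_DP_cnj algebra_simps)

definition c1 :: "real \<Rightarrow> real" where "c1 x = (DR x - NR x) / (2 * x)"
definition c2 :: "real \<Rightarrow> real" where "c2 x = (DR x + NR x) / (2 * x)"

lemma Q_of_real:
  assumes "x \<noteq> 0"
  shows "poly (Q1 l m) (of_real x) / of_real x = 1 * of_real (c1 x + l + m * x)"
    and "poly (Q2 l m) (of_real x) / of_real x = \<i> * of_real (c2 x + l + m * x)"
  using assms by (simp_all add: Q1_def Q2_def poly_NP_DP_of_real c1_def c2_def field_simps)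

lemma continuous_on_c: "0 < s \<Longrightarrow> continuous_on {s..t} c1" "0 < s \<Longrightarrow> continuous_on {s..t} c2"
  unfolding c1_def c2_def DR_def NR_def by (intro continuous_intros; simp)+

section \<open>Integrals over the edges between branch points\<close>

lemma card_roots_above:
  "b1 < x \<Longrightarrow> x < a1 \<Longrightarrow> card {r \<in> B. x < r} = 5"
  "a1 < x \<Longrightarrow> x < a2 \<Longrightarrow> card {r \<in> B. x < r} = 4"
  "a2 < x \<Longrightarrow> x < a3 \<Longrightarrow> card {r \<in> B. x < r} = 3"
  "a3 < x \<Longrightarrow> x < a4 \<Longrightarrow> card {r \<in> B. x < r} = 2"
  "a4 < x \<Longrightarrow> x < a5 \<Longrightarrow> card {r \<in> B. x < r} = 1"
  "a5 < x \<Longrightarrow> card {r \<in> B. x < r} = 0"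
  "x < b1 \<Longrightarrow> card {r \<in> B. x < r} = 6"
proof -
  note o = a distinct
  have c: "{r \<in> B. x < r} = S \<Longrightarrow> card S = n \<Longrightarrow> card {r \<in> B. x < r} = n" for S n by simp
  show "b1 < x \<Longrightarrow> x < a1 \<Longrightarrow> card {r \<in> B. x < r} = 5"
    by (rule c[of "{a1, a2, a3, a4, a5}"]) (use o in \<open>auto simp: B_def\<close>)
  show "a1 < x \<Longrightarrow> x < a2 \<Longrightarrow> card {r \<in> B. x < r} = 4"
    by (rule c[of "{a2, a3, a4, a5}"]) (use o in \<open>auto simp: B_def\<close>)
  show "a2 < x \<Longrightarrow> x < a3 \<Longrightarrow> card {r \<in> B. x < r} = 3"
    by (rule c[of "{a3, a4, a5}"]) (use o in \<open>auto simp: B_def\<close>)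
  show "a3 < x \<Longrightarrow> x < a4 \<Longrightarrow> card {r \<in> B. x < r} = 2"
    by (rule c[of "{a4, a5}"]) (use o in \<open>auto simp: B_def\<close>)
  show "a4 < x \<Longrightarrow> x < a5 \<Longrightarrow> card {r \<in> B. x < r} = 1"
    by (rule c[of "{a5}"]) (use o in \<open>auto simp: B_def\<close>)
  show "a5 < x \<Longrightarrow> card {r \<in> B. x < r} = 0"
    by (rule c[of "{}"]) (use o in \<open>auto simp: B_def\<close>)
  show "x < b1 \<Longrightarrow> card {r \<in> B. x < r} = 6"
    by (rule c[of B]) (use o in \<open>auto simp: B_def\<close>)
qed

lemma i_powers: "\<i> ^ 3 = - \<i>" "\<i> ^ 4 = 1" "\<i> ^ 5 = \<i>" "\<i> ^ 6 = -1"
  by (simp_all add: eval_nat_numeral)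

text \<open>On an edge the phase of w is the constant \<open>\<i> ^ n\<close>, so the integrand is a
  constant times a real function; its values at the two end points are negligible.\<close>

lemma edge_integral:
  assumes ab: "s \<in> B" "t \<in> B" "s < t" "\<And>x. s < x \<Longrightarrow> x < t \<Longrightarrow> x \<notin> B"
    and n: "\<And>x. s < x \<Longrightarrow> x < t \<Longrightarrow> card {r \<in> B. x < r} = n" and p: "continuous_on {s..t} p"
    and \<phi>: "\<And>x. s < x \<Longrightarrow> x < t \<Longrightarrow> \<phi> (of_real x) = \<tau> * of_real (p x) / branch (of_real x)"
  shows "(\<lambda>x. \<phi> (of_real x)) absolutely_integrable_on {s..t}"
    and "((\<lambda>x. \<phi> (of_real x)) has_integral \<tau> / \<i> ^ n * of_real (integral {s..t} (\<lambda>x. p x / root_dist B x))) {s..t}"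
proof -
  define h where "h = (\<lambda>y. \<tau> / \<i> ^ n * complex_of_real y)"
  have h: "bounded_linear h" unfolding h_def by (intro bounded_linear_mult_right bounded_linear_of_real bounded_linear_const_mult)
  have i: "(\<lambda>x. p x / root_dist B x) absolutely_integrable_on {s..t}"
    by (rule root_dist_integrable[OF finite_B ab p])
  have eq: "\<phi> (of_real x) = (h \<circ> (\<lambda>x. p x / root_dist B x)) x" if "x \<in> {s..t} - {s, t}" for x
    using \<phi>[of x] n[of x] that by (simp add: h_def branch_of_real)
  have neg: "negligible {s, t}" by simp
  show "(\<lambda>x. \<phi> (of_real x)) absolutely_integrable_on {s..t}"
    by (rule absolutely_integrable_spike[OF absolutely_integrable_linear[OF i h] neg]) (use eq in auto)
  have "((h \<circ> (\<lambda>x. p x / root_dist B x)) has_integral h (integral {s..t} (\<lambda>x. p x / root_dist B x))) {s..t}"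
    using i h by (intro has_integral_linear) (auto simp: absolutely_integrable_on_def has_integral_integral)
  hence "((\<lambda>x. \<phi> (of_real x)) has_integral h (integral {s..t} (\<lambda>x. p x / root_dist B x))) {s..t}"
    by (rule has_integral_spike[OF neg, rotated]) (use eq in auto)
  thus "((\<lambda>x. \<phi> (of_real x)) has_integral \<tau> / \<i> ^ n * of_real (integral {s..t} (\<lambda>x. p x / root_dist B x))) {s..t}"
    by (simp add: h_def)
qed

lemma Re_times_of_real: "Re (c * of_real x) = Re c * x"
  by simp

lemma edge_re_integral:
  assumes "s \<in> B" "t \<in> B" "s < t" "\<And>x. s < x \<Longrightarrow> x < t \<Longrightarrow> x \<notin> B"
    "\<And>x. s < x \<Longrightarrow> x < t \<Longrightarrow> card {r \<in> B. x < r} = n" "continuous_on {s..t} p"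
    "\<And>x. s < x \<Longrightarrow> x < t \<Longrightarrow> \<phi> (of_real x) = \<tau> * of_real (p x) / branch (of_real x)"
    and v: "Re (\<tau> / \<i> ^ n) * integral {s..t} (\<lambda>x. p x / root_dist B x) = v"
  shows "re_integral_eq \<phi> s t v"
proof -
  have I: "(\<lambda>x. \<phi> (of_real x)) absolutely_integrable_on {s..t}"
    "((\<lambda>x. \<phi> (of_real x)) has_integral \<tau> / \<i> ^ n * of_real (integral {s..t} (\<lambda>x. p x / root_dist B x))) {s..t}"
    by (rule edge_integral[OF assms(1-7)], assumption+)+
  show ?thesis unfolding re_integral_eq_def integral_unique[OF I(2)] Re_times_of_real using I(1) v by blast
qed

lemma Re_boundary_value_edge:
  assumes F: "\<And>z. z \<in> upper \<Longrightarrow> (F has_field_derivative poly q z / z / branch z) (at z)"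
    and q: "\<And>x. x \<noteq> 0 \<Longrightarrow> poly q (of_real x) / of_real x = \<tau> * of_real (p x)"
    and st: "s \<le> t" "0 < s \<or> t < 0" "\<And>x. s < x \<Longrightarrow> x < t \<Longrightarrow> x \<notin> B"
    and n: "\<And>x. s < x \<Longrightarrow> x < t \<Longrightarrow> Re (\<tau> / \<i> ^ card {r \<in> B. x < r}) = 0"
  shows "Re (boundary_value upper F (of_real t)) = Re (boundary_value upper F (of_real s))"
proof (rule Re_boundary_value_constant[where \<rho> = "\<lambda>z. poly q z / z" and \<Omega> = "- {0}"])
  fix x assume x: "s < x" "x < t"
  hence "x \<noteq> 0" using st by auto
  hence "poly q (of_real x) / of_real x / branch (of_real x) = \<tau> / \<i> ^ card {r \<in> B. x < r} * of_real (p x / root_dist B x)"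
    by (simp add: q branch_of_real)
  thus "Re (poly q (of_real x) / of_real x / branch (of_real x)) = 0"
    using n[OF x] by (simp only: Re_times_of_real mult_zero_left)
qed (use st F in \<open>auto intro!: holomorphic_intros\<close>)

lemma Re_boundary_value_period:
  assumes F: "\<And>z. z \<in> upper \<Longrightarrow> (F has_field_derivative poly q z / z / branch z) (at z)"
    and q: "\<And>x. x \<noteq> 0 \<Longrightarrow> poly q (of_real x) / of_real x = \<tau> * of_real (p x)" and p: "continuous_on {s..t} p"
    and st: "s \<in> B" "t \<in> B" "s < t" "0 < s" "\<And>x. s < x \<Longrightarrow> x < t \<Longrightarrow> x \<notin> B"
    and n: "\<And>x. s < x \<Longrightarrow> x < t \<Longrightarrow> card {r \<in> B. x < r} = n"
  shows "Re (boundary_value upper F (of_real t)) - Re (boundary_value upper F (of_real s)) =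
    Re (\<tau> / \<i> ^ n) * integral {s..t} (\<lambda>x. p x / root_dist B x)"
proof -
  have "((\<lambda>x. poly q (of_real x) / of_real x / branch (of_real x)) has_integral
      (boundary_value upper F (of_real t) - boundary_value upper F (of_real s))) {s..t}"
    by (rule boundary_value_FTC[where \<rho> = "\<lambda>z. poly q z / z" and \<Omega> = "- {0}"])
      (use st F in \<open>auto intro!: holomorphic_intros\<close>)
  moreover have "((\<lambda>x. poly q (of_real x) / of_real x / branch (of_real x)) has_integral
      \<tau> / \<i> ^ n * of_real (integral {s..t} (\<lambda>x. p x / root_dist B x))) {s..t}"
    by (rule edge_integral(2)[where \<phi> = "\<lambda>z. poly q z / z / branch z", OF st(1-3,5) n p]) (use q st in auto)
  ultimately have "boundary_value upper F (of_real t) - boundary_value upper F (of_real s) =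
      \<tau> / \<i> ^ n * of_real (integral {s..t} (\<lambda>x. p x / root_dist B x))"
    by (rule has_integral_unique)
  hence "Re (boundary_value upper F (of_real t) - boundary_value upper F (of_real s)) =
      Re (\<tau> / \<i> ^ n * of_real (integral {s..t} (\<lambda>x. p x / root_dist B x)))" by simp
  thus ?thesis by (simp only: Re_times_of_real minus_complex.sel)
qed

text \<open>The edge condition of \<open>real_period_in_lattice\<close> concerns Re F itself and not
  differences of it, so the additive constant has to be fixed.\<close>

lemma normalized_primitive:
  obtains F where "\<And>z. z \<in> upper \<Longrightarrow> (F has_field_derivative poly q z / z / branch z) (at z)"
    "boundary_value upper F (of_real a1) = 0"
proof -
  have "(\<lambda>z. poly q z / z / branch z) holomorphic_on upper"
    using holomorphic_on_branch branch_nonzero by (intro holomorphic_intros) (auto simp: upper_def)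
  then obtain F0 where F0: "\<And>z. z \<in> upper \<Longrightarrow> (F0 has_field_derivative poly q z / z / branch z) (at z within upper)"
    by (rule holomorphic_convex_primitive'[OF half_planes(3,1)]) blast
  have F1: "(F0 has_field_derivative poly q z / z / branch z) (at z)" if "z \<in> upper" for z
    using F0[OF that] at_within_open[OF that half_planes(1)] by simp
  define F where "F = (\<lambda>z. F0 z - boundary_value upper F0 (of_real a1))"
  have "(F has_field_derivative poly q z / z / branch z) (at z)" if "z \<in> upper" for z
    unfolding F_def using F1[OF that] by (auto intro!: derivative_eq_intros)
  moreover have "boundary_value upper F (of_real a1) = 0"
  proof -
    have hol: "(\<lambda>z. poly q z / z) holomorphic_on - {0}" by (intro holomorphic_intros) auto
    have "(F0 \<longlongrightarrow> boundary_value upper F0 (of_real a1)) (at (of_real a1) within upper)"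
      using a by (intro boundary_value_sheet(3)[OF sheet_upper[OF F1] hol]) (auto simp: half_planes)
    thus ?thesis unfolding F_def
      by (subst boundary_value_diff_const) (auto simp: half_planes)
  qed
  ultimately show ?thesis by (rule that)
qed

lemma B_gaps:
  "a1 < x \<Longrightarrow> x < a2 \<Longrightarrow> x \<notin> B" "a2 < x \<Longrightarrow> x < a3 \<Longrightarrow> x \<notin> B" "a3 < x \<Longrightarrow> x < a4 \<Longrightarrow> x \<notin> B"
  "a4 < x \<Longrightarrow> x < a5 \<Longrightarrow> x \<notin> B" "b1 < x \<Longrightarrow> x < a1 \<Longrightarrow> x \<notin> B" "x < b1 \<Longrightarrow> x \<notin> B" "a5 < x \<Longrightarrow> x \<notin> B"
  using a distinct by (auto simp: B_def)

lemma ends_in_B: "a1 \<in> B" "a2 \<in> B" "a3 \<in> B" "a4 \<in> B" "a5 \<in> B" "b1 \<in> B"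
  by (auto simp: B_def)

lemma cnj_branch: "cnj (branch (of_real x)) = (-1) ^ card {r \<in> B. x < r} * branch (of_real x)"
  by (simp add: branch_of_real power_minus[of "\<i>"])

text \<open>The choice of \<open>b1\<close> gives |b1| a2 a3 = a1 a4 a5, which makes the product of
  the moduli of all roots a perfect square.\<close>

lemma root_dist_0: "root_dist B 0 = a1 * a4 * a5"
proof -
  have "(root_dist B 0)\<^sup>2 = (\<Prod>r\<in>B. \<bar>r\<bar>)" by (simp add: root_dist_def prod_power_distrib)
  also have "\<dots> = - b1 * a1 * a2 * a3 * a4 * a5"
    using a distinct b1_neg by (simp add: B_def prod.insert_if)
  also have "\<dots> = (a1 * a4 * a5)\<^sup>2" using a by (simp add: b1 field_simps power2_eq_square)
  finally show ?thesis using a root_dist_nonneg[of B 0] by (simp add: power2_eq_iff_nonneg)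
qed

lemma branch_0: "branch 0 = \<i> * of_real (a1 * a4 * a5)"
  using branch_of_real[of 0] card_roots_above(1)[of 0] a b1_neg by (simp add: root_dist_0 i_powers)

text \<open>The numerator is real, so \<open>h\<close> = Re F is constant on edges with an odd
  number of roots above, exactly those where sheets are exchanged. The other edges between positive
  branch points contribute the prescribed integrals 0, so \<open>h\<close> is 0 on the odd edges in
  x > 0; beyond 0 it is shifted by \<pi>.\<close>

lemma period_Q1:
  assumes lm: "integral {a1..a2} (\<lambda>x. (c1 x + l + m * x) / root_dist B x) = 0"
      "integral {a3..a4} (\<lambda>x. (c1 x + l + m * x) / root_dist B x) = 0"
    and f: "represents f (Q1 l m)"
    and \<gamma>: "has_form_integral A (fdh f z_fun) \<gamma> I" "\<gamma> ` {0..1} \<subseteq> affine_ends_removed" "\<gamma> 1 = \<gamma> 0"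
  shows "\<exists>n :: int. Re I = 2 * pi * of_int n"
proof -
  obtain F where F: "\<And>z. z \<in> upper \<Longrightarrow> (F has_field_derivative poly (Q1 l m) z / z / branch z) (at z)"
    and F1: "boundary_value upper F (of_real a1) = 0"
    using normalized_primitive by blast
  define h where "h = (\<lambda>x. Re (boundary_value upper F (of_real x)))"
  have q: "poly (Q1 l m) (of_real x) / of_real x = 1 * of_real (c1 x + l + m * x)" if "x \<noteq> 0" for x
    using Q_of_real(1)[OF that] .
  have edge: "h t = h s" if "s \<le> t" "0 < s \<or> t < 0" "\<And>x. s < x \<Longrightarrow> x < t \<Longrightarrow> x \<notin> B"
      "\<And>x. s < x \<Longrightarrow> x < t \<Longrightarrow> card {r \<in> B. x < r} = n" "odd n" for s t n
    unfolding h_def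
  proof (rule Re_boundary_value_edge[OF F q that(1-3)])
    show "Re (1 / \<i> ^ card {r \<in> B. x < r}) = 0" if "s < x" "x < t" for x
      using \<open>odd n\<close> unfolding that(2)[THEN \<open>\<And>x. s < x \<Longrightarrow> x < t \<Longrightarrow> card {r \<in> B. x < r} = n\<close>[OF that(1)]]
      by (elim oddE) (simp add: power_mult minus_one_power_iff)
  qed
  have cont: "continuous_on {s..t} (\<lambda>x. c1 x + l + m * x)" if "0 < s" for s t
    using that by (intro continuous_intros continuous_on_c)
  have h1: "h x = 0" if "0 < x" "x \<le> a1" for x
    using edge[of x a1 5] that F1 B_gaps(5) card_roots_above(1) b1_neg by (simp add: h_def)
  have h2: "h a2 = 0"
    using Re_boundary_value_period[OF F q cont ends_in_B(1,2) a(2,1) B_gaps(1) card_roots_above(2)] a F1 lm(1)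
    by (simp add: h_def)
  have h3: "h x = 0" if "a2 \<le> x" "x \<le> a3" for x
    using edge[of a2 x 3] that h2 a B_gaps(2) card_roots_above(3) by simp
  have h4: "h a4 = 0"
    using Re_boundary_value_period[OF F q cont ends_in_B(3,4) a(4) _ B_gaps(3) card_roots_above(4)] a h3[of a3] lm(2)
    by (simp add: h_def)
  have h5: "h x = 0" if "a4 \<le> x" "x \<le> a5" for x
    using edge[of a4 x 1] that h4 a B_gaps(4) card_roots_above(5) by simp
  have h6: "h x = h b1" if "b1 \<le> x" "x < 0" for x
    using edge[of b1 x 5] that a B_gaps(5) card_roots_above(1) by simp
  \<comment> \<open>The half turn at 0 adds \<i> \<pi> Q1(0)/w(0), and w(0) = \<i> Q1(0). On both
    sides of 0 the function \<open>h\<close> is constant, so the limit is its value.\<close>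
  have hb: "h b1 = pi"
  proof -
    have B0: "0 \<notin> B" using a b1_neg by (simp add: B_def)
    have "\<i> * pi * (poly (Q1 l m) 0 / branch 0) = of_real pi"
      using a by (simp add: Q_at_0 branch_0) (simp add: complex_eq_iff)
    with jump_at_0[OF B0 F] have "((\<lambda>t. boundary_value upper F (of_real (- t)) - boundary_value upper F (of_real t)) \<longlongrightarrow>
        of_real pi) (at_right 0)" by simp
    from tendsto_Re[OF this] have lim: "((\<lambda>t. h (- t) - h t) \<longlongrightarrow> pi) (at_right 0)" by (simp add: h_def)
    have "\<forall>\<^sub>F t in at_right (0::real). t \<in> {0<..<min a1 (- b1)}"
      by (rule eventually_at_right_field[THEN iffD2]) (use a b1_neg in \<open>auto intro!: exI[of _ "min a1 (- b1)"]\<close>)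
    hence "\<forall>\<^sub>F t in at_right (0::real). h (- t) - h t = h b1"
    proof (rule eventually_mono)
      fix t :: real assume "t \<in> {0<..<min a1 (- b1)}"
      thus "h (- t) - h t = h b1" using h1[of t] h6[of "- t"] by simp
    qed
    with lim have "((\<lambda>t::real. h b1) \<longlongrightarrow> pi) (at_right 0)" by (rule Lim_transform_eventually)
    thus ?thesis by (simp add: tendsto_const_iff)
  qed
  have e: "exp (2 * \<i> * of_real (h x)) = 1"
    if x: "x \<noteq> 0" "cnj (branch (of_real x)) = - of_real 1 * branch (of_real x)" for x
  proof -
    have odd: "x \<in> B \<or> odd (card {r \<in> B. x < r})"
    proof (cases "x \<in> B")
      case False
      hence "branch (of_real x) \<noteq> 0" by (auto simp: branch_eq_0_iff)
      thus ?thesis using x(2) unfolding cnj_branch by (cases "even (card {r \<in> B. x < r})") simp_all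
    qed simp
    \<comment> \<open>On these four intervals the number of roots above is even, where the reflected
      branch matches without any condition.\<close>
    have "\<not> x < b1" "\<not> (a1 < x \<and> x < a2)" "\<not> (a3 < x \<and> x < a4)" "\<not> a5 < x"
      using odd B_gaps card_roots_above by auto
    hence "x \<in> {b1..<0} \<or> 0 < x \<and> x \<le> a1 \<or> a2 \<le> x \<and> x \<le> a3 \<or> a4 \<le> x \<and> x \<le> a5"
      using x(1) by auto
    hence "h x = 0 \<or> h x = pi" using h1[of x] h3[of x] h5[of x] h6[of x] hb by auto
    thus ?thesis by (auto simp: exp_eq_1)
  qed
  show ?thesis
  proof (rule real_period_in_lattice[where \<epsilon> = 1 and \<rho> = "\<lambda>z. poly (Q1 l m) z / z" and \<omega> = "fdh f z_fun"])
    show "(\<lambda>z. poly (Q1 l m) z / z) holomorphic_on - {0}" by (intro holomorphic_intros) auto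
    show "poly (Q1 l m) (cnj z) / cnj z = of_real 1 * cnj (poly (Q1 l m) z / z)" for z by (simp add: Q_cnj)
    show "exp (2 * \<i> * of_real (Re (boundary_value upper F (of_real x)))) = 1"
      if "x \<noteq> 0" "cnj (branch (of_real x)) = - of_real 1 * branch (of_real x)" for x
      using e[OF that] by (simp add: h_def)
    show "fdh f z_fun c \<zeta> = poly (Q1 l m) (Z \<zeta>) / Z \<zeta> * N \<zeta>"
      if "aff_param c p r Z W N" "\<And>\<zeta>. \<zeta> \<in> ball (snd c p) r \<Longrightarrow> Z \<zeta> \<noteq> 0" "\<zeta> \<in> ball (snd c p) r" for c p r Z W N \<zeta>
      by (rule fdh_represents[OF f that])
    show "\<gamma> ` {0..1} \<subseteq> {Aff z w |z w. z \<noteq> 0 \<and> w\<^sup>2 = poly P z}" using \<gamma>(2) by (simp add: affine_ends_removed_def)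
  qed (use F \<gamma> in auto)
qed

text \<open>The numerator is \<i> times a real function, so the roles of odd and even edges are
  exchanged. Along the even edges \<open>h\<close> runs through 0, \<pi>, 0, and -\<pi> beyond
  infinity.\<close>

lemma period_Q2:
  assumes lm: "integral {a2..a3} (\<lambda>x. (c2 x + l + m * x) / root_dist B x) = - pi"
      "integral {a4..a5} (\<lambda>x. (c2 x + l + m * x) / root_dist B x) = - pi"
    and f: "represents f (Q2 l m)"
    and \<gamma>: "has_form_integral A (fdh f z_fun) \<gamma> I" "\<gamma> ` {0..1} \<subseteq> affine_ends_removed" "\<gamma> 1 = \<gamma> 0"
  shows "\<exists>n :: int. Re I = 2 * pi * of_int n"
proof -
  obtain F where F: "\<And>z. z \<in> upper \<Longrightarrow> (F has_field_derivative poly (Q2 l m) z / z / branch z) (at z)"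
    and F1: "boundary_value upper F (of_real a1) = 0"
    using normalized_primitive by blast
  define h where "h = (\<lambda>x. Re (boundary_value upper F (of_real x)))"
  have q: "poly (Q2 l m) (of_real x) / of_real x = \<i> * of_real (c2 x + l + m * x)" if "x \<noteq> 0" for x
    using Q_of_real(2)[OF that] .
  have edge: "h t = h s" if "s \<le> t" "0 < s \<or> t < 0" "\<And>x. s < x \<Longrightarrow> x < t \<Longrightarrow> x \<notin> B"
      "\<And>x. s < x \<Longrightarrow> x < t \<Longrightarrow> card {r \<in> B. x < r} = n" "even n" for s t n
    unfolding h_def
  proof (rule Re_boundary_value_edge[OF F q that(1-3)])
    show "Re (\<i> / \<i> ^ card {r \<in> B. x < r}) = 0" if "s < x" "x < t" for x
      using \<open>even n\<close> unfolding that(2)[THEN \<open>\<And>x. s < x \<Longrightarrow> x < t \<Longrightarrow> card {r \<in> B. x < r} = n\<close>[OF that(1)]]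
      by (elim evenE) (simp add: power_mult)
  qed
  have cont: "continuous_on {s..t} (\<lambda>x. c2 x + l + m * x)" if "0 < s" for s t
    using that by (intro continuous_intros continuous_on_c)
  have h1: "h x = 0" if "a1 \<le> x" "x \<le> a2" for x
    using edge[of a1 x 4] that F1 a B_gaps(1) card_roots_above(2) by (simp add: h_def)
  \<comment> \<open>The phase on this edge is \<i>/\<i>^3 = -1, so the moment -\<pi> raises
    \<open>h\<close> by \<pi>. Between \<open>a4\<close> and \<open>a5\<close> the phase is
    \<i>/\<i> = 1, and the same moment lowers it to 0 again.\<close>
  have h2: "h a3 = pi"
    using Re_boundary_value_period[OF F q cont ends_in_B(2,3) a(3) _ B_gaps(2) card_roots_above(3)] a h1[of a2] lm(1)
    by (simp add: h_def i_powers)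
  have h3: "h x = pi" if "a3 \<le> x" "x \<le> a4" for x
    using edge[of a3 x 2] that h2 a B_gaps(3) card_roots_above(4) by simp
  have h4: "h a5 = 0"
    using Re_boundary_value_period[OF F q cont ends_in_B(4,5) a(5) _ B_gaps(4) card_roots_above(5)] a h3[of a4] lm(2)
    by (simp add: h_def)
  have h5: "h x = 0" if "a5 \<le> x" for x
    using edge[of a5 x 0] that h4 a B_gaps(7) card_roots_above(6) by simp
  have h6: "h x = h b1" if "x \<le> b1" for x
    using edge[of x b1 6] that b1_neg B_gaps(6) card_roots_above(7) by simp
  \<comment> \<open>The half turn at infinity leads from x > a5, where \<open>h\<close> is 0, to x <
    b1; the leading coefficient \<i> gives \<i> \<pi> \<i> = -\<pi>.\<close>
  have hb: "h b1 = - pi"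
  proof -
    have "\<i> * pi * coeff (Q2 l m) 3 = of_real (- pi)"
      by (simp add: Q_degree complex_eq_iff)
    with jump_at_infinity[OF Q_degree(2) F]
    have "((\<lambda>t. boundary_value upper F (of_real (- 1 / t)) - boundary_value upper F (of_real (1 / t))) \<longlongrightarrow>
        of_real (- pi)) (at_right 0)" by simp
    from tendsto_Re[OF this] have lim: "((\<lambda>t. h (- 1 / t) - h (1 / t)) \<longlongrightarrow> - pi) (at_right 0)" by (simp add: h_def)
    have pos: "0 < min (1 / a5) (- 1 / b1)" using a b1_neg by (simp add: field_simps)
    have "\<forall>\<^sub>F t in at_right (0::real). t \<in> {0<..<min (1 / a5) (- 1 / b1)}"
      by (rule eventually_at_right_field[THEN iffD2]) (use pos in \<open>auto intro!: exI[of _ "min (1 / a5) (- 1 / b1)"]\<close>)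
    hence "\<forall>\<^sub>F t in at_right (0::real). h (- 1 / t) - h (1 / t) = h b1"
    proof (rule eventually_mono)
      fix t :: real assume t: "t \<in> {0<..<min (1 / a5) (- 1 / b1)}"
      hence t0: "0 < t" and "t < 1 / a5" "t < - 1 / b1" by auto
      hence "a5 \<le> 1 / t" "- 1 / t \<le> b1" using a b1_neg by (simp_all add: field_simps)
      thus "h (- 1 / t) - h (1 / t) = h b1" using h5[of "1 / t"] h6[of "- 1 / t"] by simp
    qed
    with lim have "((\<lambda>t::real. h b1) \<longlongrightarrow> - pi) (at_right 0)" by (rule Lim_transform_eventually)
    thus ?thesis by (simp add: tendsto_const_iff)
  qed
  have e: "exp (2 * \<i> * of_real (h x)) = 1"
    if x: "x \<noteq> 0" "cnj (branch (of_real x)) = - of_real (- 1) * branch (of_real x)" for x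
  proof -
    have even: "x \<in> B \<or> even (card {r \<in> B. x < r})"
    proof (cases "x \<in> B")
      case False
      hence "branch (of_real x) \<noteq> 0" by (auto simp: branch_eq_0_iff)
      thus ?thesis using x(2) unfolding cnj_branch by (cases "even (card {r \<in> B. x < r})") simp_all
    qed simp
    have "\<not> (b1 < x \<and> x < a1)" "\<not> (a2 < x \<and> x < a3)" "\<not> (a4 < x \<and> x < a5)"
      using even B_gaps card_roots_above by auto
    hence "x \<le> b1 \<or> a1 \<le> x \<and> x \<le> a2 \<or> a3 \<le> x \<and> x \<le> a4 \<or> a5 \<le> x" by auto
    hence "h x = 0 \<or> h x = pi \<or> h x = - pi" using h1[of x] h3[of x] h5[of x] h6[of x] hb by auto
    thus ?thesis by (auto simp: exp_eq_1 intro: exI[of _ "- 1"])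
  qed
  show ?thesis
  proof (rule real_period_in_lattice[where \<epsilon> = "-1" and \<rho> = "\<lambda>z. poly (Q2 l m) z / z" and \<omega> = "fdh f z_fun"])
    show "(\<lambda>z. poly (Q2 l m) z / z) holomorphic_on - {0}" by (intro holomorphic_intros) auto
    show "poly (Q2 l m) (cnj z) / cnj z = of_real (- 1) * cnj (poly (Q2 l m) z / z)" for z by (simp add: Q_cnj)
    show "exp (2 * \<i> * of_real (Re (boundary_value upper F (of_real x)))) = 1"
      if "x \<noteq> 0" "cnj (branch (of_real x)) = - of_real (- 1) * branch (of_real x)" for x
      using e[OF that] by (simp add: h_def)
    show "fdh f z_fun c \<zeta> = poly (Q2 l m) (Z \<zeta>) / Z \<zeta> * N \<zeta>"
      if "aff_param c p r Z W N" "\<And>\<zeta>. \<zeta> \<in> ball (snd c p) r \<Longrightarrow> Z \<zeta> \<noteq> 0" "\<zeta> \<in> ball (snd c p) r" for c p r Z W N \<zeta>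
      by (rule fdh_represents[OF f that])
    show "\<gamma> ` {0..1} \<subseteq> {Aff z w |z w. z \<noteq> 0 \<and> w\<^sup>2 = poly P z}" using \<gamma>(2) by (simp add: affine_ends_removed_def)
  qed (use F \<gamma> in auto)
qed

section \<open>The three forms assembled\<close>

lemma om_eq:
  assumes "z \<noteq> 0" "w \<noteq> 0" "w\<^sup>2 = poly P z"
  shows "om1 (of_real l) (of_real m) z w (poly NP z / w) = poly (Q1 l m) z / (z * w)"
    and "om2 (\<i> * of_real l) (\<i> * of_real m) z w (poly NP z / w) = poly (Q2 l m) z / (z * w)"
proof -
  have NP: "poly NP z \<noteq> 0" using assms P_eq[of z] by auto
  have "w / poly NP z = w\<^sup>2 / (poly NP z * w)" using assms(2) by (simp add: power2_eq_square)
  also have "\<dots> = poly DP z / w" unfolding assms(3) P_eq using NP by simp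
  finally have g: "1 / (poly NP z / w) = poly DP z / w" by simp
  show "om1 (of_real l) (of_real m) z w (poly NP z / w) = poly (Q1 l m) z / (z * w)"
    unfolding om1_def g using assms by (simp add: Q1_def field_simps)
  show "om2 (\<i> * of_real l) (\<i> * of_real m) z w (poly NP z / w) = poly (Q2 l m) z / (z * w)"
    unfolding om2_def g using assms by (simp add: Q2_def field_simps)
qed

lemma branch_factors:
  "branch z = csqrt (z - a1) * csqrt (z - a2) * csqrt (z - a3) * csqrt (z - a4) * csqrt (z - a5) * csqrt (z - b1)"
  unfolding branch_def unfolding B_def using a distinct by (simp add: prod.insert_if mult_ac)

text \<open>A quotient x/y of products of roots is x^2/(x y), and here x y is the branch of
  w.\<close>

lemma g_factors:
  assumes "branch z \<noteq> 0"
  shows "(csqrt (z - a1) * csqrt (z - a4) * csqrt (z - a5)) / (csqrt (z - a2) * csqrt (z - a3) * csqrt (z - b1)) =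
    poly NP z / branch z"
proof -
  have e: "x / y = x\<^sup>2 / b" if "x * y = b" "b \<noteq> 0" for x y b :: complex
    using that by (auto simp: field_simps power2_eq_square)
  have "(csqrt (z - a1) * csqrt (z - a4) * csqrt (z - a5)) / (csqrt (z - a2) * csqrt (z - a3) * csqrt (z - b1)) =
      (csqrt (z - a1) * csqrt (z - a4) * csqrt (z - a5))\<^sup>2 / branch z"
    by (rule e[OF _ assms]) (simp add: branch_factors mult_ac)
  thus ?thesis by (simp add: power_mult_distrib poly_NP)
qed

lemma om_of_real:
  assumes "x \<notin> B" "x \<noteq> 0"
  shows "om1 (of_real l) (of_real m) (of_real x) (branch (of_real x)) (poly NP (of_real x) / branch (of_real x)) =
      1 * of_real (c1 x + l + m * x) / branch (of_real x)"
    and "om2 (\<i> * of_real l) (\<i> * of_real m) (of_real x) (branch (of_real x)) (poly NP (of_real x) / branch (of_real x)) =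
      \<i> * of_real (c2 x + l + m * x) / branch (of_real x)"
proof -
  have b: "branch (of_real x) \<noteq> 0" using assms(1) by (auto simp: branch_eq_0_iff)
  have z: "complex_of_real x \<noteq> 0" using assms(2) by simp
  show "om1 (of_real l) (of_real m) (of_real x) (branch (of_real x)) (poly NP (of_real x) / branch (of_real x)) =
      1 * of_real (c1 x + l + m * x) / branch (of_real x)"
    unfolding om_eq(1)[OF z b branch_square] Q_of_real(1)[OF assms(2), symmetric] by simp
  show "om2 (\<i> * of_real l) (\<i> * of_real m) (of_real x) (branch (of_real x)) (poly NP (of_real x) / branch (of_real x)) =
      \<i> * of_real (c2 x + l + m * x) / branch (of_real x)"
    unfolding om_eq(2)[OF z b branch_square] Q_of_real(2)[OF assms(2), symmetric] by simp
qed

text \<open>On each edge the real part is a phase times a real moment. For the first form the phase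
  is imaginary on the second and fourth edge, for the second form on the first and third; the other
  four moments are the prescribed ones, with phases 1, -1 and -1, 1 respectively.\<close>

lemma re_integrals:
  fixes l m l' m' :: real and w g
  assumes w: "\<And>z. w z = branch z" and g: "\<And>z. branch z \<noteq> 0 \<Longrightarrow> g z = poly NP z / branch z"
    and lm: "integral {a1..a2} (\<lambda>x. (c1 x + l + m * x) / root_dist B x) = 0"
      "integral {a3..a4} (\<lambda>x. (c1 x + l + m * x) / root_dist B x) = 0"
    and lm': "integral {a2..a3} (\<lambda>x. (c2 x + l' + m' * x) / root_dist B x) = - pi"
      "integral {a4..a5} (\<lambda>x. (c2 x + l' + m' * x) / root_dist B x) = - pi"
  defines "I1 \<equiv> re_integral_eq (\<lambda>x. om1 (of_real l) (of_real m) x (w x) (g x))"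
    and "I2 \<equiv> re_integral_eq (\<lambda>x. om2 (\<i> * of_real l') (\<i> * of_real m') x (w x) (g x))"
  shows "I1 a1 a2 0 \<and> I1 a2 a3 0 \<and> I1 a3 a4 0 \<and> I1 a4 a5 0 \<and>
    I2 a1 a2 0 \<and> I2 a3 a4 0 \<and> I2 a2 a3 pi \<and> I2 a4 a5 (- pi)"
proof -
  have g': "g (of_real x) = poly NP (of_real x) / branch (of_real x)" if "x \<notin> B" for x
  proof (rule g)
    show "branch (of_real x) \<noteq> 0" using that by (auto simp: branch_eq_0_iff)
  qed
  have I1: "I1 s t (Re (1 / \<i> ^ n) * integral {s..t} (\<lambda>x. (c1 x + l + m * x) / root_dist B x))"
    if "0 < s" "s < t" "s \<in> B" "t \<in> B" "\<And>x. s < x \<Longrightarrow> x < t \<Longrightarrow> x \<notin> B"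
      "\<And>x. s < x \<Longrightarrow> x < t \<Longrightarrow> card {r \<in> B. x < r} = n" for s t n
    unfolding I1_def
    by (rule edge_re_integral[where p = "\<lambda>x. c1 x + l + m * x" and \<tau> = 1])
      (use that om_of_real(1) g' w in \<open>auto intro!: continuous_intros continuous_on_c\<close>)
  have I2: "I2 s t (Re (\<i> / \<i> ^ n) * integral {s..t} (\<lambda>x. (c2 x + l' + m' * x) / root_dist B x))"
    if "0 < s" "s < t" "s \<in> B" "t \<in> B" "\<And>x. s < x \<Longrightarrow> x < t \<Longrightarrow> x \<notin> B"
      "\<And>x. s < x \<Longrightarrow> x < t \<Longrightarrow> card {r \<in> B. x < r} = n" for s t n
    unfolding I2_def
    by (rule edge_re_integral[where p = "\<lambda>x. c2 x + l' + m' * x" and \<tau> = \<i>])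
      (use that om_of_real(2) g' w in \<open>auto intro!: continuous_intros continuous_on_c\<close>)
  show ?thesis
    using I1[OF _ a(2) ends_in_B(1,2) B_gaps(1) card_roots_above(2)] I1[OF _ a(3) ends_in_B(2,3) B_gaps(2) card_roots_above(3)]
      I1[OF _ a(4) ends_in_B(3,4) B_gaps(3) card_roots_above(4)] I1[OF _ a(5) ends_in_B(4,5) B_gaps(4) card_roots_above(5)]
      I2[OF _ a(2) ends_in_B(1,2) B_gaps(1) card_roots_above(2)] I2[OF _ a(3) ends_in_B(2,3) B_gaps(2) card_roots_above(3)]
      I2[OF _ a(4) ends_in_B(3,4) B_gaps(3) card_roots_above(4)] I2[OF _ a(5) ends_in_B(4,5) B_gaps(4) card_roots_above(5)]
      a lm lm'
    by (simp add: i_powers)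
qed

lemma doubly_periodic:
  assumes mero: "\<And>k. meromorphic_form A (fdh (f k) z_fun)"
    and f: "represents (f 1) (Q1 l m)" "represents (f 2) (Q2 l' m')" "\<And>z w. f 3 (Aff z w) = 1 / z"
    and lm: "integral {a1..a2} (\<lambda>x. (c1 x + l + m * x) / root_dist B x) = 0"
      "integral {a3..a4} (\<lambda>x. (c1 x + l + m * x) / root_dist B x) = 0"
    and lm': "integral {a2..a3} (\<lambda>x. (c2 x + l' + m' * x) / root_dist B x) = - pi"
      "integral {a4..a5} (\<lambda>x. (c2 x + l' + m' * x) / root_dist B x) = - pi"
  shows "doubly_periodic_weierstrass_rep X A (points_over_0 P \<union> points_over_inf P) (\<lambda>k. fdh (f k) z_fun)"
  unfolding doubly_periodic_weierstrass_rep_def affine_ends_removed_eq[symmetric]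
proof (intro conjI allI)
  show "compact_riemann_surface X A"
    by (rule compact_riemann_surface_X[OF connected_X]) (simp add: B_def)
  show "form_holomorphic_on A (fdh (f k) z_fun) affine_ends_removed" for k
    using exhaust_3[of k] represents_holomorphic[OF f(1)] represents_holomorphic[OF f(2)] dz_over_z_holomorphic[OF f(3)] by auto
  \<comment> \<open>All periods of the first two coordinates are multiples of 2 \<pi> and the third
    has none, so the lattice can be taken axis-parallel.\<close>
  define v1 v2 :: "real^3" where "v1 = axis 1 (2 * pi)" and "v2 = axis 2 (2 * pi)"
  define L where "L = {of_int m *\<^sub>R v1 + of_int n *\<^sub>R v2 | m n. True}"
  have v: "v1 \<noteq> v2" "v1 \<noteq> 0" "v2 \<noteq> 0" "orthogonal v1 v2"
    by (simp_all add: v1_def v2_def axis_eq_axis axis_eq_0_iff orthogonal_def inner_axis_axis)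
  hence "independent {v1, v2}"
    by (intro pairwise_orthogonal_independent) (auto simp: pairwise_def orthogonal_commute)
  with v(1) have "rank_two_lattice L" unfolding rank_two_lattice_def L_def by blast
  moreover have "real_integrals A (\<lambda>k. fdh (f k) z_fun) affine_ends_removed q q \<subseteq> L" for q
  proof
    fix x assume "x \<in> real_integrals A (\<lambda>k. fdh (f k) z_fun) affine_ends_removed q q"
    then obtain I \<gamma> where x: "x = (\<chi> k. Re (I k))" and \<gamma>: "\<gamma> ` {0..1} \<subseteq> affine_ends_removed" "\<gamma> 1 = \<gamma> 0"
      and I: "\<And>k. has_form_integral A (fdh (f k) z_fun) \<gamma> (I k)"
      unfolding real_integrals_def by auto
    obtain n1 n2 :: int where "Re (I 1) = 2 * pi * of_int n1" "Re (I 2) = 2 * pi * of_int n2"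
      using period_Q1[OF lm f(1) I \<gamma>] period_Q2[OF lm' f(2) I \<gamma>] by blast
    moreover have "Re (I 3) = 0" by (rule dz_over_z_period[OF f(3) I \<gamma>])
    ultimately have "x = of_int n1 *\<^sub>R v1 + of_int n2 *\<^sub>R v2"
      by (simp add: x vec_eq_iff forall_3 v1_def v2_def axis_def)
    thus "x \<in> L" unfolding L_def by blast
  qed
  ultimately show "\<exists>L. rank_two_lattice L \<and>
      (\<forall>q\<in>affine_ends_removed. real_integrals A (\<lambda>k. fdh (f k) z_fun) affine_ends_removed q q \<subseteq> L)" by blast
qed (use mero finite_ends ends_subset in auto)

text \<open>Over 0 the first form has residue \<plusminus>\<i> and the second none; over infinity it
  is the reverse. The translation periods are therefore parallel to the first and the second axis,
  at bottom and top respectively.\<close>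

lemma orthogonal_ends:
  assumes mero: "\<And>k. meromorphic_form A (fdh (f k) z_fun)"
    and f: "represents (f 1) (Q1 l m)" "represents (f 2) (Q2 l' m')" "\<And>z w. f 3 (Aff z w) = 1 / z"
  shows "orthogonal_scherk_ends A (\<lambda>k. fdh (f k) z_fun) (points_over_0 P) (points_over_inf P)"
proof -
  define q where "q = (\<lambda>k::3. if k = 1 then Q1 l m else Q2 l' m')"
  define V :: "3 \<Rightarrow> real \<Rightarrow> real^3" where "V = (\<lambda>j \<kappa>. \<chi> k. if k = j then - 2 * pi * \<kappa> else 0)"
  have fq: "represents (f k) (q k)" if "k \<noteq> 3" for k
    using that exhaust_3[of k] f by (auto simp: q_def)
  have bottom: "\<exists>\<kappa>. scherk_end A (\<lambda>k. fdh (f k) z_fun) p (-1) (V 1 \<kappa>)" if "p \<in> points_over_0 P" for p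
  proof -
    define c where "c = complex_of_real (a1 * a4 * a5)"
    have c: "c \<noteq> 0" using a by (simp add: c_def)
    obtain w0 where p: "p = Aff 0 w0" "w0\<^sup>2 = poly P 0" using \<open>p \<in> points_over_0 P\<close> by (auto simp: points_over_0_def)
    have "poly P 0 = - c\<^sup>2"
      \<comment> \<open>D(0) and N(0) are c and - c, so P(0) = - c^2 and the two values of w over 0
        are \<plusminus>\<i> c; this makes the residue c/w0 imaginary.\<close>
      using poly_NP_DP_of_real[of 0] by (simp add: P_eq NP_DP_values c_def power2_eq_square)
    also have "\<dots> = (\<i> * c)\<^sup>2" by (simp add: power_mult_distrib)
    finally have "poly P 0 = (\<i> * c)\<^sup>2" .
    hence w0: "w0 = \<i> * c \<or> w0 = - (\<i> * c)" using p(2) by (simp add: power2_eq_iff)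
    then obtain \<kappa> :: real where \<kappa>: "c / w0 = \<i> * of_real \<kappa>" "\<kappa> \<noteq> 0"
    proof
      assume "w0 = \<i> * c"
      thus ?thesis using c by (intro that[of "-1"]) (auto simp: field_simps)
    next
      assume "w0 = - (\<i> * c)"
      thus ?thesis using c by (intro that[of 1]) (auto simp: field_simps)
    qed
    have "scherk_end A (\<lambda>k. fdh (f k) z_fun) (Aff 0 w0) (-1) (V 1 \<kappa>)"
      unfolding V_def
    proof (rule scherk_end_over_0[where f = f and q = q, OF mero fq f(3) _ p(2) _ _ \<kappa>(2)])
      show "w0 \<noteq> 0" using w0 c by auto
      show "poly (q 1) 0 / w0 = \<i> * of_real \<kappa>" using \<kappa>(1) by (simp add: q_def Q_at_0 c_def)
    qed (auto simp: q_def Q_at_0)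
    thus ?thesis using p(1) by blast
  qed
  have top: "\<exists>\<kappa>. scherk_end A (\<lambda>k. fdh (f k) z_fun) p 1 (V 2 \<kappa>)" if "p \<in> points_over_inf P" for p
  proof -
    obtain v where p: "p = At_Inf v" "v\<^sup>2 = lead_coeff P" using \<open>p \<in> points_over_inf P\<close> by (auto simp: points_over_inf_def)
    have "lead_coeff P = 1" by (simp add: P_def lead_coeff_prod)
    hence "v = 1 \<or> v = - 1" using p(2) by (simp add: power2_eq_1_iff)
    then obtain \<kappa> :: real where \<kappa>: "- \<i> / v = \<i> * of_real \<kappa>" "\<kappa> \<noteq> 0"
    proof
      assume "v = 1"
      thus ?thesis by (intro that[of "-1"]) auto
    next
      assume "v = - 1"
      thus ?thesis by (intro that[of 1]) auto
    qed
    have "scherk_end A (\<lambda>k. fdh (f k) z_fun) (At_Inf v) 1 (V 2 \<kappa>)"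
      unfolding V_def
    proof (rule scherk_end_over_inf[where f = f and q = q, OF mero fq f(3) _ p(2) _ _ \<kappa>(2)])
      show "- coeff (q 2) 3 / v = \<i> * of_real \<kappa>" using \<kappa>(1) by (simp add: q_def Q_degree)
    qed (use exhaust_3 in \<open>auto simp: q_def Q_degree\<close>)
    thus ?thesis using p(1) by blast
  qed
  obtain \<kappa> \<kappa>' where \<kappa>: "\<And>p. p \<in> points_over_0 P \<Longrightarrow> scherk_end A (\<lambda>k. fdh (f k) z_fun) p (-1) (V 1 (\<kappa> p))"
    "\<And>p. p \<in> points_over_inf P \<Longrightarrow> scherk_end A (\<lambda>k. fdh (f k) z_fun) p 1 (V 2 (\<kappa>' p))"
    using bottom top by metis
  have disj: "p \<notin> points_over_0 P" if "p \<in> points_over_inf P" for p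
    using that by (auto simp: points_over_0_def points_over_inf_def)
  have "orthogonal (V 1 x) (V 2 y)" for x y
    by (simp add: V_def orthogonal_def inner_vec_def sum_3)
  thus ?thesis
    unfolding orthogonal_scherk_ends_def using \<kappa> disj
    by (intro exI[of _ "\<lambda>p. if p \<in> points_over_0 P then V 1 (\<kappa> p) else V 2 (\<kappa>' p)"]) auto
qed

text \<open>The first system is solved with both moments 0, the second with both moments -\<pi>. Its
  real solution enters the second form multiplied by \<i>, which keeps the whole numerator imaginary
  on the real axis.\<close>

lemma weierstrass_data:
  fixes w g gX
  assumes w: "\<And>z. w z = branch z" and g: "\<And>z. branch z \<noteq> 0 \<Longrightarrow> g z = poly NP z / branch z"
    and gX: "\<And>q. gX q = poly NP (z_fun q) / w_fun q"
  shows "\<exists>l1 l2 l3 l4 :: complex.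
    (let \<omega> = triple (fdh (\<lambda>q. om1 l1 l2 (z_fun q) (w_fun q) (gX q)) z_fun)
                    (fdh (\<lambda>q. om2 l3 l4 (z_fun q) (w_fun q) (gX q)) z_fun)
                    (fdh (\<lambda>q. om3 (z_fun q)) z_fun);
         I1 = re_integral_eq (\<lambda>x. om1 l1 l2 x (w x) (g x));
         I2 = re_integral_eq (\<lambda>x. om2 l3 l4 x (w x) (g x))
     in doubly_periodic_weierstrass_rep X A (points_over_0 P \<union> points_over_inf P) \<omega> \<and>
        has_genus X A 2 \<and> orthogonal_scherk_ends A \<omega> (points_over_0 P) (points_over_inf P) \<and>
        I1 a1 a2 0 \<and> I1 a2 a3 0 \<and> I1 a3 a4 0 \<and> I1 a4 a5 0 \<and>
        I2 a1 a2 0 \<and> I2 a3 a4 0 \<and> I2 a2 a3 pi \<and> I2 a4 a5 (- pi))"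
proof -
  obtain l m where lm: "integral {a1..a2} (\<lambda>x. (c1 x + l + m * x) / root_dist B x) = 0"
      "integral {a3..a4} (\<lambda>x. (c1 x + l + m * x) / root_dist B x) = 0"
    using moment_system_solvable[OF finite_B ends_in_B(1-4) a(2) B_gaps(1) a(4) B_gaps(3) a(3)
        continuous_on_c(1) continuous_on_c(1), of 0 0] a by auto
  obtain l' m' where lm': "integral {a2..a3} (\<lambda>x. (c2 x + l' + m' * x) / root_dist B x) = - pi"
      "integral {a4..a5} (\<lambda>x. (c2 x + l' + m' * x) / root_dist B x) = - pi"
    using moment_system_solvable[OF finite_B ends_in_B(2-5) a(3) B_gaps(2) a(5) B_gaps(4) a(4)
        continuous_on_c(2) continuous_on_c(2), of "- pi" "- pi"] a by auto
  define f1 where "f1 = (\<lambda>q. om1 (of_real l) (of_real m) (z_fun q) (w_fun q) (gX q))"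
  define f2 where "f2 = (\<lambda>q. om2 (\<i> * of_real l') (\<i> * of_real m') (z_fun q) (w_fun q) (gX q))"
  define f3 where "f3 = (\<lambda>q. om3 (z_fun q))"
  define f where "f = triple f1 f2 f3"
  have f: "f 1 = f1" "f 2 = f2" "f 3 = f3" by (simp_all add: f_def triple_def)
  have rep: "represents (f 1) (Q1 l m)" "represents (f 2) (Q2 l' m')"
    unfolding f represents_def by (simp_all add: f1_def f2_def gX om_eq)
  have f3: "f 3 (Aff z w) = 1 / z" for z w by (simp add: f f3_def om3_def)
  have mero: "meromorphic_form A (fdh (f k) z_fun)" for k
  proof (rule meromorphic_form_fdh)
    fix c assume c: "c \<in> A"
    note zw = meromorphic_z_w_fun[OF c, unfolded o_def]
    have 1: "(f 1 \<circ> chart_inv c) meromorphic_on chart_image c"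
      and 2: "(f 2 \<circ> chart_inv c) meromorphic_on chart_image c"
      and 3: "(f 3 \<circ> chart_inv c) meromorphic_on chart_image c"
      unfolding f f1_def f2_def f3_def om1_def om2_def om3_def gX poly_NP o_def
      by (intro meromorphic_intros zw)+
    from 1 2 3 show "(f k \<circ> chart_inv c) meromorphic_on chart_image c" using exhaust_3[of k] by auto
  qed (rule meromorphic_z_w_fun)
  have \<omega>: "triple (fdh f1 z_fun) (fdh f2 z_fun) (fdh f3 z_fun) = (\<lambda>k. fdh (f k) z_fun)"
    by (auto simp: triple_def f_def fun_eq_iff)
  have "has_genus X A 2" using has_genus_X by simp
  thus ?thesis
    by (intro exI[of _ "of_real l"] exI[of _ "of_real m"] exI[of _ "\<i> * of_real l'"] exI[of _ "\<i> * of_real m'"])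
      (use doubly_periodic[OF mero rep f3 lm lm'] orthogonal_ends[OF mero rep f3] re_integrals[OF w g lm lm'] in
       \<open>simp only: Let_def f1_def[symmetric] f2_def[symmetric] f3_def[symmetric] \<omega> simp_thms\<close>)
qed

end

theorem theorem5p2:
  fixes a1 a2 a3 a4 a5 b1 :: real
    and w g :: "complex \<Rightarrow> complex"
    and P :: "complex poly"
    and gX :: "hpoint \<Rightarrow> complex"
  assumes a: "0 < a1" "a1 < a2" "a2 < a3" "a3 < a4" "a4 < a5"
    and b1: "b1 = - (a1 * a4 * a5) / (a2 * a3)"
    and w: "\<And>z. w z = csqrt (z - a1) * csqrt (z - a2) * csqrt (z - a3) *
                      csqrt (z - a4) * csqrt (z - a5) * csqrt (z - b1)"
    and g: "\<And>z. g z = (csqrt (z - a1) * csqrt (z - a4) * csqrt (z - a5)) /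
                      (csqrt (z - a2) * csqrt (z - a3) * csqrt (z - b1))"
    and P: "P = [:- of_real b1, 1:] * [:- of_real a1, 1:] * [:- of_real a2, 1:] *
                [:- of_real a3, 1:] * [:- of_real a4, 1:] * [:- of_real a5, 1:]"
    and gX: "\<And>q. gX q = (z_fun q - a1) * (z_fun q - a4) * (z_fun q - a5) / w_fun q"
  shows "\<exists>l1 l2 l3 l4 :: complex.
    (let \<omega> = triple (fdh (\<lambda>q. om1 l1 l2 (z_fun q) (w_fun q) (gX q)) z_fun)
                    (fdh (\<lambda>q. om2 l3 l4 (z_fun q) (w_fun q) (gX q)) z_fun)
                    (fdh (\<lambda>q. om3 (z_fun q)) z_fun);
         I1 = re_integral_eq (\<lambda>x. om1 l1 l2 x (w x) (g x));
         I2 = re_integral_eq (\<lambda>x. om2 l3 l4 x (w x) (g x))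
     in doubly_periodic_weierstrass_rep (hyp_top P) (hyp_atlas P)
          (points_over_0 P \<union> points_over_inf P) \<omega> \<and>
        has_genus (hyp_top P) (hyp_atlas P) 2 \<and>
        orthogonal_scherk_ends (hyp_atlas P) \<omega> (points_over_0 P) (points_over_inf P) \<and>
        I1 a1 a2 0 \<and> I1 a2 a3 0 \<and> I1 a3 a4 0 \<and> I1 a4 a5 0 \<and>
        I2 a1 a2 0 \<and> I2 a3 a4 0 \<and> I2 a2 a3 pi \<and> I2 a4 a5 (- pi))"
proof -
  interpret D: doubly_periodic_data a1 a2 a3 a4 a5 b1
    using a b1 by unfold_locales
  have PD: "P = D.P" unfolding P D.P_factors ..
  show ?thesis unfolding PD
  proof (rule D.weierstrass_data)
    show "w z = D.branch z" for z unfolding w D.branch_factors ..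
    show "g z = poly D.NP z / D.branch z" if "D.branch z \<noteq> 0" for z
      unfolding g by (rule D.g_factors[OF that])
    show "gX q = poly D.NP (z_fun q) / w_fun q" for q unfolding gX D.poly_NP ..
  qed
qed

end
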